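(* Let $m\ge 3$. Then the equivariant determinantal complexity of the permanent satisfies $$\operatorname{edc}(\operatorname{perm}_m)=\binom{2m}{m}-1 .$$
   Context: All spaces are over $\mathbb{C}$. $\mathcal{M}_n(\mathbb{C})$ is the space of $n\times n$ complex matrices and $\det_n$ the determinant polynomial on it. The permanent $\operatorname{perm}_m(y)=\sum_{\sigma\in\mathfrak{S}_m}\prod_{i=1}^m y^i_{\sigma(i)}$ is a homogeneous polynomial of degree $m$ on $V=\mathcal{M}_m(\mathbb{C})$. For a nonzero homogeneous polynomial $P$ on a finite-dimensional vector space $V$, the projective symmetry group is $\mathbb{G}_P=\{g\in \mathrm{GL}(V): \exists c\in\mathbb{C}^*,\ P(g^{-1}y)=cP(y)\ \forall y\in V\}$. In particular $\mathbb{G}_{\det_n}\subset \mathrm{GL}(\mathcal{M}_n(\mathbb{C}))$; it consists of the maps $x\mapsto AxB^{-1}$ and $x\mapsto Ax^TB^{-1}$ with $A,B\in \mathrm{GL}_n(\mathbb{C})$. A determinantal representation of $P$ of size $n$ is an affine linear map $\tilde A=\Lambda+A:V\to\mathcal{M}_n(\mathbb{C})$, with $\Lambda\in\mathcal{M}_n(\mathbb{C})$ a fixed matrix and $A$ linear, such that $P=\det_n\circ\tilde A$. Put $\mathbb{G}_A=\{g\in\mathbb{G}_{\det_n}: g\cdot\Lambda=\Lambda,\ g\cdot A(V)=A(V)\}$. Assume $P$ cannot be expressed using $\dim V-1$ variables (true for $\operatorname{perm}_m$); then $A:V\to A(V)$ is bijective. Let $\bar\rho_A:\mathbb{G}_A\to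 \mathrm{GL}(V)$ be $\bar\rho_A(g)=A^{-1}\circ (g|_{A(V)})\circ A$; its image lies in $\mathbb{G}_P$. The representation $\tilde A$ is called equivariant if $\bar\rho_A(\mathbb{G}_A)=\mathbb{G}_P$. The equivariant determinantal complexity $\operatorname{edc}(P)$ is the smallest $n$ such that $P$ has an equivariant determinantal representation of size $n$. *)

theory Defs
  imports
    Jordan_Normal_Form.VS_Connect
    "HOL-Library.Extended_Nat"
begin

abbreviation Mat :: "nat \<Rightarrow> (complex, complex mat) module" where
  "Mat n \<equiv> module_mat TYPE(complex) n n"

text \<open>Row and column indices of matrices run from \<open>0\<close> to \<open>m - 1\<close>, as in \<^const>\<open>Determinant.det\<close>.\<close>

definition perm :: "nat \<Rightarrow> complex mat \<Rightarrow> complex" where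
  "perm m y = (\<Sum>\<sigma> \<in> {\<sigma>. \<sigma> permutes {0..<m}}. \<Prod>i = 0..<m. y $$ (i, \<sigma> i))"

text \<open>
  A vector space is given by its carrier inside a type, so maps between vector spaces are
  normalised outside the carrier (\<^const>\<open>extensional\<close>). This makes equality of sets of
  automorphisms mean equality of the automorphisms on the carrier.
\<close>

definition GL :: "(complex, 'v) module \<Rightarrow> ('v \<Rightarrow> 'v) set" where
  "GL V = {g \<in> extensional (carrier V).
             linear_map class_ring V V g \<and> bij_betw g (carrier V) (carrier V)}"

definition proj_sym_group :: "(complex, 'v) module \<Rightarrow> ('v \<Rightarrow> complex) \<Rightarrow> ('v \<Rightarrow> 'v) set" where
  "proj_sym_group V P =
     {g \<in> GL V. \<exists>c. c \<noteq> 0 \<and> (\<forall>y \<in> carrier V. P (inv_into (carrier V) g y) = c * P y)}"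

text \<open>The affine map is \<open>y \<mapsto> \<Lambda> + A y\<close>; its constant and linear parts are separate arguments.\<close>

definition det_rep ::
  "(complex, 'v) module \<Rightarrow> ('v \<Rightarrow> complex) \<Rightarrow> nat \<Rightarrow> complex mat \<Rightarrow> ('v \<Rightarrow> complex mat) \<Rightarrow> bool" where
  "det_rep V P n \<Lambda> A \<longleftrightarrow>
     \<Lambda> \<in> carrier_mat n n \<and> linear_map class_ring V (Mat n) A \<and>
     (\<forall>y \<in> carrier V. P y = det (\<Lambda> + A y))"

definition rep_sym_group ::
  "(complex, 'v) module \<Rightarrow> nat \<Rightarrow> complex mat \<Rightarrow> ('v \<Rightarrow> complex mat) \<Rightarrow> (complex mat \<Rightarrow> complex mat) set" where
  "rep_sym_group V n \<Lambda> A =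
     {g \<in> proj_sym_group (Mat n) det. g \<Lambda> = \<Lambda> \<and> g ` (A ` carrier V) = A ` carrier V}"

text \<open>
  The map \<open>g \<mapsto> A\<^sup>-\<^sup>1 \<circ> g \<circ> A\<close>. It is meaningful when \<open>A\<close> is injective on the carrier, which is
  automatic if \<open>A\<close> is the linear part of a determinantal representation of a polynomial that
  cannot be expressed using fewer than \<open>dim V\<close> variables, such as the permanent.
\<close>

definition rho_bar ::
  "(complex, 'v) module \<Rightarrow> ('v \<Rightarrow> complex mat) \<Rightarrow> (complex mat \<Rightarrow> complex mat) \<Rightarrow> 'v \<Rightarrow> 'v" where
  "rho_bar V A g = (\<lambda>y \<in> carrier V. inv_into (carrier V) A (g (A y)))"

definition equivariant_det_rep ::
  "(complex, 'v) module \<Rightarrow> ('v \<Rightarrow> complex) \<Rightarrow> nat \<Rightarrow> complex mat \<Rightarrow> ('v \<Rightarrow> complex mat) \<Rightarrow> bool" where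
  "equivariant_det_rep V P n \<Lambda> A \<longleftrightarrow>
     det_rep V P n \<Lambda> A \<and> rho_bar V A ` rep_sym_group V n \<Lambda> A = proj_sym_group V P"

text \<open>
  The infimum in \<^typ>\<open>enat\<close> is attained if some equivariant representation exists and is
  \<open>\<infinity>\<close> otherwise, so a finite value asserts existence as well as minimality.
\<close>

definition edc :: "(complex, 'v) module \<Rightarrow> ('v \<Rightarrow> complex) \<Rightarrow> enat" where
  "edc V P = Inf (enat ` {n. \<exists>\<Lambda> A. equivariant_det_rep V P n \<Lambda> A})"

end

theory Submission
  imports
    Defs
    Jordan_Normal_Form.Jordan_Normal_Form_Existence
begin

text \<open>
  For the lower bound, a symmetry of the permanent lifts to a symmetry of the determinant, which by
  Frobenius has the form \<open>X \<mapsto> P X Q\<close> or \<open>X \<mapsto> P X\<^sup>T Q\<close>; squares of symmetries lift without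
  transposing. Lifting a generic torus element grades the entries of \<open>\<Lambda> + A y\<close>. Pivoting on the
  constant entries leaves a graded matrix of linear or higher forms, and comparing the monomials of
  the permanent with the grading shows that this matrix is \<open>1 \<times> 1\<close>. Hence \<open>\<Lambda>\<close> has corank one and
  one may take \<open>\<Lambda> = 1 - u v\<^sup>T\<close> with \<open>v\<^sup>T u = 1\<close>. The noncommutative form
  \<open>v\<^sup>T A(y\<^sub>1) \<cdots> A(y\<^sub>r) u\<close> of least degree that does not vanish is semi-invariant under
  the lifts, so \<open>r = m\<close>, and it is nonzero on some word of matrix units whose row and column indices
  are permutations. Moving this word by even permutations gives, for every pair \<open>(I, J)\<close> of nonempty
  sets of the same size, a nonvanishing word \<open>w w'\<close> whose prefix \<open>w\<close> uses the rows \<open>I\<close> and the columns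
  \<open>J\<close>. The pairing of the covectors \<open>v\<^sup>T A(w)\<close> with the vectors \<open>A(w') u\<close> is triangular, so \<open>n\<close> is at
  least the number of these pairs.

  The upper bound is attained by a matrix indexed by these pairs which encodes the Laplace expansion
  of all square subpermanents, averaged over rows to be symmetric. By Marcus and May the symmetries
  of the permanent are monomial, up to transposition, and they act on the pairs.
\<close>

text \<open>The lifts are not assumed to form a reductive group, and a lift \<open>(P, Q)\<close> of
  a torus element need not be diagonalisable. Hence the use of one torus element whose weights
  separate all multidegrees: only the diagonals of the Jordan forms of \<open>P\<close> and of the
  inverse of \<open>Q\<close> enter the grading. Nor does a lift preserve a complement of the kernel
  of \<open>\<Lambda>\<close>, so words change by correction terms; these factor through shorter
  words, which singles out the form of least nonvanishing degree.

  Squares suffice because squaring is onto on the torus and squares of permutations generate the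
  alternating group, which for \<open>m \<ge> 3\<close> is transitive on subsets of each size. The
  bound \<open>m \<ge> 3\<close> also enters through Marcus and May, where isotropic subspaces of
  dimension 3 must lie in a line, and through the sign argument: for \<open>m = 2\<close> a sign
  change turns the permanent into a determinant.

  The value counts pairs of equal size: the sum of the squares of \<open>m choose k\<close>, less
  one for the empty pair.\<close>

section \<open>Symmetry groups on matrix spaces in concrete form\<close>

lemma linear_map_Mat_iff:
  "linear_map class_ring (Mat m) (Mat n) f \<longleftrightarrow>
     (\<forall>X\<in>carrier_mat m m. f X \<in> carrier_mat n n) \<and>
     (\<forall>X\<in>carrier_mat m m. \<forall>Y\<in>carrier_mat m m. f (X + Y) = f X + f Y) \<and>
     (\<forall>c. \<forall>X\<in>carrier_mat m m. f (c \<cdot>\<^sub>m X) = c \<cdot>\<^sub>m f X)"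
proof -
  have vs: "vectorspace class_ring (Mat n)" for n by (rule matrix_vs)
  have "linear_map class_ring (Mat m) (Mat n) f \<longleftrightarrow> f \<in> LinearCombinations.module_hom class_ring (Mat m) (Mat n)"
    using vs by (auto simp: linear_map_def mod_hom_def mod_hom_axioms_def vectorspace_def)
  also have "\<dots> \<longleftrightarrow> (\<forall>X\<in>carrier_mat m m. f X \<in> carrier_mat n n) \<and>
     (\<forall>X\<in>carrier_mat m m. \<forall>Y\<in>carrier_mat m m. f (X + Y) = f X + f Y) \<and>
     (\<forall>c. \<forall>X\<in>carrier_mat m m. f (c \<cdot>\<^sub>m X) = c \<cdot>\<^sub>m f X)"
    unfolding LinearCombinations.module_hom_def by (auto simp: module_mat_simps)
  finally show ?thesis .
qed

lemma carrier_Mat [simp]: "carrier (Mat n) = carrier_mat n n"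
  by (simp add: module_mat_simps)

text \<open>The group is defined through \<open>P\<close> composed with the inverse map. This lemma
  and \<open>proj_sym_groupD\<close> pass to the forward form \<open>P (f X) = c * P X\<close>,
  where the constant becomes its inverse.\<close>

lemma proj_sym_groupI:
  fixes f h :: "complex mat \<Rightarrow> complex mat"
  assumes f: "\<And>X. X \<in> carrier_mat n n \<Longrightarrow> f X \<in> carrier_mat n n"
    and add: "\<And>X Y. X \<in> carrier_mat n n \<Longrightarrow> Y \<in> carrier_mat n n \<Longrightarrow> f (X + Y) = f X + f Y"
    and smult: "\<And>a X. X \<in> carrier_mat n n \<Longrightarrow> f (a \<cdot>\<^sub>m X) = a \<cdot>\<^sub>m f X"
    and h: "\<And>X. X \<in> carrier_mat n n \<Longrightarrow> h X \<in> carrier_mat n n"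
    and fh: "\<And>X. X \<in> carrier_mat n n \<Longrightarrow> f (h X) = X"
    and hf: "\<And>X. X \<in> carrier_mat n n \<Longrightarrow> h (f X) = X"
    and c: "c \<noteq> 0" "\<And>X. X \<in> carrier_mat n n \<Longrightarrow> P (f X) = c * P X"
  shows "restrict f (carrier_mat n n) \<in> proj_sym_group (Mat n) P"
proof -
  let ?C = "carrier_mat n n :: complex mat set"
  let ?g = "restrict f ?C"
  have bij: "bij_betw ?g ?C ?C"
    by (rule bij_betwI[of _ _ _ h]) (use f h fh hf in auto)
  have lin: "linear_map class_ring (Mat n) (Mat n) ?g"
    unfolding linear_map_Mat_iff using f add smult by auto
  have inv: "P (inv_into ?C ?g y) = inverse c * P y" if y: "y \<in> ?C" for y
  proof -
    have "inv_into ?C ?g y = h y"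
      by (rule inv_into_f_eq) (use bij y h fh in \<open>auto simp: bij_betw_def\<close>)
    moreover have "P y = c * P (h y)" using c(2)[OF h[OF y]] fh[OF y] by simp
    ultimately show ?thesis using c(1) by simp
  qed
  show ?thesis
    unfolding proj_sym_group_def GL_def using bij lin inv c(1)
    by (auto intro!: exI[of _ "inverse c"])
qed

lemma proj_sym_groupD:
  assumes g: "g \<in> proj_sym_group (Mat n) P"
  shows "g \<in> extensional (carrier_mat n n)"
    and "bij_betw g (carrier_mat n n) (carrier_mat n n)"
    and "\<And>X. X \<in> carrier_mat n n \<Longrightarrow> g X \<in> carrier_mat n n"
    and "\<And>X Y. X \<in> carrier_mat n n \<Longrightarrow> Y \<in> carrier_mat n n \<Longrightarrow> g (X + Y) = g X + g Y"
    and "\<And>a X. X \<in> carrier_mat n n \<Longrightarrow> g (a \<cdot>\<^sub>m X) = a \<cdot>\<^sub>m g X"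
    and "\<exists>c. c \<noteq> 0 \<and> (\<forall>X\<in>carrier_mat n n. P (g X) = c * P X)"
proof -
  show ext: "g \<in> extensional (carrier_mat n n)"
    and bij: "bij_betw g (carrier_mat n n) (carrier_mat n n)"
    using g by (auto simp: proj_sym_group_def GL_def)
  have lin: "linear_map class_ring (Mat n) (Mat n) g"
    using g by (auto simp: proj_sym_group_def GL_def)
  show "\<And>X. X \<in> carrier_mat n n \<Longrightarrow> g X \<in> carrier_mat n n"
    and "\<And>X Y. X \<in> carrier_mat n n \<Longrightarrow> Y \<in> carrier_mat n n \<Longrightarrow> g (X + Y) = g X + g Y"
    and "\<And>a X. X \<in> carrier_mat n n \<Longrightarrow> g (a \<cdot>\<^sub>m X) = a \<cdot>\<^sub>m g X"
    using lin by (auto simp: linear_map_Mat_iff)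
  obtain c where c: "c \<noteq> 0" "\<forall>y\<in>carrier_mat n n. P (inv_into (carrier_mat n n) g y) = c * P y"
    using g by (auto simp: proj_sym_group_def)
  have "P (g X) = inverse c * P X" if X: "X \<in> carrier_mat n n" for X
  proof -
    have "inv_into (carrier_mat n n) g (g X) = X"
      using bij X by (auto simp: bij_betw_def)
    moreover have "g X \<in> carrier_mat n n" using bij X by (auto simp: bij_betw_def)
    ultimately have "P X = c * P (g X)" using c(2) by metis
    thus ?thesis using c(1) by simp
  qed
  thus "\<exists>c. c \<noteq> 0 \<and> (\<forall>X\<in>carrier_mat n n. P (g X) = c * P X)"
    using c(1) by (intro exI[of _ "inverse c"]) auto
qed

section \<open>Linear maps preserving the determinant\<close>

definition unit_mat :: "nat \<Rightarrow> nat \<Rightarrow> nat \<Rightarrow> complex mat" where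
  "unit_mat n i j = mat n n (\<lambda>(a, b). if a = i \<and> b = j then 1 else 0)"

definition outer :: "nat \<Rightarrow> complex vec \<Rightarrow> complex vec \<Rightarrow> complex mat" where
  "outer n u v = mat n n (\<lambda>(i, j). u $ i * v $ j)"

lemma unit_mat_carrier [simp]: "unit_mat n i j \<in> carrier_mat n n"
  by (simp add: unit_mat_def)

lemma outer_carrier [simp]: "outer n u v \<in> carrier_mat n n"
  by (simp add: outer_def)

lemma dim_unit_mat [simp]: "dim_row (unit_mat n i j) = n" "dim_col (unit_mat n i j) = n"
  by (simp_all add: unit_mat_def)

lemma dim_outer [simp]: "dim_row (outer n u v) = n" "dim_col (outer n u v) = n"
  by (simp_all add: outer_def)

lemma unit_mat_index [simp]:
  "a < n \<Longrightarrow> b < n \<Longrightarrow> unit_mat n i j $$ (a, b) = (if a = i \<and> b = j then 1 else 0)"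
  by (simp add: unit_mat_def)

lemma outer_index [simp]:
  "i < n \<Longrightarrow> j < n \<Longrightarrow> outer n u v $$ (i, j) = u $ i * v $ j"
  by (simp add: outer_def)

lemma mult_square_carrier [simp]:
  "A \<in> carrier_mat n n \<Longrightarrow> B \<in> carrier_mat n n \<Longrightarrow> A * B \<in> carrier_mat n n"
  by (rule mult_carrier_mat)

lemma linear_map_expand:
  assumes lin: "linear_map class_ring (Mat m) (Mat n) f"
    and X: "X \<in> carrier_mat m m" and ab: "a < n" "b < n"
  shows "f X $$ (a, b) = (\<Sum>i<m. \<Sum>j<m. X $$ (i, j) * f (unit_mat m i j) $$ (a, b))"
proof -
  note L = lin[unfolded linear_map_Mat_iff]
  \<comment> \<open>\<open>M S\<close> keeps the entries of \<open>X\<close> in \<open>S\<close>;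
    enlarging \<open>S\<close> by one position adds one scaled matrix unit.\<close>
  define M where "M S = mat m m (\<lambda>p. if p \<in> S then X $$ p else 0)" for S
  have MC: "M S \<in> carrier_mat m m" for S by (simp add: M_def)
  have "S \<subseteq> {..<m} \<times> {..<m} \<Longrightarrow>
      f (M S) $$ (a, b) = (\<Sum>(i, j)\<in>S. X $$ (i, j) * f (unit_mat m i j) $$ (a, b))"
    if "finite S" for S
    using that
  proof (induction S rule: finite_induct)
    case empty
    have "M {} = 0 \<cdot>\<^sub>m M {}" by (rule eq_matI) (auto simp: M_def)
    hence "f (M {}) = 0 \<cdot>\<^sub>m f (M {})" using L MC by metis
    moreover have "f (M {}) \<in> carrier_mat n n" using L MC by blast
    ultimately have "f (M {}) $$ (a, b) = 0 * f (M {}) $$ (a, b)"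
      using ab by (metis carrier_matD index_smult_mat(1))
    thus ?case by simp
  next
    case (insert p S)
    obtain i j where p: "p = (i, j)" by force
    have "M (insert p S) = X $$ (i, j) \<cdot>\<^sub>m unit_mat m i j + M S"
      using insert.hyps insert.prems p by (intro eq_matI) (auto simp: M_def unit_mat_def)
    hence e: "f (M (insert p S)) = X $$ (i, j) \<cdot>\<^sub>m f (unit_mat m i j) + f (M S)"
      using L MC by (metis smult_carrier_mat unit_mat_carrier)
    have "f (unit_mat m i j) \<in> carrier_mat n n" "f (M S) \<in> carrier_mat n n"
      using L MC by auto
    thus ?case using insert p ab unfolding e by auto
  qed
  from this[of "{..<m} \<times> {..<m}"]
  have "f (M ({..<m} \<times> {..<m})) $$ (a, b)
      = (\<Sum>i<m. \<Sum>j<m. X $$ (i, j) * f (unit_mat m i j) $$ (a, b))"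
    by (simp add: sum.cartesian_product)
  moreover have "M ({..<m} \<times> {..<m}) = X"
    using X by (intro eq_matI) (auto simp: M_def)
  ultimately show ?thesis by simp
qed

lemma obtain_inverse_mat:
  fixes P :: "'a::field mat"
  assumes "P \<in> carrier_mat n n" "det P \<noteq> 0"
  obtains P' where "P' \<in> carrier_mat n n" "P * P' = 1\<^sub>m n" "P' * P = 1\<^sub>m n" "det P' \<noteq> 0"
proof -
  from det_non_zero_imp_unit[OF assms, of n] obtain P' where
    "P' \<in> carrier_mat n n" "P * P' = 1\<^sub>m n" "P' * P = 1\<^sub>m n"
    unfolding Units_def ring_mat_def by auto
  moreover from this have "det P * det P' = 1"
    using assms by (metis det_mult det_one)
  ultimately show thesis using that by (metis mult_zero_right zero_neq_one)
qed

section \<open>Rank one as affineness of the determinant\<close>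

lemma rank_normal_form:
  fixes X :: "'a::field mat"
  assumes "X \<in> carrier_mat n n"
  shows "\<exists>P Q r. P \<in> carrier_mat n n \<and> Q \<in> carrier_mat n n \<and> det P \<noteq> 0 \<and> det Q \<noteq> 0 \<and> r \<le> n \<and>
    P * X * Q = mat n n (\<lambda>(i, j). if i = j \<and> i < r then 1 else 0)"
  using assms
proof (induction n arbitrary: X)
  case 0
  show ?case
    by (intro exI[of _ "1\<^sub>m 0"] exI[of _ 0]) (use 0 in \<open>auto intro!: eq_matI\<close>)
next
  case (Suc n)
  show ?case
  proof (cases "\<exists>a b. a < Suc n \<and> b < Suc n \<and> X $$ (a, b) \<noteq> 0")
    case False
    hence "X = mat (Suc n) (Suc n) (\<lambda>(i, j). if i = j \<and> i < 0 then 1 else 0)"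
      using Suc.prems by (intro eq_matI) auto
    thus ?thesis using Suc.prems
      by (intro exI[of _ "1\<^sub>m (Suc n)"] exI[of _ 0]) auto
  next
    case True
    then obtain a b where ab: "a < Suc n" "b < Suc n" "X $$ (a, b) \<noteq> 0" by blast
    define x where "x = X $$ (a, b)"
    have x: "x \<noteq> 0" using ab x_def by simp
    define S where "S k = (if k = 0 then 1\<^sub>m (Suc n) else swaprows_mat (Suc n) 0 k :: 'a mat)" for k
      :: nat
    have SC: "S k \<in> carrier_mat (Suc n) (Suc n)" for k by (simp add: S_def)
    have Sdet: "det (S k) \<noteq> (0::'a)" if "k < Suc n" for k
      using that by (auto simp: S_def det_swaprows_mat)
    define X1 where "X1 = S a * X * S b"
    have X1C: "X1 \<in> carrier_mat (Suc n) (Suc n)" using SC Suc.prems unfolding X1_def by auto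
    have SaX: "S a * X = (if a = 0 then X else swaprows 0 a X)"
      using swaprows_mat[OF Suc.prems, of 0 a] ab Suc.prems by (auto simp: S_def)
    have SX: "(S a * X) $$ (0, j) = X $$ (a, j)" if "j < Suc n" for j
      using that ab Suc.prems unfolding SaX by auto
    have YSb: "Y * S b = (if b = 0 then Y else swapcols 0 b Y)"
      if "Y \<in> carrier_mat (Suc n) (Suc n)" for Y :: "'a mat"
      using swapcols_mat[OF that, of 0 b] ab that by (auto simp: S_def)
    have XS: "(Y * S b) $$ (0, 0) = Y $$ (0, b)" if "Y \<in> carrier_mat (Suc n) (Suc n)" for Y :: "'a mat"
      using that ab unfolding YSb[OF that] by auto
    have X100: "X1 $$ (0, 0) = x"
      unfolding X1_def x_def using XS[of "S a * X"] SX ab SC[of a] Suc.prems by simp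
    define r c D where "r = mat 1 n (\<lambda>(i, j). X1 $$ (0, Suc j))"
      and "c = mat n 1 (\<lambda>(i, j). X1 $$ (Suc i, 0))"
      and "D = mat n n (\<lambda>(i, j). X1 $$ (Suc i, Suc j))"
    have car: "r \<in> carrier_mat 1 n" "c \<in> carrier_mat n 1" "D \<in> carrier_mat n n"
      by (auto simp: r_def c_def D_def)
    have X1: "X1 = four_block_mat (x \<cdot>\<^sub>m 1\<^sub>m 1) r c D"
      using X1C X100 by (intro eq_matI) (auto simp: r_def c_def D_def)
    \<comment> \<open>Gaussian elimination with the pivot \<open>x\<close>: \<open>L\<close>
      normalises row 0 and clears column 0, \<open>R\<close> clears row 0, and the Schur complement
      \<open>D'\<close> is left to the induction.\<close>
    define L where "L = four_block_mat (inverse x \<cdot>\<^sub>m 1\<^sub>m 1) (0\<^sub>m 1 n) (- (inverse x \<cdot>\<^sub>m c)) (1\<^sub>m n)"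
    define R where "R = four_block_mat (1\<^sub>m 1) (- (inverse x \<cdot>\<^sub>m r)) (0\<^sub>m n 1) (1\<^sub>m n)"
    have LRC: "L \<in> carrier_mat (Suc n) (Suc n)" "R \<in> carrier_mat (Suc n) (Suc n)"
      by (auto simp: L_def R_def car)
    have Ldet: "det L \<noteq> 0" unfolding L_def
      using x car by (subst det_four_block_mat_upper_right_zero) auto
    have Rdet: "det R \<noteq> 0" unfolding R_def
      using x car by (subst det_four_block_mat_lower_left_zero) auto
    define D' where "D' = D - inverse x \<cdot>\<^sub>m (c * r)"
    have D'C: "D' \<in> carrier_mat n n" using car by (auto simp: D'_def)
    have "L * X1 = four_block_mat (1\<^sub>m 1) (inverse x \<cdot>\<^sub>m r) (0\<^sub>m n 1) D'"
      unfolding L_def X1 using car x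
      apply (subst mult_four_block_mat[of _ 1 1 _ n _ n _ _ 1 _ n])
                 apply auto
       apply (rule cong_four_block_mat)
          apply (auto intro!: eq_matI simp: D'_def scalar_prod_def)
      done
    hence LXR: "L * X1 * R = four_block_mat (1\<^sub>m 1) (0\<^sub>m 1 n) (0\<^sub>m n 1) D'"
      unfolding R_def using car x D'C
      apply simp
      apply (subst mult_four_block_mat[of _ 1 1 _ n _ n _ _ 1 _ n])
                 apply auto
      done
    obtain P Q r' where IH: "P \<in> carrier_mat n n" "Q \<in> carrier_mat n n" "det P \<noteq> 0" "det Q \<noteq> 0" "r' \<le> n"
      "P * D' * Q = mat n n (\<lambda>(i, j). if i = j \<and> i < r' then 1 else 0)"
      using Suc.IH[OF D'C] by blast
    define P1 where "P1 = four_block_mat (1\<^sub>m 1) (0\<^sub>m 1 n) (0\<^sub>m n 1) P"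
    define Q1 where "Q1 = four_block_mat (1\<^sub>m 1) (0\<^sub>m 1 n) (0\<^sub>m n 1) Q"
    have PQC: "P1 \<in> carrier_mat (Suc n) (Suc n)" "Q1 \<in> carrier_mat (Suc n) (Suc n)"
      using IH by (auto simp: P1_def Q1_def)
    have dets: "det P1 \<noteq> 0" "det Q1 \<noteq> 0"
      unfolding P1_def Q1_def using IH by (subst det_four_block_mat_upper_right_zero; auto)+
    have "P1 * (L * X1 * R) * Q1 = four_block_mat (1\<^sub>m 1) (0\<^sub>m 1 n) (0\<^sub>m n 1) (P * D' * Q)"
      unfolding LXR P1_def Q1_def using IH D'C
      apply (subst mult_four_block_mat[of _ 1 1 _ n _ n _ _ 1 _ n]; simp?)
      apply (subst mult_four_block_mat[of _ 1 1 _ n _ n _ _ 1 _ n]; simp?)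
      done
    also have "\<dots> = mat (Suc n) (Suc n) (\<lambda>(i, j). if i = j \<and> i < Suc r' then 1 else 0)"
      unfolding IH using IH by (intro eq_matI) auto
    finally have fin: "P1 * (L * X1 * R) * Q1
        = mat (Suc n) (Suc n) (\<lambda>(i, j). if i = j \<and> i < Suc r' then 1 else 0)" .
    have "P1 * (L * X1 * R) * Q1 = (P1 * L * S a) * X * (S b * R * Q1)"
      unfolding X1_def using PQC LRC SC Suc.prems
      by (simp add: assoc_mult_mat[of _ "Suc n" "Suc n" _ "Suc n" _ "Suc n"])
    moreover have "det (P1 * L * S a) \<noteq> 0"
      using PQC LRC SC dets Ldet Sdet ab
      by (simp add: det_mult[of _ "Suc n"])
    moreover have "det (S b * R * Q1) \<noteq> 0"
      using PQC LRC SC dets Rdet Sdet ab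
      by (simp add: det_mult[of _ "Suc n"])
    ultimately show ?thesis using fin IH(5) PQC LRC SC
      by (intro exI[of _ "P1 * L * S a"] exI[of _ "S b * R * Q1"] exI[of _ "Suc r'"]) auto
  qed
qed

text \<open>A condition expressed through \<open>P\<close> alone, so that linear bijections scaling
  \<open>P\<close> keep it. For the determinant it characterises rank at most one; for the permanent
  it holds on each row and each column and forces all 2 x 2 subpermanents to vanish.\<close>

definition affine_along :: "(complex mat \<Rightarrow> complex) \<Rightarrow> nat \<Rightarrow> complex mat \<Rightarrow> bool" where
  "affine_along P n X \<longleftrightarrow>
     (\<forall>Y\<in>carrier_mat n n. \<exists>a b. \<forall>x. P (x \<cdot>\<^sub>m X + Y) = a + b * x)"

abbreviation "det_affine \<equiv> affine_along det"

text \<open>Dependence as vanishing of the 2 x 2 minors. The zero vector is parallel to every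
  vector, hence the nonvanishing hypothesis in \<open>parallel_trans\<close>.\<close>

definition parallel :: "nat \<Rightarrow> complex vec \<Rightarrow> complex vec \<Rightarrow> bool" where
  "parallel n u v \<longleftrightarrow> (\<forall>i<n. \<forall>k<n. u $ i * v $ k = u $ k * v $ i)"

lemma mult_add_mult_distrib_mat:
  fixes P Q X Y :: "complex mat"
  assumes "P \<in> carrier_mat n n" "Q \<in> carrier_mat n n" "X \<in> carrier_mat n n" "Y \<in> carrier_mat n n"
  shows "P * (x \<cdot>\<^sub>m X + Y) * Q = x \<cdot>\<^sub>m (P * X * Q) + P * Y * Q"
proof -
  have "P * (x \<cdot>\<^sub>m X + Y) = x \<cdot>\<^sub>m (P * X) + P * Y"
    using assms by (simp add: mult_add_distrib_mat[of _ n n _ n] mult_smult_distrib[of _ n n _ n])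
  thus ?thesis
    using assms by (simp add: add_mult_distrib_mat[of _ n n _ _ n] mult_smult_assoc_mat[of _ n n _ n])
qed

lemma det_affine_equiv:
  assumes X: "X \<in> carrier_mat n n" and P: "P \<in> carrier_mat n n" "det P \<noteq> 0"
    and Q: "Q \<in> carrier_mat n n" "det Q \<noteq> 0" and aff: "det_affine n X"
  shows "det_affine n (P * X * Q)"
  unfolding affine_along_def
proof
  fix Y :: "complex mat" assume Y: "Y \<in> carrier_mat n n"
  obtain P' where P': "P' \<in> carrier_mat n n" "P * P' = 1\<^sub>m n" "P' * P = 1\<^sub>m n"
    using obtain_inverse_mat[OF P] by metis
  obtain Q' where Q': "Q' \<in> carrier_mat n n" "Q * Q' = 1\<^sub>m n" "Q' * Q = 1\<^sub>m n"
    using obtain_inverse_mat[OF Q] by metis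
  define Z where "Z = P' * Y * Q'"
  have Z: "Z \<in> carrier_mat n n" using P' Q' Y by (simp add: Z_def)
  have "P * Z * Q = (P * P') * Y * (Q' * Q)"
    unfolding Z_def using P Q P'(1) Q'(1) Y by (simp add: assoc_mult_mat[of _ n n _ n _ n])
  hence PZQ: "P * Z * Q = Y" using P' Q' Y by simp
  obtain a b where ab: "\<And>x. det (x \<cdot>\<^sub>m X + Z) = a + b * x"
    using aff Z unfolding affine_along_def by metis
  have "det (x \<cdot>\<^sub>m (P * X * Q) + Y) = det P * (a + b * x) * det Q" for x
  proof -
    have "x \<cdot>\<^sub>m (P * X * Q) + Y = P * (x \<cdot>\<^sub>m X + Z) * Q"
      using mult_add_mult_distrib_mat[OF P(1) Q(1) X Z] PZQ by simp
    thus ?thesis using P Q X Z ab by (simp add: det_mult[of _ n])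
  qed
  thus "\<exists>a b. \<forall>x. det (x \<cdot>\<^sub>m (P * X * Q) + Y) = a + b * x"
    by (intro exI[of _ "det P * a * det Q"] exI[of _ "det P * b * det Q"]) (auto simp: algebra_simps)
qed

lemma mult_outer_mult:
  assumes "P \<in> carrier_mat n n" "Q \<in> carrier_mat n n" "u \<in> carrier_vec n" "v \<in> carrier_vec n"
  shows "P * outer n u v * Q = outer n (P *\<^sub>v u) (Q\<^sup>T *\<^sub>v v)"
proof (rule eq_matI)
  fix i j assume "i < dim_row (outer n (P *\<^sub>v u) (Q\<^sup>T *\<^sub>v v))" "j < dim_col (outer n (P *\<^sub>v u) (Q\<^sup>T *\<^sub>v v))"
  hence ij: "i < n" "j < n" by (simp_all add: outer_def)
  have "(P * outer n u v * Q) $$ (i, j) = (\<Sum>k = 0..<n. (\<Sum>l = 0..<n. P $$ (i, l) * (u $ l * v $ k)) * Q $$ (k, j))"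
    using assms ij by (simp add: scalar_prod_def outer_def row_def col_def)
  also have "\<dots> = (\<Sum>l = 0..<n. P $$ (i, l) * u $ l) * (\<Sum>k = 0..<n. Q $$ (k, j) * v $ k)"
    unfolding sum_product sum_distrib_right
    by (subst sum.swap) (simp add: mult_ac sum_distrib_left)
  also have "\<dots> = outer n (P *\<^sub>v u) (Q\<^sup>T *\<^sub>v v) $$ (i, j)"
    using assms ij by (simp add: scalar_prod_def)
  finally show "(P * outer n u v * Q) $$ (i, j) = outer n (P *\<^sub>v u) (Q\<^sup>T *\<^sub>v v) $$ (i, j)" .
qed (use assms in \<open>auto simp: outer_def\<close>)

lemma det_diag_prod:
  fixes d :: "nat \<Rightarrow> complex"
  shows "det (mat n n (\<lambda>(i, j). if i = j then d i else 0)) = (\<Prod>i<n. d i)"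
  by (subst det_upper_triangular[of _ n])
    (auto simp: prod_list_diag_prod atLeast0LessThan intro!: upper_triangularI)

lemma det_affine_outer:
  assumes "n > 0" "u \<in> carrier_vec n" "v \<in> carrier_vec n"
  shows "det_affine n (outer n u v)"
proof -
  obtain P Q r where N: "P \<in> carrier_mat n n" "Q \<in> carrier_mat n n" "det P \<noteq> 0" "det Q \<noteq> 0"
     "P * outer n u v * Q = mat n n (\<lambda>(i, j). if i = j \<and> i < r then 1 else 0)" "r \<le> n"
    using rank_normal_form[of "outer n u v" n] by auto
  let ?D = "mat n n (\<lambda>(i, j). if i = j \<and> i < r then 1 else (0::complex))"
  \<comment> \<open>Multiplying by \<open>P\<close> and \<open>Q\<close> keeps an outer product an
    outer product, whose 2 x 2 minors vanish; the normal form has a minor equal to 1 once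
    \<open>r\<close> is at least 2.\<close>
  have "r \<le> 1"
  proof (rule ccontr)
    assume "\<not> r \<le> 1"
    hence r: "0 < n" "1 < n" "r \<ge> 2" using N by auto
    have D: "outer n (P *\<^sub>v u) (Q\<^sup>T *\<^sub>v v) = ?D"
      using N mult_outer_mult[OF N(1,2) assms(2,3)] by simp
    have "outer n (P *\<^sub>v u) (Q\<^sup>T *\<^sub>v v) $$ (0, 0) * outer n (P *\<^sub>v u) (Q\<^sup>T *\<^sub>v v) $$ (1, 1)
        = outer n (P *\<^sub>v u) (Q\<^sup>T *\<^sub>v v) $$ (0, 1) * outer n (P *\<^sub>v u) (Q\<^sup>T *\<^sub>v v) $$ (1, 0)"
      using r by (simp del: index_mult_mat_vec)
    thus False unfolding D using r by simp
  qed
  \<comment> \<open>Only row 0 of \<open>x \<cdot>\<^sub>m ?D + Y\<close> depends on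
    \<open>x\<close>, so the Laplace expansion along it is affine.\<close>
  have affD: "det_affine n ?D"
    unfolding affine_along_def
  proof
    fix Y :: "complex mat" assume Y: "Y \<in> carrier_mat n n"
    define g where "g = (\<lambda>j. cofactor Y 0 j)"
    have "det (x \<cdot>\<^sub>m ?D + Y) = (\<Sum>j<n. (Y $$ (0, j) + (if j = 0 \<and> r = 1 then x else 0)) * cofactor Y 0 j)" for x
    proof -
      have C: "x \<cdot>\<^sub>m ?D + Y \<in> carrier_mat n n" using Y by simp
      have "cofactor (x \<cdot>\<^sub>m ?D + Y) 0 j = cofactor Y 0 j" if "j < n" for j
      proof -
        have "mat_delete (x \<cdot>\<^sub>m ?D + Y) 0 j = mat_delete Y 0 j"
          unfolding mat_delete_def using Y \<open>r \<le> 1\<close> that by (intro eq_matI) auto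
        thus ?thesis by (simp add: cofactor_def)
      qed
      moreover have "(x \<cdot>\<^sub>m ?D + Y) $$ (0, j) = Y $$ (0, j) + (if j = 0 \<and> r = 1 then x else 0)" if "j < n" for j
        using Y \<open>r \<le> 1\<close> that by auto
      ultimately show ?thesis
        using laplace_expansion_row[OF C assms(1)] by simp
    qed
    moreover have "(\<Sum>j<n. (Y $$ (0, j) + (if j = 0 \<and> r = 1 then x else 0)) * cofactor Y 0 j)
        = (\<Sum>j<n. Y $$ (0, j) * cofactor Y 0 j) + (\<Sum>j<n. (if j = 0 \<and> r = 1 then 1 else 0) * cofactor Y 0 j) * x" for x
      unfolding sum_distrib_right sum.distrib[symmetric]
      by (intro sum.cong) (auto simp: algebra_simps)
    ultimately show "\<exists>a b. \<forall>x. det (x \<cdot>\<^sub>m ?D + Y) = a + b * x"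
      by (intro exI[of _ "\<Sum>j<n. Y $$ (0, j) * cofactor Y 0 j"]
          exI[of _ "\<Sum>j<n. (if j = 0 \<and> r = 1 then 1 else 0) * cofactor Y 0 j"] allI) (simp only:)
  qed
  obtain P' where P': "P' \<in> carrier_mat n n" "P * P' = 1\<^sub>m n" "P' * P = 1\<^sub>m n" "det P' \<noteq> 0"
    using obtain_inverse_mat[OF N(1,3)] by metis
  obtain Q' where Q': "Q' \<in> carrier_mat n n" "Q * Q' = 1\<^sub>m n" "Q' * Q = 1\<^sub>m n" "det Q' \<noteq> 0"
    using obtain_inverse_mat[OF N(2,4)] by metis
  have "P' * ?D * Q' = (P' * P) * outer n u v * (Q * Q')"
    unfolding N(5)[symmetric] using N(1,2) P'(1) Q'(1) by (simp add: assoc_mult_mat[of _ n n _ n _ n])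
  also have "\<dots> = outer n u v" using P' Q' outer_carrier[of n u v]
    by (simp add: left_mult_one_mat[of _ n n] right_mult_one_mat[of _ n n])
  finally show ?thesis using det_affine_equiv[OF _ P'(1,4) Q'(1,4) affD] by simp
qed

text \<open>After reduction to the normal form of rank \<open>r\<close>, adding the complementary
  projection gives the determinant \<open>x ^ r\<close>, which is affine in \<open>x\<close> only
  for \<open>r \<le> 1\<close>.\<close>

lemma outer_if_det_affine:
  assumes X: "X \<in> carrier_mat n n" and aff: "det_affine n X"
  shows "\<exists>u v. u \<in> carrier_vec n \<and> v \<in> carrier_vec n \<and> X = outer n u v"
proof -
  obtain P Q r where N: "P \<in> carrier_mat n n" "Q \<in> carrier_mat n n" "det P \<noteq> 0" "det Q \<noteq> 0"
     "P * X * Q = mat n n (\<lambda>(i, j). if i = j \<and> i < r then 1 else 0)" "r \<le> n"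
    using rank_normal_form[OF X] by auto
  let ?D = "mat n n (\<lambda>(i, j). if i = j \<and> i < r then 1 else (0::complex))"
  have affD: "det_affine n ?D" using det_affine_equiv[OF X N(1,3) N(2,4) aff] N by simp
  have r: "r \<le> 1"
  proof -
    define Y where "Y = mat n n (\<lambda>(i, j). if i = j \<and> \<not> i < r then 1 else (0::complex))"
    obtain a b where ab: "\<And>x. det (x \<cdot>\<^sub>m ?D + Y) = a + b * x"
      using affD mat_carrier[of n n "\<lambda>(i, j). if i = j \<and> \<not> i < r then 1 else (0::complex)"]
      unfolding affine_along_def Y_def by blast
    have "det (x \<cdot>\<^sub>m ?D + Y) = x ^ r" for x
    proof -
      have "x \<cdot>\<^sub>m ?D + Y = mat n n (\<lambda>(i, j). if i = j then (if i < r then x else 1) else 0)"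
        unfolding Y_def by (intro eq_matI) auto
      hence "det (x \<cdot>\<^sub>m ?D + Y) = (\<Prod>i<n. if i < r then x else 1)"
        by (simp add: det_diag_prod)
      also have "\<dots> = (\<Prod>i<r. x)" using N(6)
        by (intro prod.mono_neutral_cong_right) auto
      finally show ?thesis by simp
    qed
    hence e: "x ^ r = a + b * x" for x using ab[of x] by simp
    show ?thesis
    proof (rule ccontr)
      assume "\<not> r \<le> 1"
      then obtain k where k: "r = Suc (Suc k)" by (cases r; cases "r - 1") auto
      have "a = 0" using e[of 0] k by simp
      have "b = 1" using e[of 1] \<open>a = 0\<close> by simp
      have "(2::complex) ^ r = 2" using e[of 2] \<open>a = 0\<close> \<open>b = 1\<close> by simp
      hence "(2::complex) ^ Suc k = 1" unfolding k by simp
      hence "norm ((2::complex) ^ Suc k) = 1" by simp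
      hence "(2::real) ^ Suc k = 1" by (simp add: norm_mult norm_power)
      thus False using one_less_power[of "2::real" "Suc k"] by simp
    qed
  qed
  define e where "e = vec n (\<lambda>i. if i < r then 1 else (0::complex))"
  have D: "?D = outer n e e" using r by (intro eq_matI) (auto simp: e_def outer_def)
  obtain P' where P': "P' \<in> carrier_mat n n" "P * P' = 1\<^sub>m n" "P' * P = 1\<^sub>m n" "det P' \<noteq> 0"
    using obtain_inverse_mat[OF N(1,3)] by metis
  obtain Q' where Q': "Q' \<in> carrier_mat n n" "Q * Q' = 1\<^sub>m n" "Q' * Q = 1\<^sub>m n" "det Q' \<noteq> 0"
    using obtain_inverse_mat[OF N(2,4)] by metis
  have "P' * ?D * Q' = (P' * P) * X * (Q * Q')"
    unfolding N(5)[symmetric] using N(1,2) P'(1) Q'(1) X by (simp add: assoc_mult_mat[of _ n n _ n _ n])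
  also have "\<dots> = X" using P' Q' X by simp
  finally have "X = outer n (P' *\<^sub>v e) (Q'\<^sup>T *\<^sub>v e)"
    unfolding D using mult_outer_mult[OF P'(1) Q'(1), of e e] by (simp add: e_def)
  thus ?thesis using P'(1) Q'(1)
    by (intro exI[of _ "P' *\<^sub>v e"] exI[of _ "Q'\<^sup>T *\<^sub>v e"]) (auto simp: e_def)
qed

lemma det_affine_minor:
  assumes "X \<in> carrier_mat n n" "det_affine n X" "i < n" "j < n" "k < n" "l < n"
  shows "X $$ (i, j) * X $$ (k, l) = X $$ (i, l) * X $$ (k, j)"
  using outer_if_det_affine[OF assms(1,2)] assms by auto

lemma affine_along_map:
  assumes g: "g \<in> proj_sym_group (Mat n) P" and X: "X \<in> carrier_mat n n"
  shows "affine_along P n (g X) \<longleftrightarrow> affine_along P n X"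
proof -
  note G = proj_sym_groupD[OF g]
  obtain c where c: "c \<noteq> 0" "\<And>X. X \<in> carrier_mat n n \<Longrightarrow> P (g X) = c * P X" using G(6) by blast
  have e: "P (x \<cdot>\<^sub>m g X + g Y) = c * P (x \<cdot>\<^sub>m X + Y)" if "Y \<in> carrier_mat n n" for x Y
    using G(4,5) c(2) X that by (metis add_carrier_mat smult_carrier_mat)
  show ?thesis
  proof
    assume L: "affine_along P n (g X)"
    show "affine_along P n X" unfolding affine_along_def
    proof
      fix Y :: "complex mat" assume Y: "Y \<in> carrier_mat n n"
      from L obtain a b where "\<forall>x. P (x \<cdot>\<^sub>m g X + g Y) = a + b * x"
        unfolding affine_along_def using G(3)[OF Y] by blast
      hence "\<forall>x. P (x \<cdot>\<^sub>m X + Y) = a / c + b / c * x"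
        using e[OF Y] c(1) by (auto simp: field_simps)
      thus "\<exists>a b. \<forall>x. P (x \<cdot>\<^sub>m X + Y) = a + b * x" by blast
    qed
  next
    assume R: "affine_along P n X"
    show "affine_along P n (g X)" unfolding affine_along_def
    proof
      fix Y' :: "complex mat" assume "Y' \<in> carrier_mat n n"
      then obtain Y where Y: "Y \<in> carrier_mat n n" "Y' = g Y"
        using G(2) unfolding bij_betw_def by blast
      from R obtain a b where "\<forall>x. P (x \<cdot>\<^sub>m X + Y) = a + b * x"
        unfolding affine_along_def using Y by blast
      hence "\<forall>x. P (x \<cdot>\<^sub>m g X + Y') = c * a + c * b * x"
        using e[OF Y(1)] Y by (auto simp: field_simps)
      thus "\<exists>a b. \<forall>x. P (x \<cdot>\<^sub>m g X + Y') = a + b * x" by blast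
    qed
  qed
qed

text \<open>\<open>U\<close> and \<open>V\<close> will say that the images of two matrix units have parallel left, respectively
  right, factors.\<close>

lemma rook_colouring:
  fixes U V :: "nat \<times> nat \<Rightarrow> nat \<times> nat \<Rightarrow> bool" and n :: nat
  defines "C \<equiv> {..<n} \<times> {..<n}"
  assumes Urefl: "\<And>c. c \<in> C \<Longrightarrow> U c c" and Vrefl: "\<And>c. c \<in> C \<Longrightarrow> V c c"
    and Usym: "\<And>c d. c \<in> C \<Longrightarrow> d \<in> C \<Longrightarrow> U c d \<Longrightarrow> U d c"
    and Vsym: "\<And>c d. c \<in> C \<Longrightarrow> d \<in> C \<Longrightarrow> V c d \<Longrightarrow> V d c"
    and Utrans: "\<And>c d e. c \<in> C \<Longrightarrow> d \<in> C \<Longrightarrow> e \<in> C \<Longrightarrow> U c d \<Longrightarrow> U d e \<Longrightarrow> U c e"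
    and Vtrans: "\<And>c d e. c \<in> C \<Longrightarrow> d \<in> C \<Longrightarrow> e \<in> C \<Longrightarrow> V c d \<Longrightarrow> V d e \<Longrightarrow> V c e"
    and line: "\<And>c d. c \<in> C \<Longrightarrow> d \<in> C \<Longrightarrow> c \<noteq> d \<Longrightarrow> fst c = fst d \<or> snd c = snd d \<Longrightarrow> U c d \<longleftrightarrow> \<not> V c d"
    and off: "\<And>c d. c \<in> C \<Longrightarrow> d \<in> C \<Longrightarrow> fst c \<noteq> fst d \<Longrightarrow> snd c \<noteq> snd d \<Longrightarrow> \<not> U c d \<and> \<not> V c d"
  shows "(\<forall>i<n. \<forall>j<n. \<forall>k<n. U (i, j) (i, k) \<and> V (j, i) (k, i)) \<or>
         (\<forall>i<n. \<forall>j<n. \<forall>k<n. V (i, j) (i, k) \<and> U (j, i) (k, i))"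
proof (cases "n \<le> 1")
  case True
  have "(i, j) = (i, k)" "(j, i) = (k, i)" "(i, j) \<in> C" "(j, i) \<in> C"
    if "i < n" "j < n" "k < n" for i j k using that True by (auto simp: C_def)
  thus ?thesis using Urefl Vrefl by metis
next
  case False
  have C: "(i, j) \<in> C" if "i < n" "j < n" for i j using that by (simp add: C_def)
  \<comment> \<open>If \<open>U\<close> links \<open>c\<close> to \<open>a\<close> but
    \<open>V\<close> links \<open>c\<close> to \<open>b\<close>, then \<open>a\<close> and
    \<open>b\<close>, being on one line, are linked by \<open>U\<close> or by \<open>V\<close>, and
    transitivity contradicts \<open>line\<close> either way.\<close>
  have same: "U c b" if "c \<in> C" "a \<in> C" "b \<in> C" "a \<noteq> c" "b \<noteq> c" "U c a"
      "(fst a = fst c \<and> fst b = fst c) \<or> (snd a = snd c \<and> snd b = snd c)" for a b c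
  proof (rule ccontr)
    assume "\<not> U c b"
    hence V: "V c b" using line[of c b] that by auto
    have ab: "a \<noteq> b" using \<open>\<not> U c b\<close> that by auto
    show False
    proof (cases "U a b")
      case True thus False using \<open>\<not> U c b\<close> Utrans that by blast
    next
      case False
      hence "V a b" using line[of a b] that ab by auto
      hence "V c a" using Vtrans[of c b a] Vsym V that by blast
      thus False using line[of c a] that by auto
    qed
  qed
  \<comment> \<open>Were the row link and the column link at \<open>(i, j)\<close> of the same type,
    transitivity would link \<open>(i, l)\<close> to \<open>(k, j)\<close>, which \<open>off\<close>
    forbids. Hence rows and columns have opposite types.\<close>
  have cross: "U (i, j) (i, l) \<longleftrightarrow> V (i, j) (k, j)"
    if "i < n" "j < n" "k < n" "l < n" "l \<noteq> j" "k \<noteq> i" for i j k l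
  proof -
    have "\<not> (U (i, j) (i, l) \<and> U (i, j) (k, j))"
      using Utrans[OF C C C, of i l i j k j] Usym[OF C C, of i j i l] off[OF C C, of i l k j] that by auto
    moreover have "\<not> (V (i, j) (i, l) \<and> V (i, j) (k, j))"
      using Vtrans[OF C C C, of i l i j k j] Vsym[OF C C, of i j i l] off[OF C C, of i l k j] that by auto
    moreover have "U (i, j) (i, l) \<longleftrightarrow> \<not> V (i, j) (i, l)" "U (i, j) (k, j) \<longleftrightarrow> \<not> V (i, j) (k, j)"
      using line[OF C C, of i j i l] line[OF C C, of i j k j] that by auto
    ultimately show ?thesis by blast
  qed
  \<comment> \<open>From here the type of the row link at one cell is spread along its row and then
    over all rows.\<close>
  have S1: "U (i, j) (i, l) \<longleftrightarrow> U (i, j) (i, l')"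
    if "i < n" "j < n" "l < n" "l' < n" "l \<noteq> j" "l' \<noteq> j" for i j l l'
  proof
    show "U (i, j) (i, l')" if "U (i, j) (i, l)"
      by (rule same[OF C C C, of i j i l i l']) (use that \<open>i < n\<close> \<open>j < n\<close> \<open>l < n\<close> \<open>l' < n\<close> \<open>l \<noteq> j\<close> \<open>l' \<noteq> j\<close> in simp_all)
    show "U (i, j) (i, l)" if "U (i, j) (i, l')"
      by (rule same[OF C C C, of i j i l' i l]) (use that \<open>i < n\<close> \<open>j < n\<close> \<open>l < n\<close> \<open>l' < n\<close> \<open>l \<noteq> j\<close> \<open>l' \<noteq> j\<close> in simp_all)
  qed
  have S2: "U (i, j) (i, l) \<longleftrightarrow> U (i, l) (i, j)" if "i < n" "j < n" "l < n" for i j l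
    using Usym[OF C C] that by blast
  have S3: "U (i, j) (i, l) \<longleftrightarrow> U (i, j') (i, l')"
    if "i < n" "j < n" "l < n" "j' < n" "l' < n" "l \<noteq> j" "l' \<noteq> j'" for i j l j' l'
  proof (cases "j' = j")
    case True thus ?thesis using S1 that by blast
  next
    case False
    have "U (i, j) (i, l) \<longleftrightarrow> U (i, j) (i, j')" using that False by (intro S1) auto
    also have "\<dots> \<longleftrightarrow> U (i, j') (i, j)" using that by (intro S2) auto
    also have "\<dots> \<longleftrightarrow> U (i, j') (i, l')" using that False by (intro S1) auto
    finally show ?thesis .
  qed
  have S4: "U (i, j) (i, l) \<longleftrightarrow> U (k, j) (k, l)"
    if "i < n" "j < n" "l < n" "k < n" "l \<noteq> j" for i j k l
  proof (cases "i = k")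
    case False
    have "U (i, j) (i, l) \<longleftrightarrow> V (i, j) (k, j)" using that False by (intro cross) auto
    also have "\<dots> \<longleftrightarrow> V (k, j) (i, j)" using Vsym[OF C C] that by blast
    also have "\<dots> \<longleftrightarrow> U (k, j) (k, l)" using that False by (intro cross[symmetric]) auto
    finally show ?thesis .
  qed simp
  have n: "0 < n" "1 < n" using False by auto
  have S: "U (i, j) (i, l) \<longleftrightarrow> U (0, 0) (0, 1)" if "i < n" "j < n" "l < n" "l \<noteq> j" for i j l
  proof -
    have "U (i, j) (i, l) \<longleftrightarrow> U (i, 0) (i, 1)" using that n by (intro S3) auto
    also have "\<dots> \<longleftrightarrow> U (0, 0) (0, 1)" using that n by (intro S4) auto
    finally show ?thesis .
  qed
  have rows: "U (i, j) (i, l) \<longleftrightarrow> U (0, 0) (0, 1)" "V (i, j) (i, l) \<longleftrightarrow> \<not> U (0, 0) (0, 1)"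
    "V (j, i) (l, i) \<longleftrightarrow> U (0, 0) (0, 1)" "U (j, i) (l, i) \<longleftrightarrow> \<not> U (0, 0) (0, 1)"
    if "i < n" "j < n" "l < n" "l \<noteq> j" for i j l
  proof -
    show 1: "U (i, j) (i, l) \<longleftrightarrow> U (0, 0) (0, 1)" using S that by blast
    show "V (i, j) (i, l) \<longleftrightarrow> \<not> U (0, 0) (0, 1)"
      using 1 line[OF C C, of i j i l] that by simp blast
    have "\<exists>i'<n. i' \<noteq> i" using n by (intro exI[of _ "if i = 0 then 1 else 0"]) auto
    then obtain i' where i': "i' < n" "i' \<noteq> i" by blast
    show 2: "V (j, i) (l, i) \<longleftrightarrow> U (0, 0) (0, 1)"
    proof -
      have "V (j, i) (l, i) \<longleftrightarrow> U (j, i) (j, i')" using that i' by (intro cross[symmetric]) auto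
      also have "\<dots> \<longleftrightarrow> U (0, 0) (0, 1)" using that i' by (intro S) auto
      finally show ?thesis .
    qed
    show "U (j, i) (l, i) \<longleftrightarrow> \<not> U (0, 0) (0, 1)"
      using 2 line[OF C C, of j i l i] that by auto
  qed
  show ?thesis
  proof (cases "U (0, 0) (0, 1)")
    case True
    hence "U (i, j) (i, k) \<and> V (j, i) (k, i)" if "i < n" "j < n" "k < n" for i j k
      using rows[of i j k] Urefl[OF C, of i j] Vrefl[OF C, of j i] that by (cases "k = j") auto
    thus ?thesis by blast
  next
    case False
    hence "V (i, j) (i, k) \<and> U (j, i) (k, i)" if "i < n" "j < n" "k < n" for i j k
      using rows[of i j k] Vrefl[OF C, of i j] Urefl[OF C, of j i] that by (cases "k = j") auto
    thus ?thesis by blast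
  qed
qed

section \<open>Images of matrix units and the theorem of Frobenius\<close>

lemma parallel_scale:
  assumes "u \<in> carrier_vec n" "v \<in> carrier_vec n" "parallel n u v" "u \<noteq> 0\<^sub>v n"
  shows "\<exists>c. v = c \<cdot>\<^sub>v u"
proof -
  obtain k where k: "k < n" "u $ k \<noteq> 0" using assms(1,4) by (metis (no_types, lifting) carrier_vecD eq_vecI index_zero_vec)
  have "v = (v $ k / u $ k) \<cdot>\<^sub>v u"
    using assms k by (intro eq_vecI) (auto simp: parallel_def field_simps)
  thus ?thesis by blast
qed

lemma parallel_refl: "parallel n u u" by (simp add: parallel_def)
lemma parallel_sym: "parallel n u v \<Longrightarrow> parallel n v u" by (auto simp: parallel_def mult.commute)

lemma parallel_trans:
  assumes "u \<in> carrier_vec n" "v \<in> carrier_vec n" "w \<in> carrier_vec n" "v \<noteq> 0\<^sub>v n"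
    "parallel n u v" "parallel n v w"
  shows "parallel n u w"
proof -
  obtain c d where "u = c \<cdot>\<^sub>v v" "w = d \<cdot>\<^sub>v v"
    using parallel_scale[OF assms(2,1) _ assms(4)] parallel_scale[OF assms(2,3,6,4)] parallel_sym[OF assms(5)] by blast
  thus ?thesis using assms by (auto simp: parallel_def)
qed

text \<open>By Cauchy-Binet a 2 x 2 minor of the sum is the product of a minor of \<open>u\<close>,
  \<open>u'\<close> and a minor of \<open>v\<close>, \<open>v'\<close>, and it vanishes in rank
  one.\<close>

lemma parallel_if_det_affine:
  assumes "det_affine n (outer n u v + outer n u' v')"
  shows "parallel n u u' \<or> parallel n v v'"
proof (rule ccontr)
  assume "\<not> ?thesis"
  then obtain i k j l where *: "i < n" "k < n" "j < n" "l < n"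
    "u $ i * u' $ k \<noteq> u $ k * u' $ i" "v $ j * v' $ l \<noteq> v $ l * v' $ j"
    by (auto simp: parallel_def)
  have "(u $ i * u' $ k - u $ k * u' $ i) * (v $ j * v' $ l - v $ l * v' $ j) = 0"
    using det_affine_minor[OF _ assms *(1,3,2,4)] * by (auto simp: algebra_simps)
  thus False using * by simp
qed

lemma outer_zero: "outer n (0\<^sub>v n) v = 0\<^sub>m n n" "outer n u (0\<^sub>v n) = 0\<^sub>m n n"
  by (intro eq_matI; auto)+

lemma det_affine_unit_add:
  assumes "n > 0" "i = k \<or> j = l" "i < n" "j < n" "k < n" "l < n"
  shows "det_affine n (unit_mat n i j + x \<cdot>\<^sub>m unit_mat n k l)"
proof -
  let ?e = "\<lambda>i. vec n (\<lambda>a. if a = i then 1 else (0::complex))"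
  have e: "unit_mat n i j = outer n (?e i) (?e j)" for i j
    by (intro eq_matI) (auto simp: unit_mat_def outer_def)
  from assms(2) show ?thesis
  proof
    assume "i = k"
    hence "unit_mat n i j + x \<cdot>\<^sub>m unit_mat n k l = outer n (?e i) (?e j + x \<cdot>\<^sub>v ?e l)"
      unfolding e by (intro eq_matI) (auto simp: outer_def)
    thus ?thesis using det_affine_outer[OF assms(1)] by simp
  next
    assume "j = l"
    hence "unit_mat n i j + x \<cdot>\<^sub>m unit_mat n k l = outer n (?e i + x \<cdot>\<^sub>v ?e k) (?e j)"
      unfolding e by (intro eq_matI) (auto simp: outer_def)
    thus ?thesis using det_affine_outer[OF assms(1)] by simp
  qed
qed

lemma carrier_mat_0_eq: "X \<in> carrier_mat 0 0 \<Longrightarrow> Y \<in> carrier_mat 0 0 \<Longrightarrow> X = Y"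
  by (intro eq_matI) auto

text \<open>With a common left factor \<open>a i\<close> for each row of units and a common right
  factor \<open>b j\<close> for each column, a unit goes to \<open>s i j\<close> times their outer
  product. It remains to split the scalars \<open>s i j\<close> into a row factor and a column
  factor.\<close>

lemma det_preserver_units:
  assumes g: "g \<in> proj_sym_group (Mat n) det"
    and u: "\<And>i j. i < n \<Longrightarrow> j < n \<Longrightarrow> u i j \<in> carrier_vec n \<and> v i j \<in> carrier_vec n \<and> g (unit_mat n i j) = outer n (u i j) (v i j)"
    and lines: "\<And>i j k. i < n \<Longrightarrow> j < n \<Longrightarrow> k < n \<Longrightarrow> parallel n (u i j) (u i k) \<and> parallel n (v j i) (v k i)"
    and off: "\<And>i j k l. i < n \<Longrightarrow> j < n \<Longrightarrow> k < n \<Longrightarrow> l < n \<Longrightarrow> i \<noteq> k \<Longrightarrow> j \<noteq> l \<Longrightarrow>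
       \<not> parallel n (u i j) (u k l) \<and> \<not> parallel n (v i j) (v k l)"
    and nz: "\<And>i j. i < n \<Longrightarrow> j < n \<Longrightarrow> g (unit_mat n i j) \<noteq> 0\<^sub>m n n"
  shows "\<exists>P Q. P \<in> carrier_mat n n \<and> Q \<in> carrier_mat n n \<and> (\<forall>X\<in>carrier_mat n n. g X = P * X * Q)"
proof (cases "n = 0")
  case True
  hence "g X = 1\<^sub>m 0 * X * 1\<^sub>m 0" if "X \<in> carrier_mat n n" for X
    using that proj_sym_groupD(3)[OF g that] by (intro carrier_mat_0_eq) auto
  thus ?thesis using True by (intro exI[of _ "1\<^sub>m 0"]) auto
next
  case False
  hence n: "0 < n" by simp
  note G = proj_sym_groupD[OF g]
  have unz: "u i j \<noteq> 0\<^sub>v n" "v i j \<noteq> 0\<^sub>v n" if "i < n" "j < n" for i j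
    using u[OF that] nz[OF that] outer_zero by auto
  define a where "a i = u i 0" for i
  define b where "b j = v 0 j" for j
  have ab: "a i \<in> carrier_vec n" "b i \<in> carrier_vec n" if "i < n" for i
    using u that n by (auto simp: a_def b_def)
  have "\<exists>s. g (unit_mat n i j) = s \<cdot>\<^sub>m outer n (a i) (b j)" if ij: "i < n" "j < n" for i j
  proof -
    obtain c d where "u i j = c \<cdot>\<^sub>v a i" "v i j = d \<cdot>\<^sub>v b j"
      using parallel_scale[of "u i 0" n "u i j"] parallel_scale[of "v 0 j" n "v i j"]
        lines[OF ij(1) n ij(2)] lines[OF ij(2) n ij(1)] u[OF ij] u[OF ij(1) n] u[OF n ij(2)]
        unz[OF ij(1) n] unz[OF n ij(2)] unfolding a_def b_def by auto
    hence "g (unit_mat n i j) = (d * c) \<cdot>\<^sub>m outer n (a i) (b j)"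
      using u[OF ij] ab(1)[OF ij(1)] ab(2)[OF ij(2)] by (intro eq_matI) auto
    thus ?thesis by blast
  qed
  then obtain s where s: "\<And>i j. i < n \<Longrightarrow> j < n \<Longrightarrow> g (unit_mat n i j) = s i j \<cdot>\<^sub>m outer n (a i) (b j)"
    by metis
  have snz: "s i j \<noteq> 0" if "i < n" "j < n" for i j
  proof
    assume "s i j = 0"
    hence "g (unit_mat n i j) = 0\<^sub>m n n" using s[OF that] by (intro eq_matI) auto
    thus False using nz that by blast
  qed
  \<comment> \<open>The all-one matrix on rows 0, \<open>i\<close> and columns 0, \<open>j\<close>
    has rank one. As \<open>a i\<close>, \<open>a 0\<close> and \<open>b j\<close>,
    \<open>b 0\<close> are not parallel, its image has rank one only if this minor of
    \<open>s\<close> vanishes.\<close>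
  have sq: "s i j * s 0 0 = s i 0 * s 0 j" if ij: "i < n" "j < n" for i j
  proof (cases "i = 0 \<or> j = 0")
    case False
    define e where "e = vec n (\<lambda>k. if k = 0 \<or> k = i then 1 else (0::complex))"
    define f where "f = vec n (\<lambda>k. if k = 0 \<or> k = j then 1 else (0::complex))"
    let ?X = "outer n e f"
    have X: "?X = (unit_mat n i j + unit_mat n i 0) + (unit_mat n 0 j + unit_mat n 0 0)"
      using False ij by (intro eq_matI) (auto simp: e_def f_def)
    have "g ?X = (g (unit_mat n i j) + g (unit_mat n i 0)) + (g (unit_mat n 0 j) + g (unit_mat n 0 0))"
      unfolding X using G(4) by (simp add: add_carrier_mat)
    also have "\<dots> = outer n (a i) (s i j \<cdot>\<^sub>v b j + s i 0 \<cdot>\<^sub>v b 0) + outer n (a 0) (s 0 j \<cdot>\<^sub>v b j + s 0 0 \<cdot>\<^sub>v b 0)"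
      using s ij n ab[OF ij(1)] ab[OF ij(2)] ab[OF n] by (intro eq_matI) (auto simp: algebra_simps)
    finally have gX: "g ?X = outer n (a i) (s i j \<cdot>\<^sub>v b j + s i 0 \<cdot>\<^sub>v b 0) + outer n (a 0) (s 0 j \<cdot>\<^sub>v b j + s 0 0 \<cdot>\<^sub>v b 0)" .
    have "det_affine n (g ?X)"
      using affine_along_map[OF g, of ?X] det_affine_outer[OF n, of e f] by (simp add: e_def f_def)
    hence "parallel n (a i) (a 0) \<or> parallel n (s i j \<cdot>\<^sub>v b j + s i 0 \<cdot>\<^sub>v b 0) (s 0 j \<cdot>\<^sub>v b j + s 0 0 \<cdot>\<^sub>v b 0)"
      unfolding gX by (rule parallel_if_det_affine)
    moreover have "\<not> parallel n (a i) (a 0)"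
    proof
      assume "parallel n (a i) (a 0)"
      moreover have "parallel n (u 0 0) (u 0 j)" using lines ij n by blast
      ultimately have "parallel n (u i 0) (u 0 j)" unfolding a_def
        using parallel_trans[of "u i 0" n "u 0 0" "u 0 j"]
          u[OF ij(1) n] u[OF n n] u[OF n ij(2)] unz[OF n n] by simp
      thus False using off[of i 0 0 j] ij n False by auto
    qed
    ultimately have par: "parallel n (s i j \<cdot>\<^sub>v b j + s i 0 \<cdot>\<^sub>v b 0) (s 0 j \<cdot>\<^sub>v b j + s 0 0 \<cdot>\<^sub>v b 0)" by blast
    have "\<not> parallel n (b j) (b 0)"
    proof
      assume "parallel n (b j) (b 0)"
      moreover have "parallel n (v 0 0) (v i 0)" using lines ij n by blast
      ultimately have "parallel n (v 0 j) (v i 0)" unfolding b_def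
        using parallel_trans[of "v 0 j" n "v 0 0" "v i 0"]
          u[OF ij(1) n] u[OF n n] u[OF n ij(2)] unz[OF n n] by simp
      thus False using off[of 0 j i 0] ij n False by auto
    qed
    then obtain p q where pq: "p < n" "q < n" "b j $ p * b 0 $ q \<noteq> b j $ q * b 0 $ p"
      by (auto simp: parallel_def)
    have "(s i j * b j $ p + s i 0 * b 0 $ p) * (s 0 j * b j $ q + s 0 0 * b 0 $ q)
        = (s i j * b j $ q + s i 0 * b 0 $ q) * (s 0 j * b j $ p + s 0 0 * b 0 $ p)"
      using par[unfolded parallel_def, rule_format, OF pq(1,2)] pq ab[of j] ab[of 0] ij n by simp
    hence "(s i j * s 0 0 - s i 0 * s 0 j) * (b j $ p * b 0 $ q - b j $ q * b 0 $ p) = 0"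
      by (simp add: algebra_simps)
    thus ?thesis using pq by simp
  qed auto
  \<comment> \<open>The columns of \<open>P\<close> are multiples of the \<open>a i\<close> and the
    rows of \<open>Q\<close> multiples of the \<open>b j\<close>; together they carry the
    factorisation of \<open>s\<close>.\<close>
  define P where "P = mat n n (\<lambda>(k, i). s i 0 / s 0 0 * a i $ k)"
  define Q where "Q = mat n n (\<lambda>(j, k). s 0 j * b j $ k)"
  have sij: "s i j = s i 0 / s 0 0 * s 0 j" if "i < n" "j < n" for i j
    using sq[OF that] snz[OF n n] by (simp add: field_simps)
  have "g X = P * X * Q" if X: "X \<in> carrier_mat n n" for X
  proof (rule eq_matI)
    have lin: "linear_map class_ring (Mat n) (Mat n) g"
      using g by (auto simp: proj_sym_group_def GL_def)
    fix k l assume "k < dim_row (P * X * Q)" "l < dim_col (P * X * Q)"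
    hence kl: "k < n" "l < n" by (auto simp: P_def Q_def)
    have "g X $$ (k, l) = (\<Sum>i<n. \<Sum>j<n. X $$ (i, j) * (s i j * (a i $ k * b j $ l)))"
      using linear_map_expand[OF lin X kl] s kl by simp
    also have "\<dots> = (\<Sum>i<n. \<Sum>j<n. P $$ (k, i) * X $$ (i, j) * Q $$ (j, l))"
    proof (intro sum.cong refl)
      fix i j assume "i \<in> {..<n}" "j \<in> {..<n}"
      hence ij: "i < n" "j < n" by auto
      show "X $$ (i, j) * (s i j * (a i $ k * b j $ l)) = P $$ (k, i) * X $$ (i, j) * Q $$ (j, l)"
        by (subst sij[OF ij]) (simp add: P_def Q_def kl ij)
    qed
    also have "\<dots> = (\<Sum>j<n. (\<Sum>i<n. P $$ (k, i) * X $$ (i, j)) * Q $$ (j, l))"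
      unfolding sum_distrib_right by (rule sum.swap)
    also have "\<dots> = (P * X * Q) $$ (k, l)"
      using kl X by (simp add: P_def Q_def scalar_prod_def atLeast0LessThan)
    finally show "g X $$ (k, l) = (P * X * Q) $$ (k, l)" .
  qed (use G(3)[OF X] in \<open>auto simp: P_def Q_def\<close>)
  thus ?thesis by (intro exI[of _ P] exI[of _ Q]) (auto simp: P_def Q_def)
qed

text \<open>Composition with the transpose reduces the transposing case of a preserver to the direct
  one.\<close>

lemma transpose_proj_sym_group:
  assumes g: "g \<in> proj_sym_group (Mat n) P"
    and P: "\<And>X. X \<in> carrier_mat n n \<Longrightarrow> P X\<^sup>T = P X"
  shows "(\<lambda>X\<in>carrier_mat n n. g X\<^sup>T) \<in> proj_sym_group (Mat n) P"
proof -
  note G = proj_sym_groupD[OF g]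
  obtain c where c: "c \<noteq> 0" "\<And>X. X \<in> carrier_mat n n \<Longrightarrow> P (g X) = c * P X" using G(6) by blast
  have inj: "inj_on g (carrier_mat n n)" and surj: "g ` carrier_mat n n = carrier_mat n n"
    using G(2) by (auto simp: bij_betw_def)
  show ?thesis
  proof (rule proj_sym_groupI[where h = "\<lambda>X. (inv_into (carrier_mat n n) g X)\<^sup>T" and c = c])
    fix X Y :: "complex mat" and a
    assume X: "X \<in> carrier_mat n n"
    show "g X\<^sup>T \<in> carrier_mat n n" using G(3) X by simp
    show "g (a \<cdot>\<^sub>m X)\<^sup>T = a \<cdot>\<^sub>m g X\<^sup>T" 
    proof -
      have "(a \<cdot>\<^sub>m X)\<^sup>T = a \<cdot>\<^sub>m X\<^sup>T" by (intro eq_matI) auto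
      thus ?thesis using G(5)[of "X\<^sup>T" a] X by simp
    qed
    show "(inv_into (carrier_mat n n) g X)\<^sup>T \<in> carrier_mat n n"
      using inv_into_into[of X g "carrier_mat n n"] X surj by simp
    show "g ((inv_into (carrier_mat n n) g X)\<^sup>T)\<^sup>T = X"
      using f_inv_into_f[of X g "carrier_mat n n"] X surj by simp
    show "(inv_into (carrier_mat n n) g (g X\<^sup>T))\<^sup>T = X"
      using inv_into_f_f[OF inj, of "X\<^sup>T"] X by simp
    show "P (g X\<^sup>T) = c * P X" using c(2)[of "X\<^sup>T"] P X by simp
  next
    fix X Y :: "complex mat"
    assume X: "X \<in> carrier_mat n n" and Y: "Y \<in> carrier_mat n n"
    show "g (X + Y)\<^sup>T = g X\<^sup>T + g Y\<^sup>T" using G(4) X Y by (simp add: transpose_add)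
  qed (rule c(1))
qed

text \<open>Two distinct units on a line have a sum of rank one, two units off a line have not; so
  their images share exactly one factor up to scaling, respectively none. By
  \<open>rook_colouring\<close> the units of a row all share the left factor and those of a column
  the right one, or the other way round throughout, which is the transposed case.\<close>

theorem det_preserver:
  assumes g: "g \<in> proj_sym_group (Mat n) det"
  shows "\<exists>P Q. P \<in> carrier_mat n n \<and> Q \<in> carrier_mat n n \<and> det P \<noteq> 0 \<and> det Q \<noteq> 0 \<and>
     ((\<forall>X\<in>carrier_mat n n. g X = P * X * Q) \<or> (\<forall>X\<in>carrier_mat n n. g X = P * X\<^sup>T * Q))"
proof (cases "n = 0")
  case True
  hence "g X = 1\<^sub>m 0 * X * 1\<^sub>m 0" if "X \<in> carrier_mat n n" for X
    using that proj_sym_groupD(3)[OF g that] by (intro carrier_mat_0_eq) auto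
  thus ?thesis using True by (intro exI[of _ "1\<^sub>m 0"]) auto
next
  case False
  hence n: "0 < n" by simp
  note G = proj_sym_groupD[OF g]
  have inj: "inj_on g (carrier_mat n n)" using G(2) by (auto simp: bij_betw_def)
  have g0: "g (0\<^sub>m n n) = 0\<^sub>m n n"
  proof -
    have "g (0 \<cdot>\<^sub>m 0\<^sub>m n n) = 0 \<cdot>\<^sub>m g (0\<^sub>m n n)" by (rule G(5)) simp
    moreover have "0 \<cdot>\<^sub>m 0\<^sub>m n n = (0\<^sub>m n n :: complex mat)" "0 \<cdot>\<^sub>m g (0\<^sub>m n n) = 0\<^sub>m n n"
      using G(3)[of "0\<^sub>m n n"] by (auto intro!: eq_matI)
    ultimately show ?thesis by simp
  qed
  have nz: "g (unit_mat n i j) \<noteq> 0\<^sub>m n n" if "i < n" "j < n" for i j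
  proof
    assume "g (unit_mat n i j) = 0\<^sub>m n n"
    hence "unit_mat n i j = 0\<^sub>m n n" using inj_onD[OF inj, of "unit_mat n i j" "0\<^sub>m n n"] g0 by simp
    hence "unit_mat n i j $$ (i, j) = 0" using that by simp
    thus False using that by simp
  qed
  have unit: "det_affine n (unit_mat n i j)" if "i < n" "j < n" for i j
  proof -
    have "unit_mat n i j + 0 \<cdot>\<^sub>m unit_mat n i j = unit_mat n i j" by (intro eq_matI) auto
    thus ?thesis using det_affine_unit_add[OF n, of i i j j 0] that by simp
  qed
  have "\<exists>u v. u \<in> carrier_vec n \<and> v \<in> carrier_vec n \<and> g (unit_mat n i j) = outer n u v" if "i < n" "j < n" for i j
    using outer_if_det_affine[OF G(3)[OF unit_mat_carrier]] affine_along_map[OF g unit_mat_carrier] unit that by blast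
  then obtain u v where uv: "\<And>i j. i < n \<Longrightarrow> j < n \<Longrightarrow> u i j \<in> carrier_vec n \<and> v i j \<in> carrier_vec n \<and>
      g (unit_mat n i j) = outer n (u i j) (v i j)" by metis
  have unz: "u i j \<noteq> 0\<^sub>v n" "v i j \<noteq> 0\<^sub>v n" if "i < n" "j < n" for i j
    using uv[OF that] nz[OF that] outer_zero by auto
  let ?U = "\<lambda>(i, j) (k, l). parallel n (u i j) (u k l)"
  let ?V = "\<lambda>(i, j) (k, l). parallel n (v i j) (v k l)"
  have add: "g (unit_mat n i j + x \<cdot>\<^sub>m unit_mat n k l) = outer n (u i j) (v i j) + x \<cdot>\<^sub>m outer n (u k l) (v k l)"
    if "i < n" "j < n" "k < n" "l < n" for i j k l x
    using G(4,5) uv that by simp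
  have off: "\<not> parallel n (u i j) (u k l) \<and> \<not> parallel n (v i j) (v k l)"
    if ijkl: "i < n" "j < n" "k < n" "l < n" "i \<noteq> k" "j \<noteq> l" for i j k l
  proof -
    have na: "\<not> det_affine n (unit_mat n i j + 1 \<cdot>\<^sub>m unit_mat n k l)"
    proof
      assume "det_affine n (unit_mat n i j + 1 \<cdot>\<^sub>m unit_mat n k l)"
      from det_affine_minor[OF _ this ijkl(1,2,3,4)] show False using ijkl by auto
    qed
    have C: "unit_mat n i j + 1 \<cdot>\<^sub>m unit_mat n k l \<in> carrier_mat n n" by simp
    have no: "outer n (u i j) (v i j) + 1 \<cdot>\<^sub>m outer n (u k l) (v k l) \<noteq> outer n p q"
      if "p \<in> carrier_vec n" "q \<in> carrier_vec n" for p q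
    proof
      assume "outer n (u i j) (v i j) + 1 \<cdot>\<^sub>m outer n (u k l) (v k l) = outer n p q"
      hence "g (unit_mat n i j + 1 \<cdot>\<^sub>m unit_mat n k l) = outer n p q"
        using add[OF ijkl(1-4), of 1] by simp
      thus False using na affine_along_map[OF g C] det_affine_outer[OF n that] by simp
    qed
    note car = uv[OF ijkl(1,2)] uv[OF ijkl(3,4)]
    show ?thesis
    proof (intro conjI notI)
      assume "parallel n (u i j) (u k l)"
      then obtain c where c: "u k l = c \<cdot>\<^sub>v u i j"
        using parallel_scale[of "u i j" n "u k l"] car unz(1)[OF ijkl(1,2)] by auto
      have "outer n (u i j) (v i j) + 1 \<cdot>\<^sub>m outer n (u k l) (v k l) = outer n (u i j) (v i j + c \<cdot>\<^sub>v v k l)"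
        unfolding c using car by (intro eq_matI) (auto simp: algebra_simps)
      thus False using no[of "u i j" "v i j + c \<cdot>\<^sub>v v k l"] car by simp
    next
      assume "parallel n (v i j) (v k l)"
      then obtain c where c: "v k l = c \<cdot>\<^sub>v v i j"
        using parallel_scale[of "v i j" n "v k l"] car unz(2)[OF ijkl(1,2)] by auto
      have "outer n (u i j) (v i j) + 1 \<cdot>\<^sub>m outer n (u k l) (v k l) = outer n (u i j + c \<cdot>\<^sub>v u k l) (v i j)"
        unfolding c using car by (intro eq_matI) (auto simp: algebra_simps)
      thus False using no[of "u i j + c \<cdot>\<^sub>v u k l" "v i j"] car by simp
    qed
  qed
  have line: "parallel n (u i j) (u k l) \<longleftrightarrow> \<not> parallel n (v i j) (v k l)"
    if ij: "i < n" "j < n" "k < n" "l < n" "(i, j) \<noteq> (k, l)" "i = k \<or> j = l" for i j k l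
  proof -
    have "det_affine n (outer n (u i j) (v i j) + 1 \<cdot>\<^sub>m outer n (u k l) (v k l))"
      using det_affine_unit_add[OF n, of i k j l 1] ij affine_along_map[OF g, of "unit_mat n i j + 1 \<cdot>\<^sub>m unit_mat n k l"]
        add[OF ij(1-4), of 1] by simp
    moreover have "1 \<cdot>\<^sub>m outer n (u k l) (v k l) = outer n (u k l) (v k l)" by (intro eq_matI) auto
    ultimately have "parallel n (u i j) (u k l) \<or> parallel n (v i j) (v k l)"
      using parallel_if_det_affine by simp
    moreover have "\<not> (parallel n (u i j) (u k l) \<and> parallel n (v i j) (v k l))"
    proof
      assume "parallel n (u i j) (u k l) \<and> parallel n (v i j) (v k l)"
      then obtain c d where cd: "u k l = c \<cdot>\<^sub>v u i j" "v k l = d \<cdot>\<^sub>v v i j"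
        using parallel_scale[of "u i j" n "u k l"] parallel_scale[of "v i j" n "v k l"]
          uv[OF ij(1,2)] uv[OF ij(3,4)] unz[OF ij(1,2)] by auto
      have "g (unit_mat n k l) = (c * d) \<cdot>\<^sub>m g (unit_mat n i j)"
        using uv[OF ij(1,2)] uv[OF ij(3,4)] by (intro eq_matI) (auto simp: cd)
      also have "\<dots> = g ((c * d) \<cdot>\<^sub>m unit_mat n i j)" using G(5) by simp
      finally have "unit_mat n k l = (c * d) \<cdot>\<^sub>m unit_mat n i j"
        by (rule inj_onD[OF inj]) simp_all
      hence "unit_mat n k l $$ (k, l) = ((c * d) \<cdot>\<^sub>m unit_mat n i j) $$ (k, l)" by simp
      thus False using ij by auto
    qed
    ultimately show ?thesis by blast
  qed
  have "(\<forall>i<n. \<forall>j<n. \<forall>k<n. ?U (i, j) (i, k) \<and> ?V (j, i) (k, i)) \<or>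
         (\<forall>i<n. \<forall>j<n. \<forall>k<n. ?V (i, j) (i, k) \<and> ?U (j, i) (k, i))"
  proof (rule rook_colouring)
    fix c d e assume cde: "c \<in> {..<n} \<times> {..<n}" "d \<in> {..<n} \<times> {..<n}" "e \<in> {..<n} \<times> {..<n}"
    obtain i j k l p q where [simp]: "c = (i, j)" "d = (k, l)" "e = (p, q)" by (metis surj_pair)
    have b: "i < n" "j < n" "k < n" "l < n" "p < n" "q < n" using cde by auto
    show "?U c d \<Longrightarrow> ?U d e \<Longrightarrow> ?U c e"
      using parallel_trans[of "u i j" n "u k l" "u p q"] uv[OF b(1,2)] uv[OF b(3,4)] uv[OF b(5,6)] unz[OF b(3,4)] by simp
    show "?V c d \<Longrightarrow> ?V d e \<Longrightarrow> ?V c e"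
      using parallel_trans[of "v i j" n "v k l" "v p q"] uv[OF b(1,2)] uv[OF b(3,4)] uv[OF b(5,6)] unz[OF b(3,4)] by simp
  next
    fix c d assume cd: "c \<in> {..<n} \<times> {..<n}" "d \<in> {..<n} \<times> {..<n}"
    obtain i j k l where [simp]: "c = (i, j)" "d = (k, l)" by (metis surj_pair)
    have b: "i < n" "j < n" "k < n" "l < n" using cd by auto
    show "?U c d \<Longrightarrow> ?U d c" "?V c d \<Longrightarrow> ?V d c" by (simp_all add: parallel_sym)
    show "c \<noteq> d \<Longrightarrow> fst c = fst d \<or> snd c = snd d \<Longrightarrow> ?U c d = (\<not> ?V c d)" using line b by simp
    show "fst c \<noteq> fst d \<Longrightarrow> snd c \<noteq> snd d \<Longrightarrow> \<not> ?U c d \<and> \<not> ?V c d" using off b by simp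
  qed (auto simp: parallel_refl)
  hence "\<exists>P Q. P \<in> carrier_mat n n \<and> Q \<in> carrier_mat n n \<and>
     ((\<forall>X\<in>carrier_mat n n. g X = P * X * Q) \<or> (\<forall>X\<in>carrier_mat n n. g X = P * X\<^sup>T * Q))"
  proof
    assume A: "\<forall>i<n. \<forall>j<n. \<forall>k<n. ?U (i, j) (i, k) \<and> ?V (j, i) (k, i)"
    have "\<exists>P Q. P \<in> carrier_mat n n \<and> Q \<in> carrier_mat n n \<and> (\<forall>X\<in>carrier_mat n n. g X = P * X * Q)"
      by (rule det_preserver_units[OF g uv]) (use A off nz in auto)
    thus ?thesis by blast
  next
    assume A: "\<forall>i<n. \<forall>j<n. \<forall>k<n. ?V (i, j) (i, k) \<and> ?U (j, i) (k, i)"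
    define h where "h = (\<lambda>X\<in>carrier_mat n n. g X\<^sup>T)"
    have h: "h \<in> proj_sym_group (Mat n) det"
      unfolding h_def by (rule transpose_proj_sym_group[OF g]) (rule det_transpose)
    have hu: "h (unit_mat n i j) = g (unit_mat n j i)" for i j
    proof -
      have "(unit_mat n i j)\<^sup>T = unit_mat n j i" by (intro eq_matI) auto
      thus ?thesis by (simp add: h_def)
    qed
    have "\<exists>P Q. P \<in> carrier_mat n n \<and> Q \<in> carrier_mat n n \<and> (\<forall>X\<in>carrier_mat n n. h X = P * X * Q)"
      by (rule det_preserver_units[OF h, of "\<lambda>i j. u j i" "\<lambda>i j. v j i"])
        (use A off nz uv hu in auto)
    then obtain P Q where PQ: "P \<in> carrier_mat n n" "Q \<in> carrier_mat n n"
      "\<And>X. X \<in> carrier_mat n n \<Longrightarrow> h X = P * X * Q" by blast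
    have "g X = P * X\<^sup>T * Q" if "X \<in> carrier_mat n n" for X
      using PQ(3)[of "X\<^sup>T"] that by (simp add: h_def)
    thus ?thesis using PQ by blast
  qed
  then obtain P Q where PQ: "P \<in> carrier_mat n n" "Q \<in> carrier_mat n n"
     "(\<forall>X\<in>carrier_mat n n. g X = P * X * Q) \<or> (\<forall>X\<in>carrier_mat n n. g X = P * X\<^sup>T * Q)" by blast
  obtain c where c: "c \<noteq> 0" "\<And>X. X \<in> carrier_mat n n \<Longrightarrow> det (g X) = c * det X" using G(6) by blast
  have "g (1\<^sub>m n) = P * Q" using PQ by (auto simp: right_mult_one_mat[of _ n n])
  hence "det P * det Q = c" using c(2)[of "1\<^sub>m n"] PQ by (simp add: det_mult[of _ n])
  hence "det P \<noteq> 0" "det Q \<noteq> 0" using c by auto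
  thus ?thesis using PQ by blast
qed

section \<open>Linear maps preserving the permanent\<close>

abbreviation "perm_affine m \<equiv> affine_along (perm m) m"

text \<open>The quadratic relations that replace the rank one condition. They are much stricter: by
  \<open>subperms_zero_block\<close> a solution with two nonzero entries off a common line is
  supported on one 2 x 2 block.\<close>

definition subperms_zero :: "nat \<Rightarrow> complex mat \<Rightarrow> bool" where
  "subperms_zero m X \<longleftrightarrow> (\<forall>i<m. \<forall>j<m. \<forall>k<m. \<forall>l<m. i \<noteq> k \<longrightarrow> j \<noteq> l \<longrightarrow>
      X $$ (i, j) * X $$ (k, l) + X $$ (i, l) * X $$ (k, j) = 0)"

definition in_row :: "nat \<Rightarrow> nat \<Rightarrow> complex mat \<Rightarrow> bool" where
  "in_row m r X \<longleftrightarrow> (\<forall>i<m. \<forall>j<m. i \<noteq> r \<longrightarrow> X $$ (i, j) = 0)"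

definition in_col :: "nat \<Rightarrow> nat \<Rightarrow> complex mat \<Rightarrow> bool" where
  "in_col m s X \<longleftrightarrow> (\<forall>i<m. \<forall>j<m. j \<noteq> s \<longrightarrow> X $$ (i, j) = 0)"

lemma perm_transpose:
  assumes X: "X \<in> carrier_mat m m"
  shows "perm m X\<^sup>T = perm m X"
proof -
  have "(\<Prod>i = 0..<m. X\<^sup>T $$ (i, inv_into UNIV \<sigma> i)) = (\<Prod>i = 0..<m. X $$ (i, \<sigma> i))" if "\<sigma> permutes {0..<m}" for \<sigma>
  proof -
    have "(\<Prod>i = 0..<m. X\<^sup>T $$ (i, inv_into UNIV \<sigma> i)) = (\<Prod>i = 0..<m. X\<^sup>T $$ (\<sigma> i, inv_into UNIV \<sigma> (\<sigma> i)))"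
      using prod.permute[OF that, of "\<lambda>i. X\<^sup>T $$ (i, inv_into UNIV \<sigma> i)"] by simp
    also have "\<dots> = (\<Prod>i = 0..<m. X $$ (i, \<sigma> i))"
    proof (rule prod.cong[OF refl])
      fix i assume "i \<in> {0..<m}"
      hence "i < m" "\<sigma> i < m" using permutes_in_image[OF that] by auto
      thus "X\<^sup>T $$ (\<sigma> i, inv_into UNIV \<sigma> (\<sigma> i)) = X $$ (i, \<sigma> i)"
        using X permutes_inverses(2)[OF that] by simp
    qed
    finally show ?thesis .
  qed
  thus ?thesis unfolding perm_def
    by (subst sum_permutations_inverse) (auto intro: sum.cong)
qed

text \<open>Each product in the permanent takes exactly one factor from row
  \<open>r\<close>.\<close>

lemma perm_affine_row:
  assumes X: "X \<in> carrier_mat m m" and r: "r < m" and row: "in_row m r X"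
  shows "perm_affine m X"
  unfolding affine_along_def
proof
  fix Y :: "complex mat" assume Y: "Y \<in> carrier_mat m m"
  define f where "f \<sigma> = (\<Prod>i\<in>{0..<m} - {r}. Y $$ (i, \<sigma> i))" for \<sigma>
  have "(\<Prod>i = 0..<m. (x \<cdot>\<^sub>m X + Y) $$ (i, \<sigma> i)) = Y $$ (r, \<sigma> r) * f \<sigma> + X $$ (r, \<sigma> r) * f \<sigma> * x"
    if p: "\<sigma> permutes {0..<m}" for \<sigma> x
  proof -
    have lt: "\<sigma> i < m" if "i < m" for i using permutes_in_image[OF p, of i] that by simp
    have "(\<Prod>i = 0..<m. (x \<cdot>\<^sub>m X + Y) $$ (i, \<sigma> i))
        = (x \<cdot>\<^sub>m X + Y) $$ (r, \<sigma> r) * (\<Prod>i\<in>{0..<m} - {r}. (x \<cdot>\<^sub>m X + Y) $$ (i, \<sigma> i))"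
      using r by (subst prod.remove[of _ r]) auto
    also have "(\<Prod>i\<in>{0..<m} - {r}. (x \<cdot>\<^sub>m X + Y) $$ (i, \<sigma> i)) = f \<sigma>"
      unfolding f_def using X Y lt row by (intro prod.cong) (auto simp: in_row_def)
    finally show ?thesis using X Y lt r by (simp add: algebra_simps)
  qed
  hence "perm m (x \<cdot>\<^sub>m X + Y) = (\<Sum>\<sigma> | \<sigma> permutes {0..<m}. Y $$ (r, \<sigma> r) * f \<sigma>)
      + (\<Sum>\<sigma> | \<sigma> permutes {0..<m}. X $$ (r, \<sigma> r) * f \<sigma>) * x" for x
    unfolding perm_def sum_distrib_right sum.distrib[symmetric] by (intro sum.cong) auto
  thus "\<exists>a b. \<forall>x. perm m (x \<cdot>\<^sub>m X + Y) = a + b * x" by blast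
qed

lemma perm_affine_transpose:
  assumes X: "X \<in> carrier_mat m m" and "perm_affine m X"
  shows "perm_affine m X\<^sup>T"
  unfolding affine_along_def
proof
  fix Y :: "complex mat" assume Y: "Y \<in> carrier_mat m m"
  obtain a b where ab: "\<And>x. perm m (x \<cdot>\<^sub>m X + Y\<^sup>T) = a + b * x"
    using assms(2) Y unfolding affine_along_def by (metis transpose_carrier_mat)
  have "perm m (x \<cdot>\<^sub>m X\<^sup>T + Y) = a + b * x" for x
  proof -
    have "x \<cdot>\<^sub>m X\<^sup>T + Y = (x \<cdot>\<^sub>m X + Y\<^sup>T)\<^sup>T"
      using X Y by (intro eq_matI) auto
    thus ?thesis using perm_transpose[of "x \<cdot>\<^sub>m X + Y\<^sup>T" m] X Y ab by simp
  qed
  thus "\<exists>a b. \<forall>x. perm m (x \<cdot>\<^sub>m X\<^sup>T + Y) = a + b * x" by blast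
qed

lemma perm_affine_col:
  assumes X: "X \<in> carrier_mat m m" and r: "r < m" and col: "in_col m r X"
  shows "perm_affine m X"
proof -
  have "in_row m r X\<^sup>T" using col X by (auto simp: in_row_def in_col_def)
  hence "perm_affine m X\<^sup>T" using perm_affine_row[of "X\<^sup>T" m r] X r by simp
  from perm_affine_transpose[OF _ this] X show ?thesis by simp
qed

lemma permutes_two_points:
  fixes i j k l m :: nat
  assumes "i < m" "k < m" "i \<noteq> k" "j < m" "l < m" "j \<noteq> l"
  shows "\<exists>\<tau>. \<tau> permutes {0..<m} \<and> \<tau> i = j \<and> \<tau> k = l"
proof -
  define \<alpha> where "\<alpha> = Transposition.transpose i j"
  \<comment> \<open>The first transposition may have moved \<open>k\<close>, so the second starts
    from \<open>\<alpha> k\<close>; it leaves \<open>j\<close> in place because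
    \<open>\<alpha> k\<close> and \<open>l\<close> both differ from \<open>j\<close>.\<close>
  define \<beta> where "\<beta> = Transposition.transpose (\<alpha> k) l"
  have a: "\<alpha> permutes {0..<m}" unfolding \<alpha>_def using assms by (intro permutes_swap_id) auto
  have "\<alpha> k < m" using permutes_in_image[OF a, of k] assms by simp
  hence b: "\<beta> permutes {0..<m}" unfolding \<beta>_def using assms by (intro permutes_swap_id) auto
  have "\<alpha> k \<noteq> j" using assms unfolding \<alpha>_def by (auto simp: transpose_def)
  hence "(\<beta> \<circ> \<alpha>) i = j" "(\<beta> \<circ> \<alpha>) k = l"
    using assms by (auto simp: \<alpha>_def \<beta>_def transpose_def)
  thus ?thesis using permutes_compose[OF a b] by blast
qed

lemma permutes_agree_off_two:
  assumes p: "\<sigma> permutes S" "\<tau> permutes S" and ik: "i \<in> S" "k \<in> S"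
    and agree: "\<And>a. a \<in> S \<Longrightarrow> a \<noteq> i \<Longrightarrow> a \<noteq> k \<Longrightarrow> \<sigma> a = \<tau> a"
  shows "\<sigma> = \<tau> \<or> \<sigma> = \<tau> \<circ> Transposition.transpose i k"
proof -
  have inj: "inj \<sigma>" "inj \<tau>" using p permutes_inj by auto
  have out: "\<sigma> a = \<tau> a" if "a \<noteq> i" "a \<noteq> k" for a
    using agree that p by (cases "a \<in> S") (auto simp: permutes_not_in)
  have "\<exists>a. \<tau> a = \<sigma> i" "\<exists>a. \<tau> a = \<sigma> k" using permutes_surj[OF p(2)] by (metis surjD)+
  then obtain a b where ab: "\<tau> a = \<sigma> i" "\<tau> b = \<sigma> k" by blast
  have a: "a = i \<or> a = k" using out[of a] ab inj by (metis injD)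
  have b: "b = i \<or> b = k" using out[of b] ab inj by (metis injD)
  show ?thesis
  proof (cases "i = k")
    case True
    hence "\<sigma> x = \<tau> x" for x using a ab out by (cases "x = k") auto
    thus ?thesis by auto
  next
    case False
    have "a \<noteq> b" using ab False inj by (metis injD)
    hence "(a = i \<and> b = k) \<or> (a = k \<and> b = i)" using a b by auto
    thus ?thesis
    proof
      assume "a = i \<and> b = k"
      hence "\<sigma> x = \<tau> x" for x using ab out by (cases "x = i"; cases "x = k") auto
      thus ?thesis by auto
    next
      assume "a = k \<and> b = i"
      hence "\<sigma> x = (\<tau> \<circ> Transposition.transpose i k) x" for x
        using ab out by (cases "x = i"; cases "x = k") (auto simp: transpose_def)
      thus ?thesis by auto
    qed
  qed
qed

lemma prod_remove_two:
  fixes f :: "'a \<Rightarrow> 'b::comm_monoid_mult"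
  assumes "finite S" "i \<in> S" "k \<in> S" "i \<noteq> k"
  shows "prod f S = f i * f k * prod f (S - {i} - {k})"
  using assms prod.remove[of S i f] prod.remove[of "S - {i}" k f] by (simp add: mult.assoc)

text \<open>The coefficient of \<open>x ^ 2\<close> must vanish for every \<open>Y\<close>. If
  \<open>Y\<close> is a permutation matrix with rows \<open>i\<close> and \<open>k\<close> deleted,
  only that permutation and its composition with the transposition of \<open>i\<close> and
  \<open>k\<close> contribute, and they give the subpermanent.\<close>

lemma subperms_zero_if_perm_affine:
  assumes X: "X \<in> carrier_mat m m" and aff: "perm_affine m X"
  shows "subperms_zero m X"
  unfolding subperms_zero_def
proof (intro allI impI)
  fix i j k l assume b: "i < m" "j < m" "k < m" "l < m" "i \<noteq> k" "j \<noteq> l"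
  obtain \<tau> where \<tau>: "\<tau> permutes {0..<m}" "\<tau> i = j" "\<tau> k = l"
    using permutes_two_points[of i m k j l] b by blast
  define \<tau>' where "\<tau>' = \<tau> \<circ> Transposition.transpose i k"
  have \<tau>': "\<tau>' permutes {0..<m}"
    unfolding \<tau>'_def using \<tau> b by (intro permutes_compose permutes_swap_id) auto
  have \<tau>'v: "\<tau>' i = l" "\<tau>' k = j" using \<tau> by (auto simp: \<tau>'_def)
  define y where "y a c = (if a \<noteq> i \<and> a \<noteq> k \<and> c = \<tau> a then 1 else 0::complex)" for a c
  define Y where "Y = mat m m (\<lambda>(a, c). y a c)"
  define T where "T \<sigma> = (\<Prod>a = 0..<m. [:y a (\<sigma> a), X $$ (a, \<sigma> a):])" for \<sigma>
  define p where "p = (\<Sum>\<sigma> | \<sigma> permutes {0..<m}. T \<sigma>)"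
  obtain \<alpha> \<beta> where ab: "\<And>x. perm m (x \<cdot>\<^sub>m X + Y) = \<alpha> + \<beta> * x"
    using aff unfolding affine_along_def Y_def by (meson mat_carrier)
  have "poly p x = perm m (x \<cdot>\<^sub>m X + Y)" for x
    unfolding p_def perm_def poly_sum T_def poly_prod
  proof (intro sum.cong prod.cong refl)
    fix \<sigma> a assume "\<sigma> \<in> {\<sigma>. \<sigma> permutes {0..<m}}" "a \<in> {0..<m}"
    hence "a < m" "\<sigma> a < m" using permutes_in_image[of \<sigma> "{0..<m}" a] by auto
    thus "poly [:y a (\<sigma> a), X $$ (a, \<sigma> a):] x = (x \<cdot>\<^sub>m X + Y) $$ (a, \<sigma> a)"
      using X by (simp add: Y_def)
  qed
  hence "poly p = poly [:\<alpha>, \<beta>:]" using ab by (auto simp: mult.commute)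
  hence "p = [:\<alpha>, \<beta>:]" by (simp only: poly_eq_poly_eq_iff)
  hence c0: "coeff p 2 = 0" by (simp add: numeral_2_eq_2)
  have split: "T \<sigma> = [:y i (\<sigma> i), X $$ (i, \<sigma> i):] * [:y k (\<sigma> k), X $$ (k, \<sigma> k):] *
      (\<Prod>a\<in>{0..<m} - {i} - {k}. [:y a (\<sigma> a), X $$ (a, \<sigma> a):])" for \<sigma>
    unfolding T_def using b by (intro prod_remove_two) auto
  have lin: "[:0, c:] = monom 1 1 * [:c:]" for c :: complex by (simp add: monom_altdef)
  \<comment> \<open>Rows \<open>i\<close> and \<open>k\<close> of \<open>Y\<close> are zero, so
    their two linear factors already supply \<open>x ^ 2\<close>, and only the constant terms of the
    other factors matter.\<close>
  have m2: "T \<sigma> = monom 1 2 * ([:X $$ (i, \<sigma> i) * X $$ (k, \<sigma> k):] * (\<Prod>a\<in>{0..<m} - {i} - {k}. [:y a (\<sigma> a), X $$ (a, \<sigma> a):]))" for \<sigma>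
  proof -
    have y0: "y i c = 0" "y k c = 0" for c by (auto simp: y_def)
    have "monom (1::complex) 2 = monom 1 1 * monom 1 1" by (simp add: mult_monom numeral_2_eq_2)
    thus ?thesis unfolding split y0 lin by (simp only: mult_ac) (simp add: mult_ac)
  qed
  have coeffT: "coeff (T \<sigma>) 2 = (if \<sigma> = \<tau> \<or> \<sigma> = \<tau>' then X $$ (i, \<sigma> i) * X $$ (k, \<sigma> k) else 0)"
    if \<sigma>: "\<sigma> permutes {0..<m}" for \<sigma>
  proof (cases "\<forall>a\<in>{0..<m} - {i} - {k}. \<sigma> a = \<tau> a")
    case True
    hence "\<sigma> = \<tau> \<or> \<sigma> = \<tau>'"
      unfolding \<tau>'_def using permutes_agree_off_two[OF \<sigma> \<tau>(1), of i k] b by auto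
    moreover have "coeff (\<Prod>a\<in>{0..<m} - {i} - {k}. [:y a (\<sigma> a), X $$ (a, \<sigma> a):]) 0 = 1"
      using True by (simp add: poly_0_coeff_0[symmetric] poly_prod y_def)
    ultimately show ?thesis unfolding m2 by (auto simp: coeff_monom_mult)
  next
    case False
    then obtain a where a: "a \<in> {0..<m} - {i} - {k}" "\<sigma> a \<noteq> \<tau> a" by blast
    hence "coeff (\<Prod>a\<in>{0..<m} - {i} - {k}. [:y a (\<sigma> a), X $$ (a, \<sigma> a):]) 0 = 0"
      unfolding poly_0_coeff_0[symmetric] poly_prod by (intro prod_zero) (auto simp: y_def)
    moreover have "\<sigma> \<noteq> \<tau>" "\<sigma> \<noteq> \<tau>'"
      using a by (auto simp: \<tau>'_def transpose_def)
    ultimately show ?thesis unfolding m2 by (auto simp: coeff_monom_mult)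
  qed
  have ne: "\<tau> \<noteq> \<tau>'" using \<tau> \<tau>'v b by auto
  have "coeff p 2 = (\<Sum>\<sigma> | \<sigma> permutes {0..<m}. if \<sigma> = \<tau> \<or> \<sigma> = \<tau>' then X $$ (i, \<sigma> i) * X $$ (k, \<sigma> k) else 0)"
    unfolding p_def coeff_sum using coeffT by (intro sum.cong) auto
  also have "\<dots> = (\<Sum>\<sigma>\<in>{\<tau>, \<tau>'}. X $$ (i, \<sigma> i) * X $$ (k, \<sigma> k))"
    using \<tau>(1) \<tau>' by (intro sum.mono_neutral_cong_right) (auto simp: finite_permutations)
  also have "\<dots> = X $$ (i, j) * X $$ (k, l) + X $$ (i, l) * X $$ (k, j)"
    using ne \<tau> \<tau>'v by simp
  finally show "X $$ (i, j) * X $$ (k, l) + X $$ (i, l) * X $$ (k, j) = 0" using c0 by simp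
qed

section \<open>Isotropic subspaces for the 2 x 2 subpermanents\<close>

text \<open>The cross product of the two coefficient vectors solves both equations; when it
  vanishes, the vectors are parallel and a solution can be written down directly.\<close>

lemma two_equations_three_unknowns:
  fixes a b :: "nat \<Rightarrow> complex"
  shows "\<exists>x0 x1 x2. (x0 \<noteq> 0 \<or> x1 \<noteq> 0 \<or> x2 \<noteq> 0) \<and>
    x0 * a 0 + x1 * a 1 + x2 * a 2 = 0 \<and> x0 * b 0 + x1 * b 1 + x2 * b 2 = 0"
proof -
  define c0 c1 c2 where "c0 = a 1 * b 2 - a 2 * b 1" and "c1 = a 2 * b 0 - a 0 * b 2"
    and "c2 = a 0 * b 1 - a 1 * b 0"
  have c: "c0 * a 0 + c1 * a 1 + c2 * a 2 = 0" "c0 * b 0 + c1 * b 1 + c2 * b 2 = 0"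
    unfolding c0_def c1_def c2_def by (simp_all add: algebra_simps)
  show ?thesis
  proof (cases "c0 = 0 \<and> c1 = 0 \<and> c2 = 0")
    case False thus ?thesis using c by blast
  next
    case True
    hence e: "a 1 * b 2 = a 2 * b 1" "a 2 * b 0 = a 0 * b 2" "a 0 * b 1 = a 1 * b 0"
      by (auto simp: c0_def c1_def c2_def)
    consider "a 0 \<noteq> 0 \<or> a 1 \<noteq> 0" | "b 0 \<noteq> 0 \<or> b 1 \<noteq> 0" | "a 0 = 0 \<and> a 1 = 0 \<and> b 0 = 0 \<and> b 1 = 0"
      by blast
    thus ?thesis
    proof cases
      case 1 thus ?thesis using e
        by (intro exI[of _ "a 1"] exI[of _ "- a 0"] exI[of _ 0]) (auto simp: mult.commute)
    next
      case 2 thus ?thesis using e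
        by (intro exI[of _ "b 1"] exI[of _ "- b 0"] exI[of _ 0]) (auto simp: mult.commute)
    next
      case 3 thus ?thesis by (intro exI[of _ 1] exI[of _ 0]) auto
    qed
  qed
qed

text \<open>The quadratic form \<open>a d + b c\<close> is nondegenerate on a space of dimension 4, so a totally
  isotropic subspace has dimension at most 2.\<close>

lemma isotropic_three:
  fixes a b c d :: "nat \<Rightarrow> complex"
  assumes iso: "\<And>x0 x1 x2. (x0 * a 0 + x1 * a 1 + x2 * a 2) * (x0 * d 0 + x1 * d 1 + x2 * d 2)
       + (x0 * b 0 + x1 * b 1 + x2 * b 2) * (x0 * c 0 + x1 * c 1 + x2 * c 2) = 0"
    and indep: "\<And>x0 x1 x2. x0 * a 0 + x1 * a 1 + x2 * a 2 = 0 \<Longrightarrow> x0 * b 0 + x1 * b 1 + x2 * b 2 = 0 \<Longrightarrow>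
       x0 * c 0 + x1 * c 1 + x2 * c 2 = 0 \<Longrightarrow> x0 * d 0 + x1 * d 1 + x2 * d 2 = 0 \<Longrightarrow> x0 = 0 \<and> x1 = 0 \<and> x2 = 0"
  shows "x0 * a 0 + x1 * a 1 + x2 * a 2 = 0"
proof -
  let ?L = "\<lambda>f x0 x1 x2. x0 * f 0 + x1 * f 1 + x2 * f (2::nat) :: complex"
  \<comment> \<open>Polarisation turns isotropy of all vectors into orthogonality of every
    two.\<close>
  have polar: "?L a x0 x1 x2 * ?L d y0 y1 y2 + ?L a y0 y1 y2 * ?L d x0 x1 x2
     + ?L b x0 x1 x2 * ?L c y0 y1 y2 + ?L b y0 y1 y2 * ?L c x0 x1 x2 = 0" for x0 x1 x2 y0 y1 y2
  proof -
    have add: "?L f (x0 + y0) (x1 + y1) (x2 + y2) = ?L f x0 x1 x2 + ?L f y0 y1 y2" for f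
      by (simp add: algebra_simps)
    have "A * D' + A' * D + B * C' + B' * C
      = (A + A') * (D + D') + (B + B') * (C + C') - (A * D + B * C) - (A' * D' + B' * C')"
      for A B C D A' B' C' D' :: complex by (simp add: algebra_simps)
    thus ?thesis
      using iso[of "x0 + y0" "x1 + y1" "x2 + y2"] iso[of x0 x1 x2] iso[of y0 y1 y2]
      unfolding add by simp
  qed
  \<comment> \<open>A nonzero vector with \<open>a = b = c = 0\<close> has
    \<open>d \<noteq> 0\<close> by independence, and orthogonality to it is the vanishing of
    \<open>a\<close>.\<close>
  have zero: "?L a x0 x1 x2 = 0" if "?L a y0 y1 y2 = 0" "?L b y0 y1 y2 = 0" "?L c y0 y1 y2 = 0"
     "y0 \<noteq> 0 \<or> y1 \<noteq> 0 \<or> y2 \<noteq> 0" for x0 x1 x2 y0 y1 y2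
  proof -
    have "?L d y0 y1 y2 \<noteq> 0" using indep[of y0 y1 y2] that by blast
    thus ?thesis using polar[of x0 x1 x2 y0 y1 y2] that by simp
  qed
  \<comment> \<open>One vector kills \<open>a\<close> and \<open>b\<close>, another kills
    \<open>a\<close> and \<open>c\<close>. Their pairing is a single product, so one of them kills
    all three and \<open>zero\<close> applies to it.\<close>
  obtain y0 y1 y2 where y: "y0 \<noteq> 0 \<or> y1 \<noteq> 0 \<or> y2 \<noteq> 0" "?L a y0 y1 y2 = 0" "?L b y0 y1 y2 = 0"
    using two_equations_three_unknowns[of a b] by blast
  obtain z0 z1 z2 where z: "z0 \<noteq> 0 \<or> z1 \<noteq> 0 \<or> z2 \<noteq> 0" "?L a z0 z1 z2 = 0" "?L c z0 z1 z2 = 0"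
    using two_equations_three_unknowns[of a c] by blast
  have "?L b z0 z1 z2 * ?L c y0 y1 y2 = 0"
    using polar[of y0 y1 y2 z0 z1 z2] unfolding y(2,3) z(2,3)
    by (simp only: mult_zero_left mult_zero_right add_0_left)
  hence "?L b z0 z1 z2 = 0 \<or> ?L c y0 y1 y2 = 0" by (simp only: mult_eq_0_iff)
  thus ?thesis using zero[OF y(2,3) _ y(1)] zero[OF z(2) _ z(3) z(1)] by blast
qed

text \<open>Serves to add a multiple of one matrix to another without losing chosen nonzero entries
  of the latter; each such entry excludes at most one value.\<close>

lemma generic_scalar:
  fixes x z :: "'a \<Rightarrow> complex"
  assumes "finite F" "\<And>p. p \<in> F \<Longrightarrow> x p \<noteq> 0"
  shows "\<exists>e. e \<noteq> 0 \<and> (\<forall>p\<in>F. x p + e * z p \<noteq> 0)"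
proof -
  have "finite (insert 0 ((\<lambda>p. - x p / z p) ` F))" using assms(1) by simp
  then obtain e where e: "e \<notin> insert 0 ((\<lambda>p. - x p / z p) ` F)"
    using infinite_UNIV_char_0 by (metis UNIV_I ex_new_if_finite)
  have "x p + e * z p \<noteq> 0" if p: "p \<in> F" for p
  proof
    assume eq: "x p + e * z p = 0"
    hence "z p \<noteq> 0" using assms(2)[OF p] by auto
    hence "e = - x p / z p" using eq by (simp add: field_simps add_eq_0_iff)
    thus False using e p by auto
  qed
  thus ?thesis using e by auto
qed

lemma subperms_zero_block:
  assumes X: "subperms_zero m X" and b: "i < m" "j < m" "k < m" "l < m" "i \<noteq> k" "j \<noteq> l"
    and nz: "X $$ (i, j) \<noteq> 0" "X $$ (k, l) \<noteq> 0"
  shows "X $$ (i, l) \<noteq> 0" "X $$ (k, j) \<noteq> 0"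
    and "\<And>p q. p < m \<Longrightarrow> q < m \<Longrightarrow> \<not> (p \<in> {i, k} \<and> q \<in> {j, l}) \<Longrightarrow> X $$ (p, q) = 0"
proof -
  have S: "X $$ (i, j) * X $$ (k, l) + X $$ (i, l) * X $$ (k, j) = 0"
    if "i < m" "j < m" "k < m" "l < m" "i \<noteq> k" "j \<noteq> l" for i j k l
    using X that unfolding subperms_zero_def by blast
  show il: "X $$ (i, l) \<noteq> 0" and kj: "X $$ (k, j) \<noteq> 0" using S[OF b] nz by auto
  \<comment> \<open>the three equations \<open>u\<^sub>1 v\<^sub>2 + u\<^sub>2 v\<^sub>1 = u\<^sub>1 v\<^sub>3 + u\<^sub>3 v\<^sub>1 = u\<^sub>2 v\<^sub>3 + u\<^sub>3 v\<^sub>2 = 0\<close> force \<open>v\<^sub>3 = u\<^sub>3 = 0\<close>\<close>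
  have three: "u3 = 0 \<and> v3 = 0" if "u1 * v2 + u2 * v1 = 0" "u1 * v3 + u3 * v1 = 0" "u2 * v3 + u3 * v2 = 0"
     "u1 \<noteq> 0" "u2 \<noteq> 0" "v1 \<noteq> 0" "v2 \<noteq> 0" for u1 u2 u3 v1 v2 v3 :: complex
  proof -
    have "2 * (u1 * u2 * v3) = u1 * (u2 * v3 + u3 * v2) - u3 * (u1 * v2 + u2 * v1) + u2 * (u1 * v3 + u3 * v1)"
      by (simp add: algebra_simps)
    hence "2 * (u1 * u2 * v3) = 0" unfolding that(1-3) by simp
    hence "v3 = 0" using that by simp
    thus ?thesis using that by auto
  qed
  have col: "X $$ (i, q) = 0 \<and> X $$ (k, q) = 0" if "q < m" "q \<noteq> j" "q \<noteq> l" for q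
    using three[of "X $$ (i, j)" "X $$ (k, l)" "X $$ (i, l)" "X $$ (k, j)" "X $$ (k, q)" "X $$ (i, q)"]
      S[OF b] S[of i j k q] S[of i l k q] b that nz il kj by (simp add: mult.commute add.commute)
  have row: "X $$ (p, j) = 0 \<and> X $$ (p, l) = 0" if "p < m" "p \<noteq> i" "p \<noteq> k" for p
    using three[of "X $$ (i, j)" "X $$ (k, l)" "X $$ (k, j)" "X $$ (i, l)" "X $$ (p, l)" "X $$ (p, j)"]
      S[OF b] S[of i j p l] S[of k j p l] b that nz il kj by (simp add: mult.commute add.commute)
  show "X $$ (p, q) = 0" if "p < m" "q < m" "\<not> (p \<in> {i, k} \<and> q \<in> {j, l})" for p q
  proof (cases "p \<in> {i, k}")
    case True
    thus ?thesis using col[of q] that by auto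
  next
    case p: False
    show ?thesis
    proof (cases "q \<in> {j, l}")
      case True
      thus ?thesis using row[of p] that p by auto
    next
      case False
      have "X $$ (i, j) * X $$ (p, q) + X $$ (i, q) * X $$ (p, j) = 0"
        using S[of i j p q] p False that b by auto
      thus ?thesis using row[of p] p that nz by auto
    qed
  qed
qed

text \<open>If some member has nonzero entries off a common line, adding generic multiples of the
  others confines all of \<open>U\<close> to one 2 x 2 block, where isotropic subspaces have
  dimension at most 2. Otherwise a member with two nonzero entries fixes a line for all of
  \<open>U\<close>, and such a member exists since two independent members with one nonzero entry
  each would have a sum with two.\<close>

lemma isotropic_subspace_in_line:
  fixes U :: "complex mat set"
  assumes U: "U \<subseteq> carrier_mat m m"
    and add: "\<And>X Y. X \<in> U \<Longrightarrow> Y \<in> U \<Longrightarrow> X + Y \<in> U"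
    and smult: "\<And>a X. X \<in> U \<Longrightarrow> a \<cdot>\<^sub>m X \<in> U"
    and zero: "\<And>X. X \<in> U \<Longrightarrow> subperms_zero m X"
    and Z: "Z0 \<in> U" "Z1 \<in> U" "Z2 \<in> U"
    and indep: "\<And>x0 x1 x2. x0 \<cdot>\<^sub>m Z0 + x1 \<cdot>\<^sub>m Z1 + x2 \<cdot>\<^sub>m Z2 = 0\<^sub>m m m \<Longrightarrow> x0 = 0 \<and> x1 = 0 \<and> x2 = 0"
  shows "(\<exists>r<m. \<forall>X\<in>U. in_row m r X) \<or> (\<exists>s<m. \<forall>X\<in>U. in_col m s X)"
proof -
  have comb: "X + e \<cdot>\<^sub>m Y \<in> U" if "X \<in> U" "Y \<in> U" for X Y e by (intro add smult that)
  have idx: "(X + e \<cdot>\<^sub>m Y) $$ (i, j) = X $$ (i, j) + e * Y $$ (i, j)"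
    if "X \<in> U" "Y \<in> U" "i < m" "j < m" for X Y e i j using that U by auto
  have Zc: "Z0 \<in> carrier_mat m m" "Z1 \<in> carrier_mat m m" "Z2 \<in> carrier_mat m m" using Z U by auto
  define W where "W x0 x1 x2 = x0 \<cdot>\<^sub>m Z0 + x1 \<cdot>\<^sub>m Z1 + x2 \<cdot>\<^sub>m Z2" for x0 x1 x2
  have WU: "W x0 x1 x2 \<in> U" for x0 x1 x2 unfolding W_def by (intro add smult Z)
  have Widx: "W x0 x1 x2 $$ (i, j) = x0 * Z0 $$ (i, j) + x1 * Z1 $$ (i, j) + x2 * Z2 $$ (i, j)"
    if "i < m" "j < m" for x0 x1 x2 i j using Zc that by (simp add: W_def)
  have Wc: "W x0 x1 x2 \<in> carrier_mat m m" for x0 x1 x2 using WU U by blast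
  have noblock: "X $$ (i, j) = 0 \<or> X $$ (k, l) = 0"
    if X: "X \<in> U" and b: "i < m" "j < m" "k < m" "l < m" "i \<noteq> k" "j \<noteq> l" for X i j k l
  proof (rule ccontr)
    assume "\<not> ?thesis"
    hence nz: "X $$ (i, j) \<noteq> 0" "X $$ (k, l) \<noteq> 0" by auto
    have block: "Y $$ (p, q) = 0" if Y: "Y \<in> U" and pq: "p < m" "q < m" "\<not> (p \<in> {i, k} \<and> q \<in> {j, l})" for Y p q
    proof -
      obtain e where e: "e \<noteq> 0" "\<forall>p\<in>{(i, j), (k, l)}. X $$ p + e * Y $$ p \<noteq> 0"
        using generic_scalar[of "{(i, j), (k, l)}" "\<lambda>p. X $$ p" "\<lambda>p. Y $$ p"] nz by auto
      have "(X + e \<cdot>\<^sub>m Y) $$ (i, j) \<noteq> 0" "(X + e \<cdot>\<^sub>m Y) $$ (k, l) \<noteq> 0"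
        using e idx[OF X Y] b by auto
      from subperms_zero_block(3)[OF zero[OF comb[OF X Y]] b this pq]
      have "(X + e \<cdot>\<^sub>m Y) $$ (p, q) = 0" .
      moreover have "X $$ (p, q) = 0" using subperms_zero_block(3)[OF zero[OF X] b nz pq] .
      ultimately show ?thesis using idx[OF X Y pq(1,2)] e(1) by simp
    qed
    define A B C D where "A n = [Z0, Z1, Z2] ! n $$ (i, j)" and "B n = [Z0, Z1, Z2] ! n $$ (i, l)"
      and "C n = [Z0, Z1, Z2] ! n $$ (k, j)" and "D n = [Z0, Z1, Z2] ! n $$ (k, l)" for n
    note defs = A_def B_def C_def D_def
    let ?L = "\<lambda>f x0 x1 x2. x0 * f 0 + x1 * f 1 + x2 * f (2::nat) :: complex"
    have WL: "W x0 x1 x2 $$ (i, j) = ?L A x0 x1 x2" "W x0 x1 x2 $$ (i, l) = ?L B x0 x1 x2"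
      "W x0 x1 x2 $$ (k, j) = ?L C x0 x1 x2" "W x0 x1 x2 $$ (k, l) = ?L D x0 x1 x2" for x0 x1 x2
      using Widx b by (simp_all add: defs)
    have iso: "?L A x0 x1 x2 * ?L D x0 x1 x2 + ?L B x0 x1 x2 * ?L C x0 x1 x2 = 0" for x0 x1 x2
      using zero[OF WU, of x0 x1 x2] b unfolding subperms_zero_def WL[symmetric] by blast
    have ind: "x0 = 0 \<and> x1 = 0 \<and> x2 = 0"
      if "?L A x0 x1 x2 = 0" "?L B x0 x1 x2 = 0" "?L C x0 x1 x2 = 0" "?L D x0 x1 x2 = 0" for x0 x1 x2
    proof -
      have "W x0 x1 x2 $$ (p, q) = 0" if "p < m" "q < m" for p q
        using block[OF WU that] WL[of x0 x1 x2] \<open>?L A x0 x1 x2 = 0\<close> \<open>?L B x0 x1 x2 = 0\<close>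
          \<open>?L C x0 x1 x2 = 0\<close> \<open>?L D x0 x1 x2 = 0\<close> by (cases "p \<in> {i, k} \<and> q \<in> {j, l}") auto
      hence "W x0 x1 x2 = 0\<^sub>m m m" using Wc[of x0 x1 x2] by (intro eq_matI) auto
      thus ?thesis using indep by (simp add: W_def)
    qed
    have comm: "d * a + b * c = 0 \<and> b * c + a * d = 0 \<and> c * b + a * d = 0"
      if "a * d + b * c = 0" for a b c d :: complex
      using that by (auto simp: mult.commute add.commute)
    note iso' = comm[OF iso, THEN conjunct1] comm[OF iso, THEN conjunct2, THEN conjunct1]
      comm[OF iso, THEN conjunct2, THEN conjunct2]
    \<comment> \<open>Reordering the coordinates keeps the shape of the form, so
      \<open>isotropic_three\<close> applies to each of the four; then the first member is zero on
      the block, against independence.\<close>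
    have "?L A 1 0 0 = 0" by (rule isotropic_three[OF iso]; rule ind; assumption)
    moreover have "?L B 1 0 0 = 0" by (rule isotropic_three[OF iso'(2)]; rule ind; assumption)
    moreover have "?L C 1 0 0 = 0" by (rule isotropic_three[OF iso'(3)]; rule ind; assumption)
    moreover have "?L D 1 0 0 = 0" by (rule isotropic_three[OF iso'(1)]; rule ind; assumption)
    ultimately have "(1::complex) = 0" using ind[of 1 0 0] by blast
    thus False by simp
  qed
  have rowcase: "in_row m r Y"
    if X: "X \<in> U" and Y: "Y \<in> U" and r: "r < m" "s < m" "s' < m" "s \<noteq> s'" and nz: "X $$ (r, s) \<noteq> 0" "X $$ (r, s') \<noteq> 0"
    for X Y r s s'
    unfolding in_row_def
  proof (intro allI impI, rule ccontr)
    fix p q assume pq: "p < m" "q < m" "p \<noteq> r" "Y $$ (p, q) \<noteq> 0"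
    have X0: "X $$ (p, q) = 0"
      using noblock[OF X, of p q r s] noblock[OF X, of p q r s'] pq r nz by auto
    obtain e where e: "e \<noteq> 0" "\<forall>p\<in>{(r, s), (r, s')}. X $$ p + e * Y $$ p \<noteq> 0"
      using generic_scalar[of "{(r, s), (r, s')}" "\<lambda>p. X $$ p" "\<lambda>p. Y $$ p"] nz by auto
    show False
      using noblock[OF comb[OF X Y], of p q r s e] noblock[OF comb[OF X Y], of p q r s' e]
        idx[OF X Y] pq r e X0 by auto
  qed
  have colcase: "in_col m r Y"
    if X: "X \<in> U" and Y: "Y \<in> U" and r: "r < m" "s < m" "s' < m" "s \<noteq> s'" and nz: "X $$ (s, r) \<noteq> 0" "X $$ (s', r) \<noteq> 0"
    for X Y r s s'
    unfolding in_col_def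
  proof (intro allI impI, rule ccontr)
    fix p q assume pq: "p < m" "q < m" "q \<noteq> r" "Y $$ (p, q) \<noteq> 0"
    have X0: "X $$ (p, q) = 0"
      using noblock[OF X, of p q s r] noblock[OF X, of p q s' r] pq r nz by auto
    obtain e where e: "e \<noteq> 0" "\<forall>p\<in>{(s, r), (s', r)}. X $$ p + e * Y $$ p \<noteq> 0"
      using generic_scalar[of "{(s, r), (s', r)}" "\<lambda>p. X $$ p" "\<lambda>p. Y $$ p"] nz by auto
    show False
      using noblock[OF comb[OF X Y], of p q s r e] noblock[OF comb[OF X Y], of p q s' r e]
        idx[OF X Y] pq r e X0 by auto
  qed
  show ?thesis
  proof (rule ccontr)
    assume no: "\<not> ?thesis"
    have single: "X $$ (p, q) = 0 \<or> X $$ (p', q') = 0"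
      if "X \<in> U" "p < m" "q < m" "p' < m" "q' < m" "(p, q) \<noteq> (p', q')" for X p q p' q'
    proof (rule ccontr)
      assume c: "\<not> ?thesis"
      hence "p = p' \<or> q = q'" using noblock[of X p q p' q'] that by blast
      thus False
      proof
        assume "p = p'"
        hence "\<forall>Y\<in>U. in_row m p Y" using rowcase[OF that(1), of _ p q q'] c that by auto
        thus False using no that by blast
      next
        assume "q = q'"
        hence "\<forall>Y\<in>U. in_col m q Y" using colcase[OF that(1), of _ q p p'] c that by auto
        thus False using no that by blast
      qed
    qed
    have "\<exists>p q. p < m \<and> q < m \<and> Z0 $$ (p, q) \<noteq> 0"
    proof (rule ccontr)
      assume "\<not> ?thesis"
      hence "1 \<cdot>\<^sub>m Z0 + 0 \<cdot>\<^sub>m Z1 + 0 \<cdot>\<^sub>m Z2 = 0\<^sub>m m m" using Zc by (intro eq_matI) auto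
      thus False using indep[of 1 0 0] by simp
    qed
    then obtain p q where p: "p < m" "q < m" "Z0 $$ (p, q) \<noteq> 0" by blast
    have "\<exists>p q. p < m \<and> q < m \<and> Z1 $$ (p, q) \<noteq> 0"
    proof (rule ccontr)
      assume "\<not> ?thesis"
      hence "0 \<cdot>\<^sub>m Z0 + 1 \<cdot>\<^sub>m Z1 + 0 \<cdot>\<^sub>m Z2 = 0\<^sub>m m m" using Zc by (intro eq_matI) auto
      thus False using indep[of 0 1 0] by simp
    qed
    then obtain p' q' where p': "p' < m" "q' < m" "Z1 $$ (p', q') \<noteq> 0" by blast
    show False
    proof (cases "(p, q) = (p', q')")
      case True
      define c where "c = - Z1 $$ (p, q) / Z0 $$ (p, q)"
      have "c * Z0 $$ (a, b) + Z1 $$ (a, b) = 0" if "a < m" "b < m" for a b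
        using single[OF Z(1) that p(1,2)] single[OF Z(2) that p(1,2)] p p' True
        by (cases "(a, b) = (p, q)") (auto simp: c_def)
      hence "c \<cdot>\<^sub>m Z0 + 1 \<cdot>\<^sub>m Z1 + 0 \<cdot>\<^sub>m Z2 = 0\<^sub>m m m" using Zc by (intro eq_matI) auto
      thus False using indep[of c 1 0] by simp
    next
      case False
      have "Z0 $$ (p', q') = 0" "Z1 $$ (p, q) = 0"
        using single[OF Z(1) p(1,2) p'(1,2) False] single[OF Z(2) p(1,2) p'(1,2) False] p p' by auto
      thus False
        using single[OF comb[OF Z(1,2), of 1] p(1,2) p'(1,2) False] idx[OF Z(1,2)] p p' by auto
    qed
  qed
qed

section \<open>Images of rows and columns under a permanent preserver\<close>

lemma linear_zero:
  assumes "g \<in> proj_sym_group (Mat n) P" shows "g (0\<^sub>m n n) = 0\<^sub>m n n"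
proof -
  note G = proj_sym_groupD[OF assms]
  have "g (0 \<cdot>\<^sub>m 0\<^sub>m n n) = 0 \<cdot>\<^sub>m g (0\<^sub>m n n)" by (rule G(5)) simp
  moreover have "0 \<cdot>\<^sub>m 0\<^sub>m n n = (0\<^sub>m n n :: complex mat)" "0 \<cdot>\<^sub>m g (0\<^sub>m n n) = 0\<^sub>m n n"
    using G(3)[of "0\<^sub>m n n"] by (auto intro!: eq_matI)
  ultimately show ?thesis by simp
qed

lemma proj_sym_group_zeroD:
  assumes "g \<in> proj_sym_group (Mat n) P" "X \<in> carrier_mat n n" "g X = 0\<^sub>m n n"
  shows "X = 0\<^sub>m n n"
proof (rule inj_onD[of g "carrier_mat n n"])
  show "inj_on g (carrier_mat n n)" using proj_sym_groupD(2)[OF assms(1)] by (simp add: bij_betw_def)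
  show "g X = g (0\<^sub>m n n)" using assms(3) linear_zero[OF assms(1)] by simp
qed (use assms(2) in auto)

lemma unit_mat_neq_zero: "i < n \<Longrightarrow> j < n \<Longrightarrow> unit_mat n i j \<noteq> 0\<^sub>m n n"
proof
  assume "i < n" "j < n" "unit_mat n i j = 0\<^sub>m n n"
  hence "unit_mat n i j $$ (i, j) = 0\<^sub>m n n $$ (i, j)" by simp
  thus False using \<open>i < n\<close> \<open>j < n\<close> by simp
qed

text \<open>The permanent is affine along each matrix of a row, so the image of the row is
  isotropic, and \<open>m \<ge> 3\<close> provides the three independent members that force it into
  a line.\<close>

lemma perm_preserver_row_in_line:
  assumes g: "g \<in> proj_sym_group (Mat m) (perm m)" and m: "m \<ge> 3" and i: "i < m"
  shows "(\<exists>r<m. \<forall>X\<in>carrier_mat m m. in_row m i X \<longrightarrow> in_row m r (g X)) \<or>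
         (\<exists>s<m. \<forall>X\<in>carrier_mat m m. in_row m i X \<longrightarrow> in_col m s (g X))"
proof -
  note G = proj_sym_groupD[OF g]
  define U where "U = g ` {X \<in> carrier_mat m m. in_row m i X}"
  have unit: "unit_mat m i j \<in> {X \<in> carrier_mat m m. in_row m i X}" for j
    by (simp add: in_row_def)
  have "(\<exists>r<m. \<forall>X\<in>U. in_row m r X) \<or> (\<exists>s<m. \<forall>X\<in>U. in_col m s X)"
  proof (rule isotropic_subspace_in_line)
    show "U \<subseteq> carrier_mat m m" using G(3) by (auto simp: U_def)
    show "X + Y \<in> U" if "X \<in> U" "Y \<in> U" for X Y
    proof -
      obtain X' Y' where X': "X' \<in> carrier_mat m m" "in_row m i X'" "X = g X'"
        and Y': "Y' \<in> carrier_mat m m" "in_row m i Y'" "Y = g Y'" using \<open>X \<in> U\<close> \<open>Y \<in> U\<close> U_def by auto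
      have "X + Y = g (X' + Y')" using G(4)[OF X'(1) Y'(1)] X' Y' by simp
      moreover have "in_row m i (X' + Y')" using X' Y' by (auto simp: in_row_def)
      ultimately show ?thesis using X' Y' by (auto simp: U_def)
    qed
    show "a \<cdot>\<^sub>m X \<in> U" if "X \<in> U" for a X
    proof -
      obtain X' where X': "X' \<in> carrier_mat m m" "in_row m i X'" "X = g X'"
        using \<open>X \<in> U\<close> by (auto simp: U_def)
      have "a \<cdot>\<^sub>m X = g (a \<cdot>\<^sub>m X')" using G(5)[OF X'(1)] X' by simp
      moreover have "in_row m i (a \<cdot>\<^sub>m X')" using X' by (auto simp: in_row_def)
      ultimately show ?thesis using X' by (auto simp: U_def)
    qed
    show "subperms_zero m X" if "X \<in> U" for X
    proof -
      obtain X' where X': "X' \<in> carrier_mat m m" "in_row m i X'" "X = g X'"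
        using \<open>X \<in> U\<close> by (auto simp: U_def)
      thus ?thesis using perm_affine_row[OF X'(1) i X'(2)] affine_along_map[OF g X'(1)]
          subperms_zero_if_perm_affine G(3)[OF X'(1)] by simp
    qed
    show "g (unit_mat m i 0) \<in> U" "g (unit_mat m i 1) \<in> U" "g (unit_mat m i 2) \<in> U"
      unfolding U_def using unit by blast+
    fix x0 x1 x2
    let ?X = "x0 \<cdot>\<^sub>m unit_mat m i 0 + x1 \<cdot>\<^sub>m unit_mat m i 1 + x2 \<cdot>\<^sub>m unit_mat m i 2"
    assume "x0 \<cdot>\<^sub>m g (unit_mat m i 0) + x1 \<cdot>\<^sub>m g (unit_mat m i 1) + x2 \<cdot>\<^sub>m g (unit_mat m i 2) = 0\<^sub>m m m"
    hence "g ?X = 0\<^sub>m m m" by (simp add: G(4,5))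
    hence "?X = 0\<^sub>m m m" using proj_sym_group_zeroD[OF g, of ?X] by simp
    hence "?X $$ (i, j) = 0" if "j < m" for j using that i by simp
    from this[of 0] this[of 1] this[of 2] show "x0 = 0 \<and> x1 = 0 \<and> x2 = 0"
      using m i by simp
  qed
  thus ?thesis unfolding U_def by auto
qed

lemma perm_preserver_col_in_line:
  assumes g: "g \<in> proj_sym_group (Mat m) (perm m)" and m: "m \<ge> 3" and i: "i < m"
  shows "(\<exists>r<m. \<forall>X\<in>carrier_mat m m. in_col m i X \<longrightarrow> in_row m r (g X)) \<or>
         (\<exists>s<m. \<forall>X\<in>carrier_mat m m. in_col m i X \<longrightarrow> in_col m s (g X))"
proof -
  define h where "h = (\<lambda>X\<in>carrier_mat m m. g X\<^sup>T)"
  have h: "h \<in> proj_sym_group (Mat m) (perm m)"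
    unfolding h_def by (rule transpose_proj_sym_group[OF g]) (rule perm_transpose)
  have "in_row m i X\<^sup>T" if "in_col m i X" "X \<in> carrier_mat m m" for X
    using that by (auto simp: in_row_def in_col_def)
  moreover have "h X\<^sup>T = g X" if "X \<in> carrier_mat m m" for X using that by (simp add: h_def)
  ultimately show ?thesis
    using perm_preserver_row_in_line[OF h m i] by (metis transpose_carrier_mat)
qed

text \<open>The sum of the two units has a nonzero subpermanent, whereas the permanent is affine
  along every matrix in one line.\<close>

lemma perm_preserver_units_off_line:
  assumes g: "g \<in> proj_sym_group (Mat m) (perm m)"
    and b: "i < m" "j < m" "k < m" "l < m" "i \<noteq> k" "j \<noteq> l" and r: "r < m"
  shows "\<not> (in_row m r (g (unit_mat m i j)) \<and> in_row m r (g (unit_mat m k l)))"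
    and "\<not> (in_col m r (g (unit_mat m i j)) \<and> in_col m r (g (unit_mat m k l)))"
proof -
  note G = proj_sym_groupD[OF g]
  let ?X = "unit_mat m i j + unit_mat m k l"
  have "\<not> subperms_zero m ?X"
  proof
    assume "subperms_zero m ?X"
    hence "?X $$ (i, j) * ?X $$ (k, l) + ?X $$ (i, l) * ?X $$ (k, j) = 0"
      using b unfolding subperms_zero_def by blast
    thus False using b by simp
  qed
  hence na: "\<not> perm_affine m (g ?X)"
    using subperms_zero_if_perm_affine[of ?X m] affine_along_map[OF g, of ?X] by auto
  have gX: "g ?X = g (unit_mat m i j) + g (unit_mat m k l)" by (simp add: G(4))
  have c: "g (unit_mat m i j) \<in> carrier_mat m m" "g (unit_mat m k l) \<in> carrier_mat m m" using G(3) by auto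
  show "\<not> (in_row m r (g (unit_mat m i j)) \<and> in_row m r (g (unit_mat m k l)))"
  proof
    assume "in_row m r (g (unit_mat m i j)) \<and> in_row m r (g (unit_mat m k l))"
    hence "in_row m r (g ?X)" unfolding gX using c by (auto simp: in_row_def)
    thus False using na perm_affine_row[of "g ?X" m r] G(3)[of ?X] r by auto
  qed
  show "\<not> (in_col m r (g (unit_mat m i j)) \<and> in_col m r (g (unit_mat m k l)))"
  proof
    assume "in_col m r (g (unit_mat m i j)) \<and> in_col m r (g (unit_mat m k l))"
    hence "in_col m r (g ?X)" unfolding gX using c by (auto simp: in_col_def)
    thus False using na perm_affine_col[of "g ?X" m r] G(3)[of ?X] r by auto
  qed
qed

lemma perm_permutation_mat:
  assumes "\<sigma> permutes {0..<m}"
  shows "perm m (mat m m (\<lambda>(i, j). if j = \<sigma> i then c i else 0)) = (\<Prod>i = 0..<m. c i)"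
proof -
  let ?Y = "mat m m (\<lambda>(i, j). if j = \<sigma> i then c i else 0)"
  have lt: "\<tau> i < m" if "\<tau> permutes {0..<m}" "i < m" for \<tau> i
    using permutes_in_image[OF that(1), of i] that by simp
  have "(\<Prod>i = 0..<m. ?Y $$ (i, \<tau> i)) = (if \<tau> = \<sigma> then \<Prod>i = 0..<m. c i else 0)"
    if t: "\<tau> permutes {0..<m}" for \<tau>
  proof (cases "\<tau> = \<sigma>")
    case True
    thus ?thesis using lt[OF t] by (auto intro!: prod.cong)
  next
    case False
    then obtain i where "\<tau> i \<noteq> \<sigma> i" by auto
    moreover from this have "i < m" using permutes_not_in[OF t, of i] permutes_not_in[OF assms, of i] by force
    ultimately show ?thesis using False lt[OF t] by (auto intro!: prod_zero)
  qed
  hence "perm m ?Y = (\<Sum>\<tau> | \<tau> permutes {0..<m}. if \<tau> = \<sigma> then \<Prod>i = 0..<m. c i else 0)"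
    unfolding perm_def by (intro sum.cong) auto
  also have "\<dots> = (\<Prod>i = 0..<m. c i)" using assms by (simp add: finite_permutations)
  finally show ?thesis .
qed

text \<open>Rows to rows forces columns to columns, so a unit goes to a multiple
  \<open>c i j\<close> of a unit. Comparing permanents on permutation matrices, all products of the
  \<open>c i (\<sigma> i)\<close> have the same value; exchanging two values of
  \<open>\<sigma>\<close> makes the 2 x 2 minors of \<open>c\<close> vanish.\<close>

lemma perm_preserver_rows:
  assumes g: "g \<in> proj_sym_group (Mat m) (perm m)" and m: "m \<ge> 3"
    and rows: "\<And>i. i < m \<Longrightarrow> \<exists>r<m. \<forall>X\<in>carrier_mat m m. in_row m i X \<longrightarrow> in_row m r (g X)"
  shows "\<exists>a b \<pi> \<rho>. \<pi> permutes {0..<m} \<and> \<rho> permutes {0..<m} \<and> (\<forall>i<m. a i \<noteq> 0 \<and> b i \<noteq> 0) \<and>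
     (\<forall>i<m. \<forall>j<m. g (unit_mat m i j) = (a i * b j) \<cdot>\<^sub>m unit_mat m (\<pi> i) (\<rho> j))"
proof -
  note G = proj_sym_groupD[OF g]
  have m0: "0 < m" "1 < m" using m by auto
  have urow: "in_row m i (unit_mat m i j)" and ucol: "in_col m j (unit_mat m i j)" for i j
    by (auto simp: in_row_def in_col_def)
  have nz: "\<exists>p<m. \<exists>q<m. g (unit_mat m i j) $$ (p, q) \<noteq> 0" if "i < m" "j < m" for i j
  proof (rule ccontr)
    assume "\<not> ?thesis"
    hence "g (unit_mat m i j) = 0\<^sub>m m m" using G(3)[of "unit_mat m i j"] by (intro eq_matI) auto
    thus False using proj_sym_group_zeroD[OF g] unit_mat_neq_zero[OF that] by simp
  qed
  obtain \<pi>0 where p0: "\<And>i. i < m \<Longrightarrow> \<pi>0 i < m" "\<And>i j. i < m \<Longrightarrow> j < m \<Longrightarrow> in_row m (\<pi>0 i) (g (unit_mat m i j))"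
    using rows urow unit_mat_carrier by metis
  have pinj: "\<pi>0 i \<noteq> \<pi>0 k" if "i < m" "k < m" "i \<noteq> k" for i k
    using perm_preserver_units_off_line(1)[OF g that(1) m0(1) that(2) m0(2) that(3) _ p0(1)[OF that(1)]]
      p0(2)[OF that(1) m0(1)] p0(2)[OF that(2) m0(2)] by auto
  have "\<exists>s<m. \<forall>i<m. in_col m s (g (unit_mat m i j))" if j: "j < m" for j
  proof -
    have "\<not> (\<exists>r<m. \<forall>X\<in>carrier_mat m m. in_col m j X \<longrightarrow> in_row m r (g X))"
    proof
      assume "\<exists>r<m. \<forall>X\<in>carrier_mat m m. in_col m j X \<longrightarrow> in_row m r (g X)"
      then obtain r where r: "r < m" "\<And>i. in_row m r (g (unit_mat m i j))" using ucol unit_mat_carrier by blast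
      have "\<pi>0 i = r" if "i < m" for i
        using nz[OF that j] p0(2)[OF that j] r(2)[of i] unfolding in_row_def by blast
      thus False using pinj[OF m0] m0 by auto
    qed
    thus ?thesis using perm_preserver_col_in_line[OF g m j] ucol unit_mat_carrier by blast
  qed
  then obtain \<rho>0 where r0: "\<And>j. j < m \<Longrightarrow> \<rho>0 j < m" "\<And>i j. i < m \<Longrightarrow> j < m \<Longrightarrow> in_col m (\<rho>0 j) (g (unit_mat m i j))"
    by metis
  have rinj: "\<rho>0 i \<noteq> \<rho>0 k" if "i < m" "k < m" "i \<noteq> k" for i k
    using perm_preserver_units_off_line(2)[OF g m0(1) that(1) m0(2) that(2) _ that(3) r0(1)[OF that(1)]]
      r0(2)[OF m0(1) that(1)] r0(2)[OF m0(2) that(2)] by auto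
  define \<pi> where "\<pi> i = (if i < m then \<pi>0 i else i)" for i
  define \<rho> where "\<rho> i = (if i < m then \<rho>0 i else i)" for i
  have perm: "f permutes {0..<m}" if "\<And>i. i < m \<Longrightarrow> f i < m" "\<And>i. \<not> i < m \<Longrightarrow> f i = i"
     "\<And>i k. i < m \<Longrightarrow> k < m \<Longrightarrow> i \<noteq> k \<Longrightarrow> f i \<noteq> f k" for f :: "nat \<Rightarrow> nat"
  proof (rule bij_imp_permutes)
    have "inj_on f {0..<m}" using that(3) by (metis atLeastLessThan_iff inj_onI)
    moreover have "f ` {0..<m} \<subseteq> {0..<m}" using that(1) by auto
    ultimately show "bij_betw f {0..<m} {0..<m}"
      by (simp add: bij_betw_def endo_inj_surj)
  qed (use that(2) in auto)
  have pp: "\<pi> permutes {0..<m}" by (rule perm) (use p0 pinj in \<open>auto simp: \<pi>_def\<close>)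
  have rp: "\<rho> permutes {0..<m}" by (rule perm) (use r0 rinj in \<open>auto simp: \<rho>_def\<close>)
  define c where "c i j = g (unit_mat m i j) $$ (\<pi> i, \<rho> j)" for i j
  have gc: "g (unit_mat m i j) = c i j \<cdot>\<^sub>m unit_mat m (\<pi> i) (\<rho> j)" if ij: "i < m" "j < m" for i j
  proof (rule eq_matI)
    fix p q assume "p < dim_row (c i j \<cdot>\<^sub>m unit_mat m (\<pi> i) (\<rho> j))" "q < dim_col (c i j \<cdot>\<^sub>m unit_mat m (\<pi> i) (\<rho> j))"
    hence pq: "p < m" "q < m" by auto
    show "g (unit_mat m i j) $$ (p, q) = (c i j \<cdot>\<^sub>m unit_mat m (\<pi> i) (\<rho> j)) $$ (p, q)"
      using p0(2)[OF ij] r0(2)[OF ij] pq ij by (auto simp: in_row_def in_col_def c_def \<pi>_def \<rho>_def)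
  qed (use G(3)[of "unit_mat m i j"] in auto)
  have cnz: "c i j \<noteq> 0" if ij: "i < m" "j < m" for i j
  proof
    assume "c i j = 0"
    hence "g (unit_mat m i j) = 0\<^sub>m m m" using gc[OF ij] by (intro eq_matI) auto
    thus False using proj_sym_group_zeroD[OF g] unit_mat_neq_zero[OF ij] by simp
  qed
  obtain C where C: "C \<noteq> 0" "\<And>X. X \<in> carrier_mat m m \<Longrightarrow> perm m (g X) = C * perm m X" using G(6) by blast
  have lin: "linear_map class_ring (Mat m) (Mat m) g" using g by (auto simp: proj_sym_group_def GL_def)
  have prodc: "(\<Prod>i = 0..<m. c i (\<sigma> i)) = C" if s: "\<sigma> permutes {0..<m}" for \<sigma>
  proof -
    define X where "X = mat m m (\<lambda>(i, j). if j = \<sigma> i then 1 else (0::complex))"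
    have X: "X \<in> carrier_mat m m" by (simp add: X_def)
    \<comment> \<open>The image of the permutation matrix of \<open>\<sigma>\<close> is a rescaled
      permutation matrix of \<open>\<tau>\<close>.\<close>
    define \<tau> where "\<tau> = \<rho> \<circ> \<sigma> \<circ> inv_into UNIV \<pi>"
    have \<tau>: "\<tau> permutes {0..<m}" unfolding \<tau>_def
      by (intro permutes_compose permutes_inv pp rp s)
    define d where "d p = c (inv_into UNIV \<pi> p) (\<sigma> (inv_into UNIV \<pi> p))" for p
    have slt: "\<sigma> i < m" if "i < m" for i using permutes_in_image[OF s, of i] that by simp
    have "g X = mat m m (\<lambda>(p, q). if q = \<tau> p then d p else 0)"
    proof (rule eq_matI)
      fix p q assume "p < dim_row (mat m m (\<lambda>(p, q). if q = \<tau> p then d p else 0))" "q < dim_col (mat m m (\<lambda>(p, q). if q = \<tau> p then d p else 0))"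
      hence pq: "p < m" "q < m" by auto
      define i where "i = inv_into UNIV \<pi> p"
      have i: "i < m" "\<pi> i = p" using permutes_in_image[OF permutes_inv[OF pp], of p] pq permutes_inverses[OF pp] by (auto simp: i_def)
      have "g X $$ (p, q) = (\<Sum>k<m. \<Sum>j<m. X $$ (k, j) * g (unit_mat m k j) $$ (p, q))"
        by (rule linear_map_expand[OF lin X pq])
      also have "\<dots> = (\<Sum>k<m. if k = i then (if q = \<rho> (\<sigma> i) then c i (\<sigma> i) else 0) else 0)"
      proof (intro sum.cong refl)
        fix k assume k: "k \<in> {..<m}"
        have "p = \<pi> k \<longleftrightarrow> k = i" using i permutes_inverses[OF pp] by (metis i_def)
        hence "(\<Sum>j<m. X $$ (k, j) * g (unit_mat m k j) $$ (p, q))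
           = (\<Sum>j<m. if j = \<sigma> k then (if k = i \<and> q = \<rho> j then c i j else 0) else 0)"
          using k pq by (intro sum.cong) (auto simp: X_def gc)
        also have "\<dots> = (if k = i then (if q = \<rho> (\<sigma> i) then c i (\<sigma> i) else 0) else 0)"
          using slt[of k] k by (simp add: sum.delta)
        finally show "(\<Sum>j<m. X $$ (k, j) * g (unit_mat m k j) $$ (p, q))
          = (if k = i then (if q = \<rho> (\<sigma> i) then c i (\<sigma> i) else 0) else 0)" .
      qed
      also have "\<dots> = (if q = \<rho> (\<sigma> i) then c i (\<sigma> i) else 0)"
        using i by (simp add: sum.delta)
      finally show "g X $$ (p, q) = mat m m (\<lambda>(p, q). if q = \<tau> p then d p else 0) $$ (p, q)"
        using pq by (simp add: \<tau>_def d_def i_def)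
    qed (use G(3)[OF X] in auto)
    hence "perm m (g X) = (\<Prod>p = 0..<m. d p)" using perm_permutation_mat[OF \<tau>] by simp
    moreover have "perm m X = 1" unfolding X_def using perm_permutation_mat[OF s, of "\<lambda>_. 1"] by simp
    ultimately have "C = (\<Prod>p = 0..<m. d p)" using C(2)[OF X] by simp
    also have "\<dots> = (\<Prod>i = 0..<m. d (\<pi> i))" using prod.permute[OF pp, of d] by simp
    also have "\<dots> = (\<Prod>i = 0..<m. c i (\<sigma> i))" unfolding d_def using permutes_inverses[OF pp] by simp
    finally show ?thesis by simp
  qed
  have sq: "c i j * c k l = c i l * c k j" if b: "i < m" "j < m" "k < m" "l < m" for i j k l
  proof (cases "i = k \<or> j = l")
    case False
    obtain \<tau> where \<tau>: "\<tau> permutes {0..<m}" "\<tau> i = j" "\<tau> k = l"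
      using permutes_two_points[of i m k j l] b False by blast
    define \<tau>' where "\<tau>' = \<tau> \<circ> Transposition.transpose i k"
    have \<tau>': "\<tau>' permutes {0..<m}"
      unfolding \<tau>'_def using \<tau> b by (intro permutes_compose permutes_swap_id) auto
    let ?S = "{0..<m} - {i} - {k}"
    have e: "(\<Prod>a\<in>?S. c a (\<tau>' a)) = (\<Prod>a\<in>?S. c a (\<tau> a))"
      by (intro prod.cong) (auto simp: \<tau>'_def transpose_def)
    have lt: "\<tau> a < m" if "a < m" for a using permutes_in_image[OF \<tau>(1), of a] that by simp
    have n0: "(\<Prod>a\<in>?S. c a (\<tau> a)) \<noteq> 0" using cnz lt by auto
    have "(\<Prod>a = 0..<m. c a (\<tau> a)) = c i j * c k l * (\<Prod>a\<in>?S. c a (\<tau> a))"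
      using prod_remove_two[of "{0..<m}" i k "\<lambda>a. c a (\<tau> a)"] b False \<tau> by auto
    moreover have "(\<Prod>a = 0..<m. c a (\<tau>' a)) = c i l * c k j * (\<Prod>a\<in>?S. c a (\<tau> a))"
      using prod_remove_two[of "{0..<m}" i k "\<lambda>a. c a (\<tau>' a)"] b False \<tau> e by (auto simp: \<tau>'_def)
    ultimately show ?thesis using prodc[OF \<tau>(1)] prodc[OF \<tau>'] n0 by simp
  qed (auto simp: mult.commute)
  have "g (unit_mat m i j) = ((c i 0 / c 0 0) * c 0 j) \<cdot>\<^sub>m unit_mat m (\<pi> i) (\<rho> j)"
    if ij: "i < m" "j < m" for i j
  proof -
    have "(c i 0 / c 0 0) * c 0 j = c i j"
      using sq[OF ij m0(1) m0(1)] cnz[OF m0(1) m0(1)] by (simp add: field_simps)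
    thus ?thesis using gc[OF ij] by (simp only:)
  qed
  hence "\<forall>i<m. \<forall>j<m. g (unit_mat m i j) = ((c i 0 / c 0 0) * c 0 j) \<cdot>\<^sub>m unit_mat m (\<pi> i) (\<rho> j)"
    by blast
  moreover have "\<forall>i<m. c i 0 / c 0 0 \<noteq> 0 \<and> c 0 i \<noteq> 0" using cnz m0 by simp
  ultimately show ?thesis using pp rp
    by (intro exI[of _ "\<lambda>i. c i 0 / c 0 0"] exI[of _ "c 0"] exI[of _ \<pi>] exI[of _ \<rho>] conjI)
qed

text \<open>Once a mixture of rows going to rows and rows going to columns is excluded,
  \<open>perm_preserver_rows\<close> applies either directly or after composition with the
  transpose.\<close>

theorem perm_preserver:
  assumes g: "g \<in> proj_sym_group (Mat m) (perm m)" and m: "m \<ge> 3"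
  shows "\<exists>a b \<pi> \<rho>. \<pi> permutes {0..<m} \<and> \<rho> permutes {0..<m} \<and> (\<forall>i<m. a i \<noteq> 0 \<and> b i \<noteq> 0) \<and>
     ((\<forall>i<m. \<forall>j<m. g (unit_mat m i j) = (a i * b j) \<cdot>\<^sub>m unit_mat m (\<pi> i) (\<rho> j)) \<or>
      (\<forall>i<m. \<forall>j<m. g (unit_mat m i j) = (a i * b j) \<cdot>\<^sub>m unit_mat m (\<rho> j) (\<pi> i)))"
proof -
  note G = proj_sym_groupD[OF g]
  have m0: "0 < m" "1 < m" using m by auto
  have urow: "in_row m i (unit_mat m i j)" and ucol: "in_col m j (unit_mat m i j)" for i j
    by (auto simp: in_row_def in_col_def)
  have nz: "\<exists>p<m. \<exists>q<m. g (unit_mat m i j) $$ (p, q) \<noteq> 0" if "i < m" "j < m" for i j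
  proof (rule ccontr)
    assume "\<not> ?thesis"
    hence "g (unit_mat m i j) = 0\<^sub>m m m" using G(3)[of "unit_mat m i j"] by (intro eq_matI) auto
    thus False using proj_sym_group_zeroD[OF g] unit_mat_neq_zero[OF that] by simp
  qed
  have same_row: "r = r'" if "i < m" "j < m" "in_row m r (g (unit_mat m i j))" "in_row m r' (g (unit_mat m i j))" for i j r r'
    using nz[OF that(1,2)] that(3,4) unfolding in_row_def by metis
  have same_col: "r = r'" if "i < m" "j < m" "in_col m r (g (unit_mat m i j))" "in_col m r' (g (unit_mat m i j))" for i j r r'
    using nz[OF that(1,2)] that(3,4) unfolding in_col_def by metis
  note off = perm_preserver_units_off_line[OF g]
  let ?R = "\<lambda>i r. r < m \<and> (\<forall>X\<in>carrier_mat m m. in_row m i X \<longrightarrow> in_row m r (g X))"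
  let ?Rc = "\<lambda>i s. s < m \<and> (\<forall>X\<in>carrier_mat m m. in_row m i X \<longrightarrow> in_col m s (g X))"
  let ?C = "\<lambda>j r. r < m \<and> (\<forall>X\<in>carrier_mat m m. in_col m j X \<longrightarrow> in_row m r (g X))"
  let ?Cc = "\<lambda>j s. s < m \<and> (\<forall>X\<in>carrier_mat m m. in_col m j X \<longrightarrow> in_col m s (g X))"
  have U: "?R i r \<Longrightarrow> in_row m r (g (unit_mat m i j))" "?Rc i r \<Longrightarrow> in_col m r (g (unit_mat m i j))"
    "?C j r \<Longrightarrow> in_row m r (g (unit_mat m i j))" "?Cc j r \<Longrightarrow> in_col m r (g (unit_mat m i j))" for i j r
    using urow ucol unit_mat_carrier by blast+
  have rows: "(\<exists>r. ?R i r) \<or> (\<exists>s. ?Rc i s)" if "i < m" for i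
    using perm_preserver_row_in_line[OF g m that] by blast
  have cols: "(\<exists>r. ?C j r) \<or> (\<exists>s. ?Cc j s)" if "j < m" for j
    using perm_preserver_col_in_line[OF g m that] by blast
  \<comment> \<open>If one row goes into row \<open>r\<close> and another into column
    \<open>s\<close>, every column must go into row \<open>r\<close> or column \<open>s\<close>, but
    no two columns into the same one; three columns are too many.\<close>
  have mixed: False if "i < m" "k < m" "i \<noteq> k" "?R i r" "?Rc k s" for i k r s
  proof -
    have c1: "?C j r' \<Longrightarrow> r' = r" "?Cc j r' \<Longrightarrow> r' = s" if "j < m" for j r'
      using same_row[OF \<open>i < m\<close> that U(3) U(1)] same_col[OF \<open>k < m\<close> that U(4) U(2)]
        \<open>?R i r\<close> \<open>?Rc k s\<close> by blast+
    have 1: "\<not> (?C j r \<and> ?C l r)" if "j < m" "l < m" "j \<noteq> l" for j l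
      using off(1)[of i j k l r] U(3)[of r j i] U(3)[of r l k] that \<open>i < m\<close> \<open>k < m\<close> \<open>i \<noteq> k\<close> by blast
    have 2: "\<not> (?Cc j s \<and> ?Cc l s)" if "j < m" "l < m" "j \<noteq> l" for j l
      using off(2)[of i j k l s] U(4)[of s j i] U(4)[of s l k] that \<open>i < m\<close> \<open>k < m\<close> \<open>i \<noteq> k\<close> by blast
    have 3: "?C j r \<or> ?Cc j s" if "j < m" for j
      using cols[OF that] c1[OF that] by blast
    define P Q where "P j = ?C j r" and "Q j = ?Cc j s" for j
    have lt: "0 < m" "1 < m" "2 < m" using m by auto
    have ne: "(0::nat) \<noteq> 1" "(0::nat) \<noteq> 2" "(1::nat) \<noteq> 2" by auto
    have "P 0 \<or> Q 0" "P 1 \<or> Q 1" "P 2 \<or> Q 2"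
      unfolding P_def Q_def by (rule 3[OF lt(1)], rule 3[OF lt(2)], rule 3[OF lt(3)])
    moreover have "\<not> (P 0 \<and> P 1)" "\<not> (P 0 \<and> P 2)" "\<not> (P 1 \<and> P 2)"
      unfolding P_def by (rule 1[OF lt(1,2) ne(1)], rule 1[OF lt(1,3) ne(2)], rule 1[OF lt(2,3) ne(3)])
    moreover have "\<not> (Q 0 \<and> Q 1)" "\<not> (Q 0 \<and> Q 2)" "\<not> (Q 1 \<and> Q 2)"
      unfolding Q_def by (rule 2[OF lt(1,2) ne(1)], rule 2[OF lt(1,3) ne(2)], rule 2[OF lt(2,3) ne(3)])
    ultimately show False by blast
  qed
  show ?thesis
  proof (cases "\<exists>r. ?R 0 r")
    case True
    then obtain r where "?R 0 r" by blast
    hence "\<exists>r<m. \<forall>X\<in>carrier_mat m m. in_row m i X \<longrightarrow> in_row m r (g X)" if "i < m" for i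
      using rows[OF that] mixed[OF m0(1) that] that by metis
    from perm_preserver_rows[OF g m this] show ?thesis by metis
  next
    case False
    then obtain s where s: "?Rc 0 s" using rows[OF m0(1)] by blast
    have "\<exists>s. ?Rc i s" if "i < m" for i
      using rows[OF that] mixed[OF that m0(1)] s by metis
    then obtain f where f: "\<And>i. i < m \<Longrightarrow> ?Rc i (f i)" by metis
    have ff: "f 0 \<noteq> f 1"
      using off(2)[of 0 0 1 1 "f 0"] U(2)[OF f[of 0], of 0] U(2)[OF f[of 1], of 1] f[of 0] m0 by auto
    have "\<exists>r. ?C j r" if j: "j < m" for j
    proof (rule ccontr)
      assume "\<not> ?thesis"
      then obtain s where s: "?Cc j s" using cols[OF j] by blast
      have "f i = s" if "i < m" for i using same_col[OF that j U(2)[OF f[OF that]] U(4)[OF s]] .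
      thus False using ff m0 by auto
    qed
    note cc = this
    define h where "h = (\<lambda>X\<in>carrier_mat m m. g X\<^sup>T)"
    have h: "h \<in> proj_sym_group (Mat m) (perm m)"
      unfolding h_def by (rule transpose_proj_sym_group[OF g]) (rule perm_transpose)
    have "\<exists>r<m. \<forall>X\<in>carrier_mat m m. in_row m i X \<longrightarrow> in_row m r (h X)" if i: "i < m" for i
    proof -
      obtain r where r: "?C i r" using cc[OF i] by blast
      have "in_row m r (h X)" if X: "X \<in> carrier_mat m m" "in_row m i X" for X
      proof -
        have "in_col m i X\<^sup>T" using X by (auto simp: in_row_def in_col_def)
        thus ?thesis using r X by (simp add: h_def)
      qed
      thus ?thesis using r by blast
    qed
    from perm_preserver_rows[OF h m this] obtain a b \<pi> \<rho> where *: "\<pi> permutes {0..<m}" "\<rho> permutes {0..<m}"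
      "\<forall>i<m. a i \<noteq> 0 \<and> b i \<noteq> 0" "\<forall>i<m. \<forall>j<m. h (unit_mat m i j) = (a i * b j) \<cdot>\<^sub>m unit_mat m (\<pi> i) (\<rho> j)" by blast
    have hu: "h (unit_mat m j i) = g (unit_mat m i j)" for i j
    proof -
      have "(unit_mat m j i)\<^sup>T = unit_mat m i j" by (intro eq_matI) auto
      thus ?thesis by (simp add: h_def)
    qed
    have "\<forall>i<m. \<forall>j<m. g (unit_mat m i j) = (b i * a j) \<cdot>\<^sub>m unit_mat m (\<pi> j) (\<rho> i)"
      using *(4) hu by (metis mult.commute)
    thus ?thesis using *(1-3) by blast
  qed
qed

section \<open>Gradings by a generic torus\<close>

lemma sum_eq_at:
  fixes f :: "'a \<Rightarrow> 'b::comm_monoid_add"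
  assumes "finite S" "a \<in> S" "\<And>l. l \<in> S \<Longrightarrow> l \<noteq> a \<Longrightarrow> f l = 0"
  shows "sum f S = f a"
  using assms sum.remove[of S a f] sum.neutral[of "S - {a}" f] by simp

text \<open>These are the two features of a Jordan matrix on which the grading rests.\<close>

lemma jordan_matrix_entry:
  assumes "i < sum_list (map fst n_as)" "j < sum_list (map fst n_as)" "jordan_matrix n_as $$ (i, j) \<noteq> (0 :: complex)"
  shows "i \<le> j \<and> jordan_matrix n_as $$ (i, i) = jordan_matrix n_as $$ (j, j)"
  using assms
proof (induction n_as arbitrary: i j)
  case (Cons na n_as)
  obtain n a where na: "na = (n, a)" by force
  let ?s = "sum_list (map fst n_as)"
  have IH: "i - n \<le> j - n \<and> jordan_matrix n_as $$ (i - n, i - n) = jordan_matrix n_as $$ (j - n, j - n)"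
    if "\<not> i < n" "\<not> j < n" "jordan_matrix n_as $$ (i - n, j - n) \<noteq> 0"
    using Cons.IH[of "i - n" "j - n"] Cons.prems that by (auto simp: na)
  show ?case using Cons.prems IH
    by (auto simp: na jordan_matrix_Cons split: if_splits)
qed simp

lemma jordan_basis:
  fixes A :: "complex mat"
  assumes A: "A \<in> carrier_mat n n"
  obtains S S' J where "S \<in> carrier_mat n n" "S' \<in> carrier_mat n n" "J \<in> carrier_mat n n"
    "S * S' = 1\<^sub>m n" "S' * S = 1\<^sub>m n" "A = S * J * S'"
    "\<And>i j. i < n \<Longrightarrow> j < n \<Longrightarrow> J $$ (i, j) \<noteq> 0 \<Longrightarrow> i \<le> j \<and> J $$ (i, i) = J $$ (j, j)"
proof -
  obtain as where "char_poly A = (\<Prod>a\<leftarrow>as. [:- a, 1:])" using char_poly_factorized[OF A] by blast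
  then obtain n_as where "jordan_nf A n_as" using jordan_nf_exists[OF A] by blast
  hence "similar_mat A (jordan_matrix n_as)" by (simp add: jordan_nf_def)
  then obtain n' S S' where s: "{A, jordan_matrix n_as, S, S'} \<subseteq> carrier_mat n' n'"
    "S * S' = 1\<^sub>m n'" "S' * S = 1\<^sub>m n'" "A = S * jordan_matrix n_as * S'"
    using similar_matD by blast
  have n': "n' = n" using s(1) A by auto
  have dim: "sum_list (map fst n_as) = n" using s(1) n' by auto
  show thesis
  proof (rule that[of S S' "jordan_matrix n_as"])
    show "A = S * jordan_matrix n_as * S'" by (rule s(4))
    show "i \<le> j \<and> jordan_matrix n_as $$ (i, i) = jordan_matrix n_as $$ (j, j)"
      if "i < n" "j < n" "jordan_matrix n_as $$ (i, j) \<noteq> 0" for i j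
      by (rule jordan_matrix_entry) (use that dim in auto)
  qed (use s(1-3) n' in auto)
qed

text \<open>Blocks between generalised eigenvalues that do not match vanish. The other terms in the
  equation at \<open>(a, b)\<close> carry entries of \<open>X\<close> further down its column or
  further left in its row, for the same eigenvalues, hence the induction measure.\<close>

lemma intertwiner_entry:
  fixes J K X :: "complex mat"
  assumes J: "J \<in> carrier_mat n n" "\<And>i j. i < n \<Longrightarrow> j < n \<Longrightarrow> J $$ (i, j) \<noteq> 0 \<Longrightarrow> i \<le> j \<and> J $$ (i, i) = J $$ (j, j)"
    and K: "K \<in> carrier_mat n n" "\<And>i j. i < n \<Longrightarrow> j < n \<Longrightarrow> K $$ (i, j) \<noteq> 0 \<Longrightarrow> i \<le> j \<and> K $$ (i, i) = K $$ (j, j)"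
    and X: "X \<in> carrier_mat n n" and eq: "J * X = c \<cdot>\<^sub>m (X * K)"
    and ab: "a < n" "b < n" "J $$ (a, a) \<noteq> c * K $$ (b, b)"
  shows "X $$ (a, b) = 0"
  using ab
proof (induction "(n - a) + b" arbitrary: a b rule: less_induct)
  case less
  note a = less.prems(1) and b = less.prems(2)
  have "(\<Sum>l = 0..<n. J $$ (a, l) * X $$ (l, b)) = c * (\<Sum>l = 0..<n. X $$ (a, l) * K $$ (l, b))"
  proof -
    have "(J * X) $$ (a, b) = (c \<cdot>\<^sub>m (X * K)) $$ (a, b)" using eq by simp
    thus ?thesis using J(1) K(1) X a b by (simp add: scalar_prod_def)
  qed
  moreover have "(\<Sum>l = 0..<n. J $$ (a, l) * X $$ (l, b)) = J $$ (a, a) * X $$ (a, b)"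
  proof -
    have "J $$ (a, l) * X $$ (l, b) = 0" if l0: "l \<in> {0..<n}" "l \<noteq> a" for l
    proof (rule ccontr)
      have l: "l < n" "l \<noteq> a" using l0 by auto
      assume nz: "J $$ (a, l) * X $$ (l, b) \<noteq> 0"
      hence *: "a < l" "J $$ (l, l) = J $$ (a, a)" using J(2)[OF a l(1)] l by auto
      have "X $$ (l, b) = 0" using less.hyps[of l b] * l a b less.prems(3) by auto
      thus False using nz by simp
    qed
    moreover have "a \<in> {0..<n}" using a by simp
    ultimately show ?thesis by (intro sum_eq_at[where a = a]) (blast | simp)+
  qed
  moreover have "(\<Sum>l = 0..<n. X $$ (a, l) * K $$ (l, b)) = X $$ (a, b) * K $$ (b, b)"
  proof -
    have "X $$ (a, l) * K $$ (l, b) = 0" if l0: "l \<in> {0..<n}" "l \<noteq> b" for l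
    proof (rule ccontr)
      have l: "l < n" "l \<noteq> b" using l0 by auto
      assume nz: "X $$ (a, l) * K $$ (l, b) \<noteq> 0"
      hence *: "l < b" "K $$ (l, l) = K $$ (b, b)" using K(2)[OF l(1) b] l by auto
      have "X $$ (a, l) = 0" using less.hyps[of a l] * l a b less.prems(3) by auto
      thus False using nz by simp
    qed
    moreover have "b \<in> {0..<n}" using b by simp
    ultimately show ?thesis by (intro sum_eq_at[where a = b]) (blast | simp)+
  qed
  ultimately have "(J $$ (a, a) - c * K $$ (b, b)) * X $$ (a, b) = 0" by (simp add: algebra_simps)
  thus ?case using less.prems(3) by simp
qed

section \<open>Multihomogeneous polynomials and torus weights\<close>

text \<open>Multihomogeneous polynomials of degree \<open>\<alpha> i\<close> in row \<open>i\<close>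
  and \<open>\<beta> j\<close> in column \<open>j\<close>, as functions on matrices. Multidegrees
  are functions on all indices; by \<open>hpoly_support\<close> they vanish from \<open>m\<close>
  on.\<close>

inductive hpoly :: "nat \<Rightarrow> (nat \<Rightarrow> nat) \<Rightarrow> (nat \<Rightarrow> nat) \<Rightarrow> (complex mat \<Rightarrow> complex) \<Rightarrow> bool" for m where
  const: "hpoly m (\<lambda>_. 0) (\<lambda>_. 0) (\<lambda>_. c)"
| var: "hpoly m \<alpha> \<beta> f \<Longrightarrow> i < m \<Longrightarrow> j < m \<Longrightarrow>
    hpoly m (\<alpha>(i := Suc (\<alpha> i))) (\<beta>(j := Suc (\<beta> j))) (\<lambda>y. y $$ (i, j) * f y)"
| add: "hpoly m \<alpha> \<beta> f \<Longrightarrow> hpoly m \<alpha> \<beta> g \<Longrightarrow> hpoly m \<alpha> \<beta> (\<lambda>y. f y + g y)"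

lemma hpoly_scale: "hpoly m \<alpha> \<beta> f \<Longrightarrow> hpoly m \<alpha> \<beta> (\<lambda>y. c * f y)"
proof (induction rule: hpoly.induct)
  case (const d) show ?case by (rule hpoly.const)
next
  case (var \<alpha> \<beta> f i j)
  have "(\<lambda>y. c * (y $$ (i, j) * f y)) = (\<lambda>y. y $$ (i, j) * (c * f y))" by (simp add: mult_ac)
  thus ?case using hpoly.var[OF var.IH var.hyps(2,3)] by (simp only:)
next
  case (add \<alpha> \<beta> f g) thus ?case using hpoly.add by (simp add: distrib_left)
qed

lemma hpoly_mult:
  assumes "hpoly m \<alpha> \<beta> f" "hpoly m \<alpha>' \<beta>' g"
  shows "hpoly m (\<lambda>i. \<alpha> i + \<alpha>' i) (\<lambda>i. \<beta> i + \<beta>' i) (\<lambda>y. f y * g y)"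
  using assms
proof (induction rule: hpoly.induct)
  case (const c) thus ?case using hpoly_scale by simp
next
  case (var \<alpha> \<beta> f i j)
  have "(\<lambda>y. y $$ (i, j) * f y * g y) = (\<lambda>y. y $$ (i, j) * (f y * g y))" by (simp add: mult_ac)
  moreover have "(\<lambda>k. (\<alpha>(i := Suc (\<alpha> i))) k + \<alpha>' k) = (\<lambda>k. \<alpha> k + \<alpha>' k)(i := Suc (\<alpha> i + \<alpha>' i))"
    "(\<lambda>k. (\<beta>(j := Suc (\<beta> j))) k + \<beta>' k) = (\<lambda>k. \<beta> k + \<beta>' k)(j := Suc (\<beta> j + \<beta>' j))"
    by auto
  ultimately show ?case using hpoly.var[OF var.IH[OF var.prems] var.hyps(2,3)] by (simp only:)
next
  case (add \<alpha> \<beta> f g') thus ?case using hpoly.add by (simp add: distrib_right)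
qed

lemma hpoly_support: "hpoly m \<alpha> \<beta> f \<Longrightarrow> \<not> i < m \<Longrightarrow> \<alpha> i = 0 \<and> \<beta> i = 0"
  by (induction rule: hpoly.induct) auto

lemma hpoly_constant:
  "hpoly m \<alpha> \<beta> f \<Longrightarrow> \<alpha> = (\<lambda>_. 0) \<Longrightarrow> \<exists>c. f = (\<lambda>_. c)"
proof (induction rule: hpoly.induct)
  case (var \<alpha> \<beta> f i j)
  thus ?case by (metis fun_upd_same nat.distinct(1))
qed auto

lemma hpoly_at_zero: "hpoly m \<alpha> \<beta> f \<Longrightarrow> f (0\<^sub>m m m) \<noteq> 0 \<Longrightarrow> \<alpha> = (\<lambda>_. 0) \<and> \<beta> = (\<lambda>_. 0)"
proof (induction rule: hpoly.induct)
  case (add \<alpha> \<beta> f g)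
  hence "f (0\<^sub>m m m) \<noteq> 0 \<or> g (0\<^sub>m m m) \<noteq> 0" by auto
  thus ?case using add.IH by blast
qed auto

lemma hpoly_linear:
  assumes "hpoly m \<alpha> \<beta> f" "\<alpha> = (\<lambda>_. 0)(i := 1)" "\<beta> = (\<lambda>_. 0)(j := 1)"
  shows "\<exists>c. \<forall>y. f y = c * y $$ (i, j)"
  using assms
proof (induction rule: hpoly.induct)
  case (const c) thus ?case by (metis fun_upd_same zero_neq_one)
next
  case (var \<alpha> \<beta> f i' j')
  have "i' = i" using fun_cong[OF var.prems(1), of i'] by (auto split: if_splits)
  moreover have "j' = j" using fun_cong[OF var.prems(2), of j'] by (auto split: if_splits)
  moreover have "\<alpha> = (\<lambda>_. 0)"
  proof
    fix k show "\<alpha> k = 0" using fun_cong[OF var.prems(1), of k] \<open>i' = i\<close> by (auto split: if_splits)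
  qed
  ultimately show ?case using hpoly_constant[OF var.hyps(1)] by (metis mult.commute)
next
  case (add \<alpha> \<beta> f g)
  then obtain c d where "\<forall>y. f y = c * y $$ (i, j)" "\<forall>y. g y = d * y $$ (i, j)" by blast
  thus ?case by (intro exI[of _ "c + d"]) (simp add: distrib_right)
qed

text \<open>A monomial that does not vanish at the permutation matrix of \<open>\<sigma>\<close> has
  only factors \<open>y $$ (k, \<sigma> k)\<close>, each raising the degrees of row \<open>k\<close>
  and column \<open>\<sigma> k\<close> together.\<close>

lemma hpoly_permutation_mat:
  assumes "hpoly m \<alpha> \<beta> f" "f (mat m m (\<lambda>(i, j). if j = \<sigma> i then 1 else 0)) \<noteq> 0" "\<sigma> permutes {0..<m}"
  shows "\<beta> (\<sigma> i) = \<alpha> i"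
  using assms
proof (induction arbitrary: i rule: hpoly.induct)
  case (var \<alpha> \<beta> f k l)
  have "l = \<sigma> k" "f (mat m m (\<lambda>(i, j). if j = \<sigma> i then 1 else 0)) \<noteq> 0"
    using var.prems(1) var.hyps by (auto split: if_splits)
  moreover have "\<sigma> i = \<sigma> k \<longleftrightarrow> i = k" using permutes_inj[OF var.prems(2)] by (auto dest: injD)
  ultimately show ?case using var.IH[OF _ var.prems(2)] by auto
next
  case (add \<alpha> \<beta> f g)
  have "f (mat m m (\<lambda>(i, j). if j = \<sigma> i then 1 else 0)) \<noteq> 0 \<or> g (mat m m (\<lambda>(i, j). if j = \<sigma> i then 1 else 0)) \<noteq> 0"
    using add.prems(1) by auto
  thus ?case using add by blast
qed simp

definition wt :: "nat \<Rightarrow> (nat \<Rightarrow> complex) \<Rightarrow> (nat \<Rightarrow> complex) \<Rightarrow> (nat \<Rightarrow> nat) \<Rightarrow> (nat \<Rightarrow> nat) \<Rightarrow> complex" where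
  "wt m t s \<alpha> \<beta> = (\<Prod>i<m. t i ^ \<alpha> i) * (\<Prod>j<m. s j ^ \<beta> j)"

text \<open>The weights separate multidegrees, so this single element grades polynomials as finely
  as the whole torus.\<close>

definition generic_torus :: "nat \<Rightarrow> (nat \<Rightarrow> complex) \<Rightarrow> (nat \<Rightarrow> complex) \<Rightarrow> bool" where
  "generic_torus m t s \<longleftrightarrow> (\<forall>\<alpha> \<beta> \<alpha>' \<beta>'. wt m t s \<alpha> \<beta> = wt m t s \<alpha>' \<beta>' \<longrightarrow> (\<forall>i<m. \<alpha> i = \<alpha>' i \<and> \<beta> i = \<beta>' i))"

text \<open>The zero function is given every weight, since a vanishing entry of a graded matrix may
  sit at a quotient that is the weight of no multidegree.\<close>

definition wpoly :: "nat \<Rightarrow> (nat \<Rightarrow> complex) \<Rightarrow> (nat \<Rightarrow> complex) \<Rightarrow> complex \<Rightarrow> (complex mat \<Rightarrow> complex) \<Rightarrow> bool" where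
  "wpoly m t s \<chi> f \<longleftrightarrow> f = (\<lambda>_. 0) \<or> (\<exists>\<alpha> \<beta>. hpoly m \<alpha> \<beta> f \<and> \<chi> = wt m t s \<alpha> \<beta>)"

lemma wt_add: "wt m t s \<alpha> \<beta> * wt m t s \<alpha>' \<beta>' = wt m t s (\<lambda>i. \<alpha> i + \<alpha>' i) (\<lambda>i. \<beta> i + \<beta>' i)"
  by (simp add: wt_def power_add prod.distrib mult_ac)

lemma wt_zero [simp]: "wt m t s (\<lambda>_. 0) (\<lambda>_. 0) = 1"
  by (simp add: wt_def)

lemma wpoly_add:
  assumes g: "generic_torus m t s" and f: "wpoly m t s \<chi> f" and h: "wpoly m t s \<chi> h"
  shows "wpoly m t s \<chi> (\<lambda>y. f y + h y)"
proof (cases "f = (\<lambda>_. 0) \<or> h = (\<lambda>_. 0)")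
  case True thus ?thesis using f h by auto
next
  case False
  then obtain \<alpha> \<beta> \<alpha>' \<beta>' where *: "hpoly m \<alpha> \<beta> f" "\<chi> = wt m t s \<alpha> \<beta>" "hpoly m \<alpha>' \<beta>' h" "\<chi> = wt m t s \<alpha>' \<beta>'"
    using f h unfolding wpoly_def by blast
  have lt: "\<alpha> i = \<alpha>' i \<and> \<beta> i = \<beta>' i" if "i < m" for i
    using g * that unfolding generic_torus_def by metis
  have "\<alpha> i = \<alpha>' i \<and> \<beta> i = \<beta>' i" for i
    using lt[of i] hpoly_support[OF *(1), of i] hpoly_support[OF *(3), of i] by (cases "i < m") auto
  hence "\<alpha> = \<alpha>'" "\<beta> = \<beta>'" by auto
  thus ?thesis unfolding wpoly_def using * hpoly.add by metis
qed

lemma wpoly_scale: "wpoly m t s \<chi> f \<Longrightarrow> wpoly m t s \<chi> (\<lambda>y. c * f y)"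
  unfolding wpoly_def using hpoly_scale by (metis mult_zero_right)

lemma wpoly_mult: "wpoly m t s \<chi> f \<Longrightarrow> wpoly m t s \<psi> h \<Longrightarrow> wpoly m t s (\<chi> * \<psi>) (\<lambda>y. f y * h y)"
  unfolding wpoly_def
proof (elim disjE exE conjE)
  fix \<alpha> \<beta> \<alpha>' \<beta>' assume "hpoly m \<alpha> \<beta> f" "\<chi> = wt m t s \<alpha> \<beta>" "hpoly m \<alpha>' \<beta>' h" "\<psi> = wt m t s \<alpha>' \<beta>'"
  thus "(\<lambda>y. f y * h y) = (\<lambda>_. 0) \<or> (\<exists>\<alpha> \<beta>. hpoly m \<alpha> \<beta> (\<lambda>y. f y * h y) \<and> \<chi> * \<psi> = wt m t s \<alpha> \<beta>)"
    using hpoly_mult wt_add by blast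
qed auto

lemma wpoly_sum:
  assumes "generic_torus m t s" "\<And>i. i \<in> S \<Longrightarrow> wpoly m t s \<chi> (f i)"
  shows "wpoly m t s \<chi> (\<lambda>y. \<Sum>i\<in>S. f i y)"
  using assms(2)
proof (induction S rule: infinite_finite_induct)
  case (insert x S)
  thus ?case using wpoly_add[OF assms(1), of \<chi> "f x" "\<lambda>y. \<Sum>i\<in>S. f i y"] by simp
qed (auto simp: wpoly_def)

lemma wpoly_at_zero:
  assumes f: "wpoly m t s \<chi> f" and nz: "f (0\<^sub>m m m) \<noteq> 0"
  shows "\<chi> = 1 \<and> (\<exists>c. f = (\<lambda>_. c))"
proof -
  obtain \<alpha> \<beta> where *: "hpoly m \<alpha> \<beta> f" "\<chi> = wt m t s \<alpha> \<beta>" using f nz unfolding wpoly_def by auto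
  have "\<alpha> = (\<lambda>_. 0) \<and> \<beta> = (\<lambda>_. 0)" using hpoly_at_zero[OF *(1) nz] .
  thus ?thesis using * hpoly_constant[OF *(1)] by simp
qed

lemma wpoly_var:
  assumes "i < m" "j < m"
  shows "wpoly m t s (t i * s j) (\<lambda>y. y $$ (i, j) * c)"
proof -
  have "hpoly m ((\<lambda>_. 0)(i := Suc 0)) ((\<lambda>_. 0)(j := Suc 0)) (\<lambda>y. y $$ (i, j) * c)"
    using hpoly.var[OF hpoly.const[of m c] assms] by simp
  moreover have "wt m t s ((\<lambda>_. 0)(i := Suc 0)) ((\<lambda>_. 0)(j := Suc 0)) = t i * s j"
  proof -
    have "(\<Prod>k<m. (x k :: complex) ^ ((\<lambda>_. 0)(i := Suc 0)) k) = x i" if "i < m" for x i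
      using that by (subst prod.remove[of _ i]) auto
    thus ?thesis using assms by (simp add: wt_def)
  qed
  ultimately show ?thesis unfolding wpoly_def by metis
qed

section \<open>Pivoting on the constant entries of a graded matrix\<close>

lemma det_permute_index:
  fixes f :: "nat \<Rightarrow> nat \<Rightarrow> complex"
  assumes p: "p permutes {0..<n}" and q: "q permutes {0..<n}"
  shows "det (mat n n (\<lambda>(i, j). f (p i) (q j))) = signof p * signof q * det (mat n n (\<lambda>(i, j). f i j))"
proof -
  have plt: "p i < n" if "i < n" for i using permutes_in_image[OF p, of i] that by simp
  have qlt: "q i < n" if "i < n" for i using permutes_in_image[OF q, of i] that by simp
  have "det (mat n n (\<lambda>(i, j). f (p i) (q j))) = signof p * det (mat n n (\<lambda>(i, j). f i (q j)))"
  proof -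
    have "mat n n (\<lambda>(i, j). mat n n (\<lambda>(i, j). f i (q j)) $$ (p i, j)) = mat n n (\<lambda>(i, j). f (p i) (q j))"
      by (intro eq_matI) (auto simp: plt)
    thus ?thesis using det_permute_rows[of "mat n n (\<lambda>(i, j). f i (q j))" n p] p by simp
  qed
  also have "det (mat n n (\<lambda>(i, j). f i (q j))) = det (mat n n (\<lambda>(i, j). f j (q i)))"
  proof -
    have "(mat n n (\<lambda>(i, j). f i (q j)))\<^sup>T = mat n n (\<lambda>(i, j). f j (q i))" by (intro eq_matI) auto
    thus ?thesis using det_transpose[of "mat n n (\<lambda>(i, j). f i (q j))" n] by simp
  qed
  also have "\<dots> = signof q * det (mat n n (\<lambda>(i, j). f j i))"
  proof -
    have "mat n n (\<lambda>(i, j). mat n n (\<lambda>(i, j). f j i) $$ (q i, j)) = mat n n (\<lambda>(i, j). f j (q i))"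
      by (intro eq_matI) (auto simp: qlt)
    thus ?thesis using det_permute_rows[of "mat n n (\<lambda>(i, j). f j i)" n q] q by simp
  qed
  also have "det (mat n n (\<lambda>(i, j). f j i)) = det (mat n n (\<lambda>(i, j). f i j))"
  proof -
    have "(mat n n (\<lambda>(i, j). f i j))\<^sup>T = mat n n (\<lambda>(i, j). f j i)" by (intro eq_matI) auto
    thus ?thesis using det_transpose[of "mat n n (\<lambda>(i, j). f i j)" n] by simp
  qed
  finally show ?thesis by simp
qed

lemma det_schur_complement:
  fixes f :: "nat \<Rightarrow> nat \<Rightarrow> complex"
  assumes x: "f 0 0 \<noteq> 0"
  shows "det (mat (Suc n) (Suc n) (\<lambda>(i, j). f i j))
    = f 0 0 * det (mat n n (\<lambda>(i, j). f (Suc i) (Suc j) - f (Suc i) 0 * f 0 (Suc j) / f 0 0))"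
proof -
  define X where "X = mat (Suc n) (Suc n) (\<lambda>(i, j). f i j)"
  define r c D D' where "r = mat 1 n (\<lambda>(i, j). f 0 (Suc j))"
    and "c = mat n 1 (\<lambda>(i, j). f (Suc i) 0)"
    and "D = mat n n (\<lambda>(i, j). f (Suc i) (Suc j))"
    and "D' = mat n n (\<lambda>(i, j). f (Suc i) (Suc j) - f (Suc i) 0 * f 0 (Suc j) / f 0 0)"
  have car: "r \<in> carrier_mat 1 n" "c \<in> carrier_mat n 1" "D \<in> carrier_mat n n" "D' \<in> carrier_mat n n"
    by (auto simp: r_def c_def D_def D'_def)
  have X: "X = four_block_mat (f 0 0 \<cdot>\<^sub>m 1\<^sub>m 1) r c D"
    by (intro eq_matI) (auto simp: X_def r_def c_def D_def)
  define L where "L = four_block_mat (1\<^sub>m 1) (0\<^sub>m 1 n) (- (inverse (f 0 0) \<cdot>\<^sub>m c)) (1\<^sub>m n)"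
  have LC: "L \<in> carrier_mat (Suc n) (Suc n)" "X \<in> carrier_mat (Suc n) (Suc n)"
    by (auto simp: L_def car X_def)
  have Ldet: "det L = 1" unfolding L_def
    using car by (subst det_four_block_mat_upper_right_zero) auto
  have "L * X = four_block_mat (f 0 0 \<cdot>\<^sub>m 1\<^sub>m 1) r (0\<^sub>m n 1) D'"
    unfolding L_def X using car x
    apply (subst mult_four_block_mat[of _ 1 1 _ n _ n _ _ 1 _ n])
               apply auto
     apply (rule cong_four_block_mat)
        apply (auto intro!: eq_matI simp: D'_def D_def c_def r_def scalar_prod_def field_simps)
    done
  hence "det (L * X) = f 0 0 * det D'"
    using car by (simp add: det_four_block_mat_lower_left_zero[of _ 1 _ n] det_single)
  moreover have "det (L * X) = det X" using det_mult[OF LC] Ldet by simp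
  ultimately show ?thesis by (simp add: X_def D'_def)
qed

text \<open>The sign and the two index bijections do not depend on \<open>f\<close>, so one choice
  serves all values of \<open>y\<close> and also the rank one update in
  \<open>graded_schur_reduction\<close>.\<close>

lemma det_pivot:
  assumes "a < Suc n" "b < Suc n"
  shows "\<exists>\<epsilon> \<rho> \<kappa>. \<epsilon> \<noteq> 0 \<and> bij_betw \<rho> {..<n} ({..<Suc n} - {a}) \<and> bij_betw \<kappa> {..<n} ({..<Suc n} - {b}) \<and>
    (\<forall>f :: nat \<Rightarrow> nat \<Rightarrow> complex. f a b \<noteq> 0 \<longrightarrow> det (mat (Suc n) (Suc n) (\<lambda>(i, j). f i j))
      = \<epsilon> * f a b * det (mat n n (\<lambda>(i, j). f (\<rho> i) (\<kappa> j) - f (\<rho> i) b * f a (\<kappa> j) / f a b)))"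
proof -
  define p q where "p = Transposition.transpose 0 a" and "q = Transposition.transpose 0 b"
  have p: "p permutes {0..<Suc n}" and q: "q permutes {0..<Suc n}"
    unfolding p_def q_def using assms by (auto intro!: permutes_swap_id)
  have bij: "bij_betw (\<lambda>i. r (Suc i)) {..<n} ({..<Suc n} - {r 0})" if r: "r permutes {0..<Suc n}" for r :: "nat \<Rightarrow> nat"
  proof -
    have "bij_betw Suc {..<n} ({0..<Suc n} - {0})"
      by (rule bij_betwI[of _ _ _ "\<lambda>i. i - 1"]) auto
    moreover have "bij_betw r ({0..<Suc n} - {0}) ({0..<Suc n} - {r 0})"
      using permutes_imp_bij[OF r] permutes_in_image[OF r, of 0] by (intro bij_betw_DiffI) auto
    ultimately have "bij_betw (r \<circ> Suc) {..<n} ({0..<Suc n} - {r 0})" by (rule bij_betw_trans)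
    thus ?thesis by (simp add: comp_def atLeast0LessThan)
  qed
  have p0: "p 0 = a" "q 0 = b" by (auto simp: p_def q_def)
  have s: "signof p * signof q \<noteq> (0::complex)" by (simp add: sign_def)
  have "det (mat (Suc n) (Suc n) (\<lambda>(i, j). f i j))
      = inverse (signof p * signof q) * f a b * det (mat n n (\<lambda>(i, j). f (p (Suc i)) (q (Suc j)) - f (p (Suc i)) b * f a (q (Suc j)) / f a b))"
    if "f a b \<noteq> 0" for f :: "nat \<Rightarrow> nat \<Rightarrow> complex"
    using det_permute_index[OF p q, of f] det_schur_complement[of "\<lambda>i j. f (p i) (q j)" n] that s
    by (simp add: p0 field_simps)
  thus ?thesis using bij[OF p] bij[OF q] s unfolding p0
    by (intro exI[of _ "inverse (signof p * signof q)"] exI[of _ "\<lambda>i. p (Suc i)"] exI[of _ "\<lambda>i. q (Suc i)"]) auto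
qed

text \<open>A constant nonzero entry has weight one, so its row and column weights \<open>p a\<close> and \<open>q b\<close> agree and
  the Schur complement is graded by the remaining weights.\<close>

lemma graded_schur_reduction:
  fixes N :: "nat \<Rightarrow> nat \<Rightarrow> complex mat \<Rightarrow> complex"
  assumes gen: "generic_torus m t s"
    and W: "\<And>a b. a < n \<Longrightarrow> b < n \<Longrightarrow> wpoly m t s (p a / q b) (N a b)"
    and nz: "\<And>a. a < n \<Longrightarrow> p a \<noteq> 0 \<and> q a \<noteq> (0 :: complex)"
  shows "\<exists>k p' q' M c. c \<noteq> 0 \<and> (\<forall>a<k. p' a \<noteq> 0 \<and> q' a \<noteq> 0) \<and>
    (\<forall>a<k. \<forall>b<k. wpoly m t s (p' a / q' b) (M a b) \<and> M a b (0\<^sub>m m m) = 0) \<and>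
    (\<forall>y. det (mat n n (\<lambda>(i, j). N i j y)) = c * det (mat k k (\<lambda>(i, j). M i j y))) \<and>
    (\<Prod>a<n. p a) / (\<Prod>a<n. q a) = (\<Prod>a<k. p' a) / (\<Prod>a<k. q' a) \<and>
    (k = 1 \<longrightarrow> (\<exists>u v. det (mat n n (\<lambda>(i, j). N i j (0\<^sub>m m m) + u i * v j)) \<noteq> 0))"
  using W nz
proof (induction n arbitrary: p q N)
  case 0
  show ?case by (intro exI[of _ 0] exI[of _ p] exI[of _ q] exI[of _ N] exI[of _ 1]) auto
next
  case (Suc n)
  show ?case
  proof (cases "\<exists>a<Suc n. \<exists>b<Suc n. N a b (0\<^sub>m m m) \<noteq> 0")
    case False
    \<comment> \<open>Nothing is left to pivot on; a 1 x 1 matrix that vanishes at zero becomes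
      invertible by adding 1.\<close>
    have "det (mat (Suc n) (Suc n) (\<lambda>(i, j). N i j (0\<^sub>m m m) + 1 * 1)) \<noteq> 0" if "Suc n = 1"
      using False that by (subst det_single) auto
    hence "Suc n = 1 \<longrightarrow> (\<exists>u v. det (mat (Suc n) (Suc n) (\<lambda>(i, j). N i j (0\<^sub>m m m) + u i * v j)) \<noteq> 0)"
      by (intro impI exI[of _ "\<lambda>_. 1"])
    thus ?thesis using False Suc.prems
      by - (rule exI[of _ "Suc n"], rule exI[of _ p], rule exI[of _ q], rule exI[of _ N], rule exI[of _ 1],
        simp del: One_nat_def)
  next
    case True
    then obtain a b where ab: "a < Suc n" "b < Suc n" "N a b (0\<^sub>m m m) \<noteq> 0" by blast
    obtain x where pq: "p a / q b = 1" and x: "N a b = (\<lambda>_. x)"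
      using wpoly_at_zero[OF Suc.prems(1)[OF ab(1,2)] ab(3)] by blast
    have x0: "x \<noteq> 0" using ab x by simp
    have pq': "p a = q b" using pq Suc.prems(2)[OF ab(2)] by (simp add: divide_eq_1_iff)
    obtain \<epsilon> \<rho> \<kappa> where piv: "\<epsilon> \<noteq> 0" "bij_betw \<rho> {..<n} ({..<Suc n} - {a})" "bij_betw \<kappa> {..<n} ({..<Suc n} - {b})"
      "\<And>f :: nat \<Rightarrow> nat \<Rightarrow> complex. f a b \<noteq> 0 \<Longrightarrow> det (mat (Suc n) (Suc n) (\<lambda>(i, j). f i j))
      = \<epsilon> * f a b * det (mat n n (\<lambda>(i, j). f (\<rho> i) (\<kappa> j) - f (\<rho> i) b * f a (\<kappa> j) / f a b))"
      using det_pivot[OF ab(1,2)] by blast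
    have rlt: "\<rho> i < Suc n" "\<kappa> i < Suc n" if "i < n" for i
      using bij_betwE[OF piv(2)] bij_betwE[OF piv(3)] that by auto
    define N' where "N' i j y = N (\<rho> i) (\<kappa> j) y - N (\<rho> i) b y * N a (\<kappa> j) y / x" for i j y
    have W': "wpoly m t s (p (\<rho> i) / q (\<kappa> j)) (N' i j)" if ij: "i < n" "j < n" for i j
    proof -
      have "wpoly m t s ((p (\<rho> i) / q b) * (p a / q (\<kappa> j))) (\<lambda>y. N (\<rho> i) b y * N a (\<kappa> j) y)"
        by (intro wpoly_mult Suc.prems(1) rlt ij ab)
      moreover have "(p (\<rho> i) / q b) * (p a / q (\<kappa> j)) = p (\<rho> i) / q (\<kappa> j)"
        using pq' Suc.prems(2)[OF ab(2)] by simp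
      ultimately have "wpoly m t s (p (\<rho> i) / q (\<kappa> j)) (\<lambda>y. (- 1 / x) * (N (\<rho> i) b y * N a (\<kappa> j) y))"
        using wpoly_scale by metis
      hence "wpoly m t s (p (\<rho> i) / q (\<kappa> j)) (\<lambda>y. N (\<rho> i) (\<kappa> j) y + (- 1 / x) * (N (\<rho> i) b y * N a (\<kappa> j) y))"
        by (intro wpoly_add[OF gen] Suc.prems(1) rlt ij)
      thus ?thesis unfolding N'_def by simp
    qed
    have det1: "det (mat (Suc n) (Suc n) (\<lambda>(i, j). N i j y)) = \<epsilon> * x * det (mat n n (\<lambda>(i, j). N' i j y))" for y
      using piv(4)[of "\<lambda>i j. N i j y"] x x0 by (simp add: N'_def)
    have prods: "(\<Prod>i<Suc n. p i) / (\<Prod>i<Suc n. q i) = (\<Prod>i<n. p (\<rho> i)) / (\<Prod>i<n. q (\<kappa> i))"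
    proof -
      have "(\<Prod>i<Suc n. p i) = p a * (\<Prod>i<n. p (\<rho> i))"
        using ab prod.reindex_bij_betw[OF piv(2), of p] by (subst prod.remove[of _ a]) auto
      moreover have "(\<Prod>i<Suc n. q i) = q b * (\<Prod>i<n. q (\<kappa> i))"
        using ab prod.reindex_bij_betw[OF piv(3), of q] by (subst prod.remove[of _ b]) auto
      ultimately show ?thesis using pq' Suc.prems(2)[OF ab(2)] by simp
    qed
    have nz': "p (\<rho> i) \<noteq> 0 \<and> q (\<kappa> i) \<noteq> 0" if "i < n" for i
      using Suc.prems(2) rlt[OF that] by blast
    have "\<exists>k p' q' M c. c \<noteq> 0 \<and> (\<forall>a<k. p' a \<noteq> 0 \<and> q' a \<noteq> 0) \<and>
      (\<forall>a<k. \<forall>b<k. wpoly m t s (p' a / q' b) (M a b) \<and> M a b (0\<^sub>m m m) = 0) \<and>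
      (\<forall>y. det (mat n n (\<lambda>(i, j). N' i j y)) = c * det (mat k k (\<lambda>(i, j). M i j y))) \<and>
      (\<Prod>i<n. p (\<rho> i)) / (\<Prod>i<n. q (\<kappa> i)) = (\<Prod>a<k. p' a) / (\<Prod>a<k. q' a) \<and>
      (k = 1 \<longrightarrow> (\<exists>u v. det (mat n n (\<lambda>(i, j). N' i j (0\<^sub>m m m) + u i * v j)) \<noteq> 0))"
      by (rule Suc.IH[of "\<lambda>i. p (\<rho> i)" "\<lambda>j. q (\<kappa> j)" N']) (fact W', fact nz')
    then obtain k p' q' M c where IH: "c \<noteq> 0" "\<forall>a<k. p' a \<noteq> 0 \<and> q' a \<noteq> 0"
      "\<forall>a<k. \<forall>b<k. wpoly m t s (p' a / q' b) (M a b) \<and> M a b (0\<^sub>m m m) = 0"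
      "\<forall>y. det (mat n n (\<lambda>(i, j). N' i j y)) = c * det (mat k k (\<lambda>(i, j). M i j y))"
      "(\<Prod>i<n. p (\<rho> i)) / (\<Prod>i<n. q (\<kappa> i)) = (\<Prod>a<k. p' a) / (\<Prod>a<k. q' a)"
      "k = 1 \<longrightarrow> (\<exists>u v. det (mat n n (\<lambda>(i, j). N' i j (0\<^sub>m m m) + u i * v j)) \<noteq> 0)"
      by (elim exE conjE) (rule that; assumption)
    \<comment> \<open>The two vectors are extended by zero at the pivot row and column, so that the
      Schur complement of the updated matrix is the update of the Schur complement.\<close>
    have "\<exists>u v. det (mat (Suc n) (Suc n) (\<lambda>(i, j). N i j (0\<^sub>m m m) + u i * v j)) \<noteq> 0" if k1: "k = 1"
    proof -
      obtain u v where uv: "det (mat n n (\<lambda>(i, j). N' i j (0\<^sub>m m m) + u i * v j)) \<noteq> 0"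
        using IH(6) k1 by blast
      define u' where "u' i = (if i = a then 0 else u (inv_into {..<n} \<rho> i))" for i
      define v' where "v' i = (if i = b then 0 else v (inv_into {..<n} \<kappa> i))" for i
      have u': "u' (\<rho> i) = u i" "v' (\<kappa> i) = v i" if "i < n" for i
        using bij_betwE[OF piv(2)] bij_betwE[OF piv(3)] that
          bij_betw_inv_into_left[OF piv(2)] bij_betw_inv_into_left[OF piv(3)] by (auto simp: u'_def v'_def)
      have u0: "u' a = 0" "v' b = 0" by (auto simp: u'_def v'_def)
      have "det (mat (Suc n) (Suc n) (\<lambda>(i, j). N i j (0\<^sub>m m m) + u' i * v' j))
        = \<epsilon> * x * det (mat n n (\<lambda>(i, j). N' i j (0\<^sub>m m m) + u i * v j))"
      proof -
        have "mat n n (\<lambda>(i, j). N (\<rho> i) (\<kappa> j) (0\<^sub>m m m) + u' (\<rho> i) * v' (\<kappa> j)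
              - (N (\<rho> i) b (0\<^sub>m m m) + u' (\<rho> i) * v' b) * (N a (\<kappa> j) (0\<^sub>m m m) + u' a * v' (\<kappa> j)) / x)
           = mat n n (\<lambda>(i, j). N' i j (0\<^sub>m m m) + u i * v j)"
          by (intro eq_matI) (auto simp: u' u0 N'_def)
        thus ?thesis
          using piv(4)[of "\<lambda>i j. N i j (0\<^sub>m m m) + u' i * v' j"] x x0 u0 by simp
      qed
      hence "det (mat (Suc n) (Suc n) (\<lambda>(i, j). N i j (0\<^sub>m m m) + u' i * v' j)) \<noteq> 0"
        using uv piv(1) x0 by simp
      thus ?thesis by blast
    qed
    moreover have "\<forall>y. det (mat (Suc n) (Suc n) (\<lambda>(i, j). N i j y)) = (\<epsilon> * x * c) * det (mat k k (\<lambda>(i, j). M i j y))"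
      using det1 IH(4) by simp
    moreover have "\<epsilon> * x * c \<noteq> 0" using piv(1) x0 IH(1) by simp
    ultimately show ?thesis using IH(2,3,5) prods
      by - (rule exI[of _ k], rule exI[of _ p'], rule exI[of _ q'], rule exI[of _ M],
        rule exI[of _ "\<epsilon> * x * c"], simp)
  qed
qed

section \<open>The size of a graded matrix whose determinant is a multiple of the permanent\<close>

lemma image_transpose_insert:
  "a \<in> J \<Longrightarrow> b \<notin> J \<Longrightarrow> Transposition.transpose a b ` J = insert b (J - {a})"
  by (auto simp: transpose_def image_iff)

text \<open>There are \<open>m\<close> distinct sets obtained from \<open>J\<close> by no exchange
  or by one suitable exchange. Moving \<open>J\<close> to each of them gives \<open>m\<close>
  disjoint copies of the permutations in question.\<close>

lemma card_permutes_image_bound: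
  fixes m :: nat
  assumes J: "J \<subseteq> {0..<m}" "J \<noteq> {}" "J \<noteq> {0..<m}"
  shows "card {\<sigma>. \<sigma> permutes {0..<m} \<and> \<sigma> ` I = J} * m \<le> fact m"
proof -
  obtain x y where xy: "x \<in> J" "y \<notin> J" "x < m" "y < m"
  proof -
    obtain x where "x \<in> J" using J(2) by blast
    moreover obtain y where "y \<in> {0..<m}" "y \<notin> J" using J(1,3) by blast
    ultimately show thesis using that J(1) by auto
  qed
  \<comment> \<open>For fixed \<open>x\<close> in \<open>J\<close> and \<open>y\<close> outside:
    \<open>x\<close> itself stands for no exchange, any other \<open>z\<close> in \<open>J\<close>
    is exchanged for \<open>y\<close>, and for a \<open>z\<close> outside \<open>J\<close> the
    element \<open>x\<close> is exchanged for \<open>z\<close>.\<close>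
  define \<rho> where "\<rho> z = (if z = x then id else if z \<in> J then Transposition.transpose z y else Transposition.transpose x z)" for z
  have \<rho>p: "\<rho> z permutes {0..<m}" if "z < m" for z
    using that xy J by (auto simp: \<rho>_def permutes_id intro!: permutes_swap_id)
  have \<rho>J: "\<rho> z ` J = (if z = x then J else if z \<in> J then insert y (J - {z}) else insert z (J - {x}))" for z
    using xy by (auto simp: \<rho>_def image_transpose_insert)
  have \<rho>inj: "z = z'" if "\<rho> z ` J = \<rho> z' ` J" for z z'
  proof (rule ccontr)
    assume ne: "z \<noteq> z'"
    have "z \<in> J \<Longrightarrow> z' \<in> J \<Longrightarrow> False"
      using that ne xy unfolding \<rho>J by (auto split: if_splits)
    moreover have "z \<notin> J \<Longrightarrow> z' \<notin> J \<Longrightarrow> False"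
      using that ne xy unfolding \<rho>J by (auto split: if_splits)
    moreover have "x \<in> \<rho> z ` J \<longleftrightarrow> z \<in> J" for z
      using xy unfolding \<rho>J by auto
    ultimately show False using that by blast
  qed
  define F where "F = {\<sigma>. \<sigma> permutes {0..<m} \<and> \<sigma> ` I = J}"
  have "inj_on (\<lambda>(\<sigma>, z). \<rho> z \<circ> \<sigma>) (F \<times> {0..<m})"
  proof (rule inj_onI)
    fix a b assume a: "a \<in> F \<times> {0..<m}" "b \<in> F \<times> {0..<m}"
      and eq: "(\<lambda>(\<sigma>, z). \<rho> z \<circ> \<sigma>) a = (\<lambda>(\<sigma>, z). \<rho> z \<circ> \<sigma>) b"
    obtain \<sigma> z \<tau> w where ab: "a = (\<sigma>, z)" "b = (\<tau>, w)" by (metis surj_pair)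
    have im: "\<sigma> ` I = J" "\<tau> ` I = J" "z < m" using a ab by (auto simp: F_def)
    have e: "\<rho> z \<circ> \<sigma> = \<rho> w \<circ> \<tau>" using eq ab by simp
    hence "(\<rho> z \<circ> \<sigma>) ` I = (\<rho> w \<circ> \<tau>) ` I" by simp
    hence "\<rho> z ` J = \<rho> w ` J" using im by (metis image_comp)
    hence zw: "z = w" by (rule \<rho>inj)
    have "inj (\<rho> z)" using permutes_inj[OF \<rho>p[OF im(3)]] .
    hence "\<sigma> = \<tau>" using e zw by (metis fun.inj_map injD)
    thus "a = b" using ab zw by simp
  qed
  moreover have "(\<lambda>(\<sigma>, z). \<rho> z \<circ> \<sigma>) ` (F \<times> {0..<m}) \<subseteq> {\<sigma>. \<sigma> permutes {0..<m}}"
    using \<rho>p by (auto simp: F_def intro!: permutes_compose)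
  ultimately have "card (F \<times> {0..<m}) \<le> card {\<sigma>. \<sigma> permutes {0..<m}}"
    by (intro card_inj_on_le) (auto simp: finite_permutations)
  thus ?thesis by (simp add: F_def card_permutations card_cartesian_product)
qed

lemma det_nonzero_term:
  fixes f :: "nat \<Rightarrow> nat \<Rightarrow> complex"
  assumes "det (mat k k (\<lambda>(i, j). f i j)) \<noteq> 0"
  shows "\<exists>\<omega>. \<omega> permutes {0..<k} \<and> (\<forall>a<k. f a (\<omega> a) \<noteq> 0)"
proof (rule ccontr)
  assume no: "\<not> ?thesis"
  have "(\<Prod>i = 0..<k. mat k k (\<lambda>(i, j). f i j) $$ (i, \<omega> i)) = 0" if w: "\<omega> permutes {0..<k}" for \<omega>
  proof -
    obtain a where a: "a < k" "f a (\<omega> a) = 0" using no w by blast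
    moreover have "\<omega> a < k" using permutes_in_image[OF w, of a] a by simp
    ultimately show ?thesis by (intro prod_zero bexI[of _ a]) auto
  qed
  hence "det (mat k k (\<lambda>(i, j). f i j)) = 0"
    by (subst det_def'[of _ k]) (auto intro!: sum.neutral)
  thus False using assms by simp
qed

text \<open>Polya's argument: permuting the three first columns, the product over the even permutations
  equals the product over the odd ones, so the three signs cannot all be absorbed.\<close>

lemma no_sign_matrix:
  fixes C :: "nat \<Rightarrow> nat \<Rightarrow> complex"
  assumes m: "m \<ge> 3" and c: "c \<noteq> 0"
    and C: "\<And>\<omega>. \<omega> permutes {0..<m} \<Longrightarrow> signof \<omega> * (\<Prod>a = 0..<m. C a (\<omega> a)) = c"
  shows False
proof -
  define R where "R = (\<Prod>a\<in>{0..<m} - {0, 1, 2}. C a a)"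
  have split: "(\<Prod>a = 0..<m. C a (\<omega> a)) = C 0 (\<omega> 0) * C 1 (\<omega> 1) * C 2 (\<omega> 2) * R"
    if "\<And>a. a \<notin> {0, 1, 2} \<Longrightarrow> \<omega> a = a" for \<omega>
  proof -
    have "(\<Prod>a = 0..<m. C a (\<omega> a)) = (\<Prod>a\<in>{0, 1, 2}. C a (\<omega> a)) * (\<Prod>a\<in>{0..<m} - {0, 1, 2}. C a (\<omega> a))"
      using m by (subst prod.subset_diff[of "{0, 1, 2}"]) (auto simp: mult.commute)
    also have "(\<Prod>a\<in>{0..<m} - {0, 1, 2}. C a (\<omega> a)) = R"
      unfolding R_def using that by (intro prod.cong) auto
    finally show ?thesis by (simp add: mult.assoc)
  qed
  let ?t = "Transposition.transpose :: nat \<Rightarrow> nat \<Rightarrow> nat \<Rightarrow> nat"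
  have p: "?t a b permutes {0..<m}" if "a \<in> {0, 1, 2}" "b \<in> {0, 1, 2}" for a b
    using that m by (intro permutes_swap_id) auto
  have s1: "signof (?t a b) = (-1 :: complex)" if "a \<noteq> b" for a b using that by (simp add: sign_swap_id)
  have s2: "signof (?t a b \<circ> ?t a' b') = (1 :: complex)" if "a \<noteq> b" "a' \<noteq> b'" for a b a' b'
    using that by (simp add: sign_compose permutation_swap_id sign_swap_id)
  have e0: "C 0 0 * C 1 1 * C 2 2 * R = c"
    using C[OF permutes_id] split[of id] by (simp add: sign_id)
  have e1: "- (C 0 1 * C 1 0 * C 2 2 * R) = c"
    using C[OF p[of 0 1]] split[of "?t 0 1"] s1[of 0 1] by (simp add: transpose_def)
  have e2: "- (C 0 2 * C 1 1 * C 2 0 * R) = c"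
    using C[OF p[of 0 2]] split[of "?t 0 2"] s1[of 0 2] by (simp add: transpose_def)
  have e3: "- (C 0 0 * C 1 2 * C 2 1 * R) = c"
    using C[OF p[of 1 2]] split[of "?t 1 2"] s1[of 1 2] by (simp add: transpose_def)
  have e4: "C 0 1 * C 1 2 * C 2 0 * R = c"
    using C[OF permutes_compose[OF p[of 1 2] p[of 0 1]]] split[of "?t 0 1 \<circ> ?t 1 2"] s2[of 0 1 1 2] by (simp add: transpose_def)
  have e5: "C 0 2 * C 1 0 * C 2 1 * R = c"
    using C[OF permutes_compose[OF p[of 0 1] p[of 1 2]]] split[of "?t 1 2 \<circ> ?t 0 1"] s2[of 1 2 0 1] by (simp add: transpose_def)
  have "c * c * c = (C 0 0 * C 1 1 * C 2 2 * R) * (C 0 1 * C 1 2 * C 2 0 * R) * (C 0 2 * C 1 0 * C 2 1 * R)"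
    using e0 e4 e5 by simp
  also have "\<dots> = - ((- (C 0 1 * C 1 0 * C 2 2 * R)) * (- (C 0 2 * C 1 1 * C 2 0 * R)) * (- (C 0 0 * C 1 2 * C 2 1 * R)))"
    by (simp add: mult_ac)
  also have "\<dots> = - (c * c * c)" using e1 e2 e3 by (simp only:)
  finally have "c * c * c = 0" by simp
  thus False using c by simp
qed

text \<open>By the grading, the nonzero term that produces the monomial of a permutation \<open>\<sigma>\<close> forces
  \<open>\<sigma>(I) = J\<close> for the row and column supports of its entry in row 0. There are at most
  \<open>k\<close> such entries, so counting permutations leaves \<open>k = 1\<close> or \<open>k = m\<close> with entries
  \<open>c y\<^bsub>ij\<^esub>\<close>, which the sign argument excludes.\<close>

lemma graded_det_size:
  fixes M :: "nat \<Rightarrow> nat \<Rightarrow> complex mat \<Rightarrow> complex"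
  assumes gen: "generic_torus m t s" and ts: "\<And>i. i < m \<Longrightarrow> t i \<noteq> 0 \<and> s i \<noteq> 0" and m: "m \<ge> 3"
    and nz: "\<And>a. a < k \<Longrightarrow> p a \<noteq> 0 \<and> q a \<noteq> 0"
    and W: "\<And>a b. a < k \<Longrightarrow> b < k \<Longrightarrow> wpoly m t s (p a / q b) (M a b)"
    and M0: "\<And>a b. a < k \<Longrightarrow> b < k \<Longrightarrow> M a b (0\<^sub>m m m) = 0"
    and det: "\<And>y. y \<in> carrier_mat m m \<Longrightarrow> det (mat k k (\<lambda>(i, j). M i j y)) = c * perm m y" and c: "c \<noteq> 0"
    and ratio: "(\<Prod>a<k. p a) / (\<Prod>a<k. q a) = wt m t s (\<lambda>_. 1) (\<lambda>_. 1)"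
  shows "k = 1"
proof -
  define Y where "Y \<sigma> = mat m m (\<lambda>(i, j). if j = \<sigma> i then 1 else (0::complex))" for \<sigma>
  define G where "G = (\<lambda>a b. M a b \<noteq> (\<lambda>_. 0))"
  have "\<exists>\<alpha> \<beta>. hpoly m \<alpha> \<beta> (M a b) \<and> p a / q b = wt m t s \<alpha> \<beta>" if "a < k" "b < k" "G a b" for a b
    using W[OF that(1,2)] that(3) unfolding wpoly_def G_def by blast
  then obtain al be where ab: "\<And>a b. a < k \<Longrightarrow> b < k \<Longrightarrow> G a b \<Longrightarrow> hpoly m (al a b) (be a b) (M a b) \<and> p a / q b = wt m t s (al a b) (be a b)"
    by metis
  have al0: "al a b \<noteq> (\<lambda>_. 0)" if abk: "a < k" "b < k" "G a b" for a b
  proof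
    assume "al a b = (\<lambda>_. 0)"
    then obtain x where "M a b = (\<lambda>_. x)" using hpoly_constant ab[OF abk] by blast
    thus False using M0[OF abk(1,2)] abk(3) by (auto simp: G_def)
  qed
  define I where "I a b = {i. al a b i \<noteq> 0}" for a b
  define J where "J a b = {i. be a b i \<noteq> 0}" for a b
  have Ilt: "I a b \<subseteq> {0..<m}" "J a b \<subseteq> {0..<m}" if "a < k" "b < k" "G a b" for a b
  proof -
    have "i < m" if "al a b i \<noteq> 0 \<or> be a b i \<noteq> 0" for i
      using hpoly_support[of m "al a b" "be a b" "M a b" i] ab[OF \<open>a < k\<close> \<open>b < k\<close> \<open>G a b\<close>] that by blast
    thus "I a b \<subseteq> {0..<m}" "J a b \<subseteq> {0..<m}" unfolding I_def J_def by auto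
  qed
  have Ine: "I a b \<noteq> {}" if "a < k" "b < k" "G a b" for a b
    using al0[OF that] by (auto simp: I_def)
  \<comment> \<open>The terms of the determinant that survive at the permutation matrix of
    \<open>\<sigma>\<close>. One exists for each \<open>\<sigma>\<close>, because the permanent is 1
    there.\<close>
  define contrib where "contrib \<sigma> \<omega> \<longleftrightarrow> \<omega> permutes {0..<k} \<and> (\<forall>a<k. M a (\<omega> a) (Y \<sigma>) \<noteq> 0)" for \<sigma> \<omega>
  have ex: "\<exists>\<omega>. contrib \<sigma> \<omega>" if s: "\<sigma> permutes {0..<m}" for \<sigma>
  proof -
    have "perm m (Y \<sigma>) = 1" unfolding Y_def using perm_permutation_mat[OF s, of "\<lambda>_. 1"] by simp
    hence "det (mat k k (\<lambda>(i, j). M i j (Y \<sigma>))) \<noteq> 0" using det[of "Y \<sigma>"] c by (simp add: Y_def)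
    thus ?thesis unfolding contrib_def by (rule det_nonzero_term)
  qed
  have cG: "G a (\<omega> a)" "\<omega> a < k" if "contrib \<sigma> \<omega>" "a < k" for \<sigma> \<omega> a
    using that permutes_in_image[of \<omega> "{0..<k}" a] by (auto simp: contrib_def G_def)
  have albe: "be a (\<omega> a) (\<sigma> i) = al a (\<omega> a) i" if "contrib \<sigma> \<omega>" "\<sigma> permutes {0..<m}" "a < k" for \<sigma> \<omega> a i
    using hpoly_permutation_mat[of m "al a (\<omega> a)" "be a (\<omega> a)" "M a (\<omega> a)" \<sigma> i] that ab cG[OF that(1,3)]
    unfolding contrib_def Y_def by blast
  \<comment> \<open>Along any term the weights \<open>p a / q (\<omega> a)\<close> multiply to the
    weight of the permanent, so by genericity the degrees in each row add up to 1.\<close>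
  have suma: "(\<Sum>a<k. al a (\<omega> a) i) = 1" if co: "contrib \<sigma> \<omega>" and i: "i < m" for \<sigma> \<omega> i
  proof -
    have wp: "\<omega> permutes {..<k}" using co by (simp add: contrib_def atLeast0LessThan)
    have fin: "(\<Prod>a\<in>S. wt m t s (f a) (h a)) = wt m t s (\<lambda>i. \<Sum>a\<in>S. f a i) (\<lambda>i. \<Sum>a\<in>S. h a i)" if "finite S" for S :: "nat set" and f h
      using that by (induction S rule: finite_induct) (auto simp: wt_add)
    have "wt m t s (\<lambda>i. \<Sum>a<k. al a (\<omega> a) i) (\<lambda>i. \<Sum>a<k. be a (\<omega> a) i) = (\<Prod>a<k. p a / q (\<omega> a))"
      using ab cG[OF co] by (subst fin[symmetric]) (auto intro!: prod.cong)
    also have "\<dots> = (\<Prod>a<k. p a) / (\<Prod>a<k. q a)"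
      using prod.permute[OF wp, of q] by (simp add: prod_dividef comp_def)
    finally have "wt m t s (\<lambda>i. \<Sum>a<k. al a (\<omega> a) i) (\<lambda>i. \<Sum>a<k. be a (\<omega> a) i) = wt m t s (\<lambda>_. 1) (\<lambda>_. 1)"
      using ratio by simp
    from gen[unfolded generic_torus_def, rule_format, OF this i] show ?thesis by simp
  qed
  have al1: "al a (\<omega> a) i \<le> 1" if co: "contrib \<sigma> \<omega>" and a: "a < k" for \<sigma> \<omega> a i
  proof (cases "i < m")
    case True
    have "al a (\<omega> a) i \<le> (\<Sum>a<k. al a (\<omega> a) i)" using a by (intro member_le_sum) auto
    thus ?thesis using suma[OF co True] by simp
  next
    case False
    thus ?thesis using hpoly_support[of m "al a (\<omega> a)" "be a (\<omega> a)" "M a (\<omega> a)" i] ab[OF a cG(2,1)[OF co a]] by simp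
  qed
  have part: "\<exists>a<k. i \<in> I a (\<omega> a)" if "contrib \<sigma> \<omega>" "i < m" for \<sigma> \<omega> i
  proof (rule ccontr)
    assume "\<not> ?thesis"
    hence "(\<Sum>a<k. al a (\<omega> a) i) = 0" by (auto simp: I_def)
    thus False using suma[OF that] by simp
  qed
  have disj: "a = b" if co: "contrib \<sigma> \<omega>" and "a < k" "b < k" "i \<in> I a (\<omega> a)" "i \<in> I b (\<omega> b)" for \<sigma> \<omega> a b i
  proof (rule ccontr)
    assume ne: "a \<noteq> b"
    have i: "i < m" using Ilt(1)[OF \<open>a < k\<close> cG(2,1)[OF co \<open>a < k\<close>]] that by auto
    have "al a (\<omega> a) i + al b (\<omega> b) i = (\<Sum>a\<in>{a, b}. al a (\<omega> a) i)" using ne by simp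
    also have "\<dots> \<le> (\<Sum>a<k. al a (\<omega> a) i)" using that by (intro sum_mono2) auto
    finally show False using suma[OF co i] that by (auto simp: I_def)
  qed
  have im: "\<sigma> ` I a (\<omega> a) = J a (\<omega> a)" if co: "contrib \<sigma> \<omega>" and s: "\<sigma> permutes {0..<m}" and a: "a < k" for \<sigma> \<omega> a
  proof
    show "\<sigma> ` I a (\<omega> a) \<subseteq> J a (\<omega> a)" using albe[OF co s a] by (auto simp: I_def J_def)
    show "J a (\<omega> a) \<subseteq> \<sigma> ` I a (\<omega> a)"
    proof
      fix j assume j: "j \<in> J a (\<omega> a)"
      have "\<sigma> (inv_into UNIV \<sigma> j) = j" using permutes_inverses[OF s] by simp
      thus "j \<in> \<sigma> ` I a (\<omega> a)" using j albe[OF co s a, of "inv_into UNIV \<sigma> j"]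
        by (intro image_eqI[of _ _ "inv_into UNIV \<sigma> j"]) (auto simp: I_def J_def)
    qed
  qed
  obtain \<omega>0 where \<omega>0: "contrib id \<omega>0" using ex[OF permutes_id] by blast
  have "k \<noteq> 0" using part[OF \<omega>0, of 0] m by auto
  \<comment> \<open>The row supports along a surviving term are nonempty and disjoint.\<close>
  have km: "k \<le> m"
  proof -
    have "\<forall>a. \<exists>i. a < k \<longrightarrow> i \<in> I a (\<omega>0 a)" using Ine cG[OF \<omega>0] by blast
    then obtain r where r: "\<And>a. a < k \<Longrightarrow> r a \<in> I a (\<omega>0 a)" by metis
    have "inj_on r {0..<k}" using disj[OF \<omega>0] r by (intro inj_onI) (metis atLeastLessThan_iff)
    moreover have "r ` {0..<k} \<subseteq> {0..<m}" using r Ilt(1) cG[OF \<omega>0] by fastforce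
    ultimately have "card {0..<k} \<le> card {0..<m}" by (intro card_inj_on_le) auto
    thus ?thesis by simp
  qed
  show ?thesis
  proof (rule ccontr)
    assume "k \<noteq> 1"
    hence k2: "0 < k" "1 < k" using \<open>k \<noteq> 0\<close> by auto
    \<comment> \<open>The permutations are sorted by the entry \<open>b\<close> that a surviving
      term uses in row 0. Its support is proper, as row 1 has a support too, so each
      \<open>b\<close> accounts for at most one \<open>m\<close>-th of them.\<close>
    have mk: "m \<le> k"
    proof -
      define F where "F b = {\<sigma>. \<sigma> permutes {0..<m} \<and> \<sigma> ` I 0 b = J 0 b \<and> (\<exists>\<omega>. contrib \<sigma> \<omega> \<and> \<omega> 0 = b)}" for b
      have "{\<sigma>. \<sigma> permutes {0..<m}} \<subseteq> (\<Union>b<k. F b)"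
      proof
        fix \<sigma> assume "\<sigma> \<in> {\<sigma>. \<sigma> permutes {0..<m}}"
        hence s: "\<sigma> permutes {0..<m}" by simp
        obtain \<omega> where co: "contrib \<sigma> \<omega>" using ex[OF s] by blast
        have "\<sigma> \<in> F (\<omega> 0)" using im[OF co s k2(1)] s co by (auto simp: F_def)
        thus "\<sigma> \<in> (\<Union>b<k. F b)" using cG(2)[OF co k2(1)] by blast
      qed
      hence "card {\<sigma>. \<sigma> permutes {0..<m}} \<le> card (\<Union>b<k. F b)"
        by (intro card_mono) (auto simp: F_def intro: finite_subset[OF _ finite_permutations[of "{0..<m}"]])
      also have "\<dots> \<le> (\<Sum>b<k. card (F b))" by (rule card_UN_le) simp
      finally have "fact m \<le> (\<Sum>b<k. card (F b))" by (simp add: card_permutations)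
      hence "fact m * m \<le> (\<Sum>b<k. card (F b) * m)" by (simp add: sum_distrib_right[symmetric])
      also have "\<dots> \<le> (\<Sum>b<k. fact m)"
      proof (rule sum_mono)
        fix b assume b: "b \<in> {..<k}"
        show "card (F b) * m \<le> fact m"
        proof (cases "F b = {}")
          case False
          then obtain \<sigma> \<omega> where s: "\<sigma> permutes {0..<m}" "\<sigma> ` I 0 b = J 0 b" "contrib \<sigma> \<omega>" "\<omega> 0 = b" by (auto simp: F_def)
          have g: "G 0 b" using cG(1)[OF s(3) k2(1)] s by simp
          have bk: "b < k" using b by simp
          have I1: "I 0 b \<noteq> {0..<m}"
          proof
            assume eq: "I 0 b = {0..<m}"
            obtain i where i: "i \<in> I 1 (\<omega> 1)" using Ine[OF k2(2) cG(2,1)[OF s(3) k2(2)]] by blast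
            hence "i \<in> I 0 (\<omega> 0)" using eq s(4) Ilt(1)[OF k2(2) cG(2,1)[OF s(3) k2(2)]] by auto
            from disj[OF s(3) k2 this i] show False by simp
          qed
          have "J 0 b \<noteq> {}" using s(2) Ine[OF k2(1) bk g] by auto
          moreover have "J 0 b \<noteq> {0..<m}"
          proof
            assume "J 0 b = {0..<m}"
            hence "\<sigma> ` I 0 b = \<sigma> ` {0..<m}" using s permutes_image[OF s(1)] by simp
            thus False using I1 permutes_inj[OF s(1)] by (metis inj_image_eq_iff)
          qed
          ultimately have "card {\<sigma>. \<sigma> permutes {0..<m} \<and> \<sigma> ` I 0 b = J 0 b} * m \<le> fact m"
            using Ilt(2)[OF k2(1) bk g] by (intro card_permutes_image_bound) auto
          moreover have "card (F b) \<le> card {\<sigma>. \<sigma> permutes {0..<m} \<and> \<sigma> ` I 0 b = J 0 b}"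
            by (intro card_mono) (auto simp: F_def intro: finite_subset[OF _ finite_permutations[of "{0..<m}"]])
          ultimately show ?thesis by (meson le_trans mult_le_mono1)
        qed simp
      qed
      finally have "fact m * m \<le> fact m * k" by (simp add: mult.commute)
      thus ?thesis by simp
    qed
    hence k: "k = m" using km by simp
    \<comment> \<open>For \<open>k = m\<close> the supports are \<open>m\<close> disjoint nonempty
      sets among \<open>m\<close> rows.\<close>
    have single: "\<exists>i<m. al a (\<omega> a) = (\<lambda>_. 0)(i := 1)" if co: "contrib \<sigma> \<omega>" and a: "a < k" for \<sigma> \<omega> a
    proof -
      have "\<forall>a. \<exists>i. a < k \<longrightarrow> i \<in> I a (\<omega> a)" using Ine cG[OF co] by blast
      then obtain r where r: "\<And>a. a < k \<Longrightarrow> r a \<in> I a (\<omega> a)" by metis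
      have "inj_on r {0..<m}" using disj[OF co] r k by (intro inj_onI) (metis atLeastLessThan_iff)
      moreover have sub: "r ` {0..<m} \<subseteq> {0..<m}" using r Ilt(1) cG[OF co] k by fastforce
      ultimately have surj: "r ` {0..<m} = {0..<m}" by (simp add: endo_inj_surj)
      have "al a (\<omega> a) i = ((\<lambda>_. 0)(r a := 1)) i" for i
      proof (cases "i = r a")
        case True
        thus ?thesis using r[OF a] al1[OF co a, of i] by (auto simp: I_def le_Suc_eq)
      next
        case False
        have "i \<notin> I a (\<omega> a)"
        proof
          assume i: "i \<in> I a (\<omega> a)"
          hence "i < m" using Ilt(1)[OF a cG(2,1)[OF co a]] by auto
          hence "i \<in> r ` {0..<m}" unfolding surj by simp
          then obtain a' where a': "a' < m" "i = r a'" by auto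
          have "i \<in> I a' (\<omega> a')" using r[of a'] a' k by simp
          hence "a' = a" using disj[OF co, of a' a i] i a k a' by blast
          thus False using False a' by simp
        qed
        thus ?thesis using False by (simp add: I_def)
      qed
      moreover have "r a < m" using sub a k by (auto simp: image_subset_iff)
      ultimately show ?thesis by blast
    qed
    have inj: "\<sigma> = \<tau>" if co: "contrib \<sigma> \<omega>" "contrib \<tau> \<omega>" and st: "\<sigma> permutes {0..<m}" "\<tau> permutes {0..<m}" for \<sigma> \<tau> \<omega>
    proof
      fix i
      show "\<sigma> i = \<tau> i"
      proof (cases "i < m")
        case True
        then obtain a where a: "a < k" "i \<in> I a (\<omega> a)" using part[OF co(1)] by blast
        obtain i' where i': "al a (\<omega> a) = (\<lambda>_. 0)(i' := 1)" using single[OF co(1) a(1)] by blast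
        have "i = i'" using a(2) i' by (auto simp: I_def split: if_splits)
        have "be a (\<omega> a) (\<sigma> i) = 1" using albe[OF co(1) st(1) a(1), of i] i' \<open>i = i'\<close> by simp
        moreover have "\<tau> (inv_into UNIV \<tau> (\<sigma> i)) = \<sigma> i" using permutes_inverses[OF st(2)] by simp
        ultimately have "al a (\<omega> a) (inv_into UNIV \<tau> (\<sigma> i)) = 1" using albe[OF co(2) st(2) a(1), of "inv_into UNIV \<tau> (\<sigma> i)"] by simp
        hence "inv_into UNIV \<tau> (\<sigma> i) = i" using i' \<open>i = i'\<close> by (auto split: if_splits)
        thus ?thesis using \<open>\<tau> (inv_into UNIV \<tau> (\<sigma> i)) = \<sigma> i\<close> by simp
      next
        case False thus ?thesis using st by (simp add: permutes_not_in)
      qed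
    qed
    \<comment> \<open>Choosing a surviving term for each \<open>\<sigma>\<close> is injective, hence
      a bijection of the permutations. So every entry occurs in some term and is a multiple of one
      variable, and at the permutation matrix of \<open>\<sigma>\<close> exactly one term
      survives.\<close>
    define \<Omega> where "\<Omega> \<sigma> = (SOME \<omega>. contrib \<sigma> \<omega>)" for \<sigma>
    have \<Omega>: "contrib \<sigma> (\<Omega> \<sigma>)" if "\<sigma> permutes {0..<m}" for \<sigma>
      unfolding \<Omega>_def using someI_ex[OF ex[OF that]] .
    let ?S = "{\<sigma>. \<sigma> permutes {0..<m}}"
    have "inj_on \<Omega> ?S"
    proof (rule inj_onI)
      fix \<sigma> \<tau> assume "\<sigma> \<in> ?S" "\<tau> \<in> ?S" "\<Omega> \<sigma> = \<Omega> \<tau>"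
      thus "\<sigma> = \<tau>" using inj[of \<sigma> "\<Omega> \<sigma>" \<tau>] \<Omega>[of \<sigma>] \<Omega>[of \<tau>] by simp
    qed
    moreover have "\<Omega> ` ?S \<subseteq> ?S" using \<Omega> k by (auto simp: contrib_def)
    ultimately have surj: "\<Omega> ` ?S = ?S" by (intro endo_inj_surj) (auto simp: finite_permutations)
    have "\<exists>C i j. \<forall>y. M a b y = C * y $$ (i, j) \<and> i < m \<and> j < m" if ab': "a < m" "b < m" for a b
    proof -
      have "Transposition.transpose a b permutes {0..<m}" using ab' by (intro permutes_swap_id) auto
      then obtain \<sigma> where s: "\<sigma> permutes {0..<m}" "\<Omega> \<sigma> = Transposition.transpose a b"
        using surj by (metis (mono_tags, lifting) imageE mem_Collect_eq)
      have co: "contrib \<sigma> (\<Omega> \<sigma>)" using \<Omega>[OF s(1)] .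
      have ak: "a < k" "b < k" using ab' k by auto
      have wa: "\<Omega> \<sigma> a = b" using s(2) by simp
      obtain i where i: "i < m" "al a b = (\<lambda>_. 0)(i := 1)" using single[OF co ak(1)] wa by auto
      have "be a b j = ((\<lambda>_. 0)(\<sigma> i := 1)) j" for j
      proof -
        have "be a b j = al a b (inv_into UNIV \<sigma> j)"
          using albe[OF co s(1) ak(1), of "inv_into UNIV \<sigma> j"] wa permutes_inverses[OF s(1)] by simp
        moreover have "inv_into UNIV \<sigma> j = i \<longleftrightarrow> j = \<sigma> i" using permutes_inverses[OF s(1)] by metis
        ultimately show ?thesis using i(2) by simp
      qed
      hence "be a b = (\<lambda>_. 0)(\<sigma> i := 1)" by auto
      moreover have "hpoly m (al a b) (be a b) (M a b)" using ab[OF ak] cG(1)[OF co ak(1)] wa by simp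
      moreover have "\<sigma> i < m" using permutes_in_image[OF s(1), of i] i by simp
      ultimately show ?thesis using hpoly_linear[of m "al a b" "be a b" "M a b" i "\<sigma> i"] i by blast
    qed
    then obtain C e f where C: "\<And>a b y. a < m \<Longrightarrow> b < m \<Longrightarrow> M a b y = C a b * y $$ (e a b, f a b) \<and> e a b < m \<and> f a b < m"
      by metis
    have MC: "M a (\<omega> a) (Y \<sigma>) = C a (\<omega> a)" if co: "contrib \<sigma> \<omega>" and a: "a < m" for \<sigma> \<omega> a
    proof -
      have ak: "a < k" and w: "\<omega> a < m" using a k cG(2)[OF co, of a] by auto
      have "M a (\<omega> a) (Y \<sigma>) \<noteq> 0" using co ak by (simp add: contrib_def)
      thus ?thesis using C[OF a w, of "Y \<sigma>"] by (auto simp: Y_def split: if_splits)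
    qed
    have "signof \<omega> * (\<Prod>a = 0..<m. C a (\<omega> a)) = c" if w: "\<omega> permutes {0..<m}" for \<omega>
    proof -
      obtain \<sigma> where s: "\<sigma> permutes {0..<m}" "\<Omega> \<sigma> = \<omega>"
        using surj w by (metis (mono_tags, lifting) imageE mem_Collect_eq)
      have co: "contrib \<sigma> \<omega>" using \<Omega>[OF s(1)] s(2) by simp
      let ?A = "mat k k (\<lambda>(i, j). M i j (Y \<sigma>))"
      have "(\<Prod>a = 0..<k. ?A $$ (a, \<omega>' a)) = (if \<omega>' = \<omega> then (\<Prod>a = 0..<m. C a (\<omega> a)) else 0)"
        if w': "\<omega>' permutes {0..<k}" for \<omega>'
      proof (cases "\<omega>' = \<omega>")
        case True
        have "?A $$ (a, \<omega> a) = C a (\<omega> a)" if "a < k" for a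
          using MC[OF co] cG(2)[OF co that] that k by simp
        thus ?thesis using True k by (auto intro!: prod.cong)
      next
        case False
        have "\<not> contrib \<sigma> \<omega>'"
        proof
          assume co': "contrib \<sigma> \<omega>'"
          obtain \<tau> where t: "\<tau> permutes {0..<m}" "\<Omega> \<tau> = \<omega>'"
            using surj w' k by (metis (mono_tags, lifting) imageE mem_Collect_eq)
          have "\<sigma> = \<tau>" using inj[OF co' _ s(1) t(1)] \<Omega>[OF t(1)] t(2) by simp
          thus False using s t False by simp
        qed
        then obtain a where "a < k" "M a (\<omega>' a) (Y \<sigma>) = 0" using w' by (auto simp: contrib_def)
        moreover have "\<omega>' a < k" using permutes_in_image[OF w', of a] \<open>a < k\<close> by simp
        ultimately show ?thesis using False by (auto intro!: prod_zero bexI[of _ a])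
      qed
      hence "det ?A = (\<Sum>\<omega>' | \<omega>' permutes {0..<k}. if \<omega>' = \<omega> then signof \<omega> * (\<Prod>a = 0..<m. C a (\<omega> a)) else 0)"
        by (subst det_def'[of _ k]) (auto intro!: sum.cong)
      also have "\<dots> = signof \<omega> * (\<Prod>a = 0..<m. C a (\<omega> a))"
        using w k by (simp add: finite_permutations)
      finally have "det ?A = signof \<omega> * (\<Prod>a = 0..<m. C a (\<omega> a))" .
      moreover have "perm m (Y \<sigma>) = 1" unfolding Y_def using perm_permutation_mat[OF s(1), of "\<lambda>_. 1"] by simp
      ultimately show ?thesis using det[of "Y \<sigma>"] by (simp add: Y_def)
    qed
    thus False using no_sign_matrix[OF m c] by blast
  qed
qed

section \<open>The torus action and the corank of the constant part\<close>

lemma one_smult_mat [simp]: "(1 :: complex) \<cdot>\<^sub>m A = A"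
  by (intro eq_matI) auto

definition torus_act :: "nat \<Rightarrow> (nat \<Rightarrow> complex) \<Rightarrow> (nat \<Rightarrow> complex) \<Rightarrow> complex mat \<Rightarrow> complex mat" where
  "torus_act m t s y = mat m m (\<lambda>(i, j). t i * s j * y $$ (i, j))"

lemma torus_act_carrier [simp]: "torus_act m t s y \<in> carrier_mat m m"
  by (simp add: torus_act_def)

lemma prod_torus_act:
  assumes s: "\<sigma> permutes {0..<m}"
  shows "(\<Prod>i = 0..<m. torus_act m t s y $$ (i, \<sigma> i)) = (\<Prod>i<m. t i) * (\<Prod>j<m. s j) * (\<Prod>i = 0..<m. y $$ (i, \<sigma> i))"
proof -
  have "\<sigma> i < m" if "i < m" for i using permutes_in_image[OF s, of i] that by simp
  hence "(\<Prod>i = 0..<m. torus_act m t s y $$ (i, \<sigma> i)) = (\<Prod>i = 0..<m. t i * s (\<sigma> i) * y $$ (i, \<sigma> i))"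
    by (intro prod.cong) (auto simp: torus_act_def)
  also have "\<dots> = (\<Prod>i = 0..<m. t i) * (\<Prod>i = 0..<m. s (\<sigma> i)) * (\<Prod>i = 0..<m. y $$ (i, \<sigma> i))"
    by (simp add: prod.distrib)
  also have "(\<Prod>i = 0..<m. s (\<sigma> i)) = (\<Prod>j = 0..<m. s j)"
    using prod.permute[OF s, of s] by (simp add: comp_def)
  finally show ?thesis by (simp add: atLeast0LessThan)
qed

lemma perm_torus_act:
  assumes "y \<in> carrier_mat m m"
  shows "perm m (torus_act m t s y) = (\<Prod>i<m. t i) * (\<Prod>j<m. s j) * perm m y"
  unfolding perm_def sum_distrib_left by (intro sum.cong refl prod_torus_act) simp

lemma perm_one: "perm m (1\<^sub>m m) = 1"
proof -
  have "1\<^sub>m m = mat m m (\<lambda>(i, j). if j = id i then 1 else (0::complex))" by (intro eq_matI) auto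
  thus ?thesis using perm_permutation_mat[OF permutes_id, of m "\<lambda>_. 1"] by simp
qed

lemma det_upper_triangular_prod:
  fixes J :: "complex mat"
  assumes J: "J \<in> carrier_mat n n" and up: "\<And>i j. i < n \<Longrightarrow> j < n \<Longrightarrow> J $$ (i, j) \<noteq> 0 \<Longrightarrow> i \<le> j"
  shows "det J = (\<Prod>i<n. J $$ (i, i))"
proof -
  have "upper_triangular J" using J up by (intro upper_triangularI) (metis carrier_matD(1) less_trans not_le)
  thus ?thesis using J by (subst det_upper_triangular[of _ n]) (auto simp: prod_list_diag_prod atLeast0LessThan)
qed

text \<open>In Jordan bases of \<open>P\<close> and of the inverse of \<open>Q\<close>, the diagonal
  entries are row and column weights that grade the entries of \<open>\<Lambda> + A y\<close>. The
  graded reduction ends at size 1 and hands back a rank one update that makes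
  \<open>\<Lambda>\<close> invertible.\<close>

lemma corank_one:
  assumes m: "m \<ge> 3" and gen: "generic_torus m t s" and ts: "\<And>i. i < m \<Longrightarrow> t i \<noteq> 0 \<and> s i \<noteq> 0"
    and L: "\<Lambda> \<in> carrier_mat n n" and lin: "linear_map class_ring (Mat m) (Mat n) A"
    and det: "\<And>y. y \<in> carrier_mat m m \<Longrightarrow> perm m y = det (\<Lambda> + A y)"
    and P: "P \<in> carrier_mat n n" "det P \<noteq> 0" and Q: "Q \<in> carrier_mat n n" "det Q \<noteq> 0"
    and PLQ: "P * \<Lambda> * Q = \<Lambda>" and PAQ: "\<And>y. y \<in> carrier_mat m m \<Longrightarrow> P * A y * Q = A (torus_act m t s y)"
  shows "\<exists>u v. u \<in> carrier_vec n \<and> v \<in> carrier_vec n \<and> det (\<Lambda> + outer n u v) \<noteq> 0"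
proof -
  note lin' = lin[unfolded linear_map_Mat_iff]
  have AC: "A y \<in> carrier_mat n n" if "y \<in> carrier_mat m m" for y using lin' that by blast
  \<comment> \<open>With the inverse \<open>R\<close> of \<open>Q\<close>, a relation
    \<open>P * X * Q = x \<cdot>\<^sub>m X\<close> becomes an intertwining of \<open>P\<close> and
    \<open>R\<close>.\<close>
  obtain R where R: "R \<in> carrier_mat n n" "Q * R = 1\<^sub>m n" "R * Q = 1\<^sub>m n" "det R \<noteq> 0"
    using obtain_inverse_mat[OF Q] by blast
  obtain S S' J where S: "S \<in> carrier_mat n n" "S' \<in> carrier_mat n n" "J \<in> carrier_mat n n"
    "S * S' = 1\<^sub>m n" "S' * S = 1\<^sub>m n" "P = S * J * S'"
    "\<And>i j. i < n \<Longrightarrow> j < n \<Longrightarrow> J $$ (i, j) \<noteq> 0 \<Longrightarrow> i \<le> j \<and> J $$ (i, i) = J $$ (j, j)"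
    using jordan_basis[OF P(1)] by metis
  obtain T T' K where T: "T \<in> carrier_mat n n" "T' \<in> carrier_mat n n" "K \<in> carrier_mat n n"
    "T * T' = 1\<^sub>m n" "T' * T = 1\<^sub>m n" "R = T * K * T'"
    "\<And>i j. i < n \<Longrightarrow> j < n \<Longrightarrow> K $$ (i, j) \<noteq> 0 \<Longrightarrow> i \<le> j \<and> K $$ (i, i) = K $$ (j, j)"
    using jordan_basis[OF R(1)] by metis
  note assoc = assoc_mult_mat[of _ n n _ n _ n]
  have twine: "J * (S' * X * T) = x \<cdot>\<^sub>m ((S' * X * T) * K)"
    if X: "X \<in> carrier_mat n n" and eq: "P * X * Q = x \<cdot>\<^sub>m X" for X x
  proof -
    have "J * (S' * X * T) = (S' * S) * J * S' * X * T"
      using S(1-3) T(1-3) X by (simp add: assoc S(5))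
    also have "\<dots> = S' * (P * X * (Q * R)) * T"
      using S(1-3) T(1-3) X R P Q by (simp add: S(6) assoc)
    also have "\<dots> = S' * ((P * X * Q) * R) * T"
      using S(1-3) T(1-3) X R(1) P Q by (simp add: assoc)
    also have "\<dots> = x \<cdot>\<^sub>m (S' * (X * R) * T)"
      unfolding eq using S(1-3) T(1-3) X R(1)
      by (simp add: mult_smult_assoc_mat[of _ n n _ n] mult_smult_distrib[of _ n n _ n])
    also have "S' * (X * R) * T = (S' * X * T) * K * (T' * T)"
      using S(1-3) T(1-3) X by (simp add: T(6) assoc)
    also have "\<dots> = (S' * X * T) * K" using S(1-3) T(1-3,5) X by simp
    finally show ?thesis .
  qed
  define p q where "p a = J $$ (a, a)" and "q a = K $$ (a, a)" for a
  have detS: "det S * det S' = 1" using S(1,2,4) by (metis det_mult det_one)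
  have detT: "det T * det T' = 1" using T(1,2,4) by (metis det_mult det_one)
  have detJ: "det P = (\<Prod>a<n. p a)"
  proof -
    have "det P = det S * det J * det S'" using S(1-3) by (simp add: S(6) det_mult[of _ n])
    also have "\<dots> = det J" using detS by (simp add: mult_ac)
    also have "\<dots> = (\<Prod>a<n. J $$ (a, a))"
      by (rule det_upper_triangular_prod[OF S(3)]) (use S(7) in blast)
    finally show ?thesis by (simp add: p_def)
  qed
  have detK: "det R = (\<Prod>a<n. q a)"
  proof -
    have "det R = det T * det K * det T'" using T(1-3) by (simp add: T(6) det_mult[of _ n])
    also have "\<dots> = det K" using detT by (simp add: mult_ac)
    also have "\<dots> = (\<Prod>a<n. K $$ (a, a))"
      by (rule det_upper_triangular_prod[OF T(3)]) (use T(7) in blast)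
    finally show ?thesis by (simp add: q_def)
  qed
  have nz: "p a \<noteq> 0 \<and> q a \<noteq> 0" if "a < n" for a
    using detJ detK P(2) R(4) that by auto
  define X where "X i j = S' * A (unit_mat m i j) * T" for i j
  define XL where "XL = S' * \<Lambda> * T"
  have XC: "X i j \<in> carrier_mat n n" "XL \<in> carrier_mat n n" for i j
    using S(2) T(1) AC[OF unit_mat_carrier] L by (simp_all add: X_def XL_def)
  define N where "N a b y = XL $$ (a, b) + (\<Sum>i<m. \<Sum>j<m. y $$ (i, j) * X i j $$ (a, b))" for a b and y :: "complex mat"
  have W: "wpoly m t s (p a / q b) (N a b)" if ab: "a < n" "b < n" for a b
  proof -
    have qb: "q b \<noteq> 0" using nz ab by blast
    have 1: "wpoly m t s (p a / q b) (\<lambda>_. XL $$ (a, b))"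
    proof (cases "XL $$ (a, b) = 0")
      case False
      have "P * \<Lambda> * Q = 1 \<cdot>\<^sub>m \<Lambda>" using PLQ by simp
      from twine[OF L this] have "J * XL = 1 \<cdot>\<^sub>m (XL * K)" by (simp add: XL_def)
      from intertwiner_entry[OF S(3,7) T(3,7) XC(2) this ab] False
      have "p a = q b" by (auto simp: p_def q_def)
      hence "p a / q b = wt m t s (\<lambda>_. 0) (\<lambda>_. 0)" using qb by simp
      thus ?thesis unfolding wpoly_def using hpoly.const by blast
    qed (simp add: wpoly_def)
    have 2: "wpoly m t s (p a / q b) (\<lambda>y. y $$ (i, j) * X i j $$ (a, b))" if ij: "i < m" "j < m" for i j
    proof (cases "X i j $$ (a, b) = 0")
      case False
      have "torus_act m t s (unit_mat m i j) = (t i * s j) \<cdot>\<^sub>m unit_mat m i j"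
        by (intro eq_matI) (auto simp: torus_act_def)
      hence "P * A (unit_mat m i j) * Q = (t i * s j) \<cdot>\<^sub>m A (unit_mat m i j)"
        using PAQ[OF unit_mat_carrier] lin' by simp
      from twine[OF AC[OF unit_mat_carrier] this] have "J * X i j = (t i * s j) \<cdot>\<^sub>m (X i j * K)" by (simp add: X_def)
      from intertwiner_entry[OF S(3,7) T(3,7) XC(1) this ab] False
      have "p a = (t i * s j) * q b" by (auto simp: p_def q_def)
      hence "p a / q b = t i * s j" using qb by simp
      thus ?thesis using wpoly_var[OF ij, of t s] by simp
    qed (simp add: wpoly_def)
    have "wpoly m t s (p a / q b) (\<lambda>y. \<Sum>i<m. \<Sum>j<m. y $$ (i, j) * X i j $$ (a, b))"
      by (intro wpoly_sum[OF gen] 2) auto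
    from wpoly_add[OF gen 1 this] show ?thesis unfolding N_def .
  qed
  have matN: "mat n n (\<lambda>(a, b). N a b y) = S' * (\<Lambda> + A y) * T" if y: "y \<in> carrier_mat m m" for y
  proof (rule eq_matI)
    fix a b assume "a < dim_row (S' * (\<Lambda> + A y) * T)" "b < dim_col (S' * (\<Lambda> + A y) * T)"
    hence ab: "a < n" "b < n" using S(2) T(1) by auto
    have linX: "linear_map class_ring (Mat m) (Mat n) (\<lambda>y. S' * A y * T)"
      unfolding linear_map_Mat_iff
    proof (intro conjI ballI allI)
      fix X Y :: "complex mat" and c :: complex
      assume X: "X \<in> carrier_mat m m" and Y: "Y \<in> carrier_mat m m"
      have "S' * (1 \<cdot>\<^sub>m A X + A Y) * T = 1 \<cdot>\<^sub>m (S' * A X * T) + S' * A Y * T"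
        by (rule mult_add_mult_distrib_mat[OF S(2) T(1) AC[OF X] AC[OF Y]])
      thus "S' * A (X + Y) * T = S' * A X * T + S' * A Y * T" using lin' X Y by simp
    next
      fix X :: "complex mat" and c :: complex
      assume X: "X \<in> carrier_mat m m"
      show "S' * A X * T \<in> carrier_mat n n" using S(2) T(1) AC[OF X] by simp
      have "A (c \<cdot>\<^sub>m X) = c \<cdot>\<^sub>m A X" using lin' X by blast
      thus "S' * A (c \<cdot>\<^sub>m X) * T = c \<cdot>\<^sub>m (S' * A X * T)" using S(2) T(1) AC[OF X]
        by (simp add: mult_smult_assoc_mat[of _ n n _ n] mult_smult_distrib[of _ n n _ n])
    qed
    have "S' * (\<Lambda> + A y) * T = XL + S' * A y * T"
      using mult_add_mult_distrib_mat[OF S(2) T(1) L AC[OF y], of 1] by (simp add: XL_def)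
    moreover have "(XL + S' * A y * T) $$ (a, b) = N a b y"
      using linear_map_expand[OF linX y ab] ab S(2) T(1) AC[OF y] XC by (simp add: N_def X_def)
    ultimately show "mat n n (\<lambda>(a, b). N a b y) $$ (a, b) = (S' * (\<Lambda> + A y) * T) $$ (a, b)" using ab by simp
  qed (use S(2) T(1) in auto)
  define c0 where "c0 = det S' * det T"
  have c0: "c0 \<noteq> 0" using detS detT by (auto simp: c0_def)
  have detN: "det (mat n n (\<lambda>(a, b). N a b y)) = c0 * perm m y" if y: "y \<in> carrier_mat m m" for y
    unfolding matN[OF y] det[OF y] c0_def using S(2) T(1) L AC[OF y] by (simp add: det_mult[of _ n] mult_ac)
  \<comment> \<open>The product of the two determinants is read off at the identity matrix, where
    the permanent is 1.\<close>
  have ratio: "(\<Prod>a<n. p a) / (\<Prod>a<n. q a) = wt m t s (\<lambda>_. 1) (\<lambda>_. 1)"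
  proof -
    let ?o = "1\<^sub>m m :: complex mat"
    have "\<Lambda> + A (torus_act m t s ?o) = P * (\<Lambda> + A ?o) * Q"
      using mult_add_mult_distrib_mat[OF P(1) Q(1) L AC[of ?o], of 1] PLQ PAQ[of ?o] by simp
    hence "perm m (torus_act m t s ?o) = det P * perm m ?o * det Q"
      using det[of ?o] det[of "torus_act m t s ?o"] P(1) Q(1) L AC[of ?o] by (simp add: det_mult[of _ n])
    hence "det P * det Q = (\<Prod>i<m. t i) * (\<Prod>j<m. s j)"
      using perm_torus_act[of ?o m t s] by (simp add: perm_one)
    moreover have "det Q * det R = 1" using R(1,2) Q(1) by (metis det_mult det_one)
    hence "det P / det R = det P * det Q" using R(4) by (simp add: eq_divide_eq divide_eq_eq mult.assoc)
    ultimately show ?thesis unfolding detJ[symmetric] detK[symmetric] wt_def by simp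
  qed
  have "\<exists>k p' q' M c. c \<noteq> 0 \<and> (\<forall>a<k. p' a \<noteq> 0 \<and> q' a \<noteq> (0::complex)) \<and>
    (\<forall>a<k. \<forall>b<k. wpoly m t s (p' a / q' b) (M a b) \<and> M a b (0\<^sub>m m m) = 0) \<and>
    (\<forall>y. det (mat n n (\<lambda>(i, j). N i j y)) = c * det (mat k k (\<lambda>(i, j). M i j y))) \<and>
    (\<Prod>a<n. p a) / (\<Prod>a<n. q a) = (\<Prod>a<k. p' a) / (\<Prod>a<k. q' a) \<and>
    (k = 1 \<longrightarrow> (\<exists>u v. det (mat n n (\<lambda>(i, j). N i j (0\<^sub>m m m) + u i * v j)) \<noteq> 0))"
    by (rule graded_schur_reduction[OF gen]) (fact W, fact nz)
  then obtain k p' q' M c where red: "c \<noteq> 0" "\<forall>a<k. p' a \<noteq> 0 \<and> q' a \<noteq> (0::complex)"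
    "\<forall>a<k. \<forall>b<k. wpoly m t s (p' a / q' b) (M a b) \<and> M a b (0\<^sub>m m m) = 0"
    "\<forall>y. det (mat n n (\<lambda>(i, j). N i j y)) = c * det (mat k k (\<lambda>(i, j). M i j y))"
    "(\<Prod>a<n. p a) / (\<Prod>a<n. q a) = (\<Prod>a<k. p' a) / (\<Prod>a<k. q' a)"
    "k = 1 \<longrightarrow> (\<exists>u v. det (mat n n (\<lambda>(i, j). N i j (0\<^sub>m m m) + u i * v j)) \<noteq> 0)"
    by (elim exE conjE) (rule that; assumption)
  have "k = 1"
  proof (rule graded_det_size[OF gen ts m])
    show "det (mat k k (\<lambda>(i, j). M i j y)) = c0 / c * perm m y" if "y \<in> carrier_mat m m" for y
      using red(4) detN[OF that] red(1) by (simp add: field_simps)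
    show "c0 / c \<noteq> 0" using c0 red(1) by simp
    show "(\<Prod>a<k. p' a) / (\<Prod>a<k. q' a) = wt m t s (\<lambda>_. 1) (\<lambda>_. 1)" using ratio red(5) by simp
  qed (use red(2,3) in auto)
  then obtain u v where uv: "det (mat n n (\<lambda>(i, j). N i j (0\<^sub>m m m) + u i * v j)) \<noteq> 0" using red(6) by blast
  define u' v' where "u' = vec n u" and "v' = vec n v"
  have "mat n n (\<lambda>(i, j). N i j (0\<^sub>m m m) + u i * v j) = XL + outer n u' v'"
    using XC by (intro eq_matI) (auto simp: N_def u'_def v'_def)
  hence d: "det (XL + outer n u' v') \<noteq> 0" using uv by simp
  \<comment> \<open>Going back to the original bases turns the update into an outer product
    again.\<close>
  have "S * (1 \<cdot>\<^sub>m XL + outer n u' v') * T' = 1 \<cdot>\<^sub>m (S * XL * T') + S * outer n u' v' * T'"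
    by (rule mult_add_mult_distrib_mat[OF S(1) T(2) XC(2) outer_carrier])
  moreover have "S * XL * T' = (S * S') * \<Lambda> * (T * T')"
    unfolding XL_def using S(1,2) T(1,2) L by (simp add: assoc)
  moreover have "S * outer n u' v' * T' = outer n (S *\<^sub>v u') (T'\<^sup>T *\<^sub>v v')"
    by (rule mult_outer_mult) (use S T in \<open>auto simp: u'_def v'_def\<close>)
  ultimately have "\<Lambda> + outer n (S *\<^sub>v u') (T'\<^sup>T *\<^sub>v v') = S * (XL + outer n u' v') * T'"
    using S(4) T(4) L by simp
  moreover have "det (S * (XL + outer n u' v') * T') \<noteq> 0"
    using d detS detT S(1) T(2) XC by (auto simp: det_mult[of _ n])
  ultimately show ?thesis using S(1) T(2)
    by (intro exI[of _ "S *\<^sub>v u'"] exI[of _ "T'\<^sup>T *\<^sub>v v'"]) (auto simp: u'_def v'_def)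
qed

section \<open>Word forms and gauge invariance\<close>

lemma prod_lessThan_add:
  fixes g :: "nat \<Rightarrow> 'a::comm_monoid_mult"
  shows "(\<Prod>l<m + k. g l) = (\<Prod>l<m. g l) * (\<Prod>l<k. g (m + l))"
  by (induction k) (simp_all add: mult.assoc)

text \<open>Distinct primes are multiplicatively independent, so unique factorisation recovers the
  exponents. Squares appear because only squares of symmetries are lifted.\<close>

lemma generic_torus_exists:
  "\<exists>t s. (\<forall>i. t i \<noteq> 0 \<and> s i \<noteq> 0) \<and> generic_torus m (\<lambda>i. (t i)\<^sup>2) (\<lambda>j. (s j)\<^sup>2)"
proof -
  have "infinite {p :: nat. prime p}" by (rule primes_infinite)
  then obtain f :: "nat \<Rightarrow> nat" where f: "inj f" "range f \<subseteq> {p. prime p}"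
    using infinite_countable_subset by blast
  have fp: "prime (f i)" for i using f(2) by blast
  have key: "e l = e' l" if eq: "(\<Prod>l<2 * m. f l ^ e l) = (\<Prod>l<2 * m. f l ^ e' l)" and l: "l < 2 * m" for e e' :: "nat \<Rightarrow> nat" and l
  proof -
    have "multiplicity (f l) (\<Prod>l<2 * m. f l ^ e l) = e l" for e :: "nat \<Rightarrow> nat"
    proof -
      have "(\<Prod>l<2 * m. f l ^ e l) = (\<Prod>p\<in>f ` {..<2 * m}. p ^ e (inv_into UNIV f p))"
        using f(1) by (subst prod.reindex) (auto simp: inj_on_def inj_def)
      thus ?thesis using multiplicity_prod_prime_powers[of "f ` {..<2 * m}" "f l" "\<lambda>p. e (inv_into UNIV f p)"] l fp f(1)
        by auto
    qed
    thus ?thesis using eq by metis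
  qed
  define t s where "t i = (of_nat (f i) :: complex)" and "s j = (of_nat (f (m + j)) :: complex)" for i j
  have "generic_torus m (\<lambda>i. (t i)\<^sup>2) (\<lambda>j. (s j)\<^sup>2)"
    unfolding generic_torus_def
  proof (intro allI impI)
    fix \<alpha> \<beta> \<alpha>' \<beta>' :: "nat \<Rightarrow> nat" and i
    assume eq: "wt m (\<lambda>i. (t i)\<^sup>2) (\<lambda>j. (s j)\<^sup>2) \<alpha> \<beta> = wt m (\<lambda>i. (t i)\<^sup>2) (\<lambda>j. (s j)\<^sup>2) \<alpha>' \<beta>'" and i: "i < m"
    \<comment> \<open>The primes are numbered with the rows first and then the columns; the factor 2
      comes from squaring.\<close>
    define e where "e \<alpha> \<beta> l = 2 * (if l < m then \<alpha> l else \<beta> (l - m) :: nat)" for \<alpha> \<beta> l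
    have wte: "wt m (\<lambda>i. (t i)\<^sup>2) (\<lambda>j. (s j)\<^sup>2) \<alpha> \<beta> = of_nat (\<Prod>l<2 * m. f l ^ e \<alpha> \<beta> l)" for \<alpha> \<beta>
    proof -
      have "(\<Prod>l<m + m. f l ^ e \<alpha> \<beta> l) = (\<Prod>l<m. f l ^ e \<alpha> \<beta> l) * (\<Prod>l<m. f (m + l) ^ e \<alpha> \<beta> (m + l))"
        by (rule prod_lessThan_add)
      also have "\<dots> = (\<Prod>l<m. f l ^ (2 * \<alpha> l)) * (\<Prod>l<m. f (m + l) ^ (2 * \<beta> l))"
        by (simp add: e_def)
      finally show ?thesis unfolding mult_2[of m] by (simp add: wt_def t_def s_def power_mult)
    qed
    have "(\<Prod>l<2 * m. f l ^ e \<alpha> \<beta> l) = (\<Prod>l<2 * m. f l ^ e \<alpha>' \<beta>' l)"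
      using eq unfolding wte by (simp only: of_nat_eq_iff)
    from key[OF this] have "e \<alpha> \<beta> i = e \<alpha>' \<beta>' i" "e \<alpha> \<beta> (m + i) = e \<alpha>' \<beta>' (m + i)" using i by auto
    thus "\<alpha> i = \<alpha>' i \<and> \<beta> i = \<beta>' i" using i by (simp add: e_def)
  qed
  moreover have "t i \<noteq> 0 \<and> s i \<noteq> 0" for i
    using fp[of i] fp[of "m + i"] by (auto simp: t_def s_def)
  ultimately show ?thesis by blast
qed

text \<open>The vectors \<open>x\<close> are independent: in a linear relation, pairing with the
  \<open>z\<close> of a member of least \<open>h\<close> leaves only that member's own term.\<close>

lemma card_le_dim_if_triangular:
  fixes x z :: "'a \<Rightarrow> complex vec" and h :: "'a \<Rightarrow> nat"
  assumes fin: "finite T" and car: "\<And>a. a \<in> T \<Longrightarrow> x a \<in> carrier_vec n \<and> z a \<in> carrier_vec n"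
    and tri: "\<And>a b. a \<in> T \<Longrightarrow> b \<in> T \<Longrightarrow> a \<noteq> b \<Longrightarrow> h a \<le> h b \<Longrightarrow> z a \<bullet> x b = 0"
    and diag: "\<And>a. a \<in> T \<Longrightarrow> z a \<bullet> x a \<noteq> 0"
  shows "card T \<le> n"
proof (rule ccontr)
  assume "\<not> card T \<le> n"
  hence nN: "n < card T" by simp
  define N where "N = card T"
  obtain e where e: "bij_betw e {..<N} T"
    using ex_bij_betw_nat_finite[OF fin] by (auto simp: N_def atLeast0LessThan)
  \<comment> \<open>Padding with zero rows from row \<open>n\<close> on makes the matrix square and
    singular, so more than \<open>n\<close> vectors satisfy a nontrivial relation.\<close>
  define X where "X = mat N N (\<lambda>(i, j). if i < n then x (e j) $ i else 0)"
  have XC: "X \<in> carrier_mat N N" by (simp add: X_def)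
  have "det X = (\<Sum>j<N. X $$ (n, j) * cofactor X n j)"
    by (rule laplace_expansion_row[OF XC]) (use nN in \<open>simp add: N_def\<close>)
  also have "\<dots> = 0" using nN by (intro sum.neutral) (auto simp: X_def N_def)
  finally obtain c where c: "c \<in> carrier_vec N" "c \<noteq> 0\<^sub>v N" "X *\<^sub>v c = 0\<^sub>v N"
    using det_0_iff_vec_prod_zero[OF XC] by blast
  have eT: "e j \<in> T" if "j < N" for j using bij_betwE[OF e] that by auto
  have rel: "(\<Sum>j<N. c $ j * x (e j) $ i) = 0" if i: "i < n" for i
  proof -
    have "(X *\<^sub>v c) $ i = 0" using c(3) i nN by (simp add: N_def)
    thus ?thesis using i nN c(1) by (simp add: X_def N_def scalar_prod_def atLeast0LessThan mult.commute)
  qed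
  define S where "S = {j. j < N \<and> c $ j \<noteq> 0}"
  have "S \<noteq> {}"
  proof
    assume "S = {}"
    hence "c = 0\<^sub>v N" using c(1) by (intro eq_vecI) (auto simp: S_def)
    thus False using c(2) by simp
  qed
  then obtain j0 where "j0 \<in> S" by blast
  define a where "a = arg_min (\<lambda>j. h (e j)) (\<lambda>j. j \<in> S)"
  have a: "a \<in> S" "\<And>b. b \<in> S \<Longrightarrow> h (e a) \<le> h (e b)"
    using arg_min_nat_lemma[of "\<lambda>j. j \<in> S" j0 "\<lambda>j. h (e j)", OF \<open>j0 \<in> S\<close>] by (auto simp: a_def)
  have aN: "a < N" "c $ a \<noteq> 0" using a(1) by (auto simp: S_def)
  have zx: "z (e a) \<bullet> x (e j) = (\<Sum>i<n. z (e a) $ i * x (e j) $ i)" if "j < N" for j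
    using carrier_vecD[OF conjunct1[OF car[OF eT[OF that]]]] by (simp add: scalar_prod_def atLeast0LessThan)
  have "0 = (\<Sum>i<n. z (e a) $ i * (\<Sum>j<N. c $ j * x (e j) $ i))" using rel by simp
  also have "\<dots> = (\<Sum>i<n. \<Sum>j<N. c $ j * (z (e a) $ i * x (e j) $ i))"
    by (simp add: sum_distrib_left mult_ac)
  also have "\<dots> = (\<Sum>j<N. c $ j * (z (e a) \<bullet> x (e j)))"
    by (subst sum.swap) (simp add: zx sum_distrib_left)
  also have "\<dots> = c $ a * (z (e a) \<bullet> x (e a))"
  proof (rule sum_eq_at)
    fix j assume j: "j \<in> {..<N}" "j \<noteq> a"
    show "c $ j * (z (e a) \<bullet> x (e j)) = 0"
    proof (cases "c $ j = 0")
      case False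
      hence "h (e a) \<le> h (e j)" using a(2) j by (simp add: S_def)
      moreover have "e a \<noteq> e j" using e j aN by (auto simp: bij_betw_def inj_on_def)
      ultimately show ?thesis using tri[OF eT[of a] eT[of j]] j aN by simp
    qed simp
  qed (use aN in auto)
  finally show False using aN diag[OF eT[OF aN(1)]] by simp
qed

text \<open>Vandermonde's identity for the sum of the squares of \<open>m choose k\<close>, with the
  empty pair removed.\<close>

lemma card_equal_size_pairs:
  "card {(I, J). I \<subseteq> {..<m} \<and> J \<subseteq> {..<m} \<and> card I = card J \<and> I \<noteq> {}} = (2 * m choose m) - 1"
proof -
  let ?E = "\<lambda>k. {I. I \<subseteq> {..<m} \<and> card I = k}"
  have fin: "finite (?E k)" for k by (rule finite_subset[of _ "Pow {..<m}"]) auto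
  let ?S = "{(I, J). I \<subseteq> {..<m} \<and> J \<subseteq> {..<m} \<and> card I = card J}"
  have "?S = (\<Union>k\<le>m. ?E k \<times> ?E k)"
    using card_mono[of "{..<m}"] by fastforce
  hence "card ?S = (\<Sum>k\<le>m. card (?E k \<times> ?E k))"
    using fin by (simp only:) (intro card_UN_disjoint; auto)
  also have "\<dots> = (\<Sum>k\<le>m. (m choose k)\<^sup>2)"
    by (simp add: card_cartesian_product n_subsets power2_eq_square)
  finally have S: "card ?S = (2 * m choose m)" by (simp add: choose_square_sum)
  have "{(I, J). I \<subseteq> {..<m} \<and> J \<subseteq> {..<m} \<and> card I = card J \<and> I \<noteq> {}} = ?S - {({}, {})}"
    by (auto simp: finite_subset)
  thus ?thesis using S by (simp only:) (subst card_Diff_singleton; simp)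
qed

text \<open>Sylvester's identity: the products of the block matrices \<open>M\<close> and
  \<open>R\<close> in the two orders are block triangular, with one of the two determinants
  each.\<close>

lemma det_one_plus_mult_commute:
  fixes U V :: "complex mat"
  assumes U: "U \<in> carrier_mat n k" and V: "V \<in> carrier_mat k n"
  shows "det (1\<^sub>m n + U * V) = det (1\<^sub>m k + V * U)"
proof -
  define M where "M = four_block_mat (1\<^sub>m n) (- U) V (1\<^sub>m k)"
  define R where "R = four_block_mat (1\<^sub>m n) U (0\<^sub>m k n) (1\<^sub>m k)"
  have C: "M \<in> carrier_mat (n + k) (n + k)" "R \<in> carrier_mat (n + k) (n + k)"
    using U V by (auto simp: M_def R_def)
  have "M * R = four_block_mat (1\<^sub>m n) (0\<^sub>m n k) V (1\<^sub>m k + V * U)"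
    unfolding M_def R_def using U V
    apply (subst mult_four_block_mat[of _ n n _ k _ k _ _ n _ k])
               apply (auto simp: comm_add_mat[of _ k k])
    done
  hence 1: "det (M * R) = det (1\<^sub>m k + V * U)"
    using U V by (simp add: det_four_block_mat_upper_right_zero[of _ n _ k])
  have "R * M = four_block_mat (1\<^sub>m n + U * V) (0\<^sub>m n k) V (1\<^sub>m k)"
    unfolding M_def R_def using U V
    apply (subst mult_four_block_mat[of _ n n _ k _ k _ _ n _ k])
               apply (auto simp: comm_add_mat[of _ n k])
    done
  hence "det (R * M) = det (1\<^sub>m n + U * V)"
    using U V by (simp add: det_four_block_mat_upper_right_zero[of _ n _ k])
  thus ?thesis using 1 det_mult[OF C] det_mult[OF C(2,1)] by (simp add: mult.commute)
qed

lemma det_two: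
  fixes A :: "complex mat"
  assumes A: "A \<in> carrier_mat 2 2"
  shows "det A = A $$ (0, 0) * A $$ (1, 1) - A $$ (0, 1) * A $$ (1, 0)"
proof -
  have "det A = (\<Sum>i<2. A $$ (i, 0) * cofactor A i 0)"
    by (rule laplace_expansion_column[OF A]) simp
  moreover have "det (mat_delete A i 0) = A $$ (1 - i, 1)" if "i < 2" for i
    using A that by (subst det_single) (auto simp: mat_delete_def less_2_cases_iff)
  ultimately show ?thesis by (simp add: cofactor_def numeral_2_eq_2)
qed

text \<open>Sylvester's identity reduces this to a determinant of size 2 whose upper left entry is
  \<open>1 - v \<bullet> u = 0\<close>.\<close>

lemma det_one_minus_outer_plus_outer:
  assumes "u \<in> carrier_vec n" "v \<in> carrier_vec n" "a \<in> carrier_vec n" "b \<in> carrier_vec n" "v \<bullet> u = 1"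
  shows "det (1\<^sub>m n - outer n u v + outer n a b) = (v \<bullet> a) * (b \<bullet> u)"
proof -
  define U where "U = mat n 2 (\<lambda>(i, j). if j = 0 then - u $ i else a $ i)"
  define V where "V = mat 2 n (\<lambda>(i, j). if i = 0 then v $ j else b $ j)"
  have C: "U \<in> carrier_mat n 2" "V \<in> carrier_mat 2 n" by (auto simp: U_def V_def)
  have "1\<^sub>m n - outer n u v + outer n a b = 1\<^sub>m n + U * V"
    by (intro eq_matI) (auto simp: U_def V_def scalar_prod_def numeral_2_eq_2)
  moreover have "(1\<^sub>m 2 + V * U) = mat 2 2 (\<lambda>(i, j). if i = 0 then (if j = 0 then 1 - v \<bullet> u else v \<bullet> a)
      else (if j = 0 then - (b \<bullet> u) else 1 + b \<bullet> a))"
    using assms(1-4) by (intro eq_matI) (auto simp: U_def V_def scalar_prod_def less_2_cases_iff sum_negf intro!: sum.cong)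
  ultimately show ?thesis
    using det_one_plus_mult_commute[OF C] assms(5) by (simp add: det_two)
qed

text \<open>The noncommutative polynomial \<open>v A\<^sub>1 \<cdots> A\<^sub>r u\<close> of a representation with constant part
  \<open>1 - u v\<^sup>T\<close>; only its lowest degree part is independent of the choice of complements.\<close>

definition word_vec :: "complex vec \<Rightarrow> complex mat list \<Rightarrow> complex vec" where
  "word_vec u Bs = foldr (\<lambda>B x. B *\<^sub>v x) Bs u"

definition word_form :: "complex vec \<Rightarrow> complex vec \<Rightarrow> complex mat list \<Rightarrow> complex" where
  "word_form u v Bs = v \<bullet> word_vec u Bs"

lemma word_vec_simps [simp]: "word_vec u [] = u" "word_vec u (B # Bs) = B *\<^sub>v word_vec u Bs"
  by (simp_all add: word_vec_def)

lemma word_vec_append: "word_vec u (Bs @ Cs) = word_vec (word_vec u Cs) Bs"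
  by (simp add: word_vec_def)

lemma word_vec_carrier: "u \<in> carrier_vec n \<Longrightarrow> set Bs \<subseteq> carrier_mat n n \<Longrightarrow> word_vec u Bs \<in> carrier_vec n"
  by (induction Bs) auto

lemma word_vec_linear:
  assumes "x \<in> carrier_vec n" "y \<in> carrier_vec n" "set Bs \<subseteq> carrier_mat n n"
  shows "word_vec (x + c \<cdot>\<^sub>v y) Bs = word_vec x Bs + c \<cdot>\<^sub>v word_vec y Bs"
  using assms(3)
proof (induction Bs)
  case (Cons B Bs)
  have B: "B \<in> carrier_mat n n" using Cons.prems by simp
  have c: "word_vec x Bs \<in> carrier_vec n" "word_vec y Bs \<in> carrier_vec n"
    using word_vec_carrier assms Cons.prems by auto
  have "B *\<^sub>v (word_vec x Bs + c \<cdot>\<^sub>v word_vec y Bs) = B *\<^sub>v word_vec x Bs + B *\<^sub>v (c \<cdot>\<^sub>v word_vec y Bs)"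
    using B c by (intro mult_add_distrib_mat_vec) auto
  also have "B *\<^sub>v (c \<cdot>\<^sub>v word_vec y Bs) = c \<cdot>\<^sub>v (B *\<^sub>v word_vec y Bs)"
    using B c by (intro mult_mat_vec) auto
  finally show ?case using Cons by simp
qed simp

text \<open>The covector is \<open>v\<close> times the word, built from the transposed letters; it
  separates the prefix of a word from what follows.\<close>

lemma word_covec:
  assumes "v \<in> carrier_vec n" "set Bs \<subseteq> carrier_mat n n"
  shows "\<exists>w\<in>carrier_vec n. \<forall>x\<in>carrier_vec n. v \<bullet> word_vec x Bs = w \<bullet> x"
  using assms
proof (induction Bs arbitrary: v)
  case Nil thus ?case by auto
next
  case (Cons B Bs)
  have B: "B \<in> carrier_mat n n" using Cons.prems by simp
  have "B\<^sup>T *\<^sub>v v \<in> carrier_vec n" using B Cons.prems by simp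
  then obtain w where w: "w \<in> carrier_vec n" "\<forall>x\<in>carrier_vec n. (B\<^sup>T *\<^sub>v v) \<bullet> word_vec x Bs = w \<bullet> x"
    using Cons.IH[of "B\<^sup>T *\<^sub>v v"] Cons.prems by auto
  have "v \<bullet> word_vec x (B # Bs) = w \<bullet> x" if "x \<in> carrier_vec n" for x
    using transpose_vec_mult_scalar[OF B word_vec_carrier[OF that, of Bs] Cons.prems(1)] w(2) that Cons.prems by simp
  thus ?case using w(1) by blast
qed

text \<open>Inserts \<open>G\<close> between consecutive letters. Replacing each letter
  \<open>B\<close> by \<open>P * B * Q\<close> leaves \<open>G = Q * P\<close> at each joint, by
  \<open>word_vec_conjugate\<close>.\<close>

fun gauged_vec :: "complex mat \<Rightarrow> complex vec \<Rightarrow> complex mat list \<Rightarrow> complex vec" where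
  "gauged_vec G u [] = u"
| "gauged_vec G u [B] = B *\<^sub>v u"
| "gauged_vec G u (B # C # Bs) = B *\<^sub>v (G *\<^sub>v gauged_vec G u (C # Bs))"

lemma gauged_vec_carrier:
  "G \<in> carrier_mat n n \<Longrightarrow> u \<in> carrier_vec n \<Longrightarrow> set Bs \<subseteq> carrier_mat n n \<Longrightarrow> gauged_vec G u Bs \<in> carrier_vec n"
  by (induction G u Bs rule: gauged_vec.induct) auto

text \<open>At each joint \<open>G\<close> is the identity up to a multiple of \<open>u\<close>,
  which cuts off a shorter form in front, and a multiple of \<open>\<psi>\<close>, whose coefficient
  is a shorter form behind. Both vanish below degree \<open>r\<close>.\<close>

lemma gauge_invariance:
  assumes u: "u \<in> carrier_vec n" and v: "v \<in> carrier_vec n" and G: "G \<in> carrier_mat n n" and \<psi>: "\<psi> \<in> carrier_vec n"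
    and Gx: "\<And>x. x \<in> carrier_vec n \<Longrightarrow> \<exists>a. G *\<^sub>v x = x + a \<cdot>\<^sub>v u + (v \<bullet> x) \<cdot>\<^sub>v \<psi>"
    and zero: "\<And>Bs. set Bs \<subseteq> \<B> \<Longrightarrow> Bs \<noteq> [] \<Longrightarrow> length Bs < r \<Longrightarrow> word_form u v Bs = 0"
    and \<B>: "\<B> \<subseteq> carrier_mat n n"
  shows "set Cs \<subseteq> \<B> \<Longrightarrow> set Bs \<subseteq> \<B> \<Longrightarrow> Bs \<noteq> [] \<Longrightarrow> length Cs + length Bs \<le> r \<Longrightarrow>
    v \<bullet> word_vec (gauged_vec G u Bs) Cs = word_form u v (Cs @ Bs)"
\<comment> \<open>The prefix \<open>Cs\<close> is kept general, since the letter in front of the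
  first joint is moved into it.\<close>
proof (induction "length Bs" arbitrary: Bs Cs rule: less_induct)
  case (less Bs Cs)
  note 1 = less.prems
  show ?case
  proof (cases "(G, u, Bs)" rule: gauged_vec.cases)
    case (3 G' u' B C Bs')
    hence Bs: "Bs = B # C # Bs'" by simp
    let ?X = "gauged_vec G u (C # Bs')"
    have car: "B \<in> carrier_mat n n" "C \<in> carrier_mat n n" "set Bs' \<subseteq> carrier_mat n n" "set Cs \<subseteq> carrier_mat n n"
      using 1(1,2) \<B> Bs by auto
    have X: "?X \<in> carrier_vec n" using gauged_vec_carrier[OF G u, of "C # Bs'"] car by simp
    have "v \<bullet> word_vec ?X [] = word_form u v ([] @ C # Bs')"
      using less.hyps[of "C # Bs'" "[]"] 1 Bs by simp
    also have "\<dots> = 0" using zero[of "C # Bs'"] 1 Bs by simp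
    finally have vX: "v \<bullet> ?X = 0" by simp
    obtain a where "G *\<^sub>v ?X = ?X + a \<cdot>\<^sub>v u + (v \<bullet> ?X) \<cdot>\<^sub>v \<psi>" using Gx[OF X] by blast
    moreover have "0 \<cdot>\<^sub>v \<psi> = 0\<^sub>v n" using \<psi> by (intro eq_vecI) auto
    ultimately have GX: "G *\<^sub>v ?X = ?X + a \<cdot>\<^sub>v u" using vX X u by simp
    have "word_vec (gauged_vec G u Bs) Cs = word_vec (?X + a \<cdot>\<^sub>v u) (Cs @ [B])"
      unfolding Bs by (simp add: GX word_vec_append)
    also have "\<dots> = word_vec ?X (Cs @ [B]) + a \<cdot>\<^sub>v word_vec u (Cs @ [B])"
      using word_vec_linear[OF X u] car by simp
    finally have "v \<bullet> word_vec (gauged_vec G u Bs) Cs = v \<bullet> word_vec ?X (Cs @ [B]) + a * (v \<bullet> word_vec u (Cs @ [B]))"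
      using v word_vec_carrier[OF X, of "Cs @ [B]"] word_vec_carrier[OF u, of "Cs @ [B]"] car
      by (simp add: scalar_prod_add_distrib[of _ n])
    moreover have "v \<bullet> word_vec ?X (Cs @ [B]) = word_form u v ((Cs @ [B]) @ C # Bs')"
      using less.hyps[of "C # Bs'" "Cs @ [B]"] 1 Bs by simp
    moreover have "v \<bullet> word_vec u (Cs @ [B]) = 0"
      using zero[of "Cs @ [B]"] 1 Bs by (simp add: word_form_def)
    ultimately show ?thesis by (simp add: Bs)
  qed (use 1 in \<open>auto simp: word_form_def word_vec_append\<close>)
qed

lemma word_vec_conjugate:
  assumes u: "u \<in> carrier_vec n" and P: "P \<in> carrier_mat n n" and Q: "Q \<in> carrier_mat n n"
    and Qu: "Q *\<^sub>v u = q \<cdot>\<^sub>v u"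
  shows "set Bs \<subseteq> carrier_mat n n \<Longrightarrow> Bs \<noteq> [] \<Longrightarrow>
    word_vec u (map (\<lambda>B. P * B * Q) Bs) = q \<cdot>\<^sub>v (P *\<^sub>v gauged_vec (Q * P) u Bs)"
proof (induction Bs rule: induct_list012)
  case (2 B)
  hence B: "B \<in> carrier_mat n n" by simp
  have "(P * B * Q) *\<^sub>v u = P *\<^sub>v (B *\<^sub>v (Q *\<^sub>v u))"
    using P Q B u by (simp add: assoc_mult_mat_vec[of _ n n _ n])
  also have "\<dots> = q \<cdot>\<^sub>v (P *\<^sub>v (B *\<^sub>v u))"
    unfolding Qu using P B u by (simp add: mult_mat_vec[of _ n n])
  finally show ?case by simp
next
  case (3 B C Bs)
  let ?X = "gauged_vec (Q * P) u (C # Bs)"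
  have car: "B \<in> carrier_mat n n" "set (C # Bs) \<subseteq> carrier_mat n n" using 3(3) by auto
  have X: "?X \<in> carrier_vec n" using gauged_vec_carrier[OF _ u car(2), of "Q * P"] P Q by simp
  have "word_vec u (map (\<lambda>B. P * B * Q) (C # Bs)) = q \<cdot>\<^sub>v (P *\<^sub>v ?X)"
    using 3(2)[OF car(2)] by simp
  hence "word_vec u (map (\<lambda>B. P * B * Q) (B # C # Bs)) = (P * B * Q) *\<^sub>v (q \<cdot>\<^sub>v (P *\<^sub>v ?X))" by simp
  also have "\<dots> = q \<cdot>\<^sub>v (P *\<^sub>v (B *\<^sub>v ((Q * P) *\<^sub>v ?X)))"
    using P Q car(1) X by (simp add: assoc_mult_mat_vec[of _ n n _ n] mult_mat_vec[of _ n n])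
  finally show ?case by simp
qed simp

lemma outer_mult_vec:
  assumes "u \<in> carrier_vec n" "v \<in> carrier_vec n" "x \<in> carrier_vec n"
  shows "outer n u v *\<^sub>v x = (v \<bullet> x) \<cdot>\<^sub>v u"
  using assms by (intro eq_vecI) (auto simp: scalar_prod_def sum_distrib_right sum_distrib_left mult_ac)

lemma one_minus_outer_mult_vec:
  assumes "u \<in> carrier_vec n" "v \<in> carrier_vec n" "x \<in> carrier_vec n"
  shows "(1\<^sub>m n - outer n u v) *\<^sub>v x = x - (v \<bullet> x) \<cdot>\<^sub>v u"
  using assms by (simp add: minus_mult_distrib_mat_vec[of _ n n] outer_mult_vec)

text \<open>From \<open>P * \<Lambda> * Q = \<Lambda>\<close>, the kernel of
  \<open>\<Lambda>\<close>, spanned by \<open>u\<close>, is preserved by \<open>Q\<close>, and the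
  left kernel, spanned by \<open>v\<close>, by the transpose of \<open>P\<close>. On the range of
  \<open>\<Lambda>\<close> the product \<open>Q * P\<close> is the identity modulo \<open>u\<close>;
  \<open>\<psi>\<close> records its defect at \<open>u\<close>.\<close>

lemma gauge_factors:
  assumes u: "u \<in> carrier_vec n" and v: "v \<in> carrier_vec n" and vu: "v \<bullet> u = 1"
    and P: "P \<in> carrier_mat n n" "det P \<noteq> 0" and Q: "Q \<in> carrier_mat n n" "det Q \<noteq> 0"
    and L: "\<Lambda> = 1\<^sub>m n - outer n u v" and PLQ: "P * \<Lambda> * Q = \<Lambda>"
  shows "\<exists>p q \<psi>. P\<^sup>T *\<^sub>v v = p \<cdot>\<^sub>v v \<and> Q *\<^sub>v u = q \<cdot>\<^sub>v u \<and> det P * det Q = p * q \<and> \<psi> \<in> carrier_vec n \<and>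
    (\<forall>x\<in>carrier_vec n. \<exists>a. (Q * P) *\<^sub>v x = x + a \<cdot>\<^sub>v u + (v \<bullet> x) \<cdot>\<^sub>v \<psi>)"
proof -
  have LC: "\<Lambda> \<in> carrier_mat n n" unfolding L by (rule minus_carrier_mat) simp
  have Lx: "\<Lambda> *\<^sub>v x = x - (v \<bullet> x) \<cdot>\<^sub>v u" if "x \<in> carrier_vec n" for x
    unfolding L using one_minus_outer_mult_vec[OF u v that] .
  obtain P' where P': "P' \<in> carrier_mat n n" "P * P' = 1\<^sub>m n" "P' * P = 1\<^sub>m n"
    using obtain_inverse_mat[OF P] by blast
  obtain Q' where Q': "Q' \<in> carrier_mat n n" "Q * Q' = 1\<^sub>m n" "Q' * Q = 1\<^sub>m n"
    using obtain_inverse_mat[OF Q] by blast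
  note assoc = assoc_mult_mat[of _ n n _ n _ n]
  have vL: "v \<bullet> (\<Lambda> *\<^sub>v x) = 0" if x: "x \<in> carrier_vec n" for x
    using u v x vu by (simp add: Lx scalar_prod_minus_distrib[of _ n])
  have ker: "x = (v \<bullet> x) \<cdot>\<^sub>v u" if x: "x \<in> carrier_vec n" and "\<Lambda> *\<^sub>v x = 0\<^sub>v n" for x
  proof (rule eq_vecI)
    fix i assume "i < dim_vec ((v \<bullet> x) \<cdot>\<^sub>v u)"
    hence i: "i < n" using u by simp
    have "(x - (v \<bullet> x) \<cdot>\<^sub>v u) $ i = 0" using that Lx[OF x] i by simp
    thus "x $ i = ((v \<bullet> x) \<cdot>\<^sub>v u) $ i" using i u x by simp
  qed (use x u in simp)
  have LQ: "\<Lambda> * Q = P' * \<Lambda>"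
  proof -
    have "P' * (P * \<Lambda> * Q) = (P' * P) * \<Lambda> * Q" using P'(1) P Q LC by (simp add: assoc)
    also have "\<dots> = \<Lambda> * Q" using P'(3) LC Q by simp
    finally show ?thesis using PLQ by simp
  qed
  have PL: "P * \<Lambda> = \<Lambda> * Q'"
  proof -
    have "(P * \<Lambda> * Q) * Q' = P * \<Lambda> * (Q * Q')" using P Q Q'(1) LC by (simp add: assoc)
    also have "\<dots> = P * \<Lambda>" using Q'(2) LC P by simp
    finally show ?thesis using PLQ by simp
  qed
  have Qu: "Q *\<^sub>v u = (v \<bullet> (Q *\<^sub>v u)) \<cdot>\<^sub>v u"
  proof (rule ker)
    show "Q *\<^sub>v u \<in> carrier_vec n" using Q u by simp
    have "\<Lambda> *\<^sub>v (Q *\<^sub>v u) = (\<Lambda> * Q) *\<^sub>v u" using LC Q u by (simp add: assoc_mult_mat_vec[of _ n n _ n])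
    also have "\<dots> = P' *\<^sub>v (\<Lambda> *\<^sub>v u)" unfolding LQ using LC P' u by (simp add: assoc_mult_mat_vec[of _ n n _ n])
    also have "\<Lambda> *\<^sub>v u = 0\<^sub>v n" using Lx[OF u] vu u by (intro eq_vecI) auto
    also have "P' *\<^sub>v 0\<^sub>v n = 0\<^sub>v n" using P'(1) by (intro eq_vecI) auto
    finally show "\<Lambda> *\<^sub>v (Q *\<^sub>v u) = 0\<^sub>v n" .
  qed
  define w where "w = P\<^sup>T *\<^sub>v v"
  have w: "w \<in> carrier_vec n" using P v by (simp add: w_def)
  have wx: "w \<bullet> x = v \<bullet> (P *\<^sub>v x)" if "x \<in> carrier_vec n" for x
    unfolding w_def using transpose_vec_mult_scalar[OF P(1) that v] .
  have wL: "w \<bullet> x = (v \<bullet> x) * (w \<bullet> u)" if x: "x \<in> carrier_vec n" for x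
  proof -
    have "w \<bullet> (\<Lambda> *\<^sub>v x) = v \<bullet> ((P * \<Lambda>) *\<^sub>v x)" using wx[of "\<Lambda> *\<^sub>v x"] x LC P by (simp add: assoc_mult_mat_vec[of _ n n _ n])
    also have "\<dots> = v \<bullet> (\<Lambda> *\<^sub>v (Q' *\<^sub>v x))" unfolding PL using x LC Q' by (simp add: assoc_mult_mat_vec[of _ n n _ n])
    also have "\<dots> = 0" using vL[of "Q' *\<^sub>v x"] Q' x by simp
    finally show ?thesis using w u x by (simp add: Lx scalar_prod_minus_distrib[of _ n])
  qed
  have Pv: "P\<^sup>T *\<^sub>v v = (w \<bullet> u) \<cdot>\<^sub>v v"
  proof (rule eq_vecI)
    fix i assume "i < dim_vec ((w \<bullet> u) \<cdot>\<^sub>v v)"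
    hence i: "i < n" using v by simp
    have "w \<bullet> unit_vec n i = w $ i" "v \<bullet> unit_vec n i = v $ i" using w v i by auto
    thus "(P\<^sup>T *\<^sub>v v) $ i = ((w \<bullet> u) \<cdot>\<^sub>v v) $ i" using wL[of "unit_vec n i"] i v by (simp add: w_def mult.commute)
  qed (use P v in simp)
  \<comment> \<open>\<open>\<Lambda> + outer n u v\<close> is the identity, so \<open>P * Q\<close>
    equals \<open>\<Lambda>\<close> plus one outer product, and the determinant of such a sum is
    known.\<close>
  have dets: "det P * det Q = (w \<bullet> u) * (v \<bullet> (Q *\<^sub>v u))"
  proof -
    have "P * (1 \<cdot>\<^sub>m \<Lambda> + outer n u v) * Q = 1 \<cdot>\<^sub>m (P * \<Lambda> * Q) + P * outer n u v * Q"
      by (rule mult_add_mult_distrib_mat[OF P(1) Q(1) LC outer_carrier])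
    also have "P * outer n u v * Q = outer n (P *\<^sub>v u) (Q\<^sup>T *\<^sub>v v)"
      by (rule mult_outer_mult[OF P(1) Q(1) u v])
    also have "1 \<cdot>\<^sub>m \<Lambda> + outer n u v = 1\<^sub>m n" unfolding L by (intro eq_matI) auto
    finally have "P * Q = 1\<^sub>m n - outer n u v + outer n (P *\<^sub>v u) (Q\<^sup>T *\<^sub>v v)"
      using PLQ P Q by (simp add: L)
    hence "det (P * Q) = (v \<bullet> (P *\<^sub>v u)) * ((Q\<^sup>T *\<^sub>v v) \<bullet> u)"
      using det_one_minus_outer_plus_outer[OF u v, of "P *\<^sub>v u" "Q\<^sup>T *\<^sub>v v"] P Q u v vu by simp
    thus ?thesis using wx[OF u] transpose_vec_mult_scalar[OF Q(1) u v] det_mult[OF P(1) Q(1)] by simp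
  qed
  define \<psi> where "\<psi> = (Q * P) *\<^sub>v u - u"
  have "\<exists>a. (Q * P) *\<^sub>v x = x + a \<cdot>\<^sub>v u + (v \<bullet> x) \<cdot>\<^sub>v \<psi>" if x: "x \<in> carrier_vec n" for x
  proof -
    let ?G = "Q * P" and ?y = "\<Lambda> *\<^sub>v x"
    have G: "?G \<in> carrier_mat n n" using P Q by simp
    have y: "?y \<in> carrier_vec n" using LC x by simp
    have LL: "\<Lambda> * \<Lambda> = \<Lambda>"
    proof -
      have "\<Lambda> * \<Lambda> = \<Lambda> * 1\<^sub>m n - \<Lambda> * outer n u v"
        by (subst (2) L) (rule mult_minus_distrib_mat[OF LC one_carrier_mat outer_carrier])
      also have "\<Lambda> * outer n u v = 0\<^sub>m n n"
      proof -
        have "\<Lambda> *\<^sub>v u = 0\<^sub>v n" using Lx[OF u] vu u by (intro eq_vecI) auto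
        moreover have "\<Lambda> * outer n u v * 1\<^sub>m n = outer n (\<Lambda> *\<^sub>v u) ((1\<^sub>m n)\<^sup>T *\<^sub>v v)"
          by (rule mult_outer_mult[OF LC one_carrier_mat u v])
        moreover have "\<Lambda> * outer n u v * 1\<^sub>m n = \<Lambda> * outer n u v"
          by (rule right_mult_one_mat[of _ n n]) (use LC in simp)
        ultimately show ?thesis by (simp only: outer_zero(1))
      qed
      finally show ?thesis using LC by (simp add: minus_r_inv_mat) (intro eq_matI; auto)
    qed
    \<comment> \<open>As \<open>\<Lambda>\<close> is idempotent,
      \<open>\<Lambda> * (?G * \<Lambda>)\<close> collapses to \<open>\<Lambda>\<close>; this says
      that \<open>?G\<close> fixes the range of \<open>\<Lambda>\<close> modulo
      \<open>u\<close>.\<close>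
    have "\<Lambda> * (?G * \<Lambda>) = (\<Lambda> * Q) * (P * \<Lambda>)" using P Q LC by (simp add: assoc)
    also have "\<dots> = P' * (\<Lambda> * \<Lambda>) * Q'" unfolding LQ PL using P'(1) Q'(1) LC by (simp add: assoc)
    also have "\<dots> = P' * (P * \<Lambda>) " unfolding LL PL using P'(1) Q'(1) LC by (simp add: assoc)
    also have "\<dots> = (P' * P) * \<Lambda>" using P'(1) P LC by (simp add: assoc)
    also have "\<dots> = \<Lambda>" using P'(3) LC by simp
    finally have LGL: "\<Lambda> * (?G * \<Lambda>) = \<Lambda>" .
    have "\<Lambda> *\<^sub>v (?G *\<^sub>v ?y) = (\<Lambda> * (?G * \<Lambda>)) *\<^sub>v x"
      using LC G x by (simp add: assoc_mult_mat_vec[of _ n n _ n])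
    hence e1: "?G *\<^sub>v ?y - (v \<bullet> (?G *\<^sub>v ?y)) \<cdot>\<^sub>v u = ?y" using Lx[of "?G *\<^sub>v ?y"] G y LGL by simp
    have e2: "x = ?y + (v \<bullet> x) \<cdot>\<^sub>v u" using Lx[OF x] x u by (intro eq_vecI) auto
    have "?G *\<^sub>v x = ?G *\<^sub>v ?y + (v \<bullet> x) \<cdot>\<^sub>v (?G *\<^sub>v u)"
    proof -
      have "?G *\<^sub>v (?y + (v \<bullet> x) \<cdot>\<^sub>v u) = ?G *\<^sub>v ?y + (v \<bullet> x) \<cdot>\<^sub>v (?G *\<^sub>v u)"
        using G y u by (simp add: mult_add_distrib_mat_vec[of _ n n] mult_mat_vec[of _ n n])
      thus ?thesis using e2 by simp
    qed
    have "?G *\<^sub>v x = x + (v \<bullet> (?G *\<^sub>v ?y)) \<cdot>\<^sub>v u + (v \<bullet> x) \<cdot>\<^sub>v \<psi>"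
    proof (rule eq_vecI)
      fix i assume "i < dim_vec (x + (v \<bullet> (?G *\<^sub>v ?y)) \<cdot>\<^sub>v u + (v \<bullet> x) \<cdot>\<^sub>v \<psi>)"
      hence i: "i < n" using u by (simp add: \<psi>_def)
      note car = carrier_vecD[OF u] carrier_vecD[OF x] carrier_vecD[OF y] carrier_matD[OF G]
      have "(?G *\<^sub>v x) $ i = (?G *\<^sub>v ?y + (v \<bullet> x) \<cdot>\<^sub>v (?G *\<^sub>v u)) $ i"
        by (rule arg_cong[where f = "\<lambda>w. w $ i"]) fact
      hence 1: "(?G *\<^sub>v x) $ i = (?G *\<^sub>v ?y) $ i + (v \<bullet> x) * (?G *\<^sub>v u) $ i"
        using i car by (simp del: index_mult_mat_vec)
      have 2: "(?G *\<^sub>v ?y) $ i - (v \<bullet> (?G *\<^sub>v ?y)) * u $ i = ?y $ i"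
        using arg_cong[OF e1, of "\<lambda>w. w $ i"] i car by (simp del: index_mult_mat_vec)
      have "x $ i = (?y + (v \<bullet> x) \<cdot>\<^sub>v u) $ i"
        by (rule arg_cong[where f = "\<lambda>w. w $ i"]) (rule e2)
      hence 3: "x $ i = ?y $ i + (v \<bullet> x) * u $ i" using i car by (simp del: index_mult_mat_vec)
      have "(x + (v \<bullet> (?G *\<^sub>v ?y)) \<cdot>\<^sub>v u + (v \<bullet> x) \<cdot>\<^sub>v \<psi>) $ i
          = x $ i + (v \<bullet> (?G *\<^sub>v ?y)) * u $ i + (v \<bullet> x) * ((?G *\<^sub>v u) $ i - u $ i)"
        unfolding \<psi>_def using i car by (simp del: index_mult_mat_vec)
      also have "\<dots> = (?G *\<^sub>v x) $ i" using 1 2 3 by (simp add: algebra_simps del: index_mult_mat_vec)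
      finally show "(?G *\<^sub>v x) $ i = (x + (v \<bullet> (?G *\<^sub>v ?y)) \<cdot>\<^sub>v u + (v \<bullet> x) \<cdot>\<^sub>v \<psi>) $ i" by (rule sym)
    qed (use P Q x u in \<open>simp add: \<psi>_def\<close>)
    thus ?thesis by blast
  qed
  thus ?thesis using Pv Qu dets u P Q by (intro exI[of _ "w \<bullet> u"] exI[of _ "v \<bullet> (Q *\<^sub>v u)"] exI[of _ \<psi>]) (auto simp: \<psi>_def)
qed

lemma smult_mat_mult_vec:
  fixes B :: "complex mat"
  assumes "B \<in> carrier_mat n n" "x \<in> carrier_vec n"
  shows "(z \<cdot>\<^sub>m B) *\<^sub>v x = z \<cdot>\<^sub>v (B *\<^sub>v x)"
  using assms by (intro eq_vecI) (auto simp: scalar_prod_def sum_distrib_left mult_ac)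

text \<open>If the forms of degrees 1 to \<open>m\<close> vanished,
  \<open>1\<^sub>m n - outer n u v + z \<cdot>\<^sub>m B\<close> would map the truncated Neumann
  series, the sum of \<open>(- z) ^ r\<close> times \<open>B\<close> applied \<open>r\<close> times
  to \<open>u\<close>, to a multiple of \<open>z ^ (m + 1)\<close>. Cramer's rule with a determinant
  of order \<open>z ^ m\<close> then makes a chosen coordinate of the series vanish at 0, where the
  series is \<open>u\<close>.\<close>

lemma word_form_powers_nonzero:
  fixes e :: complex
  assumes u: "u \<in> carrier_vec n" and v: "v \<in> carrier_vec n" and vu: "v \<bullet> u = 1"
    and B: "B \<in> carrier_mat n n" and e: "e \<noteq> 0"
    and det: "\<And>z. det (1\<^sub>m n - outer n u v + z \<cdot>\<^sub>m B) = e * z ^ m"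
  shows "\<exists>r. 1 \<le> r \<and> r \<le> m \<and> word_form u v (replicate r B) \<noteq> 0"
proof (rule ccontr)
  assume no: "\<not> ?thesis"
  define w where "w r = word_vec u (replicate r B)" for r
  have w0: "w 0 = u" and wS: "w (Suc r) = B *\<^sub>v w r" for r by (simp_all add: w_def)
  have wC: "w r \<in> carrier_vec n" for r unfolding w_def by (rule word_vec_carrier[OF u]) (use B in auto)
  have vw: "v \<bullet> w r = 0" if "1 \<le> r" "r \<le> m" for r
    using no that by (auto simp: word_form_def w_def)
  have "u \<noteq> 0\<^sub>v n" using vu v by auto
  then obtain k where k: "k < n" "u $ k \<noteq> 0"
    using u by (metis (no_types, lifting) carrier_vecD eq_vecI index_zero_vec)
  define s where "s z i = (\<Sum>r\<le>m. (- z) ^ r * w r $ i)" for z i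
  define sv where "sv z = vec n (s z)" for z
  define N where "N z = 1\<^sub>m n - outer n u v + z \<cdot>\<^sub>m B" for z
  have NC: "N z \<in> carrier_mat n n" for z unfolding N_def using B by (auto intro: minus_carrier_mat)
  \<comment> \<open>Only the term of degree 0 pairs with \<open>v\<close>, so the rank one part of
    \<open>N z\<close> subtracts exactly \<open>u\<close> and the remaining sums telescope.\<close>
  have vs: "v \<bullet> sv z = 1" for z
  proof -
    have "v \<bullet> sv z = (\<Sum>i<n. v $ i * (\<Sum>r\<le>m. (- z) ^ r * w r $ i))"
      by (simp add: sv_def s_def scalar_prod_def atLeast0LessThan)
    also have "\<dots> = (\<Sum>r\<le>m. (- z) ^ r * (v \<bullet> w r))"
      using carrier_vecD[OF wC] unfolding sum_distrib_left scalar_prod_def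
      by (subst sum.swap) (simp add: atLeast0LessThan mult_ac)
    also have "\<dots> = (- z) ^ 0 * (v \<bullet> w 0)"
      by (rule sum_eq_at) (auto simp: vw)
    finally show ?thesis using vu by (simp add: w0)
  qed
  have Bs: "(B *\<^sub>v sv z) $ i = (\<Sum>r\<le>m. (- z) ^ r * w (Suc r) $ i)" if i: "i < n" for z i
  proof -
    have "(B *\<^sub>v sv z) $ i = (\<Sum>j<n. B $$ (i, j) * (\<Sum>r\<le>m. (- z) ^ r * w r $ j))"
      using i B by (simp add: sv_def s_def scalar_prod_def atLeast0LessThan)
    also have "\<dots> = (\<Sum>r\<le>m. (- z) ^ r * (\<Sum>j<n. B $$ (i, j) * w r $ j))"
      unfolding sum_distrib_left by (subst sum.swap) (simp add: mult_ac)
    also have "\<dots> = (\<Sum>r\<le>m. (- z) ^ r * w (Suc r) $ i)"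
      using i B carrier_vecD[OF wC] by (simp add: wS scalar_prod_def atLeast0LessThan)
    finally show ?thesis .
  qed
  have Ns: "N z *\<^sub>v sv z = (- ((- z) ^ Suc m)) \<cdot>\<^sub>v w (Suc m)" for z
  proof (rule eq_vecI)
    fix i assume "i < dim_vec ((- ((- z) ^ Suc m)) \<cdot>\<^sub>v w (Suc m))"
    hence i: "i < n" using carrier_vecD[OF wC] by simp
    have svC: "sv z \<in> carrier_vec n" by (simp add: sv_def)
    have LC: "1\<^sub>m n - outer n u v \<in> carrier_mat n n" by (auto intro: minus_carrier_mat)
    have Nsv: "N z *\<^sub>v sv z = (sv z - (v \<bullet> sv z) \<cdot>\<^sub>v u) + z \<cdot>\<^sub>v (B *\<^sub>v sv z)"
      unfolding N_def using add_mult_distrib_mat_vec[OF LC smult_carrier_mat[OF B] svC]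
        one_minus_outer_mult_vec[OF u v svC] smult_mat_mult_vec[OF B svC] by simp
    have "(N z *\<^sub>v sv z) $ i = s z i - u $ i + z * (B *\<^sub>v sv z) $ i"
      unfolding Nsv vs using i u B by (simp add: sv_def del: index_mult_mat_vec)
    also have "\<dots> = (\<Sum>r\<le>m. (- z) ^ r * w r $ i) - u $ i - (\<Sum>r\<le>m. (- z) ^ Suc r * w (Suc r) $ i)"
      unfolding Bs[OF i] s_def by (simp add: sum_distrib_left sum_negf[symmetric] mult_ac)
    also have "\<dots> = - ((- z) ^ Suc m * w (Suc m) $ i)"
    proof -
      define a where "a r = (- z) ^ r * w r $ i" for r
      have "sum a {..m} - (\<Sum>r\<le>m. a (Suc r)) = a 0 - a (Suc m)"
        using sum_telescope[of a m] by (simp add: sum_subtractf)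
      moreover have "a 0 = u $ i" by (simp add: a_def w0)
      ultimately show ?thesis unfolding a_def[symmetric] by (simp add: algebra_simps)
    qed
    finally show "(N z *\<^sub>v sv z) $ i = ((- ((- z) ^ Suc m)) \<cdot>\<^sub>v w (Suc m)) $ i"
      using i carrier_vecD[OF wC[of "Suc m"]] by simp
  qed (use NC[of z] carrier_vecD[OF wC] in \<open>simp add: sv_def\<close>)
  define h where "h z = det (replace_col (N z) (w (Suc m)) k)" for z
  have eq: "e * s z k = (- 1) ^ m * z * h z" if z: "z \<noteq> 0" for z
  proof -
    let ?c = "- ((- z) ^ Suc m)"
    have c: "?c \<noteq> 0" using z by simp
    have svC: "(1 / ?c) \<cdot>\<^sub>v sv z \<in> carrier_vec n" by (simp add: sv_def)
    have "N z *\<^sub>v ((1 / ?c) \<cdot>\<^sub>v sv z) = (1 / ?c) \<cdot>\<^sub>v (?c \<cdot>\<^sub>v w (Suc m))"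
      unfolding Ns[symmetric] by (rule mult_mat_vec[OF NC]) (simp add: sv_def)
    also have "\<dots> = w (Suc m)" using c by (simp add: smult_smult_assoc)
    finally have Nx: "N z *\<^sub>v ((1 / ?c) \<cdot>\<^sub>v sv z) = w (Suc m)" .
    have "h z = ((1 / ?c) \<cdot>\<^sub>v sv z) $ k * det (N z)"
      using cramer_lemma_mat[OF NC[of z] svC k(1)] unfolding Nx h_def .
    also have "\<dots> = s z k / ?c * (e * z ^ m)" using k(1) det by (simp add: sv_def N_def)
    finally have "h z * ?c = s z k * e * z ^ m" using c by (simp add: field_simps)
    moreover have "?c = (- 1) ^ m * z * z ^ m" by (simp add: power_minus[of z])
    ultimately have "(h z * (- 1) ^ m * z) * z ^ m = (s z k * e) * z ^ m" by (simp only: mult_ac)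
    hence "h z * (- 1) ^ m * z = s z k * e" using z by simp
    thus ?thesis by (simp add: mult_ac)
  qed
  \<comment> \<open>The identity \<open>eq\<close> holds for nonzero \<open>z\<close>; continuity
    carries it to 0, where its right side vanishes.\<close>
  have "isCont (\<lambda>z. e * s z k) 0" unfolding s_def by (intro continuous_intros)
  moreover have "isCont (\<lambda>z. (- 1) ^ m * z * h z) 0"
  proof -
    have "h z = (\<Sum>p\<in>{p. p permutes {0..<n}}. signof p * (\<Prod>i = 0..<n.
      if p i = k then w (Suc m) $ i else (1\<^sub>m n - outer n u v) $$ (i, p i) + z * B $$ (i, p i)))" for z
    proof -
      have C: "replace_col (N z) (w (Suc m)) k \<in> carrier_mat n n" using NC[of z] by (auto simp: replace_col_def)
      have "replace_col (N z) (w (Suc m)) k $$ (i, p i)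
        = (if p i = k then w (Suc m) $ i else (1\<^sub>m n - outer n u v) $$ (i, p i) + z * B $$ (i, p i))"
        if "p permutes {0..<n}" "i < n" for p i
      proof -
        have "p i < n" using permutes_in_image[OF that(1), of i] that(2) by simp
        thus ?thesis using that NC[of z] B by (auto simp: replace_col_def N_def)
      qed
      thus ?thesis unfolding h_def det_def'[OF C] by (intro sum.cong arg_cong2[where f = "(*)"] prod.cong) auto
    qed
    hence h: "h = (\<lambda>z. \<Sum>p\<in>{p. p permutes {0..<n}}. signof p * (\<Prod>i = 0..<n.
      if p i = k then w (Suc m) $ i else (1\<^sub>m n - outer n u v) $$ (i, p i) + z * B $$ (i, p i)))" by (rule ext)
    have "isCont (\<lambda>z. if p i = k then w (Suc m) $ i else (1\<^sub>m n - outer n u v) $$ (i, p i) + z * B $$ (i, p i)) 0" for p i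
      by (cases "p i = k") (auto intro!: continuous_intros)
    thus ?thesis unfolding h by (intro continuous_intros)
  qed
  ultimately have "(\<lambda>z. e * s z k) \<midarrow>0\<rightarrow> e * s 0 k" "(\<lambda>z. (- 1) ^ m * z * h z) \<midarrow>0\<rightarrow> (- 1) ^ m * 0 * h 0"
    by (simp_all add: isCont_def)
  moreover have "(\<lambda>z. e * s z k) \<midarrow>0\<rightarrow> L \<longleftrightarrow> (\<lambda>z. (- 1) ^ m * z * h z) \<midarrow>0\<rightarrow> L" for L
    by (intro LIM_cong) (auto simp: eq)
  ultimately have "e * s 0 k = (- 1) ^ m * 0 * h 0" using LIM_unique by blast
  hence "s 0 k = 0" using e by simp
  moreover have "s 0 k = u $ k" unfolding s_def
    using sum_eq_at[of "{..m}" 0 "\<lambda>r. (- 0) ^ r * w r $ k"] by (simp add: w0)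
  ultimately show False using k by simp
qed

section \<open>Permutation actions and the transitivity of their squares\<close>

text \<open>Indices are pulled back, so the inverse permutations are needed to move the matrix unit
  at \<open>(i, j)\<close> to \<open>(f i, g j)\<close>.\<close>

definition perm_act :: "nat \<Rightarrow> (nat \<Rightarrow> nat) \<Rightarrow> (nat \<Rightarrow> nat) \<Rightarrow> complex mat \<Rightarrow> complex mat" where
  "perm_act m f g y = mat m m (\<lambda>(i, j). y $$ (f i, g j))"

lemma perm_act_carrier [simp]: "perm_act m f g y \<in> carrier_mat m m"
  by (simp add: perm_act_def)

lemma perm_act_unit_mat:
  assumes "f permutes {0..<m}" "g permutes {0..<m}"
  shows "perm_act m (inv_into UNIV f) (inv_into UNIV g) (unit_mat m i j) = unit_mat m (f i) (g j)"
proof (rule eq_matI)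
  fix a b assume "a < dim_row (unit_mat m (f i) (g j))" "b < dim_col (unit_mat m (f i) (g j))"
  hence ab: "a < m" "b < m" by auto
  have "inv_into UNIV f a < m" "inv_into UNIV g b < m"
    using permutes_in_image[OF permutes_inv[OF assms(1)], of a] permutes_in_image[OF permutes_inv[OF assms(2)], of b] ab by auto
  moreover have "inv_into UNIV f a = i \<longleftrightarrow> a = f i" "inv_into UNIV g b = j \<longleftrightarrow> b = g j"
    using permutes_inverses[OF assms(1)] permutes_inverses[OF assms(2)] by metis+
  ultimately show "perm_act m (inv_into UNIV f) (inv_into UNIV g) (unit_mat m i j) $$ (a, b) = unit_mat m (f i) (g j) $$ (a, b)"
    using ab by (simp add: perm_act_def)
qed (auto simp: perm_act_def)

text \<open>A 3-cycle is the square of its inverse. A third point \<open>z\<close> completes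
  \<open>x\<close> and \<open>y\<close> to a cycle, and whether \<open>z\<close> lies in
  \<open>I\<close> decides its direction.\<close>

lemma square_exchange:
  fixes m :: nat
  assumes I: "I \<subseteq> {0..<m}" and x: "x \<in> I" and y: "y < m" "y \<notin> I" and m: "m \<ge> 3"
  shows "\<exists>h. h permutes {0..<m} \<and> (h \<circ> h) ` I = insert y (I - {x})"
proof -
  have xm: "x < m" using I x by auto
  have "\<exists>z<m. z \<noteq> x \<and> z \<noteq> y"
  proof -
    have "\<not> {0..<m} \<subseteq> {x, y}" using card_mono[of "{x, y}" "{0..<m}"] m card_insert_le_m1[of 2 "{y}" x] by auto
    thus ?thesis by auto
  qed
  then obtain z where z: "z < m" "z \<noteq> x" "z \<noteq> y" by blast
  have xy: "x \<noteq> y" using x y by auto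
  define g where "g a b c = Transposition.transpose a b \<circ> Transposition.transpose b (c::nat)" for a b c
  have gp: "g a b c permutes {0..<m}" if "a < m" "b < m" "c < m" for a b c
    unfolding g_def using that by (intro permutes_compose permutes_swap_id) auto
  have gg: "(g a b c \<circ> g a b c) p = (if p = a then c else if p = b then a else if p = c then b else p)"
    if "a \<noteq> b" "b \<noteq> c" "a \<noteq> c" for a b c p
    using that by (auto simp: g_def transpose_def)
  show ?thesis
  proof (cases "z \<in> I")
    case True
    have "(g x y z \<circ> g x y z) ` I = insert y (I - {x})"
      using gg[of x y z] xy z x y True by (auto simp: image_iff simp del: comp_apply)
    thus ?thesis using gp[of x y z] xm y z by blast
  next
    case False
    have "(g x z y \<circ> g x z y) ` I = insert y (I - {x})"
      using gg[of x z y] xy z x y False by (auto simp: image_iff simp del: comp_apply)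
    thus ?thesis using gp[of x z y] xm y z by blast
  qed
qed

text \<open>Squares of permutations generate the alternating group, which is still transitive on
  subsets of a given size.\<close>

lemma subset_square_induct:
  fixes m :: nat
  assumes m: "m \<ge> 3" and I: "I \<subseteq> {0..<m}" and I0: "I0 \<subseteq> {0..<m}" and card: "card I0 = card I"
    and base: "Q I0" and step: "\<And>h I. h permutes {0..<m} \<Longrightarrow> Q I \<Longrightarrow> Q ((h \<circ> h) ` I)"
  shows "Q I"
  using I0 card base
proof (induction "card (I - I0)" arbitrary: I0)
  case 0
  have "finite I" using I finite_subset by blast
  hence "I \<subseteq> I0" using 0 by auto
  hence "I = I0" using 0 card_subset_eq[of I0 I] finite_subset[of I0 "{0..<m}"] by auto
  thus ?case using 0 by simp
next
  case (Suc k)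
  have fin: "finite I" "finite I0" using I Suc.prems(1) finite_subset by blast+
  have "I - I0 \<noteq> {}" using Suc.hyps(2) by (metis card.empty nat.distinct(1))
  then obtain y where y: "y \<in> I" "y \<notin> I0" by blast
  have "\<not> I0 \<subseteq> I" using card_subset_eq[of I I0] fin Suc.prems(2) y by auto
  then obtain x where x: "x \<in> I0" "x \<notin> I" by blast
  have "y < m" using y I by auto
  then obtain h where h: "h permutes {0..<m}" "(h \<circ> h) ` I0 = insert y (I0 - {x})"
    using square_exchange[OF Suc.prems(1) x(1) _ y(2) m] by blast
  have e: "I - insert y (I0 - {x}) = (I - I0) - {y}" using x y by auto
  have "k = card (I - insert y (I0 - {x}))" using Suc.hyps(2) y fin unfolding e by simp
  moreover have "insert y (I0 - {x}) \<subseteq> {0..<m}" using Suc.prems(1) I y by auto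
  moreover have "card (insert y (I0 - {x})) = card I"
    using x y fin Suc.prems(2) card_Suc_Diff1[OF fin(2) x(1)] by simp
  moreover have "Q (insert y (I0 - {x}))" using step[OF h(1) Suc.prems(3)] h(2) by simp
  ultimately show ?case by (rule Suc.hyps(1))
qed

text \<open>Multilinearity in the letters: a form that vanishes on all words in matrix units
  vanishes on all words. The prefix \<open>Cs\<close> collects the units already chosen for earlier
  letters.\<close>

lemma word_form_basis_expansion:
  assumes lin: "linear_map class_ring (Mat m) (Mat n) A" and u: "u \<in> carrier_vec n" and v: "v \<in> carrier_vec n"
  shows "set Cs \<subseteq> carrier_mat n n \<Longrightarrow> set ys \<subseteq> carrier_mat m m \<Longrightarrow>
    (\<And>ws. length ws = length ys \<Longrightarrow> set ws \<subseteq> {..<m} \<times> {..<m} \<Longrightarrow>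
      v \<bullet> word_vec (word_vec u (map (\<lambda>(i, j). A (unit_mat m i j)) ws)) Cs = 0) \<Longrightarrow>
    v \<bullet> word_vec (word_vec u (map A ys)) Cs = 0"
proof (induction ys arbitrary: Cs)
  case Nil
  show ?case using Nil(3)[of "[]"] by simp
next
  case (Cons y ys)
  note lin' = lin[unfolded linear_map_Mat_iff]
  have AC: "A y \<in> carrier_mat n n" if "y \<in> carrier_mat m m" for y using lin' that by blast
  let ?X = "word_vec u (map A ys)"
  have X: "?X \<in> carrier_vec n" by (rule word_vec_carrier[OF u]) (use Cons.prems AC in auto)
  obtain w where w: "w \<in> carrier_vec n" "\<forall>x\<in>carrier_vec n. v \<bullet> word_vec x Cs = w \<bullet> x"
    using word_covec[OF v Cons.prems(1)] by blast
  \<comment> \<open>The scalar-valued linear map is wrapped as a 1 x 1 matrix so that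
    \<open>linear_map_expand\<close> applies.\<close>
  define \<phi> where "\<phi> y = mat 1 1 (\<lambda>_. w \<bullet> (A y *\<^sub>v ?X))" for y
  have "linear_map class_ring (Mat m) (Mat 1) \<phi>"
    unfolding linear_map_Mat_iff
  proof (intro conjI ballI allI)
    fix Y Z :: "complex mat" and c :: complex
    assume Y: "Y \<in> carrier_mat m m" and Z: "Z \<in> carrier_mat m m"
    have "A (Y + Z) = A Y + A Z" using lin' Y Z by blast
    hence "w \<bullet> (A (Y + Z) *\<^sub>v ?X) = w \<bullet> (A Y *\<^sub>v ?X) + w \<bullet> (A Z *\<^sub>v ?X)"
      using AC[OF Y] AC[OF Z] X w(1) by (simp add: add_mult_distrib_mat_vec[of _ n n] scalar_prod_add_distrib[of _ n])
    thus "\<phi> (Y + Z) = \<phi> Y + \<phi> Z" unfolding \<phi>_def by (intro eq_matI) auto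
  next
    fix Y :: "complex mat" and c :: complex
    assume Y: "Y \<in> carrier_mat m m"
    have "A (c \<cdot>\<^sub>m Y) = c \<cdot>\<^sub>m A Y" using lin' Y by blast
    hence "w \<bullet> (A (c \<cdot>\<^sub>m Y) *\<^sub>v ?X) = c * (w \<bullet> (A Y *\<^sub>v ?X))"
      using AC[OF Y] X w(1) by (simp add: smult_mat_mult_vec[of _ n])
    thus "\<phi> (c \<cdot>\<^sub>m Y) = c \<cdot>\<^sub>m \<phi> Y" unfolding \<phi>_def by (intro eq_matI) auto
  qed (simp add: \<phi>_def)
  hence "\<phi> y $$ (0, 0) = (\<Sum>i<m. \<Sum>j<m. y $$ (i, j) * \<phi> (unit_mat m i j) $$ (0, 0))"
    using linear_map_expand[of m 1 \<phi> y 0 0] Cons.prems(2) by simp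
  hence "w \<bullet> (A y *\<^sub>v ?X) = (\<Sum>i<m. \<Sum>j<m. y $$ (i, j) * (w \<bullet> (A (unit_mat m i j) *\<^sub>v ?X)))"
    by (simp add: \<phi>_def)
  also have "\<dots> = 0"
  proof (intro sum.neutral ballI)
    fix i j assume ij: "i \<in> {..<m}" "j \<in> {..<m}"
    have "v \<bullet> word_vec (word_vec u (map A ys)) (Cs @ [A (unit_mat m i j)]) = 0"
    proof (rule Cons.IH)
      fix ws assume ws: "length ws = length ys" "set ws \<subseteq> {..<m} \<times> {..<m}"
      show "v \<bullet> word_vec (word_vec u (map (\<lambda>(i, j). A (unit_mat m i j)) ws)) (Cs @ [A (unit_mat m i j)]) = 0"
        using Cons.prems(3)[of "(i, j) # ws"] ws ij by (simp add: word_vec_append)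
    qed (use Cons.prems AC in auto)
    hence "w \<bullet> (A (unit_mat m i j) *\<^sub>v ?X) = 0"
      using w(2) AC[of "unit_mat m i j"] X by (simp add: word_vec_append)
    thus "y $$ (i, j) * (w \<bullet> (A (unit_mat m i j) *\<^sub>v ?X)) = 0" by simp
  qed
  finally show ?case using w(2) AC[of y] X Cons.prems(2) by simp
qed

lemma word_vec_smult:
  assumes u: "u \<in> carrier_vec n"
  shows "set Bs \<subseteq> carrier_mat n n \<Longrightarrow> length cs = length Bs \<Longrightarrow>
    word_vec u (map2 (\<lambda>c B. c \<cdot>\<^sub>m B) cs Bs) = prod_list cs \<cdot>\<^sub>v word_vec u Bs"
proof (induction Bs arbitrary: cs)
  case Nil thus ?case by simp
next
  case (Cons B Bs)
  then obtain c cs' where cs: "cs = c # cs'" by (cases cs) auto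
  have X: "word_vec u Bs \<in> carrier_vec n" by (rule word_vec_carrier[OF u]) (use Cons.prems in auto)
  have B: "B \<in> carrier_mat n n" using Cons.prems by simp
  have "word_vec u (map2 (\<lambda>c B. c \<cdot>\<^sub>m B) cs' Bs) = prod_list cs' \<cdot>\<^sub>v word_vec u Bs"
    using Cons cs by simp
  thus ?case using B X cs
    by (simp add: smult_mat_mult_vec[of _ n] mult_mat_vec[of _ n n] smult_smult_assoc mult.commute)
qed

lemma prod_list_wt:
  assumes "set ws \<subseteq> {..<m} \<times> {..<m}"
  shows "prod_list (map (\<lambda>(i, j). t i * s j) ws) = wt m t s (count_list (map fst ws)) (count_list (map snd ws))"
  using assms
proof (induction ws)
  case (Cons p ws)
  obtain i j where p: "p = (i, j)" by force
  have ij: "i < m" "j < m" using Cons.prems p by auto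
  have "(\<Prod>k<m. (x k :: complex) ^ (count_list (a # l) k)) = x a * (\<Prod>k<m. x k ^ count_list l k)" if "a < m" for a x l
    using that by (simp add: prod.remove[of "{..<m}" a] mult_ac cong: prod.cong_simp)
  thus ?case using Cons p ij by (simp add: wt_def mult_ac)
qed (simp add: wt_def)

section \<open>The lower bound\<close>

definition liftable :: "nat \<Rightarrow> nat \<Rightarrow> complex mat \<Rightarrow> (complex mat \<Rightarrow> complex mat) \<Rightarrow> (complex mat \<Rightarrow> complex mat) \<Rightarrow> bool" where
  "liftable m n \<Lambda> A \<sigma> \<longleftrightarrow> (\<exists>P Q. P \<in> carrier_mat n n \<and> det P \<noteq> 0 \<and> Q \<in> carrier_mat n n \<and> det Q \<noteq> 0 \<and>
     P * \<Lambda> * Q = \<Lambda> \<and> (\<forall>y\<in>carrier_mat m m. P * A y * Q = A (\<sigma> y)))"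

lemma lower_bound_core:
  assumes m: "m \<ge> 3" and u: "u \<in> carrier_vec n" and v: "v \<in> carrier_vec n" and vu: "v \<bullet> u = 1"
    and L: "\<Lambda> = 1\<^sub>m n - outer n u v" and lin: "linear_map class_ring (Mat m) (Mat n) A"
    and d: "d \<noteq> 0" and det: "\<And>y. y \<in> carrier_mat m m \<Longrightarrow> det (\<Lambda> + A y) = d * perm m y"
    and torus: "\<And>t s. (\<And>i. t i \<noteq> 0 \<and> s i \<noteq> 0) \<Longrightarrow> liftable m n \<Lambda> A (torus_act m (\<lambda>i. (t i)\<^sup>2) (\<lambda>i. (s i)\<^sup>2))"
    and perms: "\<And>f g. f permutes {0..<m} \<Longrightarrow> g permutes {0..<m} \<Longrightarrow> liftable m n \<Lambda> A (perm_act m (f \<circ> f) (g \<circ> g))"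
  shows "(2 * m choose m) - 1 \<le> n"
proof -
  note lin' = lin[unfolded linear_map_Mat_iff]
  have AC: "A y \<in> carrier_mat n n" if "y \<in> carrier_mat m m" for y using lin' that by blast
  have LC: "\<Lambda> \<in> carrier_mat n n" unfolding L by (rule minus_carrier_mat) simp
  define \<B> where "\<B> = A ` carrier_mat m m"
  have \<B>: "\<B> \<subseteq> carrier_mat n n" using AC by (auto simp: \<B>_def)
  define F where "F = word_form u v"
  let ?R = "\<lambda>r. r \<ge> 1 \<and> (\<exists>Bs. set Bs \<subseteq> \<B> \<and> length Bs = r \<and> F Bs \<noteq> 0)"
  \<comment> \<open>On multiples of the identity matrix the permanent is \<open>z ^ m\<close>, which
    is the situation of \<open>word_form_powers_nonzero\<close>.\<close>
  have exR: "\<exists>r\<le>m. ?R r"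
  proof -
    let ?B = "A (1\<^sub>m m)"
    have "det (1\<^sub>m n - outer n u v + z \<cdot>\<^sub>m ?B) = d * z ^ m" for z
    proof -
      have "z \<cdot>\<^sub>m 1\<^sub>m m = torus_act m (\<lambda>_. z) (\<lambda>_. 1) (1\<^sub>m m)" by (intro eq_matI) (auto simp: torus_act_def)
      hence "perm m (z \<cdot>\<^sub>m 1\<^sub>m m) = z ^ m" using perm_torus_act[of "1\<^sub>m m" m "\<lambda>_. z" "\<lambda>_. 1"] by (simp add: perm_one)
      moreover have "A (z \<cdot>\<^sub>m 1\<^sub>m m) = z \<cdot>\<^sub>m ?B" using lin' by simp
      ultimately show ?thesis using det[of "z \<cdot>\<^sub>m 1\<^sub>m m"] by (simp add: L)
    qed
    from word_form_powers_nonzero[OF u v vu AC[OF one_carrier_mat] d this]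
    obtain r where r: "1 \<le> r" "r \<le> m" "word_form u v (replicate r ?B) \<noteq> 0" by blast
    moreover have "set (replicate r ?B) \<subseteq> \<B>" by (auto simp: \<B>_def)
    ultimately show ?thesis unfolding F_def by (intro exI[of _ r]) (auto intro!: exI[of _ "replicate r ?B"])
  qed
  define r where "r = (LEAST r. ?R r)"
  obtain r' where r': "r' \<le> m" "?R r'" using exR by blast
  have rR: "?R r" unfolding r_def by (rule LeastI[of ?R, OF r'(2)])
  have rmin: "F Bs = 0" if "set Bs \<subseteq> \<B>" "Bs \<noteq> []" "length Bs < r" for Bs
  proof -
    have "\<not> ?R (length Bs)" using not_less_Least[of "length Bs" ?R] that(3) unfolding r_def by blast
    moreover have "1 \<le> length Bs" using that(2) by (cases Bs) auto
    ultimately show ?thesis using that(1) by blast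
  qed
  have r1: "r \<ge> 1" using rR by blast
  \<comment> \<open>In the least degree the correction terms of a lift vanish, and the remaining
    factor \<open>p * q\<close> is the product of the determinants, which is also the factor of the
    permanent.\<close>
  have semi: "\<exists>c. c \<noteq> 0 \<and> perm m (\<sigma> (1\<^sub>m m)) = c \<and> (\<forall>ys. set ys \<subseteq> carrier_mat m m \<longrightarrow> length ys = r \<longrightarrow> F (map (\<lambda>y. A (\<sigma> y)) ys) = c * F (map A ys))"
    if lift: "liftable m n \<Lambda> A \<sigma>" and \<sigma>C: "\<And>y. y \<in> carrier_mat m m \<Longrightarrow> \<sigma> y \<in> carrier_mat m m" for \<sigma>
  proof -
    obtain P Q where PQ: "P \<in> carrier_mat n n" "det P \<noteq> 0" "Q \<in> carrier_mat n n" "det Q \<noteq> 0"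
      "P * \<Lambda> * Q = \<Lambda>" "\<And>y. y \<in> carrier_mat m m \<Longrightarrow> P * A y * Q = A (\<sigma> y)"
      using lift unfolding liftable_def by blast
    obtain p q \<psi> where gf: "P\<^sup>T *\<^sub>v v = p \<cdot>\<^sub>v v" "Q *\<^sub>v u = q \<cdot>\<^sub>v u" "det P * det Q = p * q" "\<psi> \<in> carrier_vec n"
      "\<And>x. x \<in> carrier_vec n \<Longrightarrow> \<exists>a. (Q * P) *\<^sub>v x = x + a \<cdot>\<^sub>v u + (v \<bullet> x) \<cdot>\<^sub>v \<psi>"
      using gauge_factors[OF u v vu PQ(1-4) L PQ(5)] by blast
    let ?c = "det P * det Q"
    have "\<Lambda> + A (\<sigma> (1\<^sub>m m)) = P * (\<Lambda> + A (1\<^sub>m m)) * Q"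
      using mult_add_mult_distrib_mat[OF PQ(1,3) LC AC[of "1\<^sub>m m"], of 1] PQ(5) PQ(6)[of "1\<^sub>m m"] by simp
    hence "det (\<Lambda> + A (\<sigma> (1\<^sub>m m))) = det P * det (\<Lambda> + A (1\<^sub>m m)) * det Q"
      using PQ(1,3) LC AC[of "1\<^sub>m m"] by (simp add: det_mult[of _ n])
    hence "d * perm m (\<sigma> (1\<^sub>m m)) = det P * (d * perm m (1\<^sub>m m)) * det Q"
      unfolding det[OF one_carrier_mat] det[OF \<sigma>C[OF one_carrier_mat]] .
    hence c: "perm m (\<sigma> (1\<^sub>m m)) = ?c" using d by (simp add: perm_one)
    have "F (map (\<lambda>y. A (\<sigma> y)) ys) = ?c * F (map A ys)" if ys: "set ys \<subseteq> carrier_mat m m" "length ys = r" for ys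
    proof -
      let ?Bs = "map A ys"
      have Bs: "set ?Bs \<subseteq> \<B>" "set ?Bs \<subseteq> carrier_mat n n" "?Bs \<noteq> []" using ys AC r1 by (auto simp: \<B>_def)
      have mp: "map (\<lambda>y. A (\<sigma> y)) ys = map (\<lambda>B. P * B * Q) ?Bs" using ys PQ(6) by auto
      have "F (map (\<lambda>y. A (\<sigma> y)) ys) = v \<bullet> (q \<cdot>\<^sub>v (P *\<^sub>v gauged_vec (Q * P) u ?Bs))"
        unfolding F_def word_form_def mp word_vec_conjugate[OF u PQ(1,3) gf(2) Bs(2,3)] by (rule refl)
      also have "\<dots> = q * (v \<bullet> (P *\<^sub>v gauged_vec (Q * P) u ?Bs))"
        using v PQ(1) gauged_vec_carrier[OF _ u Bs(2), of "Q * P"] PQ by simp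
      also have "v \<bullet> (P *\<^sub>v gauged_vec (Q * P) u ?Bs) = (P\<^sup>T *\<^sub>v v) \<bullet> gauged_vec (Q * P) u ?Bs"
        using transpose_vec_mult_scalar[OF PQ(1) gauged_vec_carrier[OF _ u Bs(2)] v, of "Q * P"] PQ by simp
      also have "\<dots> = p * (v \<bullet> gauged_vec (Q * P) u ?Bs)"
        unfolding gf(1) using v gauged_vec_carrier[OF _ u Bs(2), of "Q * P"] PQ by simp
      also have "v \<bullet> gauged_vec (Q * P) u ?Bs = F ?Bs"
      proof -
        have "v \<bullet> word_vec (gauged_vec (Q * P) u ?Bs) [] = word_form u v ([] @ ?Bs)"
        proof (rule gauge_invariance[OF u v mult_square_carrier[OF PQ(3,1)] gf(4), where r = r and \<B> = \<B>])
          show "\<exists>a. (Q * P) *\<^sub>v x = x + a \<cdot>\<^sub>v u + (v \<bullet> x) \<cdot>\<^sub>v \<psi>" if "x \<in> carrier_vec n" for x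
            by (rule gf(5)[OF that])
          show "word_form u v Bs = 0" if "set Bs \<subseteq> \<B>" "Bs \<noteq> []" "length Bs < r" for Bs
            using rmin[OF that] by (simp add: F_def)
        qed (use Bs ys \<B> in auto)
        thus ?thesis by (simp add: F_def)
      qed
      finally show ?thesis using gf(3) by (simp add: mult_ac)
    qed
    thus ?thesis using c PQ(2,4) by (intro exI[of _ ?c]) auto
  qed
  obtain Bs where Bs: "set Bs \<subseteq> \<B>" "length Bs = r" "F Bs \<noteq> 0" using rR by blast
  define ys where "ys = map (inv_into (carrier_mat m m) A) Bs"
  have ys: "Bs = map A ys" "set ys \<subseteq> carrier_mat m m"
  proof -
    have "A (inv_into (carrier_mat m m) A B) = B" "inv_into (carrier_mat m m) A B \<in> carrier_mat m m" if "B \<in> set Bs" for B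
      using f_inv_into_f[of B A "carrier_mat m m"] inv_into_into[of B A "carrier_mat m m"] that Bs(1)
      unfolding \<B>_def by blast+
    thus "Bs = map A ys" "set ys \<subseteq> carrier_mat m m" unfolding ys_def by (auto intro: map_idI[symmetric])
  qed
  have smultF: "F (map2 (\<lambda>c B. c \<cdot>\<^sub>m B) cs Bs) = prod_list cs * F Bs"
    if "set Bs \<subseteq> carrier_mat n n" "length cs = length Bs" for cs Bs
    using word_vec_smult[OF u that] v word_vec_carrier[OF u that(1)] by (simp add: F_def word_form_def)
  \<comment> \<open>Multiplication by 4, the square of a torus element, scales the form by
    \<open>4 ^ r\<close> and the permanent by \<open>4 ^ m\<close>.\<close>
  have "r = m"
  proof -
    let ?\<sigma> = "torus_act m (\<lambda>i. 2\<^sup>2) (\<lambda>i. 1\<^sup>2)"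
    obtain c where c: "perm m (?\<sigma> (1\<^sub>m m)) = c"
      "\<And>ys. set ys \<subseteq> carrier_mat m m \<Longrightarrow> length ys = r \<Longrightarrow> F (map (\<lambda>y. A (?\<sigma> y)) ys) = c * F (map A ys)"
      using semi[OF torus[of "\<lambda>_. 2" "\<lambda>_. 1"]] by auto
    have "c = 4 ^ m" using c(1) perm_torus_act[of "1\<^sub>m m" m "\<lambda>i. 2\<^sup>2" "\<lambda>i. 1\<^sup>2"] by (simp add: perm_one)
    have "A (?\<sigma> y) = 4 \<cdot>\<^sub>m A y" if y: "y \<in> carrier_mat m m" for y
    proof -
      have "?\<sigma> y = 4 \<cdot>\<^sub>m y" using y by (intro eq_matI) (auto simp: torus_act_def)
      thus ?thesis using lin' y by simp
    qed
    hence "map (\<lambda>y. A (?\<sigma> y)) ys = map2 (\<lambda>c B. c \<cdot>\<^sub>m B) (replicate r 4) Bs"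
      using ys Bs(2) by (intro nth_equalityI) (auto simp: subset_iff)
    hence "4 ^ r * F Bs = c * F Bs"
      using c(2)[of ys] smultF[of Bs "replicate r 4"] Bs \<B> ys by auto
    hence "(4 :: complex) ^ r = 4 ^ m" using Bs(3) \<open>c = 4 ^ m\<close> by simp
    hence "of_nat (4 ^ r) = (of_nat (4 ^ m) :: complex)" by simp
    hence "(4 :: nat) ^ r = 4 ^ m" by (simp only: of_nat_eq_iff)
    thus ?thesis by simp
  qed
  define W where "W = map (\<lambda>(i, j). A (unit_mat m i j))"
  define good where "good ws \<longleftrightarrow> length ws = m \<and> set ws \<subseteq> {..<m} \<times> {..<m} \<and> F (W ws) \<noteq> 0" for ws
  have W\<B>: "set (W ws) \<subseteq> \<B>" for ws by (auto simp: W_def \<B>_def)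
  have Wmap: "W ws = map A (map (\<lambda>(i, j). unit_mat m i j) ws)" for ws by (auto simp: W_def)
  obtain ws0 where ws0: "good ws0"
  proof (rule ccontr)
    assume no: "\<not> thesis"
    have "v \<bullet> word_vec (word_vec u (map A ys)) [] = 0"
    proof (rule word_form_basis_expansion[OF lin u v _ ys(2)])
      fix ws assume "length ws = length ys" "set ws \<subseteq> {..<m} \<times> {..<m}"
      hence "F (W ws) = 0" using no that[of ws] Bs(2) ys(1) \<open>r = m\<close> by (auto simp: good_def)
      thus "v \<bullet> word_vec (word_vec u (map (\<lambda>(i, j). A (unit_mat m i j)) ws)) [] = 0"
        by (simp add: F_def word_form_def W_def)
    qed simp
    thus False using Bs(3) ys(1) by (simp add: F_def word_form_def)
  qed
  obtain t s :: "nat \<Rightarrow> complex" where ts: "\<And>i. t i \<noteq> 0 \<and> s i \<noteq> 0" and gen: "generic_torus m (\<lambda>i. (t i)\<^sup>2) (\<lambda>i. (s i)\<^sup>2)"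
    using generic_torus_exists[of m] by blast
  \<comment> \<open>A word on which the form does not vanish has the weight of the permanent, so by
    genericity it uses each row and each column once.\<close>
  have content: "count_list (map fst ws) i = 1 \<and> count_list (map snd ws) i = 1" if g: "good ws" and i: "i < m" for ws i
  proof -
    let ?\<sigma> = "torus_act m (\<lambda>i. (t i)\<^sup>2) (\<lambda>i. (s i)\<^sup>2)"
    let ?w = "\<lambda>(i, j). (t i)\<^sup>2 * (s j)\<^sup>2"
    obtain c where c: "perm m (?\<sigma> (1\<^sub>m m)) = c"
      "\<And>ys. set ys \<subseteq> carrier_mat m m \<Longrightarrow> length ys = r \<Longrightarrow> F (map (\<lambda>y. A (?\<sigma> y)) ys) = c * F (map A ys)"
      using semi[OF torus[OF ts]] by auto
    have c1: "c = wt m (\<lambda>i. (t i)\<^sup>2) (\<lambda>i. (s i)\<^sup>2) (\<lambda>_. 1) (\<lambda>_. 1)"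
      using c(1) perm_torus_act[of "1\<^sub>m m" m "\<lambda>i. (t i)\<^sup>2" "\<lambda>i. (s i)\<^sup>2"] by (simp add: perm_one wt_def)
    have A: "A (?\<sigma> (unit_mat m i j)) = ((t i)\<^sup>2 * (s j)\<^sup>2) \<cdot>\<^sub>m A (unit_mat m i j)" for i j
    proof -
      have "?\<sigma> (unit_mat m i j) = ((t i)\<^sup>2 * (s j)\<^sup>2) \<cdot>\<^sub>m unit_mat m i j"
        by (intro eq_matI) (auto simp: torus_act_def)
      thus ?thesis using lin' by simp
    qed
    let ?us = "map (\<lambda>(i, j). unit_mat m i j) ws"
    have e1: "map (\<lambda>y. A (?\<sigma> y)) ?us = map2 (\<lambda>c B. c \<cdot>\<^sub>m B) (map ?w ws) (W ws)"
      unfolding W_def by (induction ws) (auto simp: A)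
    have e2: "F (map (\<lambda>y. A (?\<sigma> y)) ?us) = c * F (map A ?us)"
      by (rule c(2)) (use g \<open>r = m\<close> in \<open>auto simp: good_def\<close>)
    have e3: "F (map2 (\<lambda>c B. c \<cdot>\<^sub>m B) (map ?w ws) (W ws)) = prod_list (map ?w ws) * F (W ws)"
      by (rule smultF) (use W\<B>[of ws] \<B> in \<open>auto simp: W_def\<close>)
    have "prod_list (map ?w ws) * F (W ws) = c * F (W ws)"
      using e2 unfolding e1 e3 Wmap[symmetric] .
    hence "prod_list (map ?w ws) = c" using g by (simp add: good_def)
    hence "wt m (\<lambda>i. (t i)\<^sup>2) (\<lambda>i. (s i)\<^sup>2) (count_list (map fst ws)) (count_list (map snd ws)) = wt m (\<lambda>i. (t i)\<^sup>2) (\<lambda>i. (s i)\<^sup>2) (\<lambda>_. 1) (\<lambda>_. 1)"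
      using prod_list_wt[of ws m "\<lambda>i. (t i)\<^sup>2" "\<lambda>i. (s i)\<^sup>2"] g c1 by (simp add: good_def)
    from gen[unfolded generic_torus_def, rule_format, OF this i] show ?thesis .
  qed
  have distinct: "distinct (map fst ws) \<and> set (map fst ws) = {0..<m} \<and> distinct (map snd ws) \<and> set (map snd ws) = {0..<m}"
    if g: "good ws" for ws
  proof -
    have D: "distinct xs \<and> set xs = {0..<m}" if "length xs = m" "set xs \<subseteq> {0..<m}" "\<And>i. i < m \<Longrightarrow> count_list xs i = 1" for xs
    proof -
      have "set xs = {0..<m}"
      proof
        show "{0..<m} \<subseteq> set xs"
        proof
          fix i assume "i \<in> {0..<m}"
          hence "count_list xs i \<noteq> 0" using that(3)[of i] by simp
          thus "i \<in> set xs" by (simp add: count_list_0_iff)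
        qed
      qed (rule that(2))
      moreover from this have "card (set xs) = length xs" using that(1) by simp
      hence "distinct xs" by (rule card_distinct)
      ultimately show ?thesis by blast
    qed
    have sub: "set ws \<subseteq> {..<m} \<times> {..<m}" "length ws = m" using g by (auto simp: good_def)
    hence "set (map fst ws) \<subseteq> {0..<m}" "set (map snd ws) \<subseteq> {0..<m}" by auto
    thus ?thesis using D[of "map fst ws"] D[of "map snd ws"] content[OF g] sub(2) by simp
  qed
  \<comment> \<open>Since the action pulls indices back, it is the inverses of \<open>f\<close> and
    \<open>g\<close> that are lifted.\<close>
  have move: "good (map (\<lambda>(i, j). ((f \<circ> f) i, (g \<circ> g) j)) ws)"
    if f: "f permutes {0..<m}" and g: "g permutes {0..<m}" and gd: "good ws" for f g ws
  proof -
    let ?f' = "inv_into UNIV f" and ?g' = "inv_into UNIV g"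
    have ff: "(f \<circ> f) permutes {0..<m}" "(g \<circ> g) permutes {0..<m}" using f g by (auto intro: permutes_compose)
    have inv: "inv_into UNIV (f \<circ> f) = ?f' \<circ> ?f'" "inv_into UNIV (g \<circ> g) = ?g' \<circ> ?g'"
      using o_inv_distrib[OF permutes_bij[OF f] permutes_bij[OF f]] o_inv_distrib[OF permutes_bij[OF g] permutes_bij[OF g]] by auto
    let ?\<sigma> = "perm_act m (?f' \<circ> ?f') (?g' \<circ> ?g')"
    obtain c where c: "c \<noteq> 0" "\<And>ys. set ys \<subseteq> carrier_mat m m \<Longrightarrow> length ys = r \<Longrightarrow> F (map (\<lambda>y. A (?\<sigma> y)) ys) = c * F (map A ys)"
      using semi[OF perms[OF permutes_inv[OF f] permutes_inv[OF g]]] by auto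
    let ?us = "map (\<lambda>(i, j). unit_mat m i j) ws" and ?ws' = "map (\<lambda>(i, j). ((f \<circ> f) i, (g \<circ> g) j)) ws"
    have e2: "F (map (\<lambda>y. A (?\<sigma> y)) ?us) = c * F (map A ?us)"
      by (rule c(2)) (use gd \<open>r = m\<close> in \<open>auto simp: good_def\<close>)
    have e1: "map (\<lambda>y. A (?\<sigma> y)) ?us = W ?ws'"
      unfolding W_def using perm_act_unit_mat[OF ff] by (auto simp: inv)
    have "F (W ?ws') = c * F (W ws)" using e2 unfolding e1 Wmap[symmetric] .
    hence "F (W ?ws') \<noteq> 0" using c(1) gd by (simp add: good_def)
    moreover have "set ?ws' \<subseteq> {..<m} \<times> {..<m}"
    proof -
      have "(f \<circ> f) i < m" "(g \<circ> g) i < m" if "i < m" for i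
        using permutes_in_image[OF ff(1), of i] permutes_in_image[OF ff(2), of i] that by auto
      thus ?thesis using gd by (auto simp: good_def)
    qed
    ultimately show ?thesis using gd by (simp add: good_def)
  qed
  \<comment> \<open>Rows and columns are moved independently: the row set of the prefix is brought
    to \<open>I\<close> first, then the column set to \<open>J\<close> with the rows held
    fixed.\<close>
  have all: "\<exists>ws. good ws \<and> fst ` set (take k ws) = I \<and> snd ` set (take k ws) = J"
    if IJ: "I \<subseteq> {0..<m}" "J \<subseteq> {0..<m}" "card I = k" "card J = k" "k \<le> m" for I J k
  proof -
    have card0: "card (fst ` set (take k ws)) = k" "card (snd ` set (take k ws)) = k"
        "fst ` set (take k ws) \<subseteq> {0..<m}" "snd ` set (take k ws) \<subseteq> {0..<m}" if g: "good ws" for ws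
    proof -
      have l: "length ws = m" using g by (simp add: good_def)
      have "distinct (take k (map fst ws))" "distinct (take k (map snd ws))"
        using distinct[OF g] by (auto simp: distinct_take)
      from this[THEN distinct_card] show "card (fst ` set (take k ws)) = k" "card (snd ` set (take k ws)) = k"
        using l IJ(5) by (simp_all add: take_map)
      show "fst ` set (take k ws) \<subseteq> {0..<m}" "snd ` set (take k ws) \<subseteq> {0..<m}"
        using g set_take_subset[of k ws] by (auto simp: good_def)
    qed
    let ?Q1 = "\<lambda>I. \<exists>ws. good ws \<and> fst ` set (take k ws) = I"
    have "?Q1 I"
    proof (rule subset_square_induct[OF m IJ(1) card0(3)[OF ws0]])
      show "card (fst ` set (take k ws0)) = card I" using card0[OF ws0] IJ by simp
      show "?Q1 (fst ` set (take k ws0))" using ws0 by blast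
      show "?Q1 ((h \<circ> h) ` I)" if h: "h permutes {0..<m}" and "?Q1 I" for h I
      proof -
        obtain ws where ws: "good ws" "fst ` set (take k ws) = I" using \<open>?Q1 I\<close> by blast
        let ?ws = "map (\<lambda>(i, j). ((h \<circ> h) i, (id \<circ> id) j)) ws"
        have "good ?ws" by (rule move[OF h permutes_id ws(1)])
        moreover have "fst ` set (take k ?ws) = (h \<circ> h) ` I"
          unfolding ws(2)[symmetric] take_map by (force simp: image_iff)
        ultimately show ?thesis by blast
      qed
    qed
    then obtain ws1 where ws1: "good ws1" "fst ` set (take k ws1) = I" by blast
    let ?Q2 = "\<lambda>J. \<exists>ws. good ws \<and> fst ` set (take k ws) = I \<and> snd ` set (take k ws) = J"
    show "?Q2 J"
    proof (rule subset_square_induct[OF m IJ(2) card0(4)[OF ws1(1)]])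
      show "card (snd ` set (take k ws1)) = card J" using card0[OF ws1(1)] IJ by simp
      show "?Q2 (snd ` set (take k ws1))" using ws1 by blast
      show "?Q2 ((h \<circ> h) ` J)" if h: "h permutes {0..<m}" and "?Q2 J" for h J
      proof -
        obtain ws where ws: "good ws" "fst ` set (take k ws) = I" "snd ` set (take k ws) = J" using \<open>?Q2 J\<close> by blast
        let ?ws = "map (\<lambda>(i, j). ((id \<circ> id) i, (h \<circ> h) j)) ws"
        have "good ?ws" by (rule move[OF permutes_id h ws(1)])
        moreover have "fst ` set (take k ?ws) = I"
          unfolding ws(2)[symmetric] take_map by (force simp: image_iff)
        moreover have "snd ` set (take k ?ws) = (h \<circ> h) ` J"
          unfolding ws(3)[symmetric] take_map by (force simp: image_iff)
        ultimately show ?thesis by blast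
      qed
    qed
  qed
  \<comment> \<open>The empty pair has to stay out: its covector \<open>v\<close> pairs with the
    vector \<open>u\<close> of the full pair to 1, against triangularity.\<close>
  define T where "T = {(I, J). I \<subseteq> {..<m} \<and> J \<subseteq> {..<m} \<and> card I = card J \<and> I \<noteq> {}}"
  have "\<exists>ws. good ws \<and> fst ` set (take (card (fst a)) ws) = fst a \<and> snd ` set (take (card (fst a)) ws) = snd a"
    if aT: "a \<in> T" for a
  proof -
    obtain I J where a: "a = (I, J)" by force
    have "card I \<le> m" using card_mono[of "{..<m}" I] aT a by (auto simp: T_def)
    thus ?thesis using all[of I J "card I"] aT a by (auto simp: T_def atLeast0LessThan)
  qed
  then obtain ws where ws: "\<And>a. a \<in> T \<Longrightarrow> good (ws a) \<and> fst ` set (take (card (fst a)) (ws a)) = fst a \<and>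
      snd ` set (take (card (fst a)) (ws a)) = snd a" by metis
  define x where "x a = word_vec u (W (drop (card (fst a)) (ws a)))" for a
  have "\<exists>z. z \<in> carrier_vec n \<and> (\<forall>x\<in>carrier_vec n. v \<bullet> word_vec x (W (take (card (fst a)) (ws a))) = z \<bullet> x)" for a
    using word_covec[OF v, of "W (take (card (fst a)) (ws a))"] W\<B> \<B> by (meson subset_trans)
  then obtain z where z: "\<And>a. z a \<in> carrier_vec n \<and> (\<forall>x\<in>carrier_vec n. v \<bullet> word_vec x (W (take (card (fst a)) (ws a))) = z a \<bullet> x)"
    by metis
  have wxz: "good (ws a) \<and> fst ` set (take (card (fst a)) (ws a)) = fst a \<and> snd ` set (take (card (fst a)) (ws a)) = snd a \<and>
      x a = word_vec u (W (drop (card (fst a)) (ws a))) \<and> z a \<in> carrier_vec n \<and>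
      (\<forall>x\<in>carrier_vec n. v \<bullet> word_vec x (W (take (card (fst a)) (ws a))) = z a \<bullet> x)" if "a \<in> T" for a
    using ws[OF that] z[of a] by (simp add: x_def)
  have xC: "x a \<in> carrier_vec n" if "a \<in> T" for a
    using wxz[OF that] word_vec_carrier[OF u] W\<B> \<B> by (metis subset_trans)
  have zx: "z a \<bullet> x b = F (W (take (card (fst a)) (ws a) @ drop (card (fst b)) (ws b)))" if ab: "a \<in> T" "b \<in> T" for a b
  proof -
    have "v \<bullet> word_vec (x b) (W (take (card (fst a)) (ws a))) = z a \<bullet> x b" using wxz[OF ab(1)] xC[OF ab(2)] by blast
    thus ?thesis using wxz[OF ab(2)] by (simp add: F_def word_form_def W_def word_vec_append)
  qed
  have cm: "card (fst a) \<le> m" "card (fst a) > 0" if "a \<in> T" for a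
    using that card_mono[of "{..<m}" "fst a"] by (auto simp: T_def card_gt_0_iff finite_subset)
  have "card T \<le> n"
  proof (rule card_le_dim_if_triangular[where x = x and z = z and h = "\<lambda>a. card (fst a)"])
    have "T \<subseteq> Pow {..<m} \<times> Pow {..<m}" by (auto simp: T_def)
    thus "finite T" by (rule finite_subset) auto
    show "x a \<in> carrier_vec n \<and> z a \<in> carrier_vec n" if "a \<in> T" for a using xC wxz that by blast
    show "z a \<bullet> x a \<noteq> 0" if "a \<in> T" for a
      unfolding zx[OF that that] using wxz[OF that] by (simp add: good_def)
    show "z a \<bullet> x b = 0" if ab: "a \<in> T" "b \<in> T" "a \<noteq> b" "card (fst a) \<le> card (fst b)" for a b
    proof (rule ccontr)
      let ?w = "take (card (fst a)) (ws a) @ drop (card (fst b)) (ws b)"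
      assume "z a \<bullet> x b \<noteq> 0"
      hence nz: "F (W ?w) \<noteq> 0" using zx[OF ab(1,2)] by simp
      have ga: "good (ws a)" and gb: "good (ws b)" using wxz ab by blast+
      have l: "length (ws a) = m" "length (ws b) = m" using ga gb by (auto simp: good_def)
      have len: "length ?w = card (fst a) + (m - card (fst b))" using l cm[OF ab(1)] by simp
      \<comment> \<open>A smaller prefix followed by the suffix of a larger pair is too short a
        word, so the form vanishes by minimality of the degree.\<close>
      have "\<not> length ?w < m"
      proof
        assume "length ?w < m"
        hence "length (W ?w) < r" using \<open>r = m\<close> by (simp only: W_def length_map)
        moreover have "length (W ?w) > 0" using len cm(2)[OF ab(1)] by (simp only: W_def length_map)
        ultimately have "F (W ?w) = 0" by (intro rmin[OF W\<B>]) auto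
        thus False using nz by simp
      qed
      hence eq: "card (fst a) = card (fst b)" using len ab(4) cm[OF ab(2)] by linarith
      hence "length ?w = m" using len cm[OF ab(2)] by simp
      moreover have "set ?w \<subseteq> {..<m} \<times> {..<m}"
        using ga gb set_take_subset[of "card (fst a)" "ws a"] set_drop_subset[of "card (fst b)" "ws b"] by (auto simp: good_def)
      ultimately have gw: "good ?w" using nz by (simp add: good_def)
      \<comment> \<open>For equal sizes the glued word is good. Its prefix and the prefix of
        \<open>ws b\<close> complement the same suffix, so they use the same rows and the same
        columns.\<close>
      have key: "set (take k xs) = set (take k ys)"
        if "distinct (take k xs @ drop k ys)" "distinct ys" "set (take k xs @ drop k ys) = set ys" for k and xs ys :: "nat list"
      proof -
        have "set ys = set (take k ys) \<union> set (drop k ys)" by (metis append_take_drop_id set_append)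
        moreover have "set (take k ys) \<inter> set (drop k ys) = {}"
          using that(2) by (metis append_take_drop_id distinct_append)
        moreover have "set (take k xs) \<inter> set (drop k ys) = {}" using that(1) by simp
        moreover have "set (take k xs) \<union> set (drop k ys) = set ys" using that(3) by simp
        ultimately show ?thesis by blast
      qed
      have k1: "set (take (card (fst a)) (map fst (ws a))) = set (take (card (fst a)) (map fst (ws b)))"
        by (rule key) (use distinct[OF gw] distinct[OF gb] in \<open>simp_all add: take_map drop_map eq\<close>)
      have k2: "set (take (card (fst a)) (map snd (ws a))) = set (take (card (fst a)) (map snd (ws b)))"
        by (rule key) (use distinct[OF gw] distinct[OF gb] in \<open>simp_all add: take_map drop_map eq\<close>)
      note wa = wxz[OF ab(1), THEN conjunct2] and wb = wxz[OF ab(2), THEN conjunct2]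
      have "fst a = fst ` set (take (card (fst a)) (ws a))" by (rule wa[THEN conjunct1, symmetric])
      also have "\<dots> = fst ` set (take (card (fst b)) (ws b))" using k1 unfolding take_map set_map eq .
      also have "\<dots> = fst b" by (rule wb[THEN conjunct1])
      finally have 1: "fst a = fst b" .
      have "snd a = snd ` set (take (card (fst a)) (ws a))" by (rule wa[THEN conjunct2, THEN conjunct1, symmetric])
      also have "\<dots> = snd ` set (take (card (fst b)) (ws b))" using k2 unfolding take_map set_map eq .
      also have "\<dots> = snd b" by (rule wb[THEN conjunct2, THEN conjunct1])
      finally have "snd a = snd b" .
      thus False using 1 ab(3) by (simp add: prod_eq_iff)
    qed
  qed
  thus ?thesis using card_equal_size_pairs[of m] by (simp add: T_def)
qed

section \<open>Symmetries of the permanent, their lifts and the normalisation of the constant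
  part\<close>

lemma torus_act_proj_sym_groupI:
  assumes ts: "\<And>i. t i \<noteq> 0 \<and> s i \<noteq> 0"
    and P: "c \<noteq> 0" "\<And>X. X \<in> carrier_mat m m \<Longrightarrow> P (torus_act m t s X) = c * P X"
  shows "restrict (torus_act m t s) (carrier_mat m m) \<in> proj_sym_group (Mat m) P"
proof (rule proj_sym_groupI[where h = "torus_act m (\<lambda>i. inverse (t i)) (\<lambda>i. inverse (s i))" and c = c])
  fix X Y :: "complex mat" and a :: complex
  assume X: "X \<in> carrier_mat m m"
  have c: "(t i * s j) * ((inverse (t i) * inverse (s j)) * x) = x"
    "(inverse (t i) * inverse (s j)) * ((t i * s j) * x) = x" for i j x
    using ts[of i] ts[of j] by (simp_all add: field_simps)
  show "torus_act m t s (torus_act m (\<lambda>i. inverse (t i)) (\<lambda>i. inverse (s i)) X) = X"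
    using X by (intro eq_matI) (simp_all add: torus_act_def c)
  show "torus_act m (\<lambda>i. inverse (t i)) (\<lambda>i. inverse (s i)) (torus_act m t s X) = X"
    using X by (intro eq_matI) (simp_all add: torus_act_def c)
  show "torus_act m t s (a \<cdot>\<^sub>m X) = a \<cdot>\<^sub>m torus_act m t s X"
    using X by (intro eq_matI) (simp_all add: torus_act_def mult_ac)
  show "torus_act m t s (X + Y) = torus_act m t s X + torus_act m t s Y" if "Y \<in> carrier_mat m m"
    using X that by (intro eq_matI) (simp_all add: torus_act_def distrib_left)
qed (simp_all add: P)

lemma torus_act_proj_sym_group:
  assumes "\<And>i. t i \<noteq> 0 \<and> s i \<noteq> 0"
  shows "restrict (torus_act m t s) (carrier_mat m m) \<in> proj_sym_group (Mat m) (perm m)"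
  by (rule torus_act_proj_sym_groupI[OF assms, of "(\<Prod>i<m. t i) * (\<Prod>j<m. s j)"])
    (use assms in \<open>simp_all add: perm_torus_act\<close>)

lemma perm_perm_act:
  assumes f: "f permutes {0..<m}" and g: "g permutes {0..<m}"
  shows "perm m (perm_act m f g y) = perm m y"
proof -
  have lt: "\<sigma> i < m" if "\<sigma> permutes {0..<m}" "i < m" for \<sigma> i
    using permutes_in_image[OF that(1), of i] that(2) by simp
  have 1: "perm m (perm_act m f id y) = perm m y" if f: "f permutes {0..<m}" for f y
  proof -
    have "(\<Prod>i = 0..<m. perm_act m f id y $$ (i, (\<sigma> \<circ> f) i)) = (\<Prod>i = 0..<m. y $$ (i, \<sigma> i))"
      if s: "\<sigma> permutes {0..<m}" for \<sigma>
    proof -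
      have "(\<Prod>i = 0..<m. perm_act m f id y $$ (i, (\<sigma> \<circ> f) i)) = (\<Prod>i = 0..<m. y $$ (f i, \<sigma> (f i)))"
        using lt[OF f] lt[OF s] by (intro prod.cong) (auto simp: perm_act_def)
      also have "\<dots> = (\<Prod>i = 0..<m. y $$ (i, \<sigma> i))"
        using prod.permute[OF f, of "\<lambda>i. y $$ (i, \<sigma> i)"] by (simp add: comp_def)
      finally show ?thesis .
    qed
    thus ?thesis unfolding perm_def
      by (subst sum_permutations_compose_right[OF f]) (auto intro: sum.cong)
  qed
  have 2: "perm m (perm_act m id g y) = perm m y" if g: "g permutes {0..<m}" for g y
  proof -
    have "(\<Prod>i = 0..<m. perm_act m id g y $$ (i, \<sigma> i)) = (\<Prod>i = 0..<m. y $$ (i, (g \<circ> \<sigma>) i))"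
      if s: "\<sigma> permutes {0..<m}" for \<sigma>
      using lt[OF s] by (intro prod.cong) (auto simp: perm_act_def)
    hence "perm m (perm_act m id g y) = (\<Sum>\<sigma> | \<sigma> permutes {0..<m}. \<Prod>i = 0..<m. y $$ (i, (g \<circ> \<sigma>) i))"
      unfolding perm_def by (intro sum.cong) auto
    also have "\<dots> = perm m y" unfolding perm_def
      by (rule setum_permutations_compose_left[OF g, symmetric])
    finally show ?thesis .
  qed
  have "perm_act m f g y = perm_act m f id (perm_act m id g y)"
    using lt[OF f] lt[OF g] by (intro eq_matI) (auto simp: perm_act_def)
  thus ?thesis using 1[OF f] 2[OF g] by simp
qed

lemma perm_act_proj_sym_groupI:
  assumes f: "f permutes {0..<m}" and g: "g permutes {0..<m}"
    and P: "c \<noteq> 0" "\<And>X. X \<in> carrier_mat m m \<Longrightarrow> P (perm_act m f g X) = c * P X"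
  shows "restrict (perm_act m f g) (carrier_mat m m) \<in> proj_sym_group (Mat m) P"
proof (rule proj_sym_groupI[where h = "perm_act m (inv_into UNIV f) (inv_into UNIV g)" and c = c])
  have lt: "\<sigma> i < m" if "\<sigma> permutes {0..<m}" "i < m" for \<sigma> i
    using permutes_in_image[OF that(1), of i] that(2) by simp
  note l = lt[OF f] lt[OF g] lt[OF permutes_inv[OF f]] lt[OF permutes_inv[OF g]]
  fix X Y :: "complex mat" and a :: complex
  assume X: "X \<in> carrier_mat m m"
  show "perm_act m f g (a \<cdot>\<^sub>m X) = a \<cdot>\<^sub>m perm_act m f g X"
    using X l by (intro eq_matI) (auto simp: perm_act_def)
  show "perm_act m f g (perm_act m (inv_into UNIV f) (inv_into UNIV g) X) = X"
    using X l permutes_inverses[OF f] permutes_inverses[OF g] by (intro eq_matI) (auto simp: perm_act_def)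
  show "perm_act m (inv_into UNIV f) (inv_into UNIV g) (perm_act m f g X) = X"
    using X l permutes_inverses[OF f] permutes_inverses[OF g] by (intro eq_matI) (auto simp: perm_act_def)
  show "perm_act m f g (X + Y) = perm_act m f g X + perm_act m f g Y" if "Y \<in> carrier_mat m m"
    using X that l by (intro eq_matI) (auto simp: perm_act_def)
qed (simp_all add: P)

lemma perm_act_proj_sym_group:
  assumes "f permutes {0..<m}" "g permutes {0..<m}"
  shows "restrict (perm_act m f g) (carrier_mat m m) \<in> proj_sym_group (Mat m) (perm m)"
  by (rule perm_act_proj_sym_groupI[OF assms, of 1]) (simp_all add: perm_perm_act[OF assms])

text \<open>A lift may transpose, but the square of a lift does not.\<close>

lemma liftable_square:
  assumes eq: "equivariant_det_rep (Mat m) (perm m) n \<Lambda> A"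
    and \<sigma>: "restrict \<sigma> (carrier_mat m m) \<in> proj_sym_group (Mat m) (perm m)"
    and \<sigma>C: "\<And>y. y \<in> carrier_mat m m \<Longrightarrow> \<sigma> y \<in> carrier_mat m m"
    and sq: "\<And>y. y \<in> carrier_mat m m \<Longrightarrow> \<sigma> (\<sigma> y) = \<tau> y"
  shows "liftable m n \<Lambda> A \<tau>"
proof -
  have dr: "det_rep (Mat m) (perm m) n \<Lambda> A" and im: "rho_bar (Mat m) A ` rep_sym_group (Mat m) n \<Lambda> A = proj_sym_group (Mat m) (perm m)"
    using eq by (auto simp: equivariant_det_rep_def)
  have LC: "\<Lambda> \<in> carrier_mat n n" and AC: "\<And>y. y \<in> carrier_mat m m \<Longrightarrow> A y \<in> carrier_mat n n"
    using dr by (auto simp: det_rep_def linear_map_Mat_iff)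
  obtain g where g: "g \<in> rep_sym_group (Mat m) n \<Lambda> A" "rho_bar (Mat m) A g = restrict \<sigma> (carrier_mat m m)"
    using \<sigma> im by (metis imageE)
  \<comment> \<open>\<open>inv_into\<close> is a right inverse of \<open>A\<close> on its image, and
    \<open>g\<close> preserves that image.\<close>
  have gA: "g (A y) = A (\<sigma> y)" if y: "y \<in> carrier_mat m m" for y
  proof -
    have "g (A y) \<in> A ` carrier_mat m m" using g(1) y by (auto simp: rep_sym_group_def)
    hence "A (inv_into (carrier_mat m m) A (g (A y))) = g (A y)" by (rule f_inv_into_f)
    moreover have "inv_into (carrier_mat m m) A (g (A y)) = \<sigma> y"
      using fun_cong[OF g(2), of y] y by (simp add: rho_bar_def)
    ultimately show ?thesis by simp
  qed
  have gL: "g \<Lambda> = \<Lambda>" and gp: "g \<in> proj_sym_group (Mat n) det" using g(1) by (auto simp: rep_sym_group_def)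
  obtain P Q where PQ: "P \<in> carrier_mat n n" "Q \<in> carrier_mat n n" "det P \<noteq> 0" "det Q \<noteq> 0"
    "(\<forall>X\<in>carrier_mat n n. g X = P * X * Q) \<or> (\<forall>X\<in>carrier_mat n n. g X = P * X\<^sup>T * Q)"
    using det_preserver[OF gp] by blast
  note assoc = assoc_mult_mat[of _ n n _ n _ n]
  have "\<exists>P2 Q2. P2 \<in> carrier_mat n n \<and> det P2 \<noteq> 0 \<and> Q2 \<in> carrier_mat n n \<and> det Q2 \<noteq> 0 \<and>
    (\<forall>X\<in>carrier_mat n n. g (g X) = P2 * X * Q2)"
    using PQ(5)
  proof
    assume *: "\<forall>X\<in>carrier_mat n n. g X = P * X * Q"
    have "g (g X) = (P * P) * X * (Q * Q)" if "X \<in> carrier_mat n n" for X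
      using * PQ(1,2) that by (simp add: assoc)
    moreover have "det (P * P) \<noteq> 0" "det (Q * Q) \<noteq> 0" using PQ by (simp_all add: det_mult[of _ n])
    ultimately show ?thesis using PQ(1,2) by (intro exI[of _ "P * P"] exI[of _ "Q * Q"]) auto
  next
    assume *: "\<forall>X\<in>carrier_mat n n. g X = P * X\<^sup>T * Q"
    have "g (g X) = (P * Q\<^sup>T) * X * (P\<^sup>T * Q)" if X: "X \<in> carrier_mat n n" for X
    proof -
      have "(P * X\<^sup>T * Q)\<^sup>T = Q\<^sup>T * (X * P\<^sup>T)"
        using PQ(1,2) X by (simp add: transpose_mult[of _ n n _ n])
      thus ?thesis using * PQ(1,2) X by (simp add: assoc)
    qed
    moreover have "det (P * Q\<^sup>T) \<noteq> 0" "det (P\<^sup>T * Q) \<noteq> 0"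
      using PQ by (simp_all add: det_mult[of _ n] det_transpose[of _ n])
    ultimately show ?thesis using PQ(1,2) by (intro exI[of _ "P * Q\<^sup>T"] exI[of _ "P\<^sup>T * Q"]) auto
  qed
  then obtain P2 Q2 where P2: "P2 \<in> carrier_mat n n" "det P2 \<noteq> 0" "Q2 \<in> carrier_mat n n" "det Q2 \<noteq> 0"
    "\<And>X. X \<in> carrier_mat n n \<Longrightarrow> g (g X) = P2 * X * Q2" by blast
  have "P2 * \<Lambda> * Q2 = \<Lambda>" using P2(5)[OF LC] gL by simp
  moreover have "P2 * A y * Q2 = A (\<tau> y)" if y: "y \<in> carrier_mat m m" for y
    using P2(5)[OF AC[OF y]] gA[OF y] gA[OF \<sigma>C[OF y]] sq[OF y] by simp
  ultimately show ?thesis unfolding liftable_def using P2(1-4) by blast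
qed

lemma det_one_minus_outer:
  assumes u: "u \<in> carrier_vec n" and v: "v \<in> carrier_vec n"
  shows "det (1\<^sub>m n - outer n u v) = 1 - v \<bullet> u"
proof -
  define U V where "U = mat n 1 (\<lambda>(i, _). - u $ i)" and "V = mat 1 n (\<lambda>(_, j). v $ j)"
  have C: "U \<in> carrier_mat n 1" "V \<in> carrier_mat 1 n" by (auto simp: U_def V_def)
  have "1\<^sub>m n - outer n u v = 1\<^sub>m n + U * V"
    by (intro eq_matI) (auto simp: U_def V_def scalar_prod_def)
  hence "det (1\<^sub>m n - outer n u v) = det (1\<^sub>m 1 + V * U)" using det_one_plus_mult_commute[OF C] by simp
  also have "\<dots> = (1\<^sub>m 1 + V * U) $$ (0, 0)" by (rule det_single) (use C in auto)
  also have "\<dots> = 1 - v \<bullet> u"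
    using u by (simp add: U_def V_def scalar_prod_def sum_negf)
  finally show ?thesis .
qed

theorem equivariant_det_rep_lower_bound:
  assumes m: "m \<ge> 3" and eq: "equivariant_det_rep (Mat m) (perm m) n \<Lambda> A"
  shows "(2 * m choose m) - 1 \<le> n"
proof -
  have dr: "det_rep (Mat m) (perm m) n \<Lambda> A" using eq by (simp add: equivariant_det_rep_def)
  have LC: "\<Lambda> \<in> carrier_mat n n" and lin: "linear_map class_ring (Mat m) (Mat n) A"
    and det: "\<And>y. y \<in> carrier_mat m m \<Longrightarrow> perm m y = det (\<Lambda> + A y)"
    using dr by (auto simp: det_rep_def)
  note lin' = lin[unfolded linear_map_Mat_iff]
  have AC: "A y \<in> carrier_mat n n" if "y \<in> carrier_mat m m" for y using lin' that by blast
  have torus: "liftable m n \<Lambda> A (torus_act m (\<lambda>i. (t i)\<^sup>2) (\<lambda>i. (s i)\<^sup>2))" if ts: "\<And>i. t i \<noteq> 0 \<and> s i \<noteq> 0" for t s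
    by (rule liftable_square[OF eq torus_act_proj_sym_group[OF ts]])
      (auto simp: torus_act_def power2_eq_square mult_ac intro!: eq_matI)
  have perms: "liftable m n \<Lambda> A (perm_act m (f \<circ> f) (g \<circ> g))" if f: "f permutes {0..<m}" and g: "g permutes {0..<m}" for f g
  proof (rule liftable_square[OF eq perm_act_proj_sym_group[OF f g]])
    have "f i < m" "g i < m" if "i < m" for i
      using permutes_in_image[OF f, of i] permutes_in_image[OF g, of i] that by auto
    thus "perm_act m f g (perm_act m f g y) = perm_act m (f \<circ> f) (g \<circ> g) y" for y
      by (intro eq_matI) (auto simp: perm_act_def)
  qed simp
  obtain t s :: "nat \<Rightarrow> complex" where ts: "\<And>i. t i \<noteq> 0 \<and> s i \<noteq> 0" and gen: "generic_torus m (\<lambda>i. (t i)\<^sup>2) (\<lambda>i. (s i)\<^sup>2)"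
    using generic_torus_exists[of m] by blast
  obtain P Q where PQ: "P \<in> carrier_mat n n" "det P \<noteq> 0" "Q \<in> carrier_mat n n" "det Q \<noteq> 0" "P * \<Lambda> * Q = \<Lambda>"
    "\<And>y. y \<in> carrier_mat m m \<Longrightarrow> P * A y * Q = A (torus_act m (\<lambda>i. (t i)\<^sup>2) (\<lambda>i. (s i)\<^sup>2) y)"
    using torus[of t s, OF ts] unfolding liftable_def by fast
  have "\<exists>u v. u \<in> carrier_vec n \<and> v \<in> carrier_vec n \<and> det (\<Lambda> + outer n u v) \<noteq> 0"
    by (rule corank_one[OF m gen _ LC lin det PQ(1-5) PQ(6)]) (use ts in auto)
  then obtain u v where uv: "u \<in> carrier_vec n" "v \<in> carrier_vec n" "det (\<Lambda> + outer n u v) \<noteq> 0" by blast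
  \<comment> \<open>Multiplying by the inverse \<open>B\<close> of \<open>M\<close> brings the
    constant part to the form \<open>1\<^sub>m n - outer n u1 v\<close>, at the price of the factor
    \<open>det B\<close>.\<close>
  define M where "M = \<Lambda> + outer n u v"
  have MC: "M \<in> carrier_mat n n" using LC by (simp add: M_def)
  obtain B where B: "B \<in> carrier_mat n n" "M * B = 1\<^sub>m n" "B * M = 1\<^sub>m n" "det B \<noteq> 0"
    using obtain_inverse_mat[OF MC] uv(3) M_def by blast
  note assoc = assoc_mult_mat[of _ n n _ n _ n]
  define u1 where "u1 = B *\<^sub>v u"
  have u1: "u1 \<in> carrier_vec n" using B(1) uv(1) by (simp add: u1_def)
  have BO: "B * outer n u v = outer n u1 v"
  proof -
    have "B * outer n u v * 1\<^sub>m n = outer n (B *\<^sub>v u) ((1\<^sub>m n)\<^sup>T *\<^sub>v v)"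
      by (rule mult_outer_mult) (use B uv in auto)
    moreover have "B * outer n u v * 1\<^sub>m n = B * outer n u v"
      by (rule right_mult_one_mat[of _ n n]) (use B in simp)
    ultimately show ?thesis using uv(2) by (simp add: u1_def)
  qed
  define \<Lambda>1 where "\<Lambda>1 = B * \<Lambda>"
  define A1 where "A1 y = B * A y" for y
  have L1: "\<Lambda>1 = 1\<^sub>m n - outer n u1 v"
  proof -
    have e: "1\<^sub>m n = \<Lambda>1 + outer n u1 v"
      using B(3) mult_add_distrib_mat[OF B(1) LC outer_carrier[of n u v]] by (simp add: M_def \<Lambda>1_def BO)
    show ?thesis unfolding e using B(1) LC by (intro eq_matI) (auto simp: \<Lambda>1_def)
  qed
  have L1C: "\<Lambda>1 \<in> carrier_mat n n" using B(1) LC by (simp add: \<Lambda>1_def)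
  have det1: "det (\<Lambda>1 + A1 y) = det B * perm m y" if y: "y \<in> carrier_mat m m" for y
  proof -
    have "\<Lambda>1 + A1 y = B * (\<Lambda> + A y)"
      unfolding \<Lambda>1_def A1_def by (rule mult_add_distrib_mat[OF B(1) LC AC[OF y], symmetric])
    thus ?thesis using B(1) LC AC[OF y] det[OF y] by (simp add: det_mult[of _ n])
  qed
  \<comment> \<open>The permanent vanishes at zero, so the constant part is singular.\<close>
  have vu: "v \<bullet> u1 = 1"
  proof -
    have "A (0 \<cdot>\<^sub>m 0\<^sub>m m m) = 0 \<cdot>\<^sub>m A (0\<^sub>m m m)" using lin' zero_carrier_mat by blast
    moreover have "0 \<cdot>\<^sub>m 0\<^sub>m m m = (0\<^sub>m m m :: complex mat)" by (intro eq_matI) auto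
    moreover have "0 \<cdot>\<^sub>m A (0\<^sub>m m m) = 0\<^sub>m n n" using AC[of "0\<^sub>m m m"] by (intro eq_matI) auto
    ultimately have "A (0\<^sub>m m m) = 0\<^sub>m n n" by simp
    hence "det \<Lambda>1 = det B * perm m (0\<^sub>m m m)" using det1[of "0\<^sub>m m m"] B(1) L1C by (simp add: A1_def)
    moreover have "(\<Prod>i = 0..<m. (0\<^sub>m m m :: complex mat) $$ (i, \<sigma> i)) = 0" if "\<sigma> permutes {0..<m}" for \<sigma>
    proof -
      have "\<sigma> 0 < m" using permutes_in_image[OF that, of 0] m by simp
      thus ?thesis using m by (intro prod_zero bexI[of _ 0]) auto
    qed
    hence "perm m (0\<^sub>m m m) = 0" unfolding perm_def by (intro sum.neutral) auto
    ultimately show ?thesis using det_one_minus_outer[OF u1 uv(2)] L1 by simp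
  qed
  have lin1: "linear_map class_ring (Mat m) (Mat n) A1"
    unfolding linear_map_Mat_iff
  proof (intro conjI ballI allI)
    fix X Y :: "complex mat" and c :: complex
    assume X: "X \<in> carrier_mat m m" and Y: "Y \<in> carrier_mat m m"
    have "A (X + Y) = A X + A Y" using lin' X Y by blast
    thus "A1 (X + Y) = A1 X + A1 Y" unfolding A1_def
      using mult_add_distrib_mat[OF B(1) AC[OF X] AC[OF Y]] by simp
  next
    fix X :: "complex mat" and c :: complex
    assume X: "X \<in> carrier_mat m m"
    show "A1 X \<in> carrier_mat n n" using B(1) AC[OF X] by (simp add: A1_def)
    have "A (c \<cdot>\<^sub>m X) = c \<cdot>\<^sub>m A X" using lin' X by blast
    thus "A1 (c \<cdot>\<^sub>m X) = c \<cdot>\<^sub>m A1 X" unfolding A1_def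
      using B(1) AC[OF X] by (simp add: mult_smult_distrib[of _ n n _ n])
  qed
  have lift1: "liftable m n \<Lambda>1 A1 \<sigma>" if l: "liftable m n \<Lambda> A \<sigma>" for \<sigma>
  proof -
    obtain P Q where PQ: "P \<in> carrier_mat n n" "det P \<noteq> 0" "Q \<in> carrier_mat n n" "det Q \<noteq> 0" "P * \<Lambda> * Q = \<Lambda>"
      "\<And>y. y \<in> carrier_mat m m \<Longrightarrow> P * A y * Q = A (\<sigma> y)" using l unfolding liftable_def by fast
    \<comment> \<open>Left multiplication of the representation by \<open>B\<close> conjugates the
      left factor of a lift, \<open>M\<close> being the inverse of \<open>B\<close>.\<close>
    let ?P = "B * P * M"
    have conj: "?P * (B * X) * Q = B * (P * X * Q)" if X: "X \<in> carrier_mat n n" for X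
    proof -
      have "?P * (B * X) * Q = B * P * (M * B) * X * Q" using B(1) PQ(1,3) MC X by (simp add: assoc)
      thus ?thesis using B PQ(1,3) X by (simp add: assoc)
    qed
    have "det M \<noteq> 0" using uv(3) by (simp add: M_def)
    hence "det ?P \<noteq> 0" using B(1,4) PQ(1,2) MC by (simp add: det_mult[of _ n])
    moreover have "?P * \<Lambda>1 * Q = \<Lambda>1" unfolding \<Lambda>1_def conj[OF LC] PQ(5) ..
    moreover have "?P * A1 y * Q = A1 (\<sigma> y)" if y: "y \<in> carrier_mat m m" for y
      unfolding A1_def conj[OF AC[OF y]] PQ(6)[OF y] ..
    ultimately show ?thesis unfolding liftable_def using B(1) PQ(1,3,4) MC
      by (intro exI[of _ ?P] exI[of _ Q]) auto
  qed
  show ?thesis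
    by (rule lower_bound_core[OF m u1 uv(2) vu L1 lin1 B(4) det1 lift1[OF torus] lift1[OF perms]])
qed

section \<open>A representation on pairs of subsets\<close>

text \<open>The bijections are extensional, so that each of them is counted once.\<close>

definition subperm :: "complex mat \<Rightarrow> nat set \<Rightarrow> nat set \<Rightarrow> complex" where
  "subperm y I J = (\<Sum>f\<in>{f \<in> I \<rightarrow>\<^sub>E J. bij_betw f I J}. \<Prod>i\<in>I. y $$ (i, f i))"

lemma subperm_empty [simp]: "subperm y {} {} = 1"
proof -
  have "{f \<in> {} \<rightarrow>\<^sub>E {}. bij_betw f {} {}} = {\<lambda>_ :: nat. undefined :: nat}" by (auto simp: bij_betw_def)
  thus ?thesis by (simp add: subperm_def)
qed

lemma subperm_expand_row:
  assumes I: "finite I" "i \<in> I" and J: "finite J"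
  shows "subperm y I J = (\<Sum>j\<in>J. y $$ (i, j) * subperm y (I - {i}) (J - {j}))"
proof -
  let ?B = "\<lambda>I J. {f \<in> I \<rightarrow>\<^sub>E J. bij_betw f I J} :: (nat \<Rightarrow> nat) set"
  have fin: "finite (?B (I - {i}) (J - {j}))" for j
    using finite_PiE[of "I - {i}" "\<lambda>_. J - {j}"] I J by simp
  have "(\<Sum>j\<in>J. y $$ (i, j) * subperm y (I - {i}) (J - {j}))
    = (\<Sum>(j, g)\<in>(SIGMA j:J. ?B (I - {i}) (J - {j})). y $$ (i, j) * (\<Prod>k\<in>I - {i}. y $$ (k, g k)))"
    by (subst sum.Sigma[symmetric]) (use J fin in \<open>auto simp: subperm_def sum_distrib_left\<close>)
  also have "\<dots> = subperm y I J" unfolding subperm_def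
  proof (rule sum.reindex_bij_witness[where i = "\<lambda>f. (f i, restrict f (I - {i}))" and j = "\<lambda>(j, g). g(i := j)"])
    fix p assume p: "p \<in> (SIGMA j:J. ?B (I - {i}) (J - {j}))"
    then obtain j g where jg: "p = (j, g)" "j \<in> J" "g \<in> I - {i} \<rightarrow>\<^sub>E J - {j}" "bij_betw g (I - {i}) (J - {j})" by auto
    have ext: "g k = undefined" if "k \<notin> I - {i}" for k using jg(3) that by (rule PiE_arb)
    show "((case p of (j, g) \<Rightarrow> g(i := j)) i, restrict (case p of (j, g) \<Rightarrow> g(i := j)) (I - {i})) = p"
      using ext jg(1) by (auto simp: fun_eq_iff)
    have "bij_betw (g(i := j)) (I - {i}) (J - {j})" using jg(4) by (rule bij_betw_cong[THEN iffD1, rotated]) auto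
    hence "bij_betw (g(i := j)) (I - {i} \<union> {i}) (J - {j} \<union> {(g(i := j)) i})"
      by (subst notIn_Un_bij_betw3[symmetric]) auto
    moreover have "I - {i} \<union> {i} = I" "J - {j} \<union> {(g(i := j)) i} = J" using I(2) jg(2) by auto
    ultimately have "bij_betw (g(i := j)) I J" by simp
    moreover have "g(i := j) \<in> I \<rightarrow>\<^sub>E J" using jg(2,3) I(2) by (auto simp: PiE_iff extensional_def)
    ultimately show "(case p of (j, g) \<Rightarrow> g(i := j)) \<in> ?B I J" using jg(1) by simp
    have "(\<Prod>k\<in>I. y $$ (k, (g(i := j)) k)) = y $$ (i, j) * (\<Prod>k\<in>I - {i}. y $$ (k, (g(i := j)) k))"
      using I by (simp add: prod.remove[of I i])
    also have "(\<Prod>k\<in>I - {i}. y $$ (k, (g(i := j)) k)) = (\<Prod>k\<in>I - {i}. y $$ (k, g k))"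
      by (intro prod.cong) auto
    finally show "(\<Prod>k\<in>I. y $$ (k, (case p of (j, g) \<Rightarrow> g(i := j)) k)) =
      (case p of (j, g) \<Rightarrow> y $$ (i, j) * (\<Prod>k\<in>I - {i}. y $$ (k, g k)))" using jg(1) by simp
  next
    fix f assume f: "f \<in> ?B I J"
    show "(case (f i, restrict f (I - {i})) of (j, g) \<Rightarrow> g(i := j)) = f"
      using f I(2) by (auto simp: fun_eq_iff PiE_iff extensional_def)
    have "bij_betw f (I - {i}) (J - {f i})"
      using f I(2) by (auto simp: bij_betw_def inj_on_def)
    hence "bij_betw (restrict f (I - {i})) (I - {i}) (J - {f i})"
      by (rule bij_betw_cong[THEN iffD1, rotated]) auto
    moreover from this have "restrict f (I - {i}) \<in> I - {i} \<rightarrow>\<^sub>E J - {f i}"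
      by (auto simp: bij_betw_def)
    ultimately show "(f i, restrict f (I - {i})) \<in> (SIGMA j:J. ?B (I - {i}) (J - {j}))"
      using f I(2) by auto
  qed
  finally show ?thesis ..
qed

text \<open>Laplace expansions along all rows of \<open>I\<close> are added up. No row is singled
  out, which keeps the matrix built from them symmetric under row permutations.\<close>

lemma subperm_expand:
  assumes "finite I" "finite J"
  shows "of_nat (card I) * subperm y I J = (\<Sum>i\<in>I. \<Sum>j\<in>J. y $$ (i, j) * subperm y (I - {i}) (J - {j}))"
proof -
  have "(\<Sum>i\<in>I. \<Sum>j\<in>J. y $$ (i, j) * subperm y (I - {i}) (J - {j})) = (\<Sum>i\<in>I. subperm y I J)"
    using assms by (intro sum.cong) (simp_all add: subperm_expand_row[symmetric])
  thus ?thesis by simp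
qed

lemma subperm_full: "subperm y {..<m} {..<m} = perm m y"
  unfolding subperm_def perm_def
proof (rule sum.reindex_bij_witness[where i = "\<lambda>\<sigma>. restrict \<sigma> {..<m}" and j = "\<lambda>f i. if i < m then f i else i"])
  fix f assume f: "f \<in> {f \<in> {..<m} \<rightarrow>\<^sub>E {..<m}. bij_betw f {..<m} {..<m}}"
  show "restrict (\<lambda>i. if i < m then f i else i) {..<m} = f"
    using f by (auto simp: fun_eq_iff PiE_iff extensional_def)
  have "bij_betw (\<lambda>i. if i < m then f i else i) {..<m} {..<m}"
    using f by (auto intro: bij_betw_cong[THEN iffD1, rotated])
  thus "(\<lambda>i. if i < m then f i else i) \<in> {\<sigma>. \<sigma> permutes {0..<m}}"
    by (auto intro!: bij_imp_permutes simp: atLeast0LessThan split: if_splits)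
  show "(\<Prod>i = 0..<m. y $$ (i, if i < m then f i else i)) = (\<Prod>i<m. y $$ (i, f i))"
    by (simp add: atLeast0LessThan)
next
  fix \<sigma> assume "\<sigma> \<in> {\<sigma>. \<sigma> permutes {0..<m}}"
  hence s: "\<sigma> permutes {..<m}" by (simp add: atLeast0LessThan)
  show "(\<lambda>i. if i < m then restrict \<sigma> {..<m} i else i) = \<sigma>"
    using permutes_not_in[OF s] by (auto simp: fun_eq_iff)
  have "bij_betw (restrict \<sigma> {..<m}) {..<m} {..<m}"
    using permutes_imp_bij[OF s] by (rule bij_betw_cong[THEN iffD1, rotated]) auto
  thus "restrict \<sigma> {..<m} \<in> {f \<in> {..<m} \<rightarrow>\<^sub>E {..<m}. bij_betw f {..<m} {..<m}}"
    by (auto simp: bij_betw_def)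
qed

text \<open>The weighted adjacency of a graph on pairs, with one edge for each deletion of a row and
  a column; at most one term of the sum is nonzero.\<close>

definition pair_entry :: "complex mat \<Rightarrow> nat set \<times> nat set \<Rightarrow> nat set \<times> nat set \<Rightarrow> complex" where
  "pair_entry y p q = (\<Sum>i\<in>fst p. \<Sum>j\<in>snd p. if q = (fst p - {i}, snd p - {j}) then y $$ (i, j) else 0)"

definition square_pairs :: "nat \<Rightarrow> (nat set \<times> nat set) set" where
  "square_pairs m = {(I, J). I \<subseteq> {..<m} \<and> J \<subseteq> {..<m} \<and> card I = card J \<and> I \<noteq> {}}"

lemma pair_entry_nonzero:
  assumes "pair_entry y p q \<noteq> 0"
  shows "\<exists>i\<in>fst p. \<exists>j\<in>snd p. q = (fst p - {i}, snd p - {j})"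
proof (rule ccontr)
  assume "\<not> ?thesis"
  hence "pair_entry y p q = 0" unfolding pair_entry_def by (intro sum.neutral ballI) auto
  thus False using assms by simp
qed

lemma pair_entry_card:
  assumes "pair_entry y p q \<noteq> 0" "p \<in> square_pairs m"
  shows "card (fst q) < card (fst p)"
proof -
  obtain i j where "i \<in> fst p" "q = (fst p - {i}, snd p - {j})" using pair_entry_nonzero[OF assms(1)] by blast
  moreover have "finite (fst p)" using assms(2) by (auto simp: square_pairs_def dest: finite_subset[OF _ finite_lessThan])
  ultimately show ?thesis by (metis card_Diff1_less fst_conv)
qed

lemma square_pairs_enumeration:
  obtains e where "bij_betw e {..<(2 * m choose m) - 1} (square_pairs m)"
    "\<And>a b. a \<le> b \<Longrightarrow> b < (2 * m choose m) - 1 \<Longrightarrow> card (fst (e b)) \<le> card (fst (e a))"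
proof -
  let ?n = "(2 * m choose m) - 1"
  let ?f = "\<lambda>p :: nat set \<times> nat set. m - card (fst p)"
  have fin: "finite (square_pairs m)"
    by (rule finite_subset[of _ "Pow {..<m} \<times> Pow {..<m}"]) (auto simp: square_pairs_def)
  then obtain xs where xs: "distinct xs" "set xs = square_pairs m" using finite_distinct_list by blast
  define ys where "ys = sort_key ?f xs"
  have ys: "distinct ys" "set ys = square_pairs m" "sorted (map ?f ys)" using xs by (simp_all add: ys_def)
  have len: "length ys = ?n"
    using distinct_card[OF ys(1)] ys(2) card_equal_size_pairs[of m] by (simp add: square_pairs_def)
  show ?thesis
  proof (rule that[of "(!) ys"])
    show "bij_betw ((!) ys) {..<?n} (square_pairs m)" by (rule bij_betw_nth[OF ys(1)]) (simp_all add: len ys(2))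
    fix a b assume ab: "a \<le> b" "b < ?n"
    have "?f (ys ! a) \<le> ?f (ys ! b)" using sorted_nth_mono[OF ys(3) ab(1)] ab len by simp
    moreover have "card (fst (ys ! c)) \<le> m" if "c < ?n" for c
    proof -
      have "fst (ys ! c) \<subseteq> {..<m}" using nth_mem[of c ys] that len ys(2) by (auto simp: square_pairs_def)
      thus ?thesis using card_mono[of "{..<m}"] by fastforce
    qed
    ultimately show "card (fst (ys ! b)) \<le> card (fst (ys ! a))" using ab by fastforce
  qed
qed

section \<open>Symmetries acting on the entries indexed by pairs\<close>

lemma proj_sym_group_compose:
  assumes f: "f \<in> proj_sym_group (Mat n) P" and g: "g \<in> proj_sym_group (Mat n) P"
  shows "restrict (\<lambda>X. f (g X)) (carrier_mat n n) \<in> proj_sym_group (Mat n) P"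
proof -
  note F = proj_sym_groupD[OF f] and G = proj_sym_groupD[OF g]
  let ?C = "carrier_mat n n :: complex mat set"
  obtain c where c: "c \<noteq> 0" "\<And>X. X \<in> ?C \<Longrightarrow> P (f X) = c * P X" using F(6) by blast
  obtain d where d: "d \<noteq> 0" "\<And>X. X \<in> ?C \<Longrightarrow> P (g X) = d * P X" using G(6) by blast
  have inv: "inv_into ?C k X \<in> ?C" "k (inv_into ?C k X) = X" "inv_into ?C k (k X) = X"
    if "bij_betw k ?C ?C" "X \<in> ?C" for k X
    using that by (auto simp: bij_betw_def inv_into_into f_inv_into_f)
  show ?thesis
    by (rule proj_sym_groupI[where h = "\<lambda>X. inv_into ?C g (inv_into ?C f X)" and c = "c * d"])
      (simp_all add: F(3-5) G(3-5) inv[OF F(2)] inv[OF G(2)] c d)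
qed

lemma det_torus_act:
  assumes "X \<in> carrier_mat n n"
  shows "det (torus_act n t s X) = (\<Prod>i<n. t i) * (\<Prod>j<n. s j) * det X"
proof -
  have "(\<Prod>i = 0..<n. torus_act n t s X $$ (i, \<sigma> i)) = (\<Prod>i<n. t i) * (\<Prod>j<n. s j) * (\<Prod>i = 0..<n. X $$ (i, \<sigma> i))"
    if s: "\<sigma> permutes {0..<n}" for \<sigma>
    by (rule prod_torus_act[OF s])
  thus ?thesis unfolding det_def'[OF assms] det_def'[OF torus_act_carrier] sum_distrib_left
    by (intro sum.cong) auto
qed

lemma det_perm_act:
  assumes X: "X \<in> carrier_mat n n" and f: "f permutes {0..<n}" and g: "g permutes {0..<n}"
  shows "det (perm_act n f g X) = signof f * signof g * det X"
proof -
  have "X = mat n n (\<lambda>(i, j). X $$ (i, j))" using X by (intro eq_matI) auto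
  thus ?thesis using det_permute_index[OF f g, of "\<lambda>i j. X $$ (i, j)"] by (simp add: perm_act_def)
qed

lemma rho_bar_proj_sym_group:
  assumes dr: "det_rep (Mat m) P n \<Lambda> A" and inj: "inj_on A (carrier_mat m m)"
    and g: "g \<in> rep_sym_group (Mat m) n \<Lambda> A"
  shows "rho_bar (Mat m) A g \<in> proj_sym_group (Mat m) P"
proof -
  let ?C = "carrier_mat m m :: complex mat set" and ?D = "carrier_mat n n :: complex mat set"
  have LC: "\<Lambda> \<in> ?D" and lin: "linear_map class_ring (Mat m) (Mat n) A"
    and det: "\<And>y. y \<in> ?C \<Longrightarrow> P y = det (\<Lambda> + A y)" using dr by (auto simp: det_rep_def)
  have A: "A y \<in> ?D" "y \<in> ?C \<Longrightarrow> z \<in> ?C \<Longrightarrow> A (y + z) = A y + A z" "A (a \<cdot>\<^sub>m y) = a \<cdot>\<^sub>m A y"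
    if "y \<in> ?C" for y z a using lin[unfolded linear_map_Mat_iff] that by blast+
  have gp: "g \<in> proj_sym_group (Mat n) det" and gL: "g \<Lambda> = \<Lambda>" and gA: "g ` A ` ?C = A ` ?C"
    using g by (auto simp: rep_sym_group_def)
  note G = proj_sym_groupD[OF gp]
  have Ainv: "inv_into ?C A Z \<in> ?C" "A (inv_into ?C A Z) = Z" if "Z \<in> A ` ?C" for Z
    using that by (auto simp: inv_into_into f_inv_into_f)
  have invA: "inv_into ?C A (A y) = y" if "y \<in> ?C" for y using inj that by simp
  let ?f = "\<lambda>y. inv_into ?C A (g (A y))" and ?h = "\<lambda>y. inv_into ?C A (inv_into ?D g (A y))"
  have f: "?f y \<in> ?C" "A (?f y) = g (A y)" if "y \<in> ?C" for y
    using Ainv[of "g (A y)"] that gA by blast+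
  have gi: "inv_into ?D g (A y) \<in> A ` ?C" "g (inv_into ?D g (A y)) = A y" if y: "y \<in> ?C" for y
  proof -
    obtain z where z: "z \<in> ?C" "A y = g (A z)" using gA y by blast
    hence "inv_into ?D g (A y) = A z" using A(1)[OF z(1)] G(2) by (simp add: bij_betw_def)
    thus "inv_into ?D g (A y) \<in> A ` ?C" "g (inv_into ?D g (A y)) = A y" using z by simp_all
  qed
  have h: "?h y \<in> ?C" "A (?h y) = inv_into ?D g (A y)" if "y \<in> ?C" for y
    using Ainv[OF gi(1)[OF that]] by blast+
  obtain c where c: "c \<noteq> 0" "\<And>X. X \<in> ?D \<Longrightarrow> det (g X) = c * det X" using G(6) by blast
  have "restrict ?f ?C \<in> proj_sym_group (Mat m) P"
  proof (rule proj_sym_groupI[where h = ?h and c = c])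
    fix X Y :: "complex mat" and a :: complex
    assume X: "X \<in> ?C"
    show "?f X \<in> ?C" "?h X \<in> ?C" using f(1)[OF X] h(1)[OF X] by simp_all
    show "?f (?h X) = X" by (simp add: h(2)[OF X] gi(2)[OF X] invA[OF X])
    have "inv_into ?D g (g (A X)) = A X" using A(1)[OF X] G(2) by (simp add: bij_betw_def)
    thus "?h (?f X) = X" by (simp add: f(2)[OF X] invA[OF X])
    have "?f (a \<cdot>\<^sub>m X) = inv_into ?C A (A (a \<cdot>\<^sub>m ?f X))"
      by (simp add: A(3)[OF X] G(5)[OF A(1)[OF X]] A(3)[OF f(1)[OF X]] f(2)[OF X])
    thus "?f (a \<cdot>\<^sub>m X) = a \<cdot>\<^sub>m ?f X" using invA[of "a \<cdot>\<^sub>m ?f X"] f(1)[OF X] by simp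
    have "P (?f X) = det (g \<Lambda> + g (A X))" by (simp add: det[OF f(1)[OF X]] f(2)[OF X] gL)
    also have "\<dots> = det (g (\<Lambda> + A X))" by (simp add: G(4)[OF LC A(1)[OF X]])
    also have "\<dots> = c * P X" using LC A(1)[OF X] by (simp add: c(2) det[OF X])
    finally show "P (?f X) = c * P X" .
    show "?f (X + Y) = ?f X + ?f Y" if Y: "Y \<in> ?C"
    proof -
      have "?f (X + Y) = inv_into ?C A (A (?f X + ?f Y))"
        by (simp add: A(2)[OF X X Y] G(4)[OF A(1)[OF X] A(1)[OF Y]] A(2)[OF f(1)[OF X] f(1)[OF X] f(1)[OF Y]]
          f(2)[OF X] f(2)[OF Y])
      thus ?thesis using invA[of "?f X + ?f Y"] f(1)[OF X] f(1)[OF Y] by simp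
    qed
  qed (rule c(1))
  thus ?thesis by (simp add: rho_bar_def)
qed

lemma pair_entry_transpose:
  assumes "y \<in> carrier_mat m m" "I \<subseteq> {..<m}" "J \<subseteq> {..<m}"
  shows "pair_entry y\<^sup>T (J, I) (J', I') = pair_entry y (I, J) (I', J')"
proof -
  have "pair_entry y\<^sup>T (J, I) (J', I') = (\<Sum>j\<in>J. \<Sum>i\<in>I. if (I', J') = (I - {i}, J - {j}) then y $$ (i, j) else 0)"
    unfolding pair_entry_def fst_conv snd_conv
  proof (intro sum.cong refl)
    fix i j assume "j \<in> J" "i \<in> I"
    hence "i < m" "j < m" using assms(2,3) by auto
    thus "(if (J', I') = (J - {j}, I - {i}) then y\<^sup>T $$ (j, i) else 0)
      = (if (I', J') = (I - {i}, J - {j}) then y $$ (i, j) else 0)" using assms(1) by auto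
  qed
  also have "\<dots> = pair_entry y (I, J) (I', J')" unfolding pair_entry_def by (subst sum.swap) simp
  finally show ?thesis .
qed

text \<open>Deleting \<open>i\<close> and \<open>j\<close> divides the weight product of a pair by
  \<open>a i * b j\<close>, which is exactly the factor between \<open>z\<close> and
  \<open>y\<close> at that entry.\<close>

lemma pair_entry_monomial:
  fixes a b :: "nat \<Rightarrow> complex"
  assumes \<pi>: "inj \<pi>" and \<rho>: "inj \<rho>" and I: "I \<subseteq> {..<m}" and J: "J \<subseteq> {..<m}"
    and z: "\<And>i j. i < m \<Longrightarrow> j < m \<Longrightarrow> z $$ (\<pi> i, \<rho> j) = a i * b j * y $$ (i, j)"
  shows "pair_entry z (\<pi> ` I, \<rho> ` J) (\<pi> ` I', \<rho> ` J') * ((\<Prod>i\<in>I'. a i) * (\<Prod>j\<in>J'. b j))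
    = (\<Prod>i\<in>I. a i) * (\<Prod>j\<in>J. b j) * pair_entry y (I, J) (I', J')"
proof -
  have fin: "finite I" "finite J" using I J by (auto dest: finite_subset[OF _ finite_lessThan])
  have im: "\<pi> ` I - {\<pi> i} = \<pi> ` (I - {i})" "\<rho> ` J - {\<rho> j} = \<rho> ` (J - {j})" for i j
    using image_set_diff[OF \<pi>, of I "{i}"] image_set_diff[OF \<rho>, of J "{j}"] by simp_all
  have "pair_entry z (\<pi> ` I, \<rho> ` J) (\<pi> ` I', \<rho> ` J')
    = (\<Sum>i\<in>I. \<Sum>j\<in>J. if (I', J') = (I - {i}, J - {j}) then z $$ (\<pi> i, \<rho> j) else 0)"
    unfolding pair_entry_def fst_conv snd_conv
    by (simp add: sum.reindex[OF inj_on_subset[OF \<pi>]] sum.reindex[OF inj_on_subset[OF \<rho>]]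
        im inj_image_eq_iff[OF \<pi>] inj_image_eq_iff[OF \<rho>])
  hence "pair_entry z (\<pi> ` I, \<rho> ` J) (\<pi> ` I', \<rho> ` J') * ((\<Prod>i\<in>I'. a i) * (\<Prod>j\<in>J'. b j))
    = (\<Sum>i\<in>I. \<Sum>j\<in>J. (if (I', J') = (I - {i}, J - {j}) then z $$ (\<pi> i, \<rho> j) else 0)
        * ((\<Prod>i\<in>I'. a i) * (\<Prod>j\<in>J'. b j)))"
    by (simp add: sum_distrib_right)
  also have "\<dots> = (\<Sum>i\<in>I. \<Sum>j\<in>J. (\<Prod>i\<in>I. a i) * (\<Prod>j\<in>J. b j)
      * (if (I', J') = (I - {i}, J - {j}) then y $$ (i, j) else 0))"
  proof (intro sum.cong refl)
    fix i j assume ij: "i \<in> I" "j \<in> J"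
    hence "z $$ (\<pi> i, \<rho> j) = a i * b j * y $$ (i, j)" using I J by (intro z) auto
    thus "(if (I', J') = (I - {i}, J - {j}) then z $$ (\<pi> i, \<rho> j) else 0) * ((\<Prod>i\<in>I'. a i) * (\<Prod>j\<in>J'. b j))
      = (\<Prod>i\<in>I. a i) * (\<Prod>j\<in>J. b j) * (if (I', J') = (I - {i}, J - {j}) then y $$ (i, j) else 0)"
      by (simp add: prod.remove[OF fin(1) ij(1)] prod.remove[OF fin(2) ij(2)])
  qed
  also have "\<dots> = (\<Prod>i\<in>I. a i) * (\<Prod>j\<in>J. b j) * pair_entry y (I, J) (I', J')"
    by (simp add: pair_entry_def sum_distrib_left)
  finally show ?thesis .
qed

lemma pair_entry_add:
  assumes "X \<in> carrier_mat m m" "Y \<in> carrier_mat m m" "p \<in> square_pairs m"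
  shows "pair_entry (X + Y) p q = pair_entry X p q + pair_entry Y p q"
  using assms unfolding pair_entry_def sum.distrib[symmetric]
  by (intro sum.cong refl) (auto simp: square_pairs_def subset_eq)

lemma pair_entry_smult:
  assumes "X \<in> carrier_mat m m" "p \<in> square_pairs m"
  shows "pair_entry (c \<cdot>\<^sub>m X) p q = c * pair_entry X p q"
  using assms unfolding pair_entry_def sum_distrib_left
  by (intro sum.cong refl) (auto simp: square_pairs_def subset_eq)

section \<open>The matrix of an enumeration of the pairs\<close>

locale square_pair_enumeration =
  fixes m n :: nat and e :: "nat \<Rightarrow> nat set \<times> nat set"
  assumes m: "m \<ge> 2" and e_bij: "bij_betw e {..<n} (square_pairs m)"
    and e_antimono: "\<And>a b. a \<le> b \<Longrightarrow> b < n \<Longrightarrow> card (fst (e b)) \<le> card (fst (e a))"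
begin

text \<open>Rows carry the nonempty pairs in order of decreasing size, so row 0 carries the full pair; column 0
  carries the empty pair in its place. With this order, replacing column 0 by the vector of all
  subpermanents makes the matrix upper triangular.\<close>

definition col_label :: "nat \<Rightarrow> nat set \<times> nat set" where
  "col_label b = (if b = 0 then ({}, {}) else e b)"

text \<open>Dividing by the size averages the expansions along the rows. With the minus sign, row
  \<open>a \<noteq> 0\<close> applied to the vector of subpermanents is one subpermanent minus its
  averaged expansion, hence 0; row 0 gives the permanent.\<close>

definition row_scale :: "nat \<Rightarrow> complex" where
  "row_scale a = (if a = 0 then 1 else - 1) / of_nat (card (fst (e a)))"

definition const_part :: "complex mat" where
  "const_part = mat n n (\<lambda>(a, b). if a = b \<and> a \<noteq> 0 then 1 else 0)"

definition lin_part :: "complex mat \<Rightarrow> complex mat" where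
  "lin_part y = mat n n (\<lambda>(a, b). row_scale a * pair_entry y (e a) (col_label b))"

lemma const_part_carrier [simp]: "const_part \<in> carrier_mat n n"
  and lin_part_carrier [simp]: "lin_part y \<in> carrier_mat n n"
  by (simp_all add: const_part_def lin_part_def)

lemma dim_lin_part [simp]: "dim_row (lin_part y) = n" "dim_col (lin_part y) = n"
  by (simp_all add: lin_part_def)

lemma e_mem: "a < n \<Longrightarrow> e a \<in> square_pairs m"
  using e_bij by (auto simp: bij_betw_def)

lemma e_surj: "p \<in> square_pairs m \<Longrightarrow> \<exists>a<n. e a = p"
  using e_bij unfolding bij_betw_def by (metis imageE lessThan_iff)

lemma e_inj: "a < n \<Longrightarrow> b < n \<Longrightarrow> e a = e b \<longleftrightarrow> a = b"
  using e_bij by (auto simp: bij_betw_def inj_on_def)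

lemma card_le_m: "p \<in> square_pairs m \<Longrightarrow> card (fst p) \<le> m \<and> card (fst p) > 0"
  using card_mono[OF finite_lessThan, of "fst p" m]
  by (auto simp: square_pairs_def card_gt_0_iff dest: finite_subset[OF _ finite_lessThan])

lemma card_eq_m: "p \<in> square_pairs m \<Longrightarrow> card (fst p) = m \<Longrightarrow> p = ({..<m}, {..<m})"
  using card_subset_eq[OF finite_lessThan, of "fst p" m] card_subset_eq[OF finite_lessThan, of "snd p" m]
  by (auto simp: square_pairs_def)

lemma full_mem: "({..<m}, {..<m}) \<in> square_pairs m"
  using m by (auto simp: square_pairs_def lessThan_empty_iff)

lemma n_pos: "0 < n" using e_surj[OF full_mem] by auto

lemma e_zero: "e 0 = ({..<m}, {..<m})"
proof -
  obtain a where a: "a < n" "e a = ({..<m}, {..<m})" using e_surj[OF full_mem] by blast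
  have "card (fst (e 0)) \<ge> m" using e_antimono[of 0 a] a by simp
  thus ?thesis using card_eq_m[OF e_mem[OF n_pos]] card_le_m[OF e_mem[OF n_pos]] by simp
qed

lemma col_label_inj: "inj_on col_label {..<n}"
proof (rule inj_onI)
  fix a b assume ab: "a \<in> {..<n}" "b \<in> {..<n}" "col_label a = col_label b"
  have "e a \<noteq> ({}, {})" if "a < n" for a using e_mem[OF that] by (auto simp: square_pairs_def)
  from this[of a] this[of b] show "a = b" using ab e_inj[of a b] by (simp add: col_label_def split: if_splits)
qed

lemma remove_mem_col:
  assumes p: "p \<in> square_pairs m" and ij: "i \<in> fst p" "j \<in> snd p"
  shows "(fst p - {i}, snd p - {j}) \<in> col_label ` {..<n}"
proof -
  let ?q = "(fst p - {i}, snd p - {j})"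
  have fin: "finite (fst p)" "finite (snd p)" using p by (auto simp: square_pairs_def dest: finite_subset[OF _ finite_lessThan])
  have c: "card (fst ?q) = card (snd ?q)" "card (fst ?q) < m"
    using p ij fin card_le_m[OF p] by (auto simp: square_pairs_def)
  show ?thesis
  proof (cases "fst p - {i} = {}")
    case True
    moreover from this have "snd p - {j} = {}" using c(1) fin by (metis card_eq_0_iff finite_Diff fst_conv snd_conv)
    ultimately have "?q = col_label 0" by (simp add: col_label_def)
    thus ?thesis using n_pos by blast
  next
    case False
    hence "?q \<in> square_pairs m" using p c(1) by (auto simp: square_pairs_def)
    then obtain a where a: "a < n" "e a = ?q" using e_surj by blast
    hence "a \<noteq> 0" using c(2) e_zero by (metis card_lessThan fst_conv less_irrefl)
    hence "?q = col_label a" using a by (simp add: col_label_def)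
    thus ?thesis using a(1) by blast
  qed
qed

lemma sum_pair_entry_col:
  assumes a: "a < n"
  shows "(\<Sum>b<n. pair_entry y (e a) (col_label b) * F (col_label b))
    = (\<Sum>i\<in>fst (e a). \<Sum>j\<in>snd (e a). y $$ (i, j) * F (fst (e a) - {i}, snd (e a) - {j}))"
proof -
  let ?r = "\<lambda>i j. (fst (e a) - {i}, snd (e a) - {j})"
  have "(\<Sum>b<n. pair_entry y (e a) (col_label b) * F (col_label b)) = (\<Sum>q\<in>col_label ` {..<n}. pair_entry y (e a) q * F q)"
    by (simp add: sum.reindex[OF col_label_inj])
  also have "\<dots> = (\<Sum>q\<in>col_label ` {..<n}. \<Sum>i\<in>fst (e a). \<Sum>j\<in>snd (e a). if q = ?r i j then y $$ (i, j) * F q else 0)"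
    unfolding pair_entry_def sum_distrib_right by (intro sum.cong refl) simp
  also have "\<dots> = (\<Sum>i\<in>fst (e a). \<Sum>q\<in>col_label ` {..<n}. \<Sum>j\<in>snd (e a). if q = ?r i j then y $$ (i, j) * F q else 0)"
    by (rule sum.swap)
  also have "\<dots> = (\<Sum>i\<in>fst (e a). \<Sum>j\<in>snd (e a). \<Sum>q\<in>col_label ` {..<n}. if q = ?r i j then y $$ (i, j) * F q else 0)"
    by (intro sum.cong refl sum.swap)
  also have "\<dots> = (\<Sum>i\<in>fst (e a). \<Sum>j\<in>snd (e a). y $$ (i, j) * F (?r i j))"
    by (intro sum.cong refl) (simp add: sum.delta' remove_mem_col[OF e_mem[OF a]])
  finally show ?thesis .
qed

lemma det_const_plus_lin: "det (const_part + lin_part y) = perm m y"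
proof -
  define N where "N = const_part + lin_part y"
  have NC: "N \<in> carrier_mat n n" by (simp add: N_def)
  have N: "N $$ (a, b) = (if a = b \<and> a \<noteq> 0 then 1 else 0) + row_scale a * pair_entry y (e a) (col_label b)"
    if "a < n" "b < n" for a b using that by (simp add: N_def const_part_def lin_part_def)
  let ?x = "\<lambda>q. subperm y (fst q) (snd q)"
  \<comment> \<open>\<open>T\<close> is the identity with column 0 replaced by the subpermanents of
    the column labels. Its entry 0 belongs to the empty pair and is 1, so \<open>T\<close> has
    determinant 1.\<close>
  define u where "u = vec n (\<lambda>b. if b = 0 then 0 else - ?x (col_label b))"
  define T where "T = 1\<^sub>m n - outer n u (unit_vec n 0)"
  have uC: "u \<in> carrier_vec n" by (simp add: u_def)
  have TC: "T \<in> carrier_mat n n" unfolding T_def by (rule minus_carrier_mat) simp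
  have "unit_vec n 0 \<bullet> u = 0" using n_pos by (simp add: scalar_prod_left_unit[OF uC] u_def)
  hence detT: "det T = 1" using det_one_minus_outer[OF uC, of "unit_vec n 0"] by (simp add: T_def)
  have T: "T $$ (b, c) = (if c = 0 then ?x (col_label b) else if b = c then 1 else 0)" if "b < n" "c < n" for b c
    using that n_pos by (auto simp: T_def u_def col_label_def)
  have NT: "(N * T) $$ (a, c) = (if c = 0 then if a = 0 then perm m y else 0 else N $$ (a, c))"
    if ac: "a < n" "c < n" for a c
  proof -
    have *: "(N * T) $$ (a, c) = (\<Sum>b<n. N $$ (a, b) * T $$ (b, c))"
      using NC TC ac by (simp add: scalar_prod_def atLeast0LessThan)
    show ?thesis
    proof (cases "c = 0")
      case False
      have "(\<Sum>b<n. N $$ (a, b) * T $$ (b, c)) = (\<Sum>b<n. if b = c then N $$ (a, b) else 0)"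
        using False ac by (intro sum.cong) (auto simp: T)
      thus ?thesis using * False ac by simp
    next
      case True
      have cd: "of_nat (card (fst (e a))) \<noteq> (0::complex)" using card_le_m[OF e_mem[OF ac(1)]] by simp
      have fin: "finite (fst (e a))" "finite (snd (e a))"
        using e_mem[OF ac(1)] by (auto simp: square_pairs_def dest: finite_subset[OF _ finite_lessThan])
      have "(\<Sum>b<n. N $$ (a, b) * T $$ (b, c)) = (\<Sum>b<n. (if a = b then if a \<noteq> 0 then ?x (col_label a) else 0 else 0)
          + row_scale a * (pair_entry y (e a) (col_label b) * ?x (col_label b)))"
        using True ac n_pos by (intro sum.cong) (auto simp: T N algebra_simps)
      also have "\<dots> = (if a \<noteq> 0 then ?x (col_label a) else 0) + row_scale a * (\<Sum>b<n. pair_entry y (e a) (col_label b) * ?x (col_label b))"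
        using ac by (simp add: sum.distrib sum_distrib_left)
      also have "(\<Sum>b<n. pair_entry y (e a) (col_label b) * ?x (col_label b)) = of_nat (card (fst (e a))) * ?x (e a)"
        by (simp add: sum_pair_entry_col[OF ac(1), where F = ?x] subperm_expand[OF fin])
      also have "(if a \<noteq> 0 then ?x (col_label a) else 0) + row_scale a * (of_nat (card (fst (e a))) * ?x (e a))
          = (if a = 0 then perm m y else 0)"
        using cd by (auto simp: row_scale_def col_label_def e_zero subperm_full)
      finally show ?thesis using * True by simp
    qed
  qed
  \<comment> \<open>A deletion lowers the size, and the enumeration runs by decreasing size, so
    these entries lie strictly above the diagonal.\<close>
  have pe: "pair_entry y (e a) (e c) \<noteq> 0 \<Longrightarrow> a < c" if "a < n" "c < n" for a c
    using pair_entry_card[OF _ e_mem[OF that(1)]] e_antimono[of c a] that by (meson leD leI)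
  have "det (N * T) = (\<Prod>a<n. (N * T) $$ (a, a))"
  proof (rule det_upper_triangular_prod)
    show "N * T \<in> carrier_mat n n" using NC TC by simp
    show "a \<le> c" if "a < n" "c < n" "(N * T) $$ (a, c) \<noteq> 0" for a c
      using that pe[OF that(1,2)] by (auto simp: NT N col_label_def split: if_splits)
  qed
  also have "\<dots> = (\<Prod>a<n. if a = 0 then perm m y else 1)"
    using pe by (intro prod.cong) (auto simp: NT N col_label_def)
  also have "\<dots> = perm m y" using n_pos by simp
  finally show ?thesis using det_mult[OF NC TC] detT by (simp add: N_def)
qed

lemma lin_part_linear: "linear_map class_ring (Mat m) (Mat n) lin_part"
  unfolding linear_map_Mat_iff
proof (intro conjI ballI allI)
  fix X Y :: "complex mat" and c :: complex
  assume X: "X \<in> carrier_mat m m" and Y: "Y \<in> carrier_mat m m"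
  show "lin_part (X + Y) = lin_part X + lin_part Y"
    by (intro eq_matI) (auto simp: lin_part_def pair_entry_add[OF X Y e_mem] distrib_left)
next
  fix X :: "complex mat" and c :: complex
  assume X: "X \<in> carrier_mat m m"
  show "lin_part (c \<cdot>\<^sub>m X) = c \<cdot>\<^sub>m lin_part X"
    by (intro eq_matI) (auto simp: lin_part_def pair_entry_smult[OF X e_mem])
qed simp

lemma det_rep_lin_part: "det_rep (Mat m) (perm m) n const_part lin_part"
  by (simp add: det_rep_def lin_part_linear det_const_plus_lin)

lemma lin_part_inj: "inj_on lin_part (carrier_mat m m)"
proof (rule inj_onI)
  fix X Y :: "complex mat"
  assume X: "X \<in> carrier_mat m m" and Y: "Y \<in> carrier_mat m m" and eq: "lin_part X = lin_part Y"
  show "X = Y"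
  proof (rule eq_matI)
    fix i j assume "i < dim_row Y" "j < dim_col Y"
    hence ij: "i < m" "j < m" using Y by auto
    \<comment> \<open>A pair of singletons leads to the empty pair, so column 0 contains every entry
      of the argument up to a nonzero factor.\<close>
    have "({i}, {j}) \<in> square_pairs m" using ij by (simp add: square_pairs_def)
    then obtain a where a: "a < n" "e a = ({i}, {j})" using e_surj by blast
    have "lin_part Z $$ (a, 0) = row_scale a * Z $$ (i, j)" for Z
      using a n_pos by (simp add: lin_part_def pair_entry_def col_label_def)
    moreover have "row_scale a \<noteq> 0" using a by (simp add: row_scale_def)
    ultimately show "X $$ (i, j) = Y $$ (i, j)" using eq by (metis mult_cancel_left)
  qed (use X Y in auto)
qed

text \<open>The lift permutes rows and columns along \<open>\<phi>\<close>, rescaling rows by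
  \<open>W\<close> and columns by its inverse. Row and column labels agree at all indices but 0,
  which is where the constant part has its entries, so the scalings cancel there.\<close>

lemma label_action_lifts:
  assumes \<gamma>: "\<gamma> \<in> proj_sym_group (Mat m) (perm m)"
    and \<phi>: "bij_betw \<phi> (square_pairs m) (square_pairs m)" "\<phi> ({}, {}) = ({}, {})"
    and \<phi>_card: "\<And>p. p \<in> square_pairs m \<Longrightarrow> card (fst (\<phi> p)) = card (fst p)"
    and W: "\<And>p. W p \<noteq> 0"
    and intertwine: "\<And>y p q. y \<in> carrier_mat m m \<Longrightarrow> p \<in> square_pairs m \<Longrightarrow>
      pair_entry (\<gamma> y) (\<phi> p) (\<phi> q) * W q = W p * pair_entry y p q"
  shows "\<gamma> \<in> rho_bar (Mat m) lin_part ` rep_sym_group (Mat m) n const_part lin_part"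
proof -
  let ?C = "carrier_mat m m :: complex mat set" and ?D = "carrier_mat n n :: complex mat set"
  note \<Gamma> = proj_sym_groupD[OF \<gamma>]
  define h where "h a = (if a < n then inv_into {..<n} e (\<phi> (e a)) else a)" for a
  have eh: "h a < n" "e (h a) = \<phi> (e a)" if "a < n" for a
  proof -
    have "\<phi> (e a) \<in> e ` {..<n}" using \<phi>(1) e_bij e_mem[OF that] by (auto simp: bij_betw_def)
    thus "h a < n" "e (h a) = \<phi> (e a)" using inv_into_into[of "\<phi> (e a)" e "{..<n}"] f_inv_into_f[of "\<phi> (e a)" e "{..<n}"] that
      by (simp_all add: h_def)
  qed
  have h_inj: "inj_on h {..<n}"
  proof (rule inj_onI)
    fix a b assume ab: "a \<in> {..<n}" "b \<in> {..<n}" "h a = h b"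
    hence "\<phi> (e a) = \<phi> (e b)" using eh[of a] eh[of b] by simp
    hence "e a = e b" using \<phi>(1) e_mem ab by (auto simp: bij_betw_def dest: inj_onD)
    thus "a = b" using e_inj ab by simp
  qed
  have hp: "h permutes {0..<n}"
  proof (rule bij_imp_permutes)
    have "h ` {..<n} = {..<n}" by (rule card_subset_eq) (use eh h_inj in \<open>auto simp: card_image\<close>)
    thus "bij_betw h {0..<n} {0..<n}" using h_inj by (simp add: bij_betw_def atLeast0LessThan)
  qed (simp add: h_def)
  \<comment> \<open>The full pair is the only one of size \<open>m\<close>, so index 0 is fixed;
    this fits column 0, whose empty label is fixed by \<open>\<phi>\<close>.\<close>
  have h0: "h a = 0 \<longleftrightarrow> a = 0" if "a < n" for a
  proof -
    have "h 0 = 0"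
    proof -
      have "card (fst (e (h 0))) = m" using eh[OF n_pos] \<phi>_card[OF e_mem[OF n_pos]] e_zero by simp
      hence "e (h 0) = e 0" using card_eq_m[OF e_mem[OF eh(1)[OF n_pos]]] e_zero by simp
      thus ?thesis using e_inj eh(1) n_pos by blast
    qed
    thus ?thesis using h_inj that n_pos by (metis inj_onD lessThan_iff)
  qed
  have colh: "col_label (h b) = \<phi> (col_label b)" if "b < n" for b
    using h0[OF that] eh(2)[OF that] \<phi>(2) by (simp add: col_label_def)
  have row_scaleh: "row_scale (h a) = row_scale a" if "a < n" for a
    using h0[OF that] eh(2)[OF that] \<phi>_card[OF e_mem[OF that]] by (simp add: row_scale_def)
  let ?k = "inv_into UNIV h"
  have kp: "?k permutes {0..<n}" by (rule permutes_inv[OF hp])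
  have k: "?k a < n" "h (?k a) = a" if "a < n" for a
    using permutes_in_image[OF kp, of a] permutes_inverses(1)[OF hp, of a] that by simp_all
  define c where "c a = W (e a)" for a
  define d where "d b = inverse (W (col_label b))" for b
  have cd: "c a \<noteq> 0 \<and> d a \<noteq> 0" for a using W by (simp add: c_def d_def)
  define g where "g = restrict (\<lambda>X. restrict (perm_act n ?k ?k) ?D (restrict (torus_act n c d) ?D X)) ?D"
  have gX: "g X = mat n n (\<lambda>(a, b). c (?k a) * d (?k b) * X $$ (?k a, ?k b))" if "X \<in> ?D" for X
    using that k by (intro eq_matI) (auto simp: g_def perm_act_def torus_act_def)
  \<comment> \<open>Rows and columns undergo the same permutation, so the signs cancel.\<close>
  have sgn: "signof ?k * signof ?k = (1 :: complex)" by (simp add: sign_def)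
  have gp: "g \<in> proj_sym_group (Mat n) det" unfolding g_def
  proof (rule proj_sym_group_compose[where f = "restrict (perm_act n ?k ?k) ?D" and g = "restrict (torus_act n c d) ?D"])
    show "restrict (perm_act n ?k ?k) ?D \<in> proj_sym_group (Mat n) det"
      by (rule perm_act_proj_sym_groupI[OF kp kp, of 1]) (simp_all add: det_perm_act[OF _ kp kp] sgn)
    show "restrict (torus_act n c d) ?D \<in> proj_sym_group (Mat n) det"
      by (rule torus_act_proj_sym_groupI[OF cd, of "(\<Prod>i<n. c i) * (\<Prod>j<n. d j)"])
        (use cd in \<open>simp_all add: det_torus_act\<close>)
  qed
  have gL: "g const_part = const_part"
  proof -
    have "c (?k a) * d (?k b) * const_part $$ (?k a, ?k b) = const_part $$ (a, b)" if ab: "a < n" "b < n" for a b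
    proof -
      have "?k a = ?k b \<longleftrightarrow> a = b" "?k a = 0 \<longleftrightarrow> a = 0" using k[OF ab(1)] k[OF ab(2)] h0[OF k(1)[OF ab(1)]] by metis+
      thus ?thesis using k ab W by (auto simp: const_part_def c_def d_def col_label_def)
    qed
    thus ?thesis by (subst gX) (auto intro!: eq_matI simp: const_part_def)
  qed
  have gA: "g (lin_part y) = lin_part (\<gamma> y)" if y: "y \<in> ?C" for y
  proof -
    have "c (?k a) * d (?k b) * lin_part y $$ (?k a, ?k b) = lin_part (\<gamma> y) $$ (a, b)" if ab: "a < n" "b < n" for a b
    proof -
      let ?a = "?k a" and ?b = "?k b"
      have "pair_entry (\<gamma> y) (\<phi> (e ?a)) (\<phi> (col_label ?b)) = c ?a * d ?b * pair_entry y (e ?a) (col_label ?b)"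
        using intertwine[OF y e_mem[OF k(1)[OF ab(1)]], of "col_label ?b"] W[of "col_label ?b"]
        by (simp add: c_def d_def field_simps)
      moreover have "e a = \<phi> (e ?a)" "col_label b = \<phi> (col_label ?b)" "row_scale a = row_scale ?a"
        using eh(2)[OF k(1)[OF ab(1)]] colh[OF k(1)[OF ab(2)]] row_scaleh[OF k(1)[OF ab(1)]] k(2) ab by simp_all
      ultimately show ?thesis using ab k by (simp add: lin_part_def)
    qed
    thus ?thesis by (subst gX) (auto intro!: eq_matI)
  qed
  have "g ` lin_part ` ?C = lin_part ` \<gamma> ` ?C" using gA by (force simp: image_image)
  also have "\<gamma> ` ?C = ?C" using \<Gamma>(2) by (simp add: bij_betw_def)
  finally have gr: "g \<in> rep_sym_group (Mat m) n const_part lin_part"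
    using gp gL by (simp add: rep_sym_group_def)
  have "rho_bar (Mat m) lin_part g = \<gamma>"
  proof (rule extensionalityI[OF _ \<Gamma>(1)])
    show "rho_bar (Mat m) lin_part g \<in> extensional ?C" by (simp add: rho_bar_def)
    show "rho_bar (Mat m) lin_part g y = \<gamma> y" if "y \<in> ?C" for y
      using that \<Gamma>(3)[OF that] lin_part_inj by (simp add: rho_bar_def gA)
  qed
  thus ?thesis using gr by blast
qed

lemma image_pair_bij:
  assumes \<pi>: "\<pi> permutes {0..<m}" and \<rho>: "\<rho> permutes {0..<m}"
  shows "bij_betw (\<lambda>(I, J). (\<pi> ` I, \<rho> ` J)) (square_pairs m) (square_pairs m)"
proof -
  have im: "\<sigma> ` I \<subseteq> {..<m}" "card (\<sigma> ` I) = card I" if "\<sigma> permutes {0..<m}" "I \<subseteq> {..<m}" for \<sigma> I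
    using permutes_in_image[OF that(1)] that(2) card_image[OF inj_on_subset[OF permutes_inj[OF that(1)]], of I]
    by (auto simp: subset_eq)
  have mem: "(\<sigma> ` I, \<tau> ` J) \<in> square_pairs m"
    if "\<sigma> permutes {0..<m}" "\<tau> permutes {0..<m}" "(I, J) \<in> square_pairs m" for \<sigma> \<tau> I J
  proof -
    have IJ: "I \<subseteq> {..<m}" "J \<subseteq> {..<m}" "card I = card J" "I \<noteq> {}" using that(3) by (auto simp: square_pairs_def)
    show ?thesis unfolding square_pairs_def
      by (simp add: IJ(3,4) im[OF that(1) IJ(1)] im[OF that(2) IJ(2)] del: image_subset_iff)
  qed
  have ii: "\<sigma> ` inv_into UNIV \<sigma> ` I = I" "inv_into UNIV \<sigma> ` \<sigma> ` I = I" if "\<sigma> permutes {0..<m}" for \<sigma> I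
    using permutes_inverses[OF that] by (simp_all add: image_image)
  show ?thesis
  proof (rule bij_betwI)
    show "(\<lambda>(I, J). (\<pi> ` I, \<rho> ` J)) \<in> square_pairs m \<rightarrow> square_pairs m"
      using mem[OF \<pi> \<rho>] by auto
    show "(\<lambda>(I, J). (inv_into UNIV \<pi> ` I, inv_into UNIV \<rho> ` J)) \<in> square_pairs m \<rightarrow> square_pairs m"
      using mem[OF permutes_inv[OF \<pi>] permutes_inv[OF \<rho>]] by auto
  qed (simp_all add: case_prod_unfold ii[OF \<pi>] ii[OF \<rho>])
qed

lemma swap_pair_bij: "bij_betw prod.swap (square_pairs m) (square_pairs m)"
  by (rule bij_betwI[where g = prod.swap])
    (auto simp: square_pairs_def dest: finite_subset[OF _ finite_lessThan])

text \<open>One inclusion comes from injectivity of the linear part. For the other,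
  \<open>perm_preserver\<close> makes every symmetry monomial up to transposition, and
  \<open>pair_entry_monomial\<close> shows how it acts on labels; a transposing symmetry also swaps
  the two sets of a pair.\<close>

lemma equivariant_lin_part:
  assumes "m \<ge> 3"
  shows "equivariant_det_rep (Mat m) (perm m) n const_part lin_part"
  unfolding equivariant_det_rep_def
proof (intro conjI det_rep_lin_part subset_antisym subsetI)
  fix \<gamma> assume "\<gamma> \<in> rho_bar (Mat m) lin_part ` rep_sym_group (Mat m) n const_part lin_part"
  thus "\<gamma> \<in> proj_sym_group (Mat m) (perm m)"
    using rho_bar_proj_sym_group[OF det_rep_lin_part lin_part_inj] by blast
next
  fix \<gamma> assume \<gamma>: "\<gamma> \<in> proj_sym_group (Mat m) (perm m)"
  note \<Gamma> = proj_sym_groupD[OF \<gamma>]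
  have lin: "linear_map class_ring (Mat m) (Mat m) \<gamma>" using \<gamma> by (simp add: proj_sym_group_def GL_def)
  obtain a b :: "nat \<Rightarrow> complex" and \<pi> \<rho> where \<pi>: "\<pi> permutes {0..<m}" and \<rho>: "\<rho> permutes {0..<m}"
    and ab: "\<forall>i<m. a i \<noteq> 0 \<and> b i \<noteq> 0"
    and cases: "(\<forall>i<m. \<forall>j<m. \<gamma> (unit_mat m i j) = (a i * b j) \<cdot>\<^sub>m unit_mat m (\<pi> i) (\<rho> j)) \<or>
      (\<forall>i<m. \<forall>j<m. \<gamma> (unit_mat m i j) = (a i * b j) \<cdot>\<^sub>m unit_mat m (\<rho> j) (\<pi> i))"
    using perm_preserver[OF \<gamma> assms] by blast
  \<comment> \<open>Extending by 1 beyond \<open>m\<close> keeps the weight products nonzero on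
    arbitrary sets, as \<open>label_action_lifts\<close> asks.\<close>
  define a' b' where "a' i = (if i < m then a i else 1)" and "b' i = (if i < m then b i else 1)" for i
  have nz: "(\<Prod>i\<in>I. a' i) \<noteq> 0" "(\<Prod>i\<in>I. b' i) \<noteq> 0" for I
    using ab by (cases "finite I"; auto simp: a'_def b'_def)+
  have lt: "\<pi> i < m" "\<rho> i < m" if "i < m" for i
    using permutes_in_image[OF \<pi>, of i] permutes_in_image[OF \<rho>, of i] that by simp_all
  have inj: "inj \<pi>" "inj \<rho>" using permutes_inj[OF \<pi>] permutes_inj[OF \<rho>] by simp_all
  have cardim: "card (\<sigma> ` I) = card I" if "inj \<sigma>" for \<sigma> :: "nat \<Rightarrow> nat" and I
    by (rule card_image[OF inj_on_subset[OF that]]) simp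
  have sumd: "(\<Sum>i<m. \<Sum>j<m. if i = p \<and> j = q then f i j else 0) = (f p q :: complex)" if "p < m" "q < m" for p q f
  proof -
    have "(\<Sum>i<m. \<Sum>j<m. if i = p \<and> j = q then f i j else 0) = (\<Sum>i<m. if i = p then f i q else 0)"
      using that by (intro sum.cong) auto
    thus ?thesis using that by simp
  qed
  from cases show "\<gamma> \<in> rho_bar (Mat m) lin_part ` rep_sym_group (Mat m) n const_part lin_part"
  proof
    assume *: "\<forall>i<m. \<forall>j<m. \<gamma> (unit_mat m i j) = (a i * b j) \<cdot>\<^sub>m unit_mat m (\<pi> i) (\<rho> j)"
    have entry: "\<gamma> y $$ (\<pi> i, \<rho> j) = a' i * b' j * y $$ (i, j)" if y: "y \<in> carrier_mat m m" and ij: "i < m" "j < m" for y i j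
    proof -
      have "\<gamma> y $$ (\<pi> i, \<rho> j) = (\<Sum>k<m. \<Sum>l<m. if k = i \<and> l = j then a' k * b' l * y $$ (k, l) else 0)"
        unfolding linear_map_expand[OF lin y lt(1)[OF ij(1)] lt(2)[OF ij(2)]]
        using * lt ij by (intro sum.cong refl) (auto simp: a'_def b'_def inj_eq[OF inj(1)] inj_eq[OF inj(2)])
      thus ?thesis using sumd[OF ij] by simp
    qed
    show ?thesis
    proof (rule label_action_lifts[OF \<gamma> image_pair_bij[OF \<pi> \<rho>], where W = "\<lambda>(I, J). (\<Prod>i\<in>I. a' i) * (\<Prod>j\<in>J. b' j)"])
      fix y :: "complex mat" and p q :: "nat set \<times> nat set"
      assume y: "y \<in> carrier_mat m m" and p: "p \<in> square_pairs m"
      obtain I J I' J' where pq: "p = (I, J)" "q = (I', J')" by (metis surj_pair)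
      have "I \<subseteq> {..<m}" "J \<subseteq> {..<m}" using p pq by (auto simp: square_pairs_def)
      from pair_entry_monomial[OF inj this entry[OF y]]
      show "pair_entry (\<gamma> y) (case p of (I, J) \<Rightarrow> (\<pi> ` I, \<rho> ` J)) (case q of (I, J) \<Rightarrow> (\<pi> ` I, \<rho> ` J)) *
          (case q of (I, J) \<Rightarrow> (\<Prod>i\<in>I. a' i) * (\<Prod>j\<in>J. b' j)) =
        (case p of (I, J) \<Rightarrow> (\<Prod>i\<in>I. a' i) * (\<Prod>j\<in>J. b' j)) * pair_entry y p q"
        by (simp add: pq)
    qed (auto simp: nz cardim[OF inj(1)])
  next
    assume *: "\<forall>i<m. \<forall>j<m. \<gamma> (unit_mat m i j) = (a i * b j) \<cdot>\<^sub>m unit_mat m (\<rho> j) (\<pi> i)"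
    have entry: "\<gamma> y $$ (\<rho> j, \<pi> i) = b' j * a' i * y\<^sup>T $$ (j, i)" if y: "y \<in> carrier_mat m m" and ij: "j < m" "i < m" for y i j
    proof -
      have "\<gamma> y $$ (\<rho> j, \<pi> i) = (\<Sum>k<m. \<Sum>l<m. if k = i \<and> l = j then a' k * b' l * y $$ (k, l) else 0)"
        unfolding linear_map_expand[OF lin y lt(2)[OF ij(1)] lt(1)[OF ij(2)]]
        using * lt ij by (intro sum.cong refl) (auto simp: a'_def b'_def inj_eq[OF inj(1)] inj_eq[OF inj(2)])
      thus ?thesis using sumd[OF ij(2,1)] ij y by simp
    qed
    have bij: "bij_betw (\<lambda>(I, J). (\<rho> ` J, \<pi> ` I)) (square_pairs m) (square_pairs m)"
      using bij_betw_trans[OF swap_pair_bij image_pair_bij[OF \<rho> \<pi>]] by (simp add: comp_def case_prod_unfold)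
    show ?thesis
    proof (rule label_action_lifts[OF \<gamma> bij, where W = "\<lambda>(I, J). (\<Prod>i\<in>J. b' i) * (\<Prod>j\<in>I. a' j)"])
      fix y :: "complex mat" and p q :: "nat set \<times> nat set"
      assume y: "y \<in> carrier_mat m m" and p: "p \<in> square_pairs m"
      obtain I J I' J' where pq: "p = (I, J)" "q = (I', J')" by (metis surj_pair)
      have IJ: "J \<subseteq> {..<m}" "I \<subseteq> {..<m}" using p pq by (auto simp: square_pairs_def)
      from pair_entry_monomial[OF inj(2,1) IJ entry[OF y]]
      show "pair_entry (\<gamma> y) (case p of (I, J) \<Rightarrow> (\<rho> ` J, \<pi> ` I)) (case q of (I, J) \<Rightarrow> (\<rho> ` J, \<pi> ` I)) *
          (case q of (I, J) \<Rightarrow> (\<Prod>i\<in>J. b' i) * (\<Prod>j\<in>I. a' j)) =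
        (case p of (I, J) \<Rightarrow> (\<Prod>i\<in>J. b' i) * (\<Prod>j\<in>I. a' j)) * pair_entry y p q"
        by (simp add: pq pair_entry_transpose[OF y IJ(2,1)])
    qed (auto simp: nz cardim[OF inj(2)] square_pairs_def)
  qed
qed

end

theorem theorem2p1:
  fixes m :: nat
  assumes "m \<ge> 3"
  shows "edc (Mat m) (perm m) = enat ((2 * m choose m) - 1)"
proof (rule antisym)
  obtain e where e: "bij_betw e {..<(2 * m choose m) - 1} (square_pairs m)"
    "\<And>a b. a \<le> b \<Longrightarrow> b < (2 * m choose m) - 1 \<Longrightarrow> card (fst (e b)) \<le> card (fst (e a))"
    by (rule square_pairs_enumeration[of m]) blast
  interpret square_pair_enumeration m "(2 * m choose m) - 1" e
    by unfold_locales (use assms e in auto)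
  show "edc (Mat m) (perm m) \<le> enat ((2 * m choose m) - 1)"
    unfolding edc_def using equivariant_lin_part[OF assms] by (intro Inf_lower imageI) blast
  show "enat ((2 * m choose m) - 1) \<le> edc (Mat m) (perm m)"
    unfolding edc_def
    by (rule Inf_greatest) (use equivariant_det_rep_lower_bound[OF assms] in auto)
qed

end
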